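(* Let $p\in(1,\infty)$. Let $(\psi_\varepsilon)$ be a sequence of locally periodic transformations with limit transformation $\psi_0$, let $\Omega_\varepsilon=\psi_\varepsilon(\hat\Omega_\varepsilon)$, let $u_\varepsilon$ be a sequence in $L^p(\Omega_\varepsilon)$ and let $\hat u_\varepsilon = u_\varepsilon\circ\psi_\varepsilon$. Then $\widetilde{u_\varepsilon}$ two-scale converges weakly in $L^p$ to $\widetilde{u_0}$ for some $u_0\in L^p(\Omega;L^p(Y^*_x))$ if and only if $\widetilde{\hat u_\varepsilon}$ two-scale converges weakly in $L^p$ to $\widetilde{\hat u_0}$ for some $\hat u_0\in L^p(\Omega\times Y^* )$. Moreover, $\hat u_0(x,y)=u_0(x,\psi_0(x,y))$ holds, and equivalently $u_0(x,y)=\hat u_0(x,\psi_0^{-1}(x,y))$.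
   Context: Conventions. $(\varepsilon)=(\varepsilon_n)_{n\in\mathbb N}$ is a fixed sequence of positive numbers converging to $0$ (index suppressed); constants $C,c_J>0$ are independent of $\varepsilon$. $Y=[0,1]^N$; the subscript $\#$ denotes $Y$-periodicity in $y$. Two-scale convergence. Let $U\subset\mathbb R^N$ be bounded and open and $p,q\in(1,\infty)$ with $1/p+1/q=1$. A sequence $v_\varepsilon\in L^p(U)$ two-scale converges weakly in $L^p$ to $v_0\in L^p(U\times Y)$ if $\lim_{\varepsilon\to0}\int_U v_\varepsilon(x)\varphi(x,x/\varepsilon)\,dx=\int_U\int_Y v_0(x,y)\varphi(x,y)\,dy\,dx$ for all $\varphi\in L^q(U;C_\#(Y))$. It converges strongly in $L^p$ if in addition $\lim_{\varepsilon\to0}\|v_\varepsilon\|_{L^p(U)}=\|v_0\|_{L^p(U\times Y)}$. Geometry. $Y^*\subset Y$ is open and $Y^*_\#:=\operatorname{int}\big(\bigcup_{k\in\mathbb Z^N}(k+\overline{Y^*})\big)$ has Lipschitz boundary. $\Omega\subset\mathbb R^N$ is bounded, open, with Lipschitz boundary, and $\hat\Omega_\varepsilon:=\Omega\cap\varepsilon Y^*_\#$. Extension by zero is denoted by $\widetilde{\cdot}$: functions on $\hat\Omega_\varepsilon$ are extended to $\Omega$, functions on $\Omega\times Y^*$ to $\Omega\times Y$. Locally periodic transformations. A sequence of $C^1$-diffeomorphisms $\psi_\varepsilon:\overline{\hat\Omega_\varepsilon}\to\overline{\Omega_\varepsilon}$, $\Omega_\varepsilon:=\psi_\varepsilon(\hat\Omega_\varepsilon)\subset\mathbb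 R^N$, is a sequence of locally periodic transformations if: (1) there is $c_J>0$ with $J_\varepsilon:=\det\Psi_\varepsilon\ge c_J$, where $\Psi_\varepsilon:=D\psi_\varepsilon$; (2) with $\check\psi_\varepsilon(x):=\psi_\varepsilon(x)-x$ there is $C>0$ with $\varepsilon^{-1}\|\check\psi_\varepsilon\|_{C(\overline{\hat\Omega_\varepsilon})}+\|\nabla\check\psi_\varepsilon\|_{C(\overline{\hat\Omega_\varepsilon})}\le C$; (3) there is $\psi_0\in L^\infty(\Omega;C^1(\overline{Y^*}))^N$ (the limit transformation) such that (a) for a.e. $x\in\Omega$, $\psi_0(x,\cdot):\overline{Y^*}\to\overline{Y^*_x}$ with $Y^*_x:=\psi_0(x,Y^* )\subset Y$ is a $C^1$-diffeomorphism, (b) $\check\psi_0(x,y):=\psi_0(x,y)-y$ can be extended $Y$-periodically such that $\check\psi_0\in L^\infty(\Omega;C^1_\#(\overline{Y^*}))^N$, (c) for every $q\in(1,\infty)$, $\varepsilon^{-1}\widetilde{\check\psi_\varepsilon}$ and $\widetilde{\nabla\check\psi_\varepsilon}$ two-scale converge strongly in $L^q$ (on $U=\Omega$) to $\widetilde{\check\psi_0}$ and $\widetilde{\nabla_y\check\psi_0}$, respectively. $\psi_0^{-1}(x,\cdot)$ denotes the inverse of $\psi_0(x,\cdot)$. Functions on $\Omega_\varepsilon$. Let $Q:=\{(x,y)\in\Omega\times Y: y\in Y^*_x\}$. A small $\delta>0$ is fixed and $\Omega^{(\delta)}:=\{x\in\mathbb R^N:\operatorname{dist}(x,\Omega)<\delta\}$;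 then $\Omega_\varepsilon\subset\Omega^{(\delta)}$ for $\varepsilon$ small enough. Functions on $\Omega_\varepsilon$ are extended by $0$ to $\Omega^{(\delta)}$ and functions on $Q$ by $0$ to $\Omega^{(\delta)}\times Y$ (also denoted $\widetilde{\cdot}$). Two-scale convergence of extended functions on $\Omega_\varepsilon$ is meant on $U=\Omega^{(\delta)}$, that of extended functions on $\hat\Omega_\varepsilon$ on $U=\Omega$. Function space. $L^p(\Omega;L^p(Y^*_x)):=\{(x,y)\mapsto f(x,\psi_0^{-1}(x,y)) : f\in L^p(\Omega;L^p(Y^* ))\}$, with norm $\|\cdot\|_{L^p(Q)}$. *)

theory Defs
  imports "HOL-Analysis.Analysis"
begin

text \<open>Elements of Lebesgue and Bochner spaces are represented by functions (not by equivalence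
  classes); identities between them are therefore stated almost everywhere.\<close>

definition Lp :: "real \<Rightarrow> 'a::euclidean_space set \<Rightarrow> ('a \<Rightarrow> real) set" where
  "Lp p S = {f. f \<in> borel_measurable (lebesgue_on S) \<and>
                integrable (lebesgue_on S) (\<lambda>x. \<bar>f x\<bar> powr p)}"

definition Lp_norm :: "real \<Rightarrow> 'a::euclidean_space set \<Rightarrow> ('a \<Rightarrow> real) \<Rightarrow> real" where
  "Lp_norm p S f = (\<integral>x. \<bar>f x\<bar> powr p \<partial>lebesgue_on S) powr (1 / p)"

definition zero_ext :: "'a set \<Rightarrow> ('a \<Rightarrow> real) \<Rightarrow> 'a \<Rightarrow> real" where
  "zero_ext S f = (\<lambda>x. if x \<in> S then f x else 0)"

text \<open>The Banach space \<open>X\<close> below is a set of functions with norm \<open>nrm\<close>; strong (Bochner)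
  measurability is approximability almost everywhere by simple functions with values in \<open>X\<close>.\<close>

definition strongly_measurable ::
  "'a measure \<Rightarrow> ('b \<Rightarrow> 'c::real_normed_vector) set \<Rightarrow> (('b \<Rightarrow> 'c) \<Rightarrow> real) \<Rightarrow> ('a \<Rightarrow> 'b \<Rightarrow> 'c) \<Rightarrow> bool"
where
  "strongly_measurable M X nrm f \<longleftrightarrow>
     (AE x in M. f x \<in> X) \<and>
     (\<exists>s :: nat \<Rightarrow> 'a \<Rightarrow> 'b \<Rightarrow> 'c.
        (\<forall>i. simple_function M (s i) \<and> (\<forall>x\<in>space M. s i x \<in> X)) \<and>
        (AE x in M. (\<lambda>i. nrm (\<lambda>y. s i x y - f x y)) \<longlonglongrightarrow> 0))"

definition Bochner_Lp ::
  "real \<Rightarrow> 'a::euclidean_space set \<Rightarrow> ('b \<Rightarrow> 'c::real_normed_vector) set \<Rightarrow> (('b \<Rightarrow> 'c) \<Rightarrow> real) \<Rightarrow>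
   ('a \<Rightarrow> 'b \<Rightarrow> 'c) set" where
  "Bochner_Lp p U X nrm =
     {f. strongly_measurable (lebesgue_on U) X nrm f \<and>
         integrable (lebesgue_on U) (\<lambda>x. nrm (f x) powr p)}"

definition Bochner_Linf ::
  "'a::euclidean_space set \<Rightarrow> ('b \<Rightarrow> 'c::real_normed_vector) set \<Rightarrow> (('b \<Rightarrow> 'c) \<Rightarrow> real) \<Rightarrow>
   ('a \<Rightarrow> 'b \<Rightarrow> 'c) set" where
  "Bochner_Linf U X nrm =
     {f. strongly_measurable (lebesgue_on U) X nrm f \<and>
         (\<exists>B. AE x in lebesgue_on U. nrm (f x) \<le> B)}"

text \<open>The inserted \<open>0\<close> only serves to make the norm \<open>0\<close> when \<open>K\<close> is empty.\<close>

definition C_norm :: "'a set \<Rightarrow> ('a \<Rightarrow> 'b::real_normed_vector) \<Rightarrow> real" where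
  "C_norm K f = Sup (insert 0 ((\<lambda>x. norm (f x)) ` K))"

text \<open>For an open set \<open>S\<close>, a function is in \<open>C\<^sup>1(closure S)\<close> if it is continuous on \<open>closure S\<close>,
  differentiable in \<open>S\<close>, and its Jacobian matrix has a continuous extension to \<open>closure S\<close>; that
  extension is \<open>jacobian_cl S f\<close>.\<close>

definition jacobian_cl ::
  "(real^'n) set \<Rightarrow> (real^'n \<Rightarrow> real^'m) \<Rightarrow> real^'n \<Rightarrow> real^'n^'m" where
  "jacobian_cl S f x = (if x \<in> S then jacobian f (at x)
                        else Lim (at x within S) (\<lambda>z. jacobian f (at z)))"

definition C1_cl :: "(real^'n) set \<Rightarrow> (real^'n \<Rightarrow> real^'m) set" where
  "C1_cl S = {f. continuous_on (closure S) f \<and> (\<forall>x\<in>S. f differentiable (at x)) \<and>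
                 continuous_on (closure S) (jacobian_cl S f)}"

definition C1_norm :: "(real^'n) set \<Rightarrow> (real^'n \<Rightarrow> real^'m) \<Rightarrow> real" where
  "C1_norm S f = C_norm (closure S) f + C_norm (closure S) (jacobian_cl S f)"

text \<open>\<open>f\<close> is a \<open>C\<^sup>1\<close>-diffeomorphism from \<open>closure A\<close> onto \<open>closure (f ` A)\<close>.\<close>

definition C1_diffeo_cl :: "(real^'n) set \<Rightarrow> (real^'n \<Rightarrow> real^'n) \<Rightarrow> bool" where
  "C1_diffeo_cl A f \<longleftrightarrow>
     bij_betw f (closure A) (closure (f ` A)) \<and>
     f \<in> C1_cl A \<and> inv_into (closure A) f \<in> C1_cl (f ` A)"

definition unit_cell :: "(real^'n) set" where
  "unit_cell = cbox 0 1"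

definition int_vecs :: "(real^'n) set" where
  "int_vecs = {k. \<forall>i. k $ i \<in> \<int>}"

definition C_per :: "(real^'n \<Rightarrow> real) set" where
  "C_per = {g. continuous_on UNIV g \<and> (\<forall>y. \<forall>k\<in>int_vecs. g (y + k) = g y)}"

definition periodic_hull :: "(real^'n) set \<Rightarrow> (real^'n) set" where
  "periodic_hull Ys = interior (\<Union>k\<in>int_vecs. (\<lambda>y. k + y) ` closure Ys)"

text \<open>\<open>C\<^sup>1\<^sub>#(closure Ys)\<close>: periodic functions that are \<open>C\<^sup>1\<close> up to the boundary of the periodic
  set \<open>periodic_hull Ys\<close> (so in particular across the faces of the unit cell). Its norm is
  \<open>C1_norm (periodic_hull Ys)\<close>.\<close>

definition C1_per_cl :: "(real^'n) set \<Rightarrow> (real^'n \<Rightarrow> real^'m) set" where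
  "C1_per_cl Ys = {g \<in> C1_cl (periodic_hull Ys).
     \<forall>y\<in>closure (periodic_hull Ys). \<forall>k\<in>int_vecs. g (y + k) = g y}"

definition two_scale_weak ::
  "(nat \<Rightarrow> real) \<Rightarrow> real \<Rightarrow> (real^'n) set \<Rightarrow> (nat \<Rightarrow> real^'n \<Rightarrow> real) \<Rightarrow>
   ((real^'n) \<times> (real^'n) \<Rightarrow> real) \<Rightarrow> bool" where
  "two_scale_weak \<epsilon> p U v v0 \<longleftrightarrow>
     (\<forall>n. v n \<in> Lp p U) \<and> v0 \<in> Lp p (U \<times> unit_cell) \<and>
     (\<forall>q \<phi>. 1 < q \<and> 1 / p + 1 / q = 1 \<and> \<phi> \<in> Bochner_Lp q U C_per (C_norm unit_cell) \<longrightarrow>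
        (\<lambda>n. \<integral>x. v n x * \<phi> x (x /\<^sub>R \<epsilon> n) \<partial>lebesgue_on U)
          \<longlonglongrightarrow> (\<integral>x. (\<integral>y. v0 (x, y) * \<phi> x y \<partial>lebesgue_on unit_cell) \<partial>lebesgue_on U))"

definition two_scale_strong ::
  "(nat \<Rightarrow> real) \<Rightarrow> real \<Rightarrow> (real^'n) set \<Rightarrow> (nat \<Rightarrow> real^'n \<Rightarrow> real) \<Rightarrow>
   ((real^'n) \<times> (real^'n) \<Rightarrow> real) \<Rightarrow> bool" where
  "two_scale_strong \<epsilon> p U v v0 \<longleftrightarrow>
     two_scale_weak \<epsilon> p U v v0 \<and>
     (\<lambda>n. Lp_norm p U (v n)) \<longlonglongrightarrow> Lp_norm p (U \<times> unit_cell) v0"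

text \<open>Locally, after a rotation taking the last coordinate axis to the direction \<open>e\<close>, the set lies
  strictly above the graph of a Lipschitz function \<open>\<gamma>\<close> of the coordinates orthogonal to \<open>e\<close>.\<close>

definition lipschitz_boundary :: "(real^'n) set \<Rightarrow> bool" where
  "lipschitz_boundary D \<longleftrightarrow>
     (\<forall>x\<in>frontier D. \<exists>r>0. \<exists>e L. \<exists>\<gamma> :: real^'n \<Rightarrow> real.
        norm e = 1 \<and> L-lipschitz_on {z. z \<bullet> e = 0} \<gamma> \<and>
        D \<inter> ball x r = {y \<in> ball x r. y \<bullet> e > \<gamma> (y - (y \<bullet> e) *\<^sub>R e)})"

definition perforated :: "real \<Rightarrow> (real^'n) set \<Rightarrow> (real^'n) set \<Rightarrow> (real^'n) set" where
  "perforated e \<Omega> Ys = \<Omega> \<inter> (\<lambda>y. e *\<^sub>R y) ` periodic_hull Ys"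

text \<open>\<open>\<psi>0\<close> is the limit transformation; vector- and matrix-valued two-scale convergence is
  understood componentwise.\<close>

definition locally_periodic_transformations ::
  "(nat \<Rightarrow> real) \<Rightarrow> (real^'n) set \<Rightarrow> (real^'n) set \<Rightarrow> (nat \<Rightarrow> real^'n \<Rightarrow> real^'n) \<Rightarrow>
   (real^'n \<Rightarrow> real^'n \<Rightarrow> real^'n) \<Rightarrow> bool" where
  "locally_periodic_transformations \<epsilon> \<Omega> Ys \<psi> \<psi>0 \<longleftrightarrow>
     (let \<Omega>h = (\<lambda>n. perforated (\<epsilon> n) \<Omega> Ys) in
       (\<forall>n. C1_diffeo_cl (\<Omega>h n) (\<psi> n)) \<and>
       (\<exists>cJ>0. \<forall>n. \<forall>x\<in>closure (\<Omega>h n). det (jacobian_cl (\<Omega>h n) (\<psi> n) x) \<ge> cJ) \<and>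
       (\<exists>C>0. \<forall>n. inverse (\<epsilon> n) * C_norm (closure (\<Omega>h n)) (\<lambda>x. \<psi> n x - x) +
            C_norm (closure (\<Omega>h n)) (jacobian_cl (\<Omega>h n) (\<lambda>x. \<psi> n x - x)) \<le> C) \<and>
       \<psi>0 \<in> Bochner_Linf \<Omega> (C1_cl Ys) (C1_norm Ys) \<and>
       (AE x in lebesgue_on \<Omega>. C1_diffeo_cl Ys (\<psi>0 x) \<and> \<psi>0 x ` Ys \<subseteq> unit_cell) \<and>
       (\<exists>\<eta> \<in> Bochner_Linf \<Omega> (C1_per_cl Ys) (C1_norm (periodic_hull Ys)).
            AE x in lebesgue_on \<Omega>. \<forall>y\<in>closure Ys. \<eta> x y = \<psi>0 x y - y) \<and>
       (\<forall>q>1. \<forall>i.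
            two_scale_strong \<epsilon> q \<Omega>
              (\<lambda>n. zero_ext (\<Omega>h n) (\<lambda>x. inverse (\<epsilon> n) * (\<psi> n x - x) $ i))
              (zero_ext (\<Omega> \<times> Ys) (\<lambda>(x, y). (\<psi>0 x y - y) $ i))) \<and>
       (\<forall>q>1. \<forall>i j.
            two_scale_strong \<epsilon> q \<Omega>
              (\<lambda>n. zero_ext (\<Omega>h n) (\<lambda>x. jacobian_cl (\<Omega>h n) (\<lambda>x. \<psi> n x - x) x $ i $ j))
              (zero_ext (\<Omega> \<times> Ys) (\<lambda>(x, y). jacobian_cl Ys (\<lambda>y. \<psi>0 x y - y) y $ i $ j))))"

text \<open>The case split makes the neighbourhood of the empty set empty (\<open>infdist x {} = 0\<close>).\<close>

definition neighbourhood :: "real \<Rightarrow> (real^'n) set \<Rightarrow> (real^'n) set" where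
  "neighbourhood \<delta> \<Omega> = {x. \<Omega> \<noteq> {} \<and> infdist x \<Omega> < \<delta>}"

definition transformed_cells ::
  "(real^'n) set \<Rightarrow> (real^'n) set \<Rightarrow> (real^'n \<Rightarrow> real^'n \<Rightarrow> real^'n) \<Rightarrow> ((real^'n) \<times> (real^'n)) set" where
  "transformed_cells \<Omega> Ys \<psi>0 = {(x, y). x \<in> \<Omega> \<and> y \<in> unit_cell \<and> y \<in> \<psi>0 x ` Ys}"

definition inv_transf ::
  "(real^'n) set \<Rightarrow> (real^'n \<Rightarrow> real^'n \<Rightarrow> real^'n) \<Rightarrow> real^'n \<Rightarrow> real^'n \<Rightarrow> real^'n" where
  "inv_transf Ys \<psi>0 x y = inv_into (closure Ys) (\<psi>0 x) y"

text \<open>The space \<open>L\<^sup>p(\<Omega>; L\<^sup>p(Y\<^sup>*\<^sub>x))\<close>. Here \<open>L\<^sup>p(\<Omega>; L\<^sup>p(Ys))\<close> is identified with \<open>L\<^sup>p(\<Omega> \<times> Ys)\<close>, as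
  usual, i.e. its elements are given by jointly measurable representatives.\<close>

definition Lp_transf ::
  "real \<Rightarrow> (real^'n) set \<Rightarrow> (real^'n) set \<Rightarrow> (real^'n \<Rightarrow> real^'n \<Rightarrow> real^'n) \<Rightarrow>
   ((real^'n) \<times> (real^'n) \<Rightarrow> real) set" where
  "Lp_transf p \<Omega> Ys \<psi>0 =
     {u. \<exists>f \<in> Lp p (\<Omega> \<times> Ys).
           AE (x, y) in lebesgue_on (transformed_cells \<Omega> Ys \<psi>0). u (x, y) = f (x, inv_transf Ys \<psi>0 x y)}"

end

theory Submission
  imports Defs
begin

text \<open>The idea is to transport the pairings with test functions through \<open>\<psi> n\<close>. Substituting in
  \<open>\<integral> u n x * (\<Theta> x * g (x / \<epsilon> n))\<close> gives the integral of \<open>u n \<circ> \<psi> n\<close> against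
  \<open>\<Theta> (\<psi> n x) * g (x / \<epsilon> n + (\<psi> n x - x) / \<epsilon> n) * det (D \<psi> n x)\<close>: a function, periodic in the fast variable
  and continuous in the transformation data, evaluated at sequences that converge strongly by hypothesis.
  A weakly convergent sequence may be paired with such an expression (\<open>weak_strong_pairing\<close>). The limit
  is an integral over \<open>\<Omega> \<times> Ys\<close>, which the change of variables \<open>\<psi>0 x\<close> on almost every fibre turns into an
  integral over the transformed cells (\<open>integral_back\<close>). So convergence on the reference domain
  implies convergence on the transformed one (\<open>push_forward_two_scale\<close>).

  Conversely, \<open>\<integral> (u n \<circ> \<psi> n) x * (\<theta> x * g (x / \<epsilon> n))\<close> is the pairing of \<open>u n\<close> with the function on the
  transformed domain whose pullback is \<open>\<theta> x * g (x / \<epsilon> n) / det (D \<psi> n x)\<close>. No strong convergence is assumed for the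
  inverse transformations, so that of these weights must be proved. Their weak limits are given by
  the direction already shown, and their norms converge by substitution. That the limit of the norms
  is the norm of the limit is less obvious: the periodic tiling may contain material outside \<open>Ys\<close>
  (such as the faces of the cell), which stays where it is, and the transformed cells might overlap it.
  But an overlap would make the norm of the weak limit exceed the limit of the norms, contrary to weak
  lower semicontinuity; hence it is a null set (\<open>transformed_cells_avoid_other_material\<close>), the weights
  converge strongly (\<open>strongly_approximable_weight\<close>) and \<open>weak_strong_pairing\<close> applies again
  (\<open>pull_back_two_scale\<close>).

  The general facts behind both directions are that weakly convergent sequences are bounded
  (\<open>two_scale_weak_bounded\<close>), that bounded sequences need only be tested on products of functions of
  one variable (\<open>two_scale_weakI\<close>), that weak limits are unique (\<open>two_scale_weak_unique\<close>), and that
  convergence of norms provides strong approximation by test functions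
  (\<open>strongly_approximable_if_norms_converge\<close>). The formula relating the limits follows from
  uniqueness.\<close>

section \<open>Lebesgue measure on products\<close>

lemma AE_lebesgue_pair:
  fixes P :: "'a::euclidean_space \<times> 'b::euclidean_space \<Rightarrow> bool"
  assumes "AE z in lebesgue. P z"
  shows "AE x in lebesgue. AE y in lebesgue. P (x, y)"
proof -
  have "AE z in (lborel \<Otimes>\<^sub>M lborel). P z"
    using assms unfolding lborel_prod by (simp add: AE_completion_iff)
  from lborel_pair.AE_pair[OF this] show ?thesis
    by (simp add: AE_completion_iff)
qed

lemma nn_integral_lebesgue_pair:
  fixes f :: "'a::euclidean_space \<times> 'b::euclidean_space \<Rightarrow> ennreal"
  assumes "f \<in> borel_measurable lebesgue"
  shows "(\<integral>\<^sup>+z. f z \<partial>lebesgue) = (\<integral>\<^sup>+x. \<integral>\<^sup>+y. f (x, y) \<partial>lebesgue \<partial>lebesgue)"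
proof -
  obtain g where g: "g \<in> borel_measurable lborel" "AE z in lborel. f z = g z"
    using completion_ex_borel_measurable[OF assms] by auto
  have ae: "AE z in lebesgue. f z = g z" using g(2) by (rule AE_completion)
  have gp: "g \<in> borel_measurable (lborel \<Otimes>\<^sub>M lborel)" using g(1) by (simp add: lborel_prod)
  have "(\<integral>\<^sup>+z. f z \<partial>lebesgue) = (\<integral>\<^sup>+z. g z \<partial>lborel)"
    using nn_integral_cong_AE[OF ae] by (simp add: nn_integral_completion)
  also have "\<dots> = (\<integral>\<^sup>+z. g z \<partial>(lborel \<Otimes>\<^sub>M lborel))" by (simp add: lborel_prod)
  also have "\<dots> = (\<integral>\<^sup>+x. \<integral>\<^sup>+y. g (x, y) \<partial>lborel \<partial>lborel)"
    by (rule lborel.nn_integral_fst[OF gp, symmetric])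
  also have "\<dots> = (\<integral>\<^sup>+x. \<integral>\<^sup>+y. g (x, y) \<partial>lebesgue \<partial>lebesgue)"
    by (simp add: nn_integral_completion)
  also have "\<dots> = (\<integral>\<^sup>+x. \<integral>\<^sup>+y. f (x, y) \<partial>lebesgue \<partial>lebesgue)"
  proof (rule nn_integral_cong_AE)
    show "AE x in lebesgue. (\<integral>\<^sup>+y. g (x, y) \<partial>lebesgue) = (\<integral>\<^sup>+y. f (x, y) \<partial>lebesgue)"
      using AE_lebesgue_pair[OF ae]
      by eventually_elim (auto intro!: nn_integral_cong_AE)
  qed
  finally show ?thesis .
qed

lemma integral_lebesgue_pair:
  fixes f :: "'a::euclidean_space \<times> 'b::euclidean_space \<Rightarrow> real"
  assumes "integrable lebesgue f"
  shows "AE x in lebesgue. integrable lebesgue (\<lambda>y. f (x, y))"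
    and "(\<integral>x. \<integral>y. f (x, y) \<partial>lebesgue \<partial>lebesgue) = (\<integral>z. f z \<partial>lebesgue)"
proof -
  have "f \<in> borel_measurable lebesgue" using assms by auto
  then obtain g where g: "g \<in> borel_measurable lborel" "AE z in lborel. f z = g z"
    using completion_ex_borel_measurable_real by blast
  have ae: "AE z in lebesgue. f z = g z" using g(2) by (rule AE_completion)
  have gl: "g \<in> borel_measurable lebesgue" using g(1) by (rule measurable_completion)
  have "integrable lebesgue g"
    using integrable_cong_AE[of f lebesgue g] assms ae gl by auto
  then have ig: "integrable (lborel \<Otimes>\<^sub>M lborel) g"
    using g(1) by (simp add: lborel_prod integrable_completion)
  have sec: "(\<lambda>y. g (x, y)) \<in> borel_measurable lborel" for x
    using g(1) by simp
  note ae2 = AE_lebesgue_pair[OF ae]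
  have ae3: "AE x in lebesgue. (\<lambda>y. f (x, y)) \<in> borel_measurable lebesgue"
    using ae2
  proof eventually_elim
    case (elim x)
    have "(\<lambda>y. g (x, y)) \<in> borel_measurable lebesgue" using sec by (rule measurable_completion)
    moreover have "AE y in lebesgue. g (x,y) = f (x,y)" using elim by auto
    ultimately show ?case by (rule borel_measurable_AE)
  qed
  show "AE x in lebesgue. integrable lebesgue (\<lambda>y. f (x, y))"
    using AE_completion[OF lborel_pair.AE_integrable_fst'[OF ig]] ae2 ae3
  proof eventually_elim
    case (elim x)
    then show ?case
      using integrable_cong_AE[of "\<lambda>y. f (x,y)" lebesgue "\<lambda>y. g (x,y)"] sec measurable_completion[OF sec]
      by (auto simp: integrable_completion)
  qed
  have im: "(\<lambda>x. \<integral>y. g (x, y) \<partial>lborel) \<in> borel_measurable lborel"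
    using lborel_pair.integrable_fst'[OF ig] by auto
  have ae4: "AE x in lebesgue. (\<integral>y. g (x, y) \<partial>lborel) = (\<integral>y. f (x, y) \<partial>lebesgue)"
    using ae2 ae3
  proof eventually_elim
    case (elim x)
    have "(\<integral>y. f (x, y) \<partial>lebesgue) = (\<integral>y. g (x, y) \<partial>lebesgue)"
      by (rule integral_cong_AE) (use elim measurable_completion[OF sec] in auto)
    then show ?case using sec by (simp add: integral_completion)
  qed
  have im2: "(\<lambda>x. \<integral>y. f (x, y) \<partial>lebesgue) \<in> borel_measurable lebesgue"
    by (rule borel_measurable_AE[OF measurable_completion[OF im] ae4])
  have "(\<integral>x. \<integral>y. f (x, y) \<partial>lebesgue \<partial>lebesgue) = (\<integral>x. \<integral>y. g (x, y) \<partial>lborel \<partial>lebesgue)"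
    by (rule integral_cong_AE) (use ae4 im2 measurable_completion[OF im] in auto)
  also have "\<dots> = (\<integral>x. \<integral>y. g (x, y) \<partial>lborel \<partial>lborel)"
    using im by (simp add: integral_completion)
  also have "\<dots> = (\<integral>z. g z \<partial>lborel)"
    using lborel_pair.integral_fst'[OF ig] by (simp add: lborel_prod)
  also have "\<dots> = (\<integral>z. g z \<partial>lebesgue)" using g(1) by (simp add: integral_completion)
  also have "\<dots> = (\<integral>z. f z \<partial>lebesgue)"
    by (rule integral_cong_AE) (use ae gl assms in auto)
  finally show "(\<integral>x. \<integral>y. f (x, y) \<partial>lebesgue \<partial>lebesgue) = (\<integral>z. f z \<partial>lebesgue)" .
qed

lemma AE_lebesgue_pair_swap:
  fixes P :: "'a::euclidean_space \<times> 'b::euclidean_space \<Rightarrow> bool"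
  assumes "AE z in lebesgue. P z"
  shows "AE y in lebesgue. AE x in lebesgue. P (x, y)"
proof -
  have "AE z in (lborel \<Otimes>\<^sub>M lborel). P z"
    using assms unfolding lborel_prod by (simp add: AE_completion_iff)
  then have "AE z in distr (lborel \<Otimes>\<^sub>M lborel) (lborel \<Otimes>\<^sub>M lborel) (\<lambda>(y, x). (x, y)). P z"
    by (subst lborel_pair.distr_pair_swap[symmetric])
  from AE_distrD[OF _ this] have "AE z in (lborel \<Otimes>\<^sub>M lborel). P (snd z, fst z)"
    by (simp add: split_def)
  from lborel_pair.AE_pair[OF this] show ?thesis
    by (simp add: AE_completion_iff)
qed

lemma null_sets_lebesgue_pairI:
  fixes N :: "('a::euclidean_space \<times> 'b::euclidean_space) set"
  assumes "N \<in> sets lebesgue" "AE x in lebesgue. AE y in lebesgue. (x, y) \<notin> N"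
  shows "N \<in> null_sets lebesgue"
proof -
  have "(\<integral>\<^sup>+z. indicator N z \<partial>lebesgue) = (\<integral>\<^sup>+x. \<integral>\<^sup>+y. indicator N (x, y) \<partial>lebesgue \<partial>lebesgue)"
    by (rule nn_integral_lebesgue_pair) (use assms in auto)
  also have "\<dots> = (\<integral>\<^sup>+x. (0::ennreal) \<partial>(lebesgue :: 'a measure))"
  proof (rule nn_integral_cong_AE)
    show "AE x in lebesgue. (\<integral>\<^sup>+y. indicator N (x, y) \<partial>lebesgue) = (0::ennreal)"
      using assms(2)
    proof eventually_elim
      case (elim x)
      have "(\<integral>\<^sup>+y. indicator N (x, y) \<partial>lebesgue) = (\<integral>\<^sup>+y. 0 \<partial>(lebesgue :: 'b measure))"
        by (rule nn_integral_cong_AE) (use elim in auto)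
      then show ?case by simp
    qed
  qed
  finally show ?thesis using assms(1) by (auto simp: null_sets_def)
qed

lemma borel_Times_lebesgue:
  fixes A :: "'a::euclidean_space set" and B :: "'b::euclidean_space set"
  assumes "A \<in> sets borel" "B \<in> sets borel"
  shows "A \<times> B \<in> sets lebesgue" "A \<in> sets lebesgue" "A \<times> B \<in> sets borel"
proof -
  show "A \<times> B \<in> sets borel" using assms by (rule borel_Times)
  then show "A \<times> B \<in> sets lebesgue" by (simp add: sets_completionI_sets)
  show "A \<in> sets lebesgue" using assms(1) by (simp add: sets_completionI_sets)
qed

lemma AE_lebesgue_on_iff:
  "A \<in> sets lebesgue \<Longrightarrow> (AE x in lebesgue_on A. P x) \<longleftrightarrow> (AE x in lebesgue. x \<in> A \<longrightarrow> P x)"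
  by (simp add: AE_restrict_space_iff)

lemma AE_lebesgue_on_Times:
  fixes A :: "'a::euclidean_space set" and B :: "'b::euclidean_space set"
  assumes "A \<in> sets borel" "B \<in> sets borel" "AE z in lebesgue_on (A \<times> B). P z"
  shows "AE x in lebesgue_on A. AE y in lebesgue_on B. P (x, y)"
    and "AE y in lebesgue_on B. AE x in lebesgue_on A. P (x, y)"
proof -
  have s: "A \<times> B \<in> sets lebesgue" "A \<in> sets lebesgue" "B \<in> sets lebesgue"
    using assms borel_Times_lebesgue by auto
  have 1: "AE z in lebesgue. z \<in> A \<times> B \<longrightarrow> P z"
    using assms(3) s by (simp add: AE_lebesgue_on_iff)
  show "AE x in lebesgue_on A. AE y in lebesgue_on B. P (x, y)"
    unfolding AE_lebesgue_on_iff[OF s(2)] AE_lebesgue_on_iff[OF s(3)]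
    using AE_lebesgue_pair[OF 1]
  proof eventually_elim
    case (elim t)
    show ?case
    proof
      assume t: "t \<in> A"
      show "AE s in lebesgue. s \<in> B \<longrightarrow> P (t, s)"
        by (rule eventually_mono[OF elim]) (use t in auto)
    qed
  qed
  show "AE y in lebesgue_on B. AE x in lebesgue_on A. P (x, y)"
    unfolding AE_lebesgue_on_iff[OF s(2)] AE_lebesgue_on_iff[OF s(3)]
    using AE_lebesgue_pair_swap[OF 1]
  proof eventually_elim
    case (elim t)
    show ?case
    proof
      assume t: "t \<in> B"
      show "AE s in lebesgue. s \<in> A \<longrightarrow> P (s, t)"
        by (rule eventually_mono[OF elim]) (use t in auto)
    qed
  qed
qed

lemma integral_lebesgue_on_Times:
  fixes f :: "'a::euclidean_space \<times> 'b::euclidean_space \<Rightarrow> real"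
  assumes "A \<in> sets borel" "B \<in> sets borel" "integrable (lebesgue_on (A \<times> B)) f"
  shows "(\<integral>x. \<integral>y. f (x, y) \<partial>lebesgue_on B \<partial>lebesgue_on A) = (\<integral>z. f z \<partial>lebesgue_on (A \<times> B))"
proof -
  have s: "A \<times> B \<in> sets lebesgue" "A \<in> sets lebesgue" "B \<in> sets lebesgue"
    using assms borel_Times_lebesgue by auto
  let ?g = "\<lambda>z. indicator (A \<times> B) z *\<^sub>R f z"
  have i: "integrable lebesgue ?g" using assms(3) s by (simp add: integrable_restrict_space)
  have eq: "(\<integral>y. ?g (x, y) \<partial>lebesgue) = indicator A x *\<^sub>R (\<integral>y. f (x, y) \<partial>lebesgue_on B)" for x
    using s by (cases "x \<in> A") (auto simp: integral_restrict_space indicator_times)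
  show ?thesis
    using integral_lebesgue_pair(2)[OF i] s unfolding eq
    by (simp add: integral_restrict_space)
qed

lemma nn_integral_lebesgue_on_Times:
  fixes f :: "'a::euclidean_space \<times> 'b::euclidean_space \<Rightarrow> ennreal"
  assumes "A \<in> sets borel" "B \<in> sets borel" "f \<in> borel_measurable (lebesgue_on (A \<times> B))"
  shows "(\<integral>\<^sup>+x. \<integral>\<^sup>+y. f (x, y) \<partial>lebesgue_on B \<partial>lebesgue_on A) = (\<integral>\<^sup>+z. f z \<partial>lebesgue_on (A \<times> B))"
proof -
  have s: "A \<times> B \<in> sets lebesgue" "A \<in> sets lebesgue" "B \<in> sets lebesgue"
    using assms borel_Times_lebesgue by auto
  let ?g = "\<lambda>z. f z * indicator (A \<times> B) z"
  have i: "?g \<in> borel_measurable lebesgue" using assms(3) s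
    by (simp add: borel_measurable_restrict_space_iff_ennreal)
  have eq: "(\<integral>\<^sup>+y. ?g (x, y) \<partial>lebesgue) = (\<integral>\<^sup>+y. f (x, y) \<partial>lebesgue_on B) * indicator A x" for x
    using s by (cases "x \<in> A") (auto simp: nn_integral_restrict_space indicator_times)
  show ?thesis
    using nn_integral_lebesgue_pair[OF i] s unfolding eq
    by (simp add: nn_integral_restrict_space)
qed

section \<open>Change of variables for an arbitrary finite index type\<close>

lemma prod_Basis_cart:
  fixes x :: "real^'n"
  shows "(\<Prod>b\<in>Basis. x \<bullet> b) = (\<Prod>i\<in>UNIV. x $ i)"
proof -
  have B: "(Basis :: (real^'n) set) = range (\<lambda>i. axis i 1)"
    by (auto simp: Basis_vec_def)
  have "inj (\<lambda>i::'n. axis i (1::real))" by (auto simp: inj_def axis_eq_axis)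
  then show ?thesis unfolding B by (simp add: prod.reindex inner_axis)
qed

definition reindex_vec :: "('m \<Rightarrow> 'n) \<Rightarrow> real^'n \<Rightarrow> real^'m" where
  "reindex_vec \<sigma> x = (\<chi> i. x $ \<sigma> i)"

lemma linear_reindex_vec: "linear (reindex_vec \<sigma>)"
  by (auto simp: linear_iff reindex_vec_def vec_eq_iff)

lemma reindex_vec_inverse:
  "(\<And>i. \<sigma> (\<tau> i) = i) \<Longrightarrow> reindex_vec \<tau> (reindex_vec \<sigma> x) = x"
  by (auto simp: reindex_vec_def vec_eq_iff)

lemma distr_lebesgue_reindex_vec:
  fixes \<sigma> :: "'m::finite \<Rightarrow> 'n::finite"
  assumes "bij \<sigma>"
  shows "reindex_vec \<sigma> \<in> lebesgue \<rightarrow>\<^sub>M lebesgue"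
    and "distr lebesgue lebesgue (reindex_vec \<sigma>) = lebesgue"
proof -
  let ?L = "reindex_vec \<sigma>" and ?\<tau> = "inv \<sigma>"
  have m: "?L \<in> lborel \<rightarrow>\<^sub>M lborel"
    using borel_measurable_continuous_onI[OF linear_continuous_on[OF linear_conv_bounded_linear[THEN iffD1, OF linear_reindex_vec[of \<sigma>]]]]
    by simp
  have \<tau>: "\<sigma> (?\<tau> i) = i" "?\<tau> (\<sigma> j) = j" for i j
    using assms by (auto simp: bij_is_surj surj_f_inv_f bij_is_inj)
  have eq: "(lborel :: (real^'m) measure) = distr lborel lborel ?L"
  proof (rule lborel_eqI)
    fix l u :: "real^'m" assume "\<And>b. b \<in> Basis \<Longrightarrow> l \<bullet> b \<le> u \<bullet> b"
    then have le: "l $ i \<le> u $ i" for i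
      by (metis axis_in_Basis_iff cart_eq_inner_axis Basis_real_def insertI1)
    have box: "?L -` box l u = box (reindex_vec ?\<tau> l) (reindex_vec ?\<tau> u)"
      by (auto simp: mem_box_cart reindex_vec_def) (metis \<tau>)+
    have le': "reindex_vec ?\<tau> l \<bullet> b \<le> reindex_vec ?\<tau> u \<bullet> b" if "b \<in> Basis" for b
      using that le by (auto simp: Basis_vec_def inner_axis reindex_vec_def)
    have "emeasure (distr lborel lborel ?L) (box l u) = emeasure lborel (box (reindex_vec ?\<tau> l) (reindex_vec ?\<tau> u))"
      using m by (subst emeasure_distr) (auto simp: box)
    also have "\<dots> = (\<Prod>b\<in>Basis. (reindex_vec ?\<tau> u - reindex_vec ?\<tau> l) \<bullet> b)"
      by (rule emeasure_lborel_box) (use le' in auto)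
    also have "\<dots> = (\<Prod>i\<in>UNIV. u $ ?\<tau> i - l $ ?\<tau> i)"
      by (simp add: prod_Basis_cart) (simp add: reindex_vec_def)
    also have "\<dots> = (\<Prod>i\<in>UNIV. u $ i - l $ i)"
      by (rule arg_cong[where f=ennreal], rule prod.reindex_bij_betw) (use bij_imp_bij_inv[OF assms] in auto)
    also have "\<dots> = (\<Prod>b\<in>Basis. (u - l) \<bullet> b)"
      by (simp add: prod_Basis_cart)
    finally show "emeasure (distr lborel lborel ?L) (box l u) = ennreal (\<Prod>b\<in>Basis. (u - l) \<bullet> b)" .
  qed simp
  have mL: "?L \<in> lebesgue \<rightarrow>\<^sub>M lborel" using m by (rule measurable_completion)
  have d: "distr lebesgue lborel ?L = lborel"
    using eq distr_completion[OF m] by simp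
  show "?L \<in> lebesgue \<rightarrow>\<^sub>M lebesgue"
    by (rule completion.measurable_completion2[OF mL]) (simp add: d)
  show "distr lebesgue lebesgue ?L = lebesgue"
    using completion.completion_distr_eq[OF mL] d by simp
qed

lemma integrable_reindex_vec:
  fixes \<sigma> :: "'m::finite \<Rightarrow> 'n::finite" and f :: "real^'m \<Rightarrow> real"
  assumes "bij \<sigma>"
  shows "integrable lebesgue (\<lambda>x. f (reindex_vec \<sigma> x)) \<longleftrightarrow> integrable lebesgue f"
    and "integral\<^sup>L lebesgue (\<lambda>x. f (reindex_vec \<sigma> x)) = integral\<^sup>L lebesgue f"
proof -
  let ?\<tau> = "inv \<sigma>"
  have \<tau>: "\<sigma> (?\<tau> i) = i" "?\<tau> (\<sigma> j) = j" for i j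
    using assms by (auto simp: bij_is_surj surj_f_inv_f bij_is_inj)
  have fwd: "integrable lebesgue (\<lambda>x. g (reindex_vec \<rho> x))"
    if "integrable lebesgue g" "bij \<rho>" for g :: "real^'k::finite \<Rightarrow> real" and \<rho> :: "'k \<Rightarrow> 'l::finite"
    using that distr_lebesgue_reindex_vec[OF that(2)]
    by (metis integrable_distr)
  show iff: "integrable lebesgue (\<lambda>x. f (reindex_vec \<sigma> x)) \<longleftrightarrow> integrable lebesgue f"
  proof
    assume "integrable lebesgue (\<lambda>x. f (reindex_vec \<sigma> x))"
    from fwd[OF this bij_imp_bij_inv[OF assms]] show "integrable lebesgue f"
      by (simp add: reindex_vec_inverse \<tau>)
  qed (rule fwd[OF _ assms])
  show "integral\<^sup>L lebesgue (\<lambda>x. f (reindex_vec \<sigma> x)) = integral\<^sup>L lebesgue f"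
  proof (cases "integrable lebesgue f")
    case True
    then have "f \<in> borel_measurable lebesgue" by auto
    from integral_distr[OF distr_lebesgue_reindex_vec(1)[OF assms] this]
    show ?thesis by (simp add: distr_lebesgue_reindex_vec(2)[OF assms])
  qed (use iff in \<open>simp add: not_integrable_integral_eq\<close>)
qed

lemma set_integrable_reindex_vec:
  fixes \<sigma> :: "'m::finite \<Rightarrow> 'n::finite" and f :: "real^'m \<Rightarrow> real"
  assumes "bij \<sigma>"
  shows "(\<lambda>x. f (reindex_vec \<sigma> x)) absolutely_integrable_on S \<longleftrightarrow> f absolutely_integrable_on (reindex_vec \<sigma> ` S)"
    and "set_lebesgue_integral lebesgue S (\<lambda>x. f (reindex_vec \<sigma> x)) = set_lebesgue_integral lebesgue (reindex_vec \<sigma> ` S) f"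
proof -
  have "inj (reindex_vec \<sigma>)"
    by (rule inj_on_inverseI[where g="reindex_vec (inv \<sigma>)"])
       (use assms in \<open>simp add: reindex_vec_inverse bij_is_surj surj_f_inv_f\<close>)
  then have eq: "indicator S x = (indicator (reindex_vec \<sigma> ` S) (reindex_vec \<sigma> x) :: real)" for x
    by (auto simp: indicator_def inj_def)
  show "(\<lambda>x. f (reindex_vec \<sigma> x)) absolutely_integrable_on S \<longleftrightarrow> f absolutely_integrable_on (reindex_vec \<sigma> ` S)"
    and "set_lebesgue_integral lebesgue S (\<lambda>x. f (reindex_vec \<sigma> x)) = set_lebesgue_integral lebesgue (reindex_vec \<sigma> ` S) f"
    using integrable_reindex_vec[OF assms, of "\<lambda>y. indicator (reindex_vec \<sigma> ` S) y *\<^sub>R f y"]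
    by (simp_all add: set_integrable_def set_lebesgue_integral_def eq)
qed

text \<open>A copy of a finite type that can be well-ordered by an enumeration.\<close>

typedef 'a ordered_copy = "UNIV :: 'a set" ..

lemma bij_Rep_ordered_copy: "bij Rep_ordered_copy"
  by (rule o_bij[of Abs_ordered_copy])
     (auto simp: fun_eq_iff Abs_ordered_copy_inverse Rep_ordered_copy_inverse)

instance ordered_copy :: (finite) finite
proof
  show "finite (UNIV :: 'a ordered_copy set)"
    using bij_betw_finite[OF bij_Rep_ordered_copy[where 'a='a]] by simp
qed

instantiation ordered_copy :: (finite) wellorder
begin

definition less_eq_ordered_copy :: "'a ordered_copy \<Rightarrow> 'a ordered_copy \<Rightarrow> bool" where
  "less_eq_ordered_copy a b \<longleftrightarrow> to_nat (Rep_ordered_copy a) \<le> to_nat (Rep_ordered_copy b)"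

definition less_ordered_copy :: "'a ordered_copy \<Rightarrow> 'a ordered_copy \<Rightarrow> bool" where
  "less_ordered_copy a b \<longleftrightarrow> to_nat (Rep_ordered_copy a) < to_nat (Rep_ordered_copy b)"

instance
proof
  fix P :: "'a ordered_copy \<Rightarrow> bool" and a
  assume "\<And>x. (\<And>y. y < x \<Longrightarrow> P y) \<Longrightarrow> P x"
  then show "P a"
    unfolding less_ordered_copy_def
    using measure_induct_rule[of "\<lambda>a. to_nat (Rep_ordered_copy a)" P a] by metis
qed (auto simp: less_eq_ordered_copy_def less_ordered_copy_def Rep_ordered_copy_inject)

end

text \<open>Conjugating permutations by the bijection of the index types matches the terms of the Leibniz formula.\<close>

lemma det_reindex:
  fixes A :: "real^'n^'n" and \<sigma> :: "'m::finite \<Rightarrow> 'n::finite"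
  assumes "bij \<sigma>"
  shows "det (\<chi> i j. A $ \<sigma> i $ \<sigma> j) = det A"
proof -
  let ?\<tau> = "inv \<sigma>"
  define c where "c = (\<lambda>p. \<sigma> \<circ> p \<circ> ?\<tau>)"
  have \<tau>: "\<sigma> (?\<tau> i) = i" "?\<tau> (\<sigma> j) = j" for i j
    using assms by (auto simp: bij_is_surj surj_f_inv_f bij_is_inj)
  have perm_iff: "p permutes UNIV \<longleftrightarrow> bij p" for p :: "'k \<Rightarrow> 'k"
    by (metis bij_imp_permutes permutes_bij iso_tuple_UNIV_I)
  have swap: "swapidseq k (\<sigma> \<circ> p \<circ> ?\<tau>)" if "swapidseq k p" for k p
    using that
  proof induction
    case id
    have "\<sigma> \<circ> id \<circ> ?\<tau> = id" by (simp add: fun_eq_iff \<tau>)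
    then show ?case by (simp only: swapidseq.id)
  next
    case (comp_Suc n p a b)
    have "\<sigma> \<circ> (Transposition.transpose a b \<circ> p) \<circ> ?\<tau>
        = Transposition.transpose (\<sigma> a) (\<sigma> b) \<circ> (\<sigma> \<circ> p \<circ> ?\<tau>)"
      using \<tau> inj_eq[OF bij_is_inj[OF assms]] by (auto simp: fun_eq_iff Transposition.transpose_def)
    moreover have "\<sigma> a \<noteq> \<sigma> b" using comp_Suc \<tau> by metis
    ultimately show ?case using swapidseq.comp_Suc[OF comp_Suc.IH] by metis
  qed
  have sgn: "sign (c p) = sign p" if "p permutes UNIV" for p
  proof -
    have "permutation p" using that by (simp add: permutation_permutes) (metis finite_class.finite_UNIV)
    then obtain k where k: "swapidseq k p" unfolding permutation_def by auto
    have "evenperm p \<longleftrightarrow> even k" using evenperm_unique[OF k refl] by simp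
    moreover have "evenperm (c p) \<longleftrightarrow> even k" using evenperm_unique[OF swap[OF k] refl] by (simp add: c_def)
    ultimately show ?thesis by (simp add: sign_def)
  qed
  have bij: "bij_betw c {p. p permutes UNIV} {p. p permutes UNIV}"
  proof (rule bij_betw_byWitness[where f'="\<lambda>p. ?\<tau> \<circ> p \<circ> \<sigma>"])
    show "c ` {p. p permutes UNIV} \<subseteq> {p. p permutes UNIV}"
      using assms by (auto simp: perm_iff c_def intro!: bij_comp bij_imp_bij_inv)
    show "(\<lambda>p. ?\<tau> \<circ> p \<circ> \<sigma>) ` {p. p permutes UNIV} \<subseteq> {p. p permutes UNIV}"
      using assms by (auto simp: perm_iff intro!: bij_comp bij_imp_bij_inv)
  qed (auto simp: c_def fun_eq_iff \<tau>)
  have "det A = (\<Sum>p\<in>{p. p permutes UNIV}. of_int (sign (c p)) * (\<Prod>i\<in>UNIV. A $ i $ c p i))"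
    unfolding det_def by (rule sum.reindex_bij_betw[OF bij, symmetric])
  also have "\<dots> = (\<Sum>p\<in>{p. p permutes UNIV}. of_int (sign p) * (\<Prod>i\<in>UNIV. A $ \<sigma> i $ \<sigma> (p i)))"
  proof (rule sum.cong[OF refl])
    fix p :: "'m \<Rightarrow> 'm" assume p: "p \<in> {p. p permutes UNIV}"
    have "(\<Prod>i\<in>UNIV. A $ i $ c p i) = (\<Prod>i\<in>UNIV. A $ \<sigma> i $ c p (\<sigma> i))"
      by (rule prod.reindex_bij_betw[OF assms, symmetric])
    then show "of_int (sign (c p)) * (\<Prod>i\<in>UNIV. A $ i $ c p i) = of_int (sign p) * (\<Prod>i\<in>UNIV. A $ \<sigma> i $ \<sigma> (p i))"
      using sgn p by (simp add: c_def \<tau>)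
  qed
  finally show ?thesis by (simp add: det_def)
qed

text \<open>The change of variables theorem requires a well-ordered index type; the coordinates
  are therefore renamed by a measure preserving linear bijection.\<close>

theorem integrable_change_of_variables:
  fixes g :: "real^'n \<Rightarrow> real^'n" and f :: "real^'n \<Rightarrow> real"
  assumes S: "S \<in> sets lebesgue"
    and der: "\<And>x. x \<in> S \<Longrightarrow> (g has_derivative (\<lambda>h. D x *v h)) (at x within S)"
    and inj: "inj_on g S"
  shows "f absolutely_integrable_on (g ` S) \<longleftrightarrow> (\<lambda>x. \<bar>det (D x)\<bar> * f (g x)) absolutely_integrable_on S"
    and "f absolutely_integrable_on (g ` S) \<Longrightarrow>
      set_lebesgue_integral lebesgue (g ` S) f = set_lebesgue_integral lebesgue S (\<lambda>x. \<bar>det (D x)\<bar> * f (g x))"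
proof -
  let ?R = "Rep_ordered_copy :: 'n ordered_copy \<Rightarrow> 'n"
  let ?L = "reindex_vec ?R" and ?M = "reindex_vec (inv ?R)"
  note bR = bij_Rep_ordered_copy[where 'a='n]
  have R: "?R (inv ?R i) = i" "inv ?R (?R j) = j" for i j
    using bij_inv_eq_iff[OF bR] by metis+
  have MofL [simp]: "?M (?L x) = x" for x by (rule reindex_vec_inverse) (simp add: R)
  have LofM [simp]: "?L (?M x) = x" for x by (rule reindex_vec_inverse) (simp add: R)
  define g' where "g' = (\<lambda>y. ?L (g (?M y)))"
  define D' where "D' = (\<lambda>y. \<chi> i j. D (?M y) $ ?R i $ ?R j)"
  define f' where "f' = (\<lambda>y. f (?M y))"
  let ?S = "?L ` S"
  have LS: "?S \<in> sets lebesgue"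
  proof -
    have "?S = ?M -` S \<inter> space lebesgue" by (auto simp: image_iff) (metis LofM)
    then show ?thesis using distr_lebesgue_reindex_vec(1)[OF bij_imp_bij_inv[OF bR]] S
      by (metis measurable_sets)
  qed
  have bl: "bounded_linear ?L" "bounded_linear ?M"
    using linear_reindex_vec linear_conv_bounded_linear by blast+
  have der': "(g' has_derivative (*v) (D' y)) (at y within ?S)" if y: "y \<in> ?S" for y
  proof -
    obtain x where x: "x \<in> S" "y = ?L x" using y by auto
    have 1: "(g has_derivative (\<lambda>h. D x *v h)) (at (?M y) within ?M ` ?S)"
      using der[OF x(1)] x by (simp add: image_image)
    have 2: "((\<lambda>y. g (?M y)) has_derivative (\<lambda>h. D x *v ?M h)) (at y within ?S)"
      using diff_chain_within[OF bounded_linear_imp_has_derivative[OF bl(2)] 1]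
      by (simp add: o_def)
    have 3: "(g' has_derivative (\<lambda>h. ?L (D x *v ?M h))) (at y within ?S)"
      unfolding g'_def using bounded_linear.has_derivative[OF bl(1) 2] .
    have "?L (D x *v ?M h) = D' y *v h" for h
    proof -
      have "(\<Sum>j\<in>UNIV. D x $ ?R i $ j * h $ inv ?R j) = (\<Sum>j\<in>UNIV. D x $ ?R i $ ?R j * h $ j)" for i
        by (subst sum.reindex_bij_betw[OF bR, symmetric]) (simp add: R)
      then show ?thesis
        by (simp add: vec_eq_iff reindex_vec_def[of ?R "_ *v _"] matrix_vector_mult_def D'_def x)
           (simp add: reindex_vec_def)
    qed
    then show ?thesis using 3 by simp
  qed
  have inj': "inj_on g' ?S"
  proof (rule inj_onI)
    fix a b assume ab: "a \<in> ?S" "b \<in> ?S" and eq: "g' a = g' b"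
    obtain x y where xy: "x \<in> S" "y \<in> S" "a = ?L x" "b = ?L y" using ab by blast
    have "?M (g' a) = ?M (g' b)" using eq by simp
    then have "g x = g y" by (simp add: g'_def xy)
    then have "x = y" using inj_onD[OF inj] xy(1,2) by blast
    then show "a = b" using xy(3,4) by simp
  qed
  have detD: "det (D' y) = det (D (?M y))" for y
    unfolding D'_def by (rule det_reindex[OF bR])
  let ?v = "\<lambda>x. vec (f' x) :: real^1"
  let ?h = "\<lambda>x. \<bar>det (D (?M x))\<bar> * f' (g' x)"
  have CV: "(\<lambda>x. \<bar>det (matrix ((*v) (D' x)))\<bar> *\<^sub>R ?v (g' x)) absolutely_integrable_on ?S \<and>
      integral ?S (\<lambda>x. \<bar>det (matrix ((*v) (D' x)))\<bar> *\<^sub>R ?v (g' x)) = vec b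
      \<longleftrightarrow> ?v absolutely_integrable_on (g' ` ?S) \<and> integral (g' ` ?S) ?v = vec b" for b
    by (rule has_absolute_integral_change_of_variables[OF LS der' inj'])
  have vec_ai: "(\<lambda>x. vec (k x) :: real^1) absolutely_integrable_on T \<longleftrightarrow> k absolutely_integrable_on T"
    for k :: "real^'n ordered_copy \<Rightarrow> real" and T
    by (simp add: absolutely_integrable_on_1_iff)
  have vec_int: "integral T (\<lambda>x. vec (k x) :: real^1) = vec (integral T k)"
    for k :: "real^'n ordered_copy \<Rightarrow> real" and T
    by (simp add: integral_on_1_eq)
  have "(\<lambda>x. \<bar>det (matrix ((*v) (D' x)))\<bar> *\<^sub>R ?v (g' x)) = (\<lambda>x. vec (?h x))"
    by (auto simp: fun_eq_iff vec_eq_iff detD)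
  note CV' = CV[unfolded this vec_ai vec_int]
  have im: "g' ` ?S = ?L ` (g ` S)" by (auto simp: g'_def image_image)
  have iff: "f' absolutely_integrable_on (g' ` ?S) \<longleftrightarrow> ?h absolutely_integrable_on ?S"
    using CV'[of "integral ?S ?h"] CV'[of "integral (g' ` ?S) f'"] by auto
  have inteq: "integral (g' ` ?S) f' = integral ?S ?h" if "f' absolutely_integrable_on (g' ` ?S)"
    using CV'[of "integral (g' ` ?S) f'"] that by (auto simp: vec_eq_iff)
  have A: "f absolutely_integrable_on (g ` S) \<longleftrightarrow> f' absolutely_integrable_on (g' ` ?S)"
    using set_integrable_reindex_vec(1)[OF bR, where f=f' and S="g ` S"] by (simp add: f'_def im)
  have B: "(\<lambda>x. \<bar>det (D x)\<bar> * f (g x)) absolutely_integrable_on S \<longleftrightarrow> ?h absolutely_integrable_on ?S"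
    using set_integrable_reindex_vec(1)[OF bR, where f="?h" and S=S] by (simp add: f'_def g'_def)
  show "f absolutely_integrable_on (g ` S) \<longleftrightarrow> (\<lambda>x. \<bar>det (D x)\<bar> * f (g x)) absolutely_integrable_on S"
    using A B iff by simp
  assume f: "f absolutely_integrable_on (g ` S)"
  have "set_lebesgue_integral lebesgue (g ` S) f = set_lebesgue_integral lebesgue (g' ` ?S) f'"
    using set_integrable_reindex_vec(2)[OF bR, where f=f' and S="g ` S"] by (simp add: f'_def im)
  also have "\<dots> = integral (g' ` ?S) f'"
    using f A by (simp add: set_lebesgue_integral_eq_integral)
  also have "\<dots> = integral ?S ?h" using inteq f A by simp
  also have "\<dots> = set_lebesgue_integral lebesgue ?S ?h"
    using f A iff by (simp add: set_lebesgue_integral_eq_integral)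
  also have "\<dots> = set_lebesgue_integral lebesgue S (\<lambda>x. \<bar>det (D x)\<bar> * f (g x))"
    using set_integrable_reindex_vec(2)[OF bR, where f="?h" and S=S] by (simp add: f'_def g'_def)
  finally show "set_lebesgue_integral lebesgue (g ` S) f = set_lebesgue_integral lebesgue S (\<lambda>x. \<bar>det (D x)\<bar> * f (g x))" .
qed

section \<open>Periodic functions oscillate around their mean\<close>

definition half_open_cell :: "(real^'n) set" where
  "half_open_cell = {x. \<forall>i. 0 \<le> x $ i \<and> x $ i < 1}"

definition cell_periodic :: "(real^'n \<Rightarrow> 'b) \<Rightarrow> bool" where
  "cell_periodic g \<longleftrightarrow> (\<forall>y. \<forall>k\<in>int_vecs. g (y + k) = g y)"

lemma half_open_cell_borel [measurable]: "half_open_cell \<in> sets borel"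
  unfolding half_open_cell_def by measurable

lemma half_open_cell_subset: "box 0 1 \<subseteq> half_open_cell" "half_open_cell \<subseteq> unit_cell"
  by (auto simp: half_open_cell_def unit_cell_def mem_box_cart less_imp_le)

lemma unit_cell_borel [measurable]: "unit_cell \<in> sets borel"
  unfolding unit_cell_def by simp

lemma emeasure_unit_cell: "emeasure lborel (unit_cell :: (real^'n) set) = 1"
proof -
  have "emeasure lborel (cbox 0 1 :: (real^'n) set) = (\<Prod>b\<in>Basis. (1 - 0 :: real^'n) \<bullet> b)"
    by (rule emeasure_lborel_cbox) (auto simp: Basis_vec_def inner_axis)
  then show ?thesis by (simp add: prod_Basis_cart unit_cell_def)
qed

lemma unit_cell_minus_box_null: "unit_cell - box 0 1 \<in> null_sets (lborel :: (real^'n) measure)"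
proof -
  have b: "emeasure lborel (box 0 1 :: (real^'n) set) = (\<Prod>b\<in>Basis. (1 - 0 :: real^'n) \<bullet> b)"
    by (rule emeasure_lborel_box) (auto simp: Basis_vec_def inner_axis)
  have sub: "box 0 1 \<subseteq> (unit_cell :: (real^'n) set)"
    using half_open_cell_subset by blast
  have "emeasure lborel (unit_cell - box 0 1 :: (real^'n) set) = emeasure lborel (unit_cell :: (real^'n) set) - emeasure lborel (box 0 1 :: (real^'n) set)"
    by (rule emeasure_Diff) (use b sub in \<open>auto simp: prod_Basis_cart\<close>)
  then have "emeasure lborel (unit_cell - box 0 1 :: (real^'n) set) = 0"
    using b by (simp add: emeasure_unit_cell prod_Basis_cart)
  then show ?thesis by (auto simp: null_sets_def)
qed

lemma AE_half_open_cell_iff: "AE x in lborel. x \<in> half_open_cell \<longleftrightarrow> x \<in> (unit_cell :: (real^'n) set)"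
  using AE_not_in[OF unit_cell_minus_box_null] half_open_cell_subset by (auto elim!: eventually_mono)

lemma emeasure_half_open_cell: "emeasure lborel (half_open_cell :: (real^'n) set) = 1"
  using emeasure_eq_AE[OF AE_half_open_cell_iff[where 'n='n]] emeasure_unit_cell[where 'n='n] by auto

lemma int_vecs_floor: "(\<chi> i. of_int \<lfloor>y $ i\<rfloor>) \<in> int_vecs"
  by (auto simp: int_vecs_def)

lemma half_open_cell_translate_iff:
  assumes "k \<in> int_vecs"
  shows "y - k \<in> half_open_cell \<longleftrightarrow> k = (\<chi> i. of_int \<lfloor>y $ i\<rfloor>)"
proof
  assume h: "y - k \<in> half_open_cell"
  show "k = (\<chi> i. of_int \<lfloor>y $ i\<rfloor>)"
  proof (subst vec_eq_iff, intro allI)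
    fix i
    obtain m where m: "k $ i = of_int m" using assms by (auto simp: int_vecs_def elim!: Ints_cases)
    have "0 \<le> y $ i - k $ i \<and> y $ i - k $ i < 1" using h by (simp add: half_open_cell_def)
    then have "\<lfloor>y $ i\<rfloor> = m" using m by (intro floor_unique) auto
    then show "k $ i = (\<chi> i. of_int \<lfloor>y $ i\<rfloor>) $ i" using m by simp
  qed
next
  assume k: "k = (\<chi> i. of_int \<lfloor>y $ i\<rfloor>)"
  have "0 \<le> y $ i - of_int \<lfloor>y $ i\<rfloor> \<and> y $ i - of_int \<lfloor>y $ i\<rfloor> < 1" for i by linarith
  then show "y - k \<in> half_open_cell" by (simp add: half_open_cell_def k)
qed

lemma int_vecs_enumeration:
  obtains e :: "nat \<Rightarrow> real^'n" where "bij_betw e UNIV int_vecs"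
proof -
  have "countable (int_vecs :: (real^'n) set)"
  proof -
    have "inj_on (vec_nth :: real^'n \<Rightarrow> _) int_vecs" by (auto simp: inj_on_def vec_eq_iff)
    moreover have "vec_nth ` (int_vecs :: (real^'n) set) \<subseteq> Pi\<^sub>E UNIV (\<lambda>_. \<int>)"
      by (auto simp: int_vecs_def PiE_def)
    moreover have "countable (Pi\<^sub>E (UNIV :: 'n set) (\<lambda>_. \<int> :: real set))"
      by (rule countable_PiE) (auto simp: Ints_def)
    ultimately have "countable (vec_nth ` (int_vecs :: (real^'n) set))" by (simp only: countable_subset)
    then show ?thesis using \<open>inj_on _ _\<close> by (rule countable_image_inj_on)
  qed
  moreover have "infinite (int_vecs :: (real^'n) set)"
  proof
    assume "finite (int_vecs :: (real^'n) set)"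
    moreover have "range (\<lambda>m::nat. (\<chi> i. real m) :: real^'n) \<subseteq> int_vecs" by (auto simp: int_vecs_def)
    ultimately have "finite (range (\<lambda>m::nat. (\<chi> i. real m) :: real^'n))" using finite_subset by blast
    moreover have "inj (\<lambda>m::nat. (\<chi> i. real m) :: real^'n)" by (auto simp: inj_def vec_eq_iff)
    ultimately show False using finite_imageD by blast
  qed
  ultimately show ?thesis using that countable_infiniteE' by blast
qed

text \<open>The integral translates of the half-open cell tile the space; cutting a translate of the cell
  along this tiling and moving the pieces back gives the cell itself.\<close>

lemma nn_integral_periodic_translate:
  fixes g :: "real^'n \<Rightarrow> ennreal"
  assumes [measurable]: "g \<in> borel_measurable borel" and per: "cell_periodic g"
  shows "(\<integral>\<^sup>+y. indicator half_open_cell y * g (z + y) \<partial>lborel) = (\<integral>\<^sup>+y. indicator half_open_cell y * g y \<partial>lborel)"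
proof -
  let ?c = "indicator half_open_cell :: real^'n \<Rightarrow> ennreal"
  obtain e :: "nat \<Rightarrow> real^'n" where e: "bij_betw e UNIV int_vecs" using int_vecs_enumeration .
  have eK: "e j \<in> int_vecs" for j using e by (auto simp: bij_betw_def)
  have one: "(\<Sum>j. ?c (y - e j)) = 1" for y
  proof -
    obtain i where i: "e i = (\<chi> i. of_int \<lfloor>y $ i\<rfloor>)"
      using e int_vecs_floor[of y] by (metis bij_betw_imp_surj_on image_iff)
    have "?c (y - e j) = (if j = i then 1 else 0)" for j
      using half_open_cell_translate_iff[OF eK, of y j] i e by (auto simp: bij_betw_def inj_def)
    then have "(\<lambda>j. ?c (y - e j)) sums 1" using sums_single[of i "\<lambda>_. 1"] by simp
    then show ?thesis by (simp add: sums_iff)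
  qed
  have one': "(\<Sum>j. ?c (y + e j - z)) = 1" for y
  proof -
    obtain i where i: "e i = - (\<chi> i. of_int \<lfloor>(y - z) $ i\<rfloor>)"
    proof -
      have "- (\<chi> i. of_int \<lfloor>(y - z) $ i\<rfloor>) \<in> int_vecs" by (auto simp: int_vecs_def)
      then show ?thesis using that e by (metis bij_betw_imp_surj_on image_iff)
    qed
    have "?c (y + e j - z) = (if j = i then 1 else 0)" for j
    proof -
      have m: "- e j \<in> int_vecs" using eK[of j] by (auto simp: int_vecs_def)
      have "y + e j - z = (y - z) - (- e j)" by simp
      then have "y + e j - z \<in> half_open_cell \<longleftrightarrow> - e j = - e i"
        using half_open_cell_translate_iff[OF m, of "y - z"] i by (simp only: minus_equation_iff[of "e j"] minus_minus)
      then show ?thesis using e by (auto simp: bij_betw_def inj_def)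
    qed
    then have "(\<lambda>j. ?c (y + e j - z)) sums 1" using sums_single[of i "\<lambda>_. 1"] by simp
    then show ?thesis by (simp add: sums_iff)
  qed
  have tr: "(\<integral>\<^sup>+y. f (t + y) \<partial>lborel) = (\<integral>\<^sup>+y. f y \<partial>lborel)" if [measurable]: "f \<in> borel_measurable borel" for f :: "real^'n \<Rightarrow> ennreal" and t
  proof -
    have "(\<integral>\<^sup>+y. f y \<partial>lborel) = (\<integral>\<^sup>+y. f y \<partial>(distr lborel borel ((+) t)))" by (simp add: lborel_distr_plus)
    also have "\<dots> = (\<integral>\<^sup>+y. f (t + y) \<partial>lborel)" by (rule nn_integral_distr) auto
    finally show ?thesis ..
  qed
  have gp: "g (e j + y) = g y" for j y using per eK by (auto simp: cell_periodic_def add.commute)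
  have "(\<integral>\<^sup>+y. ?c y * g (z + y) \<partial>lborel) = (\<integral>\<^sup>+y. ?c (y - z) * g y \<partial>lborel)"
    using tr[of "\<lambda>y. ?c (y - z) * g y" z] by (simp add: algebra_simps)
  also have "\<dots> = (\<integral>\<^sup>+y. (\<Sum>j. ?c (y - e j) * (?c (y - z) * g y)) \<partial>lborel)"
    by (simp add: one)
  also have "\<dots> = (\<Sum>j. \<integral>\<^sup>+y. ?c (y - e j) * (?c (y - z) * g y) \<partial>lborel)"
    by (rule nn_integral_suminf) measurable
  also have "\<dots> = (\<Sum>j. \<integral>\<^sup>+y. ?c (y + e j - z) * (?c y * g y) \<partial>lborel)"
  proof (rule suminf_cong)
    fix j
    have "(\<integral>\<^sup>+y. ?c (y - e j) * (?c (y - z) * g y) \<partial>lborel) = (\<integral>\<^sup>+y. ?c (e j + y - e j) * (?c (e j + y - z) * g (e j + y)) \<partial>lborel)"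
      by (rule tr[symmetric]) measurable
    also have "\<dots> = (\<integral>\<^sup>+y. ?c (y + e j - z) * (?c y * g y) \<partial>lborel)"
      by (rule nn_integral_cong) (simp add: gp, simp add: ac_simps)
    finally show "(\<integral>\<^sup>+y. ?c (y - e j) * (?c (y - z) * g y) \<partial>lborel) = (\<integral>\<^sup>+y. ?c (y + e j - z) * (?c y * g y) \<partial>lborel)" .
  qed
  also have "\<dots> = (\<integral>\<^sup>+y. (\<Sum>j. ?c (y + e j - z) * (?c y * g y)) \<partial>lborel)"
    by (rule nn_integral_suminf[symmetric]) measurable
  also have "\<dots> = (\<integral>\<^sup>+y. ?c y * g y \<partial>lborel)" by (simp add: one')
  finally show ?thesis .
qed

lemma integral_periodic_translate:
  fixes g :: "real^'n \<Rightarrow> real"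
  assumes [measurable]: "g \<in> borel_measurable borel" and per: "cell_periodic g" and M: "\<And>y. \<bar>g y\<bar> \<le> M"
  shows "(\<integral>y. indicator half_open_cell y * g (z + y) \<partial>lborel) = (\<integral>y. indicator half_open_cell y * g y \<partial>lborel)"
proof -
  let ?c = "indicator half_open_cell :: real^'n \<Rightarrow> real"
  have ic: "integrable lborel ?c"
    by (rule integrable_real_indicator) (simp_all add: emeasure_half_open_cell)
  have ig: "integrable lborel (\<lambda>y. ?c y * g (t + y))" for t
    using integrableI_bounded_set_indicator[of half_open_cell lborel "\<lambda>y. g (t + y)" M] M
    by (simp add: emeasure_half_open_cell)
  have pos: "0 \<le> g y + M" for y using M[of y] by linarith
  have eq: "(\<integral>y. ?c y * (g (t + y) + M) \<partial>lborel) = enn2real (\<integral>\<^sup>+y. indicator half_open_cell y * ennreal (g (t + y) + M) \<partial>lborel)" for t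
  proof -
    have "(\<integral>y. ?c y * (g (t + y) + M) \<partial>lborel) = enn2real (\<integral>\<^sup>+y. ennreal (?c y * (g (t + y) + M)) \<partial>lborel)"
      by (rule integral_eq_nn_integral) (measurable, simp add: pos)
    also have "(\<integral>\<^sup>+y. ennreal (?c y * (g (t + y) + M)) \<partial>lborel) = (\<integral>\<^sup>+y. indicator half_open_cell y * ennreal (g (t + y) + M) \<partial>lborel)"
      by (rule nn_integral_cong) (simp split: split_indicator)
    finally show ?thesis .
  qed
  have p: "cell_periodic (\<lambda>y. ennreal (g y + M))" using per by (auto simp: cell_periodic_def)
  have m: "(\<lambda>y. ennreal (g y + M)) \<in> borel_measurable borel" by measurable
  have "(\<integral>y. ?c y * (g (z + y) + M) \<partial>lborel) = (\<integral>y. ?c y * (g (0 + y) + M) \<partial>lborel)"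
    unfolding eq nn_integral_periodic_translate[OF m p, of z] by simp
  then show ?thesis using ig[of z] ig[of 0] ic by (simp add: distrib_left)
qed

text \<open>Averaging the translation \<open>x \<mapsto> x + e y\<close> over the cell replaces \<open>g\<close> by its mean, at the
  cost of the modulus of continuity of \<open>\<theta>\<close> at scale \<open>e\<close>.\<close>

lemma periodic_mean_estimate:
  fixes g \<theta> :: "real^'n \<Rightarrow> real" and e d M R :: real
  assumes g [measurable]: "g \<in> borel_measurable borel" and per: "cell_periodic g" and M: "\<And>y. \<bar>g y\<bar> \<le> M"
    and cont: "continuous_on UNIV \<theta>" and supp: "\<And>x. R < norm x \<Longrightarrow> \<theta> x = 0"
    and e: "0 < e" "e * CARD('n) \<le> 1"
    and osc: "\<And>x v. norm v \<le> e * CARD('n) \<Longrightarrow> \<bar>\<theta> (x + v) - \<theta> x\<bar> \<le> d"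
  shows "\<bar>(\<integral>x. \<theta> x * g (x /\<^sub>R e) \<partial>lborel) - (\<integral>x. \<theta> x \<partial>lborel) * (\<integral>y. indicator half_open_cell y * g y \<partial>lborel)\<bar>
     \<le> d * M * measure lborel (cball (0::real^'n) (R + 1))"
proof -
  let ?c = "indicator half_open_cell :: real^'n \<Rightarrow> real"
  let ?B = "cball (0::real^'n) (R + 1)"
  have \<theta>m [measurable]: "\<theta> \<in> borel_measurable borel" using cont by (rule borel_measurable_continuous_onI)
  have [simp]: "0 \<le> M" using M[of 0] by linarith
  have d0: "0 \<le> d" using osc[of 0 0] e by simp
  have "bounded (\<theta> ` cball 0 R)"
    by (intro compact_imp_bounded compact_continuous_image continuous_on_subset[OF cont]) auto
  then obtain T where "\<forall>x\<in>\<theta> ` cball 0 R. norm x \<le> T" unfolding bounded_iff by blast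
  then have T: "\<bar>\<theta> x\<bar> \<le> T" if "x \<in> cball 0 R" for x using that by (metis imageI real_norm_def)
  define T' where "T' = max T 0"
  have Tb: "\<bar>\<theta> x\<bar> \<le> T'" for x
    using T[of x] supp[of x] by (cases "norm x \<le> R") (auto simp: max_def T'_def)
  have cn: "norm y \<le> CARD('n)" if "y \<in> half_open_cell" for y :: "real^'n"
  proof -
    have "norm y \<le> (\<Sum>i\<in>UNIV. \<bar>y $ i\<bar>)" by (rule norm_le_l1_cart)
    also have "\<dots> \<le> (\<Sum>i\<in>(UNIV::'n set). 1)"
      by (rule sum_mono) (use that in \<open>simp add: half_open_cell_def less_imp_le\<close>)
    finally show ?thesis by simp
  qed
  define H1 where "H1 = (\<lambda>(x, y). ?c y * (\<theta> (x + e *\<^sub>R y) * g (x /\<^sub>R e + y)))"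
  define H2 where "H2 = (\<lambda>(x, y). ?c y * (\<theta> x * g (x /\<^sub>R e + y)))"
  have near: "norm (e *\<^sub>R y) \<le> e * CARD('n)" if "y \<in> half_open_cell" for y :: "real^'n"
    using cn[OF that] e by (simp add: mult_left_mono)
  have z: "\<theta> (x + e *\<^sub>R y) = 0 \<and> \<theta> x = 0" if "y \<in> half_open_cell" "x \<notin> ?B" for x y
  proof -
    have "norm x > R + 1" using that by auto
    moreover have "norm (x + e *\<^sub>R y) \<ge> norm x - norm (e *\<^sub>R y)"
      using norm_triangle_ineq4[of "x + e *\<^sub>R y" "e *\<^sub>R y"] by simp
    ultimately show ?thesis using near[OF that(1)] e(2) supp by auto
  qed
  let ?S = "?B \<times> half_open_cell :: ((real^'n) \<times> (real^'n)) set"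
  have [measurable]: "half_open_cell \<in> sets borel" by simp
  have fin: "emeasure (lborel \<Otimes>\<^sub>M lborel) ?S < \<infinity>"
    by (subst lborel.emeasure_pair_measure_Times)
       (use emeasure_bounded_finite[OF bounded_cball, of "0::real^'n" "R + 1"] in \<open>auto simp: emeasure_half_open_cell\<close>)
  have fin1: "emeasure lborel ?B < \<infinity>" by (rule emeasure_bounded_finite) simp
  have Sm: "?S \<in> sets (lborel \<Otimes>\<^sub>M lborel)" by measurable
  have m1: "H1 \<in> borel_measurable (lborel \<Otimes>\<^sub>M lborel)" unfolding H1_def by measurable
  have m2: "H2 \<in> borel_measurable (lborel \<Otimes>\<^sub>M lborel)" unfolding H2_def by measurable
  have prodb: "\<bar>a * b\<bar> \<le> T' * M" if "\<bar>a\<bar> \<le> T'" "\<bar>b\<bar> \<le> M" for a b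
    using that by (simp add: abs_mult mult_mono)
  have i: "integrable (lborel \<Otimes>\<^sub>M lborel) H"
    if "H \<in> borel_measurable (lborel \<Otimes>\<^sub>M lborel)" "\<And>w. \<bar>H w\<bar> \<le> T' * M" "\<And>w. w \<notin> ?S \<Longrightarrow> H w = 0" for H
  proof (rule integrableI_bounded_set[OF Sm that(1) fin])
    show "AE w in lborel \<Otimes>\<^sub>M lborel. w \<in> ?S \<longrightarrow> norm (H w) \<le> T' * M" using that(2) by simp
    show "AE w in lborel \<Otimes>\<^sub>M lborel. w \<notin> ?S \<longrightarrow> H w = 0" by (rule AE_I2) (rule impI, rule that(3))
  qed
  have z': "norm x \<le> R + 1" if "y \<in> half_open_cell" "\<theta> (x + e *\<^sub>R y) \<noteq> 0 \<or> \<theta> x \<noteq> 0" for x y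
    using z[OF that(1), of x] that(2) by auto
  have b0: "0 \<le> T' * M" by (simp add: T'_def)
  have i1: "integrable (lborel \<Otimes>\<^sub>M lborel) H1"
    by (rule i[OF m1]) (use b0 in \<open>auto intro: z' simp: H1_def prodb Tb M indicator_def split: if_splits\<close>)
  have i2: "integrable (lborel \<Otimes>\<^sub>M lborel) H2"
    by (rule i[OF m2]) (use b0 in \<open>auto intro: z' simp: H2_def prodb Tb M indicator_def split: if_splits\<close>)
  let ?I = "\<integral>x. \<theta> x * g (x /\<^sub>R e) \<partial>lborel"
  let ?G = "\<integral>y. ?c y * g y \<partial>lborel"
  have c1: "(\<integral>y. ?c y \<partial>lborel) = 1"
    by (simp add: measure_def emeasure_half_open_cell)
  have tr: "(\<integral>x. f (t + x) \<partial>lborel) = (\<integral>x. f x \<partial>lborel)" if [measurable]: "f \<in> borel_measurable borel" for f :: "real^'n \<Rightarrow> real" and t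
  proof -
    have "(\<integral>x. f x \<partial>lborel) = (\<integral>x. f x \<partial>(distr lborel borel ((+) t)))" by (simp add: lborel_distr_plus)
    also have "\<dots> = (\<integral>x. f (t + x) \<partial>lborel)" by (rule integral_distr) auto
    finally show ?thesis ..
  qed
  have I1: "integral\<^sup>L (lborel \<Otimes>\<^sub>M lborel) H1 = ?I"
  proof -
    have "(\<integral>x. H1 (x, y) \<partial>lborel) = ?c y * ?I" for y
    proof -
      have "(\<integral>x. \<theta> (x + e *\<^sub>R y) * g (x /\<^sub>R e + y) \<partial>lborel) = ?I"
        using tr[of "\<lambda>x. \<theta> x * g (x /\<^sub>R e)" "e *\<^sub>R y"] e by (simp add: algebra_simps)
      then show ?thesis by (simp add: H1_def)
    qed
    moreover have "integral\<^sup>L (lborel \<Otimes>\<^sub>M lborel) H1 = (\<integral>y. \<integral>x. H1 (x, y) \<partial>lborel \<partial>lborel)"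
      using lborel_pair.integral_snd[of "\<lambda>x y. H1 (x, y)"] i1 by simp
    ultimately show ?thesis using c1 by simp
  qed
  have I2: "integral\<^sup>L (lborel \<Otimes>\<^sub>M lborel) H2 = (\<integral>x. \<theta> x \<partial>lborel) * ?G"
  proof -
    have "(\<integral>y. H2 (x, y) \<partial>lborel) = \<theta> x * ?G" for x
    proof -
      have "(\<integral>y. H2 (x, y) \<partial>lborel) = (\<integral>y. \<theta> x * (?c y * g (x /\<^sub>R e + y)) \<partial>lborel)"
        by (rule Bochner_Integration.integral_cong) (auto simp: H2_def)
      then show ?thesis using integral_periodic_translate[OF g per M, of "x /\<^sub>R e"] by simp
    qed
    moreover have "integral\<^sup>L (lborel \<Otimes>\<^sub>M lborel) H2 = (\<integral>x. \<integral>y. H2 (x, y) \<partial>lborel \<partial>lborel)"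
      using lborel_pair.integral_fst'[OF i2] by simp
    ultimately show ?thesis by simp
  qed
  have "\<bar>?I - (\<integral>x. \<theta> x \<partial>lborel) * ?G\<bar> = \<bar>integral\<^sup>L (lborel \<Otimes>\<^sub>M lborel) (\<lambda>z. H1 z - H2 z)\<bar>"
    using i1 i2 I1 I2 by simp
  also have "\<dots> \<le> integral\<^sup>L (lborel \<Otimes>\<^sub>M lborel) (\<lambda>z. \<bar>H1 z - H2 z\<bar>)"
    by (rule integral_abs_bound)
  also have "\<dots> \<le> integral\<^sup>L (lborel \<Otimes>\<^sub>M lborel) (\<lambda>z. d * M * indicator ?S z)"
  proof (rule integral_mono_AE)
    show "integrable (lborel \<Otimes>\<^sub>M lborel) (\<lambda>z. \<bar>H1 z - H2 z\<bar>)" using i1 i2 by auto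
    show "integrable (lborel \<Otimes>\<^sub>M lborel) (\<lambda>z. d * M * indicator ?S z)"
      using Sm fin by (intro integrable_mult_right integrable_real_indicator) auto
    have "\<bar>H1 w - H2 w\<bar> \<le> d * M * indicator ?S w" for w
    proof -
    obtain x y where w: "w = (x, y)" by (cases w)
    show ?thesis
    proof (cases "y \<in> half_open_cell \<and> x \<in> ?B")
      case True
      have "\<bar>H1 w - H2 w\<bar> = \<bar>\<theta> (x + e *\<^sub>R y) - \<theta> x\<bar> * \<bar>g (x /\<^sub>R e + y)\<bar>"
        using True by (simp add: w H1_def H2_def abs_mult[symmetric] left_diff_distrib)
      also have "\<dots> \<le> d * M" using osc[OF near] True M d0 by (intro mult_mono) auto
      finally show ?thesis using True w by auto
    next
      case False
      then have "H1 w = 0" "H2 w = 0" using z[of y x] by (auto simp: w H1_def H2_def split: split_indicator)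
      then show ?thesis using d0 by simp
    qed
    qed
    then show "AE z in lborel \<Otimes>\<^sub>M lborel. \<bar>H1 z - H2 z\<bar> \<le> d * M * indicator ?S z" by simp
  qed
  also have "\<dots> = d * M * measure (lborel \<Otimes>\<^sub>M lborel) ?S" using Sm fin by simp
  also have "measure (lborel \<Otimes>\<^sub>M lborel) ?S = measure lborel ?B"
    by (simp add: measure_def lborel.emeasure_pair_measure_Times emeasure_half_open_cell)
  finally show ?thesis .
qed

lemma integral_half_open_cell:
  fixes g :: "real^'n \<Rightarrow> real"
  assumes "g \<in> borel_measurable borel"
  shows "(\<integral>y. indicator half_open_cell y * g y \<partial>lborel) = (\<integral>y. g y \<partial>lebesgue_on unit_cell)"
proof -
  have "(\<integral>y. indicator half_open_cell y * g y \<partial>lborel) = (\<integral>y. indicator unit_cell y * g y \<partial>lborel)"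
    using AE_half_open_cell_iff assms
    by (intro integral_cong_AE) (auto split: split_indicator elim!: eventually_mono)
  also have "\<dots> = (\<integral>y. indicator unit_cell y * g y \<partial>lebesgue)"
    using assms by (subst integral_completion) auto
  also have "\<dots> = (\<integral>y. g y \<partial>lebesgue_on unit_cell)"
    by (subst integral_restrict_space) auto
  finally show ?thesis .
qed

lemma periodic_mean_value:
  fixes g \<theta> :: "real^'n \<Rightarrow> real" and \<epsilon> :: "nat \<Rightarrow> real"
  assumes g: "g \<in> borel_measurable borel" and per: "cell_periodic g" and M: "\<And>y. \<bar>g y\<bar> \<le> M"
    and cont: "continuous_on UNIV \<theta>" and supp: "\<And>x. R < norm x \<Longrightarrow> \<theta> x = 0"
    and \<epsilon>: "\<And>n. 0 < \<epsilon> n" "\<epsilon> \<longlonglongrightarrow> 0"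
  shows "(\<lambda>n. \<integral>x. \<theta> x * g (x /\<^sub>R \<epsilon> n) \<partial>lebesgue)
      \<longlonglongrightarrow> (\<integral>x. \<theta> x \<partial>lebesgue) * (\<integral>y. g y \<partial>lebesgue_on unit_cell)"
proof -
  let ?N = "real CARD('n)" and ?m = "measure lborel (cball (0::real^'n) (R + 1))"
  have \<theta>m: "\<theta> \<in> borel_measurable borel" using cont by (rule borel_measurable_continuous_onI)
  have M0: "0 \<le> M" using M[of 0] by linarith
  let ?G = "\<integral>y. indicator half_open_cell y * g y \<partial>lborel"
  have unif: "uniformly_continuous_on UNIV \<theta>"
  proof -
    have "uniformly_continuous_on (cball 0 (R + 1)) \<theta>"
      by (intro compact_uniformly_continuous continuous_on_subset[OF cont]) auto
    note uc = this[unfolded uniformly_continuous_on_def]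
    show ?thesis unfolding uniformly_continuous_on_def
    proof (intro allI impI)
      fix r :: real assume "0 < r"
      then obtain d where d: "0 < d" "\<And>x x'. x \<in> cball 0 (R+1) \<Longrightarrow> x' \<in> cball 0 (R+1) \<Longrightarrow> dist x' x < d \<Longrightarrow> dist (\<theta> x') (\<theta> x) < r"
        using uc by metis
      show "\<exists>d>0. \<forall>x\<in>UNIV. \<forall>x'\<in>UNIV. dist x' x < d \<longrightarrow> dist (\<theta> x') (\<theta> x) < r"
      proof (intro exI[of _ "min d 1"] conjI ballI impI)
        fix x x' :: "real^'n" assume D: "dist x' x < min d 1"
        show "dist (\<theta> x') (\<theta> x) < r"
        proof (cases "x \<in> cball 0 (R+1) \<and> x' \<in> cball 0 (R+1)")
          case True then show ?thesis using d D by auto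
        next
          case False
          have "norm x \<le> norm x' + dist x' x" "norm x' \<le> norm x + dist x' x"
            by (simp_all add: dist_norm) norm+
          then have "R < norm x \<and> R < norm x'" using False D by auto
          then show ?thesis using supp \<open>0 < r\<close> by simp
        qed
      qed (use d in auto)
    qed
  qed
  have "(\<lambda>n. \<integral>x. \<theta> x * g (x /\<^sub>R \<epsilon> n) \<partial>lborel) \<longlonglongrightarrow> (\<integral>x. \<theta> x \<partial>lborel) * ?G"
  proof (rule tendstoI)
    fix r :: real assume r: "0 < r"
    define d where "d = r / (2 * (M * ?m + 1))"
    have P: "0 < M * ?m + 1" using M0 by (simp add: add_nonneg_pos)
    then have d: "0 < d" using r by (simp add: d_def)
    obtain s where s: "0 < s" "\<And>x x'. dist x' x < s \<Longrightarrow> dist (\<theta> x') (\<theta> x) < d"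
      using unif d unfolding uniformly_continuous_on_def by (metis UNIV_I)
    have "(\<lambda>n. \<epsilon> n * ?N) \<longlonglongrightarrow> 0" using tendsto_mult_right_zero[OF \<epsilon>(2)] tendsto_mult_left_zero[OF \<epsilon>(2)] by blast
    then have "\<forall>\<^sub>F n in sequentially. \<epsilon> n * ?N < min s 1"
      by (rule order_tendstoD) (use s in auto)
    then show "\<forall>\<^sub>F n in sequentially. dist (\<integral>x. \<theta> x * g (x /\<^sub>R \<epsilon> n) \<partial>lborel) ((\<integral>x. \<theta> x \<partial>lborel) * ?G) < r"
    proof eventually_elim
      case (elim n)
      have "\<bar>(\<integral>x. \<theta> x * g (x /\<^sub>R \<epsilon> n) \<partial>lborel) - (\<integral>x. \<theta> x \<partial>lborel) * ?G\<bar> \<le> d * M * ?m"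
      proof (rule periodic_mean_estimate[OF g per M cont supp \<epsilon>(1)])
        show "\<epsilon> n * ?N \<le> 1" using elim by simp
        fix x v :: "real^'n" assume "norm v \<le> \<epsilon> n * ?N"
        then show "\<bar>\<theta> (x + v) - \<theta> x\<bar> \<le> d"
          using s(2)[of "x + v" x] elim by (simp add: dist_norm)
      qed
      also have "d * M * ?m < r"
      proof -
        have "d * (M * ?m) \<le> d * (M * ?m + 1)" using d by simp
        also have "\<dots> = r / 2" using less_imp_neq[OF P] unfolding d_def by (simp add: divide_simps del: distrib_left_numeral)
        finally show ?thesis using r by (simp add: mult.assoc)
      qed
      finally show ?case by (simp add: dist_real_def)
    qed
  qed
  moreover have "(\<integral>x. \<theta> x * g (x /\<^sub>R e) \<partial>lebesgue) = (\<integral>x. \<theta> x * g (x /\<^sub>R e) \<partial>lborel)" for e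
  proof (rule integral_completion)
    note [measurable] = g \<theta>m
    show "(\<lambda>x. \<theta> x * g (x /\<^sub>R e)) \<in> borel_measurable lborel" by measurable
  qed
  moreover have "(\<integral>x. \<theta> x \<partial>lebesgue) = (\<integral>x. \<theta> x \<partial>lborel)"
    using \<theta>m by (intro integral_completion) simp
  ultimately show ?thesis using integral_half_open_cell[OF g] by simp
qed

section \<open>Continuous periodic test functions\<close>

definition test_function :: "(real^'n \<Rightarrow> real^'n \<Rightarrow> 'b::topological_space) \<Rightarrow> bool" where
  "test_function \<phi> \<longleftrightarrow> continuous_on UNIV (\<lambda>z. \<phi> (fst z) (snd z)) \<and> (\<forall>x. cell_periodic (\<phi> x))"

text \<open>Vanishes exactly where a coordinate is an integer, that is, where the fractional part jumps.\<close>

definition fast_cutoff :: "real^'n \<Rightarrow> real" where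
  "fast_cutoff y = (\<Prod>i\<in>UNIV. 1 - cos (2 * pi * y $ i))"

definition frac_vec :: "real^'n \<Rightarrow> real^'n" where
  "frac_vec y = (\<chi> i. frac (y $ i))"

lemma fast_cutoff_nonneg: "0 \<le> fast_cutoff y"
  unfolding fast_cutoff_def by (intro prod_nonneg) auto

lemma fast_cutoff_pos_iff: "0 < fast_cutoff y \<longleftrightarrow> (\<forall>i. y $ i \<notin> \<int>)"
proof -
  have "cos (2 * pi * t) = 1 \<longleftrightarrow> t \<in> \<int>" for t
  proof
    assume "cos (2 * pi * t) = 1"
    then obtain n :: int where "2 * pi * t = real_of_int n * 2 * pi" using cos_one_2pi_int[of "2 * pi * t"] by blast
    then have "t = of_int n" by (simp add: field_simps)
    then show "t \<in> \<int>" by (simp only: Ints_of_int)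
  qed (rule cos_integer_2pi)
  then have "fast_cutoff y \<noteq> 0 \<longleftrightarrow> (\<forall>i. y $ i \<notin> \<int>)"
    unfolding fast_cutoff_def by (simp add: right_minus_eq eq_commute[of "1::real"])
  then show ?thesis using fast_cutoff_nonneg[of y] by (metis less_le)
qed

lemma cell_periodic_fast_cutoff: "cell_periodic fast_cutoff"
proof -
  have "cos (2 * pi * (a + b)) = cos (2 * pi * a)" if "b \<in> \<int>" for a b :: real
    using that by (simp add: distrib_left cos_add cos_integer_2pi sin_integer_2pi)
  then show ?thesis by (auto simp: cell_periodic_def fast_cutoff_def int_vecs_def intro!: prod.cong)
qed

lemma cell_periodic_frac_vec: "cell_periodic frac_vec"
  by (auto simp: cell_periodic_def frac_vec_def int_vecs_def vec_eq_iff elim!: Ints_cases) 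
     (metis Ints_cases frac_add_of_int_right)

lemma continuous_fast_cutoff: "continuous_on S fast_cutoff"
  unfolding fast_cutoff_def by (intro continuous_intros)

text \<open>A continuous function becomes periodic by composing with the fractional part; the cutoff removes
  the jumps across the faces of the cells.\<close>

lemma test_function_periodize:
  fixes h :: "(real^'n) \<times> (real^'n) \<Rightarrow> real"
  assumes h: "continuous_on UNIV h" and C: "\<And>z. \<bar>h z\<bar> \<le> C" and c: "0 \<le> c"
  shows "test_function (\<lambda>x y. min 1 (c * fast_cutoff y) * h (x, frac_vec y))"
proof -
  let ?\<chi> = "\<lambda>y::real^'n. min 1 (c * fast_cutoff y) :: real"
  let ?f = "\<lambda>z. ?\<chi> (snd z) * h (fst z, frac_vec (snd z))"
  have \<chi>: "continuous_on UNIV (\<lambda>z::(real^'n) \<times> (real^'n). ?\<chi> (snd z))"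
    by (intro continuous_intros continuous_on_compose2[OF continuous_fast_cutoff]) auto
  have \<chi>0: "0 \<le> ?\<chi> y" for y using c fast_cutoff_nonneg[of y] by simp
  have "isCont ?f z0" for z0
  proof (cases "fast_cutoff (snd z0) = 0")
    case True
    have "(\<lambda>z::(real^'n) \<times> (real^'n). ?\<chi> (snd z)) \<midarrow>z0\<rightarrow> ?\<chi> (snd z0)"
      using \<chi> unfolding continuous_on_eq_continuous_at[OF open_UNIV] isCont_def by blast
    then have "(\<lambda>z. C * ?\<chi> (snd z)) \<midarrow>z0\<rightarrow> C * 0"
      using True by (intro tendsto_mult) auto
    then have lim: "(\<lambda>z. C * ?\<chi> (snd z)) \<midarrow>z0\<rightarrow> 0" by simp
    have "\<forall>\<^sub>F z in at z0. norm (?f z) \<le> C * ?\<chi> (snd z)"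
    proof (intro always_eventually allI)
      fix z
      have "norm (?f z) = \<bar>h (fst z, frac_vec (snd z))\<bar> * ?\<chi> (snd z)"
        using \<chi>0[of "snd z"] by (simp add: abs_mult)
      also have "\<dots> \<le> C * ?\<chi> (snd z)" by (rule mult_right_mono[OF C \<chi>0])
      finally show "norm (?f z) \<le> C * ?\<chi> (snd z)" .
    qed
    then have "?f \<midarrow>z0\<rightarrow> 0" using lim by (rule Lim_null_comparison)
    then show ?thesis using True by (simp add: isCont_def)
  next
    case False
    then have ni: "snd z0 $ i \<notin> \<int>" for i
      using fast_cutoff_pos_iff[of "snd z0"] fast_cutoff_nonneg[of "snd z0"] by (simp add: less_le)
    define k :: "real^'n" where "k = (\<chi> i. of_int \<lfloor>snd z0 $ i\<rfloor>)"
    let ?W = "UNIV \<times> box k (k + 1) :: ((real^'n) \<times> (real^'n)) set"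
    have fr: "frac_vec y = y - k" if "y \<in> box k (k + 1)" for y
    proof -
      have "frac (y $ i) = y $ i - k $ i" for i
      proof -
        have "k $ i < y $ i \<and> y $ i < k $ i + 1" using that by (auto simp: mem_box_cart)
        then have "\<lfloor>y $ i\<rfloor> = \<lfloor>snd z0 $ i\<rfloor>" by (intro floor_unique) (auto simp: k_def)
        then show ?thesis by (simp add: frac_def k_def)
      qed
      then show ?thesis by (simp add: frac_vec_def vec_eq_iff)
    qed
    have "z0 \<in> ?W"
    proof -
      have "of_int \<lfloor>t\<rfloor> < t \<and> t < of_int \<lfloor>t\<rfloor> + 1" if "t \<notin> \<int>" for t :: real
      proof -
        have "of_int \<lfloor>t\<rfloor> \<noteq> t" using that by (metis Ints_of_int)
        then show ?thesis by linarith
      qed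
      then show ?thesis using ni by (auto simp: k_def mem_box_cart mem_Times_iff)
    qed
    moreover have "continuous_on ?W ?f"
    proof -
      have "continuous_on ?W (\<lambda>z. ?\<chi> (snd z) * h (fst z, snd z - k))"
        by (intro continuous_intros continuous_on_subset[OF \<chi>] continuous_on_compose2[OF h]) auto
      then show ?thesis by (rule continuous_on_eq) (auto simp: fr)
    qed
    moreover have "open ?W" by (intro open_Times) auto
    ultimately show ?thesis using continuous_on_eq_continuous_at by blast
  qed
  then have "continuous_on UNIV ?f" by (simp add: continuous_on_eq_continuous_at)
  moreover have "cell_periodic (\<lambda>y. ?\<chi> y * h (x, frac_vec y))" for x
  proof -
    have "cell_periodic (fast_cutoff :: real^'n \<Rightarrow> real)" "cell_periodic (frac_vec :: real^'n \<Rightarrow> real^'n)"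
      by (rule cell_periodic_fast_cutoff cell_periodic_frac_vec)+
    then show ?thesis by (simp add: cell_periodic_def)
  qed
  ultimately show ?thesis by (simp add: test_function_def)
qed

text \<open>Lebesgue measurable functions are almost everywhere limits of continuous ones. Truncation keeps
  the bound, and in the limit periodization changes the values only on the faces of the cells.\<close>

lemma test_functions_dense:
  fixes f :: "(real^'n) \<times> (real^'n) \<Rightarrow> real"
  assumes U: "U \<in> sets borel" and f: "f \<in> borel_measurable (lebesgue_on (U \<times> unit_cell))"
    and C: "AE z in lebesgue_on (U \<times> unit_cell). \<bar>f z\<bar> \<le> C" and C0: "0 \<le> C"
  obtains \<phi> :: "nat \<Rightarrow> real^'n \<Rightarrow> real^'n \<Rightarrow> real" where
    "\<And>k. test_function (\<phi> k)" "\<And>k x y. \<bar>\<phi> k x y\<bar> \<le> C"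
    "AE z in lebesgue_on (U \<times> unit_cell). (\<lambda>k. \<phi> k (fst z) (snd z)) \<longlonglongrightarrow> f z"
proof -
  let ?S = "U \<times> (unit_cell :: (real^'n) set)"
  have S: "?S \<in> sets lebesgue" using borel_Times_lebesgue(1)[OF U unit_cell_borel] .
  have "f measurable_on ?S" using f measurable_on_iff_borel_measurable[OF S] by blast
  then obtain N g where N: "negligible N" and g: "\<And>k. continuous_on UNIV (g k)"
    and lim: "\<And>z. z \<notin> N \<Longrightarrow> (\<lambda>k. g k z) \<longlonglongrightarrow> (if z \<in> ?S then f z else 0)"
    unfolding measurable_on_def by blast
  define h where "h = (\<lambda>k z. max (- C) (min C (g k z)))"
  define \<phi> where "\<phi> = (\<lambda>k x (y::real^'n). min 1 (real k * fast_cutoff y) * h k (x, frac_vec y))"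
  have hC: "\<bar>h k z\<bar> \<le> C" for k z using C0 by (auto simp: h_def)
  have hc: "continuous_on UNIV (h k)" for k unfolding h_def by (intro continuous_intros g)
  have t: "test_function (\<phi> k)" for k
    unfolding \<phi>_def by (rule test_function_periodize[OF hc hC]) simp
  have b: "\<bar>\<phi> k x y\<bar> \<le> C" for k x y
  proof -
    have m: "0 \<le> min 1 (real k * fast_cutoff y)" using fast_cutoff_nonneg[of y] by simp
    have "\<bar>\<phi> k x y\<bar> = min 1 (real k * fast_cutoff y) * \<bar>h k (x, frac_vec y)\<bar>"
      using m by (simp add: \<phi>_def abs_mult)
    also have "\<dots> \<le> 1 * C" by (rule mult_mono) (use hC m in auto)
    finally show ?thesis by simp
  qed
  let ?F = "UNIV \<times> (unit_cell - box 0 1) :: ((real^'n) \<times> (real^'n)) set"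
  have F: "?F \<in> null_sets lebesgue"
  proof (rule null_sets_lebesgue_pairI)
    have "unit_cell - box 0 1 \<in> sets (borel :: (real^'n) measure)" by measurable
    then show "?F \<in> sets lebesgue" by (intro borel_Times_lebesgue(1)) auto
    have "AE y in lebesgue. y \<notin> unit_cell - box (0::real^'n) 1"
      using AE_not_in[OF null_sets_completionI[OF unit_cell_minus_box_null]] .
    then show "AE x in lebesgue. AE y in lebesgue. (x::real^'n, y) \<notin> ?F"
      by simp
  qed
  have "AE z in lebesgue. z \<notin> N"
    using N by (intro AE_not_in) (simp add: negligible_iff_null_sets)
  moreover have "AE z in lebesgue. z \<notin> ?F" by (rule AE_not_in[OF F])
  moreover have "AE z in lebesgue. z \<in> ?S \<longrightarrow> \<bar>f z\<bar> \<le> C"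
    using C S by (simp add: AE_lebesgue_on_iff)
  ultimately have "AE z in lebesgue. z \<in> ?S \<longrightarrow> (\<lambda>k. \<phi> k (fst z) (snd z)) \<longlonglongrightarrow> f z"
  proof eventually_elim
    case (elim z)
    show ?case
    proof
      assume z: "z \<in> ?S"
      obtain x y where xy: "z = (x, y)" by (cases z)
      have y: "y \<in> box 0 1" using z elim(2) xy by auto
      have fr: "frac_vec y = y"
        using y by (auto simp: frac_vec_def vec_eq_iff mem_box_cart frac_eq less_imp_le)
      have "y $ i \<notin> \<int>" for i
        using y by (auto simp: mem_box_cart elim!: Ints_cases)
           (metis less_irrefl of_int_0_less_iff of_int_less_1_iff zero_less_imp_eq_int zless_imp_add1_zle not_le int_one_le_iff_zero_less)
      then have pos: "0 < fast_cutoff y" by (simp add: fast_cutoff_pos_iff)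
      have "\<forall>\<^sub>F k in sequentially. min 1 (real k * fast_cutoff y) = 1"
      proof -
        obtain K where K: "1 < real K * fast_cutoff y" using reals_Archimedean3[OF pos] by blast
        have "min 1 (real k * fast_cutoff y) = 1" if "K \<le> k" for k
        proof -
          have "real K * fast_cutoff y \<le> real k * fast_cutoff y" using that pos by simp
          then show ?thesis using K by simp
        qed
        then show ?thesis unfolding eventually_sequentially by blast
      qed
      then have ev: "\<forall>\<^sub>F k in sequentially. h k z = \<phi> k (fst z) (snd z)"
        by eventually_elim (simp add: \<phi>_def xy fr)
      have "(\<lambda>k. g k z) \<longlonglongrightarrow> f z" using lim[OF elim(1)] z by simp
      then have "(\<lambda>k. h k z) \<longlonglongrightarrow> max (- C) (min C (f z))"
        unfolding h_def by (intro tendsto_intros)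
      also have "max (- C) (min C (f z)) = f z" using elim(3) z by auto
      finally have "(\<lambda>k. h k z) \<longlonglongrightarrow> f z" .
      then show "(\<lambda>k. \<phi> k (fst z) (snd z)) \<longlonglongrightarrow> f z"
        using tendsto_cong[OF ev] by blast
    qed
  qed
  then have "AE z in lebesgue_on ?S. (\<lambda>k. \<phi> k (fst z) (snd z)) \<longlonglongrightarrow> f z"
    using S by (simp add: AE_lebesgue_on_iff)
  with t b show ?thesis using that by blast
qed

section \<open>Measurability and integrals of functions of the slow variable\<close>

lemma borel_measurable_lebesgue_on_AE:
  fixes f g :: "'a::euclidean_space \<Rightarrow> real"
  assumes S: "S \<in> sets lebesgue" and f: "f \<in> borel_measurable (lebesgue_on S)"
    and ae: "AE x in lebesgue_on S. f x = g x"
  shows "g \<in> borel_measurable (lebesgue_on S)"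
proof -
  have "(\<lambda>x. if x \<in> S then f x else 0) \<in> borel_measurable lebesgue"
    using f S by (simp add: borel_measurable_if)
  moreover have "AE x in lebesgue. (if x \<in> S then f x else 0) = (if x \<in> S then g x else 0)"
    using ae unfolding AE_lebesgue_on_iff[OF S] by (rule eventually_mono) auto
  ultimately have "(\<lambda>x. if x \<in> S then g x else 0) \<in> borel_measurable lebesgue"
    by (rule borel_measurable_AE)
  then show ?thesis using S by (simp add: borel_measurable_if)
qed

lemma borel_measurable_lebesgue_on_AE_limit:
  fixes f :: "nat \<Rightarrow> 'a::euclidean_space \<Rightarrow> real"
  assumes S: "S \<in> sets lebesgue" and f: "\<And>i. f i \<in> borel_measurable (lebesgue_on S)"
    and ae: "AE x in lebesgue_on S. (\<lambda>i. f i x) \<longlonglongrightarrow> g x"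
  shows "g \<in> borel_measurable (lebesgue_on S)"
proof (rule borel_measurable_lebesgue_on_AE[OF S])
  show "(\<lambda>x. lim (\<lambda>i. f i x)) \<in> borel_measurable (lebesgue_on S)"
    by (rule borel_measurable_lim_metric[OF f])
  show "AE x in lebesgue_on S. lim (\<lambda>i. f i x) = g x"
    using ae by (rule eventually_mono) (rule limI)
qed

lemma AE_fst_lebesgue_on:
  fixes A :: "'a::euclidean_space set" and B :: "'b::euclidean_space set"
  assumes A: "A \<in> sets borel" and B: "B \<in> sets borel" and P: "AE x in lebesgue_on A. P x"
  shows "AE z in lebesgue_on (A \<times> B). P (fst z)"
proof -
  have S: "A \<times> B \<in> sets lebesgue" "A \<in> sets lebesgue" using borel_Times_lebesgue A B by auto
  have "AE x in lborel. x \<in> A \<longrightarrow> P x"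
    using P unfolding AE_lebesgue_on_iff[OF S(2)] AE_completion_iff .
  then obtain N where N: "{x \<in> space lborel. \<not> (x \<in> A \<longrightarrow> P x)} \<subseteq> N" "emeasure lborel N = 0" "N \<in> sets lborel"
    by (rule AE_E)
  have "N \<times> UNIV \<in> null_sets (lebesgue :: ('a \<times> 'b) measure)"
  proof (rule null_sets_lebesgue_pairI)
    show "N \<times> UNIV \<in> sets (lebesgue :: ('a \<times> 'b) measure)"
      using N(3) by (intro borel_Times_lebesgue(1)) auto
    have "N \<in> null_sets lebesgue" using N by (intro null_sets_completionI) auto
    from AE_not_in[OF this] show "AE x in lebesgue. AE y in (lebesgue :: 'b measure). (x, y) \<notin> N \<times> UNIV"
      by (rule eventually_mono) simp
  qed
  from AE_not_in[OF this] show ?thesis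
    unfolding AE_lebesgue_on_iff[OF S(1)] by (rule eventually_mono) (use N(1) in force)
qed

lemma measurable_fst_lebesgue_on:
  fixes f :: "'a::euclidean_space \<Rightarrow> real"
  assumes A: "A \<in> sets borel" and B: "(B :: 'b::euclidean_space set) \<in> sets borel"
    and f: "f \<in> borel_measurable (lebesgue_on A)"
  shows "(\<lambda>z. f (fst z)) \<in> borel_measurable (lebesgue_on (A \<times> B))"
proof -
  have S: "A \<times> B \<in> sets lebesgue" "A \<in> sets lebesgue" using borel_Times_lebesgue A B by auto
  have "(\<lambda>x. if x \<in> A then f x else 0) \<in> borel_measurable lebesgue"
    using f S by (simp add: borel_measurable_if)
  then obtain g where g: "g \<in> borel_measurable lborel" "AE x in lborel. (if x \<in> A then f x else 0) = g x"
    using completion_ex_borel_measurable_real by blast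
  have "AE x in lebesgue_on A. g x = f x"
    unfolding AE_lebesgue_on_iff[OF S(2)] using AE_completion[OF g(2)] by (rule eventually_mono) auto
  from AE_fst_lebesgue_on[OF A B this] have ae: "AE z in lebesgue_on (A \<times> B). g (fst z) = f (fst z)" .
  have "(fst :: 'a \<times> 'b \<Rightarrow> 'a) \<in> borel_measurable borel"
    by (intro borel_measurable_continuous_onI continuous_intros)
  moreover have "g \<in> borel_measurable borel" using g(1) by simp
  ultimately have "(\<lambda>z::'a \<times> 'b. g (fst z)) \<in> borel_measurable borel" by (rule measurable_compose)
  then have "(\<lambda>z::'a \<times> 'b. g (fst z)) \<in> borel_measurable lborel" by simp
  then have "(\<lambda>z::'a \<times> 'b. g (fst z)) \<in> borel_measurable (lebesgue_on (A \<times> B))"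
    by (rule measurable_restrict_space1[OF measurable_completion])
  then show ?thesis using ae by (rule borel_measurable_lebesgue_on_AE[OF S(1)])
qed

lemma emeasure_lebesgue_on_unit_cell: "emeasure (lebesgue_on unit_cell) (space (lebesgue_on (unit_cell :: (real^'n) set))) = 1"
  by (simp add: emeasure_restrict_space emeasure_unit_cell)

lemma integral_const_unit_cell: "(\<integral>y. c \<partial>lebesgue_on (unit_cell :: (real^'n) set)) = (c :: real)"
  using emeasure_lebesgue_on_unit_cell[where 'n='n] by (simp add: measure_def)

lemma integral_fst_lebesgue_on:
  fixes f :: "real^'n \<Rightarrow> real"
  assumes A: "A \<in> sets borel" and f: "integrable (lebesgue_on A) f"
  shows "integrable (lebesgue_on (A \<times> (unit_cell :: (real^'m) set))) (\<lambda>z. f (fst z))"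
    and "(\<integral>z. f (fst z) \<partial>lebesgue_on (A \<times> (unit_cell :: (real^'m) set))) = (\<integral>x. f x \<partial>lebesgue_on A)"
proof -
  let ?Y = "unit_cell :: (real^'m) set"
  have m: "(\<lambda>z. f (fst z)) \<in> borel_measurable (lebesgue_on (A \<times> ?Y))"
    using f by (intro measurable_fst_lebesgue_on A) auto
  have "(\<integral>\<^sup>+z. ennreal (norm (f (fst z))) \<partial>lebesgue_on (A \<times> ?Y)) = (\<integral>\<^sup>+x. \<integral>\<^sup>+y. ennreal (norm (f x)) \<partial>lebesgue_on ?Y \<partial>lebesgue_on A)"
  proof -
    have "(\<lambda>z. ennreal (norm (f (fst z)))) \<in> borel_measurable (lebesgue_on (A \<times> ?Y))"
      using m by measurable
    from nn_integral_lebesgue_on_Times[OF A unit_cell_borel this] show ?thesis by (simp only: fst_conv)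
  qed
  also have "\<dots> = (\<integral>\<^sup>+x. ennreal (norm (f x)) \<partial>lebesgue_on A)"
    using emeasure_lebesgue_on_unit_cell[where 'n='m] by simp
  also have "\<dots> < \<infinity>" using f by (simp add: integrable_iff_bounded)
  finally show i: "integrable (lebesgue_on (A \<times> ?Y)) (\<lambda>z. f (fst z))" using m by (simp add: integrable_iff_bounded)
  show "(\<integral>z. f (fst z) \<partial>lebesgue_on (A \<times> ?Y)) = (\<integral>x. f x \<partial>lebesgue_on A)"
    using integral_lebesgue_on_Times[OF A unit_cell_borel i] by (simp only: fst_conv integral_const_unit_cell)
qed

section \<open>Pairing with dominated integrands\<close>

text \<open>The free parameter \<open>\<tau>\<close> lets one factor be made small in mean at the expense of the other, which
  replaces Hoelder's inequality in the approximation arguments.\<close>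

lemma Youngs_inequality_scaled:
  fixes a b p q \<tau> :: real
  assumes "1 < p" "1 < q" "1 / p + 1 / q = 1" "0 \<le> a" "0 \<le> b" "0 < \<tau>"
  shows "a * b \<le> \<tau> * a powr p + \<tau> powr (- q / p) * b powr q"
proof -
  have dv: "x / r \<le> x" if "0 \<le> x" "1 < r" for x r :: real
    using that by (auto simp: divide_le_eq mult_le_cancel_left1)
  let ?s = "\<tau> powr (1 / p)"
  have s: "0 < ?s" using assms by simp
  have "a * b = (?s * a) * (b / ?s)" using s by simp
  also have "\<dots> \<le> (?s * a) powr p / p + (b / ?s) powr q / q"
    using assms s by (intro Youngs_inequality) auto
  also have "(?s * a) powr p = \<tau> * a powr p"
    using assms by (simp add: powr_mult powr_powr)
  also have "(b / ?s) powr q = \<tau> powr (- q / p) * b powr q"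
  proof -
    have "b / ?s = b * \<tau> powr (- (1 / p))" by (simp add: powr_minus divide_inverse)
    then show ?thesis using assms by (simp add: powr_mult powr_powr)
  qed
  also have "\<tau> * a powr p / p \<le> \<tau> * a powr p"
    using assms by (intro dv) auto
  also have "\<tau> powr (- q / p) * b powr q / q \<le> \<tau> powr (- q / p) * b powr q"
    using assms by (intro dv) auto
  finally show ?thesis by simp
qed

lemma integral_pairing_bound:
  fixes v w N :: "'a \<Rightarrow> real" and p q \<tau> :: real
  assumes pq: "1 < p" "1 < q" "1 / p + 1 / q = 1" and \<tau>: "0 < \<tau>"
    and v: "v \<in> borel_measurable M" "integrable M (\<lambda>x. \<bar>v x\<bar> powr p)"
    and w: "w \<in> borel_measurable M" and N: "integrable M (\<lambda>x. N x powr q)"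
    and wN: "AE x in M. \<bar>w x\<bar> \<le> N x"
  shows "integrable M (\<lambda>x. v x * w x)"
    and "\<bar>\<integral>x. v x * w x \<partial>M\<bar> \<le> \<tau> * (\<integral>x. \<bar>v x\<bar> powr p \<partial>M) + \<tau> powr (- q / p) * (\<integral>x. N x powr q \<partial>M)"
proof -
  have i: "integrable M (\<lambda>x. t * \<bar>v x\<bar> powr p + t powr (- q / p) * N x powr q)" for t
    using v N by auto
  have b: "AE x in M. norm (v x * w x) \<le> t * \<bar>v x\<bar> powr p + t powr (- q / p) * N x powr q" if "0 < t" for t
    using wN
  proof eventually_elim
    case (elim x)
    have "norm (v x * w x) \<le> \<bar>v x\<bar> * N x" using elim by (simp add: abs_mult mult_left_mono)
    also have "\<dots> \<le> t * \<bar>v x\<bar> powr p + t powr (- q / p) * N x powr q"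
      using elim that by (intro Youngs_inequality_scaled pq) auto
    finally show ?case .
  qed
  show *: "integrable M (\<lambda>x. v x * w x)"
  proof (rule Bochner_Integration.integrable_bound[OF i[of 1]])
    show "(\<lambda>x. v x * w x) \<in> borel_measurable M" using v(1) w by (rule borel_measurable_times)
    show "AE x in M. norm (v x * w x) \<le> norm (1 * \<bar>v x\<bar> powr p + 1 powr (- q / p) * N x powr q)"
      using b[OF zero_less_one] by (rule eventually_mono) (metis abs_ge_self order_trans real_norm_def)
  qed
  have "\<bar>\<integral>x. v x * w x \<partial>M\<bar> \<le> (\<integral>x. \<tau> * \<bar>v x\<bar> powr p + \<tau> powr (- q / p) * N x powr q \<partial>M)"
    by (rule order_trans[OF integral_abs_bound]) (use integral_mono_AE[OF integrable_norm[OF *] i b[OF \<tau>]] in simp)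
  also have "\<dots> = \<tau> * (\<integral>x. \<bar>v x\<bar> powr p \<partial>M) + \<tau> powr (- q / p) * (\<integral>x. N x powr q \<partial>M)"
    using v N by simp
  finally show "\<bar>\<integral>x. v x * w x \<partial>M\<bar> \<le> \<tau> * (\<integral>x. \<bar>v x\<bar> powr p \<partial>M) + \<tau> powr (- q / p) * (\<integral>x. N x powr q \<partial>M)" .
qed

text \<open>Integrands, not necessarily continuous, whose pairings are controlled through a bound in \<open>L\<^sup>q\<close>;
  they cover both products of an indicator with a periodic function and elements of the Bochner space.\<close>

definition dominated_integrand ::
  "real \<Rightarrow> (real^'n) set \<Rightarrow> (real^'n \<Rightarrow> real^'n \<Rightarrow> real) \<Rightarrow> (real^'n \<Rightarrow> real) \<Rightarrow> bool" where
  "dominated_integrand q U \<phi> N \<longleftrightarrow>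
     integrable (lebesgue_on U) (\<lambda>x. N x powr q) \<and>
     (AE x in lebesgue_on U. \<forall>y. \<bar>\<phi> x y\<bar> \<le> N x) \<and>
     (\<forall>e>0. (\<lambda>x. \<phi> x (x /\<^sub>R e)) \<in> borel_measurable (lebesgue_on U)) \<and>
     (\<lambda>z. \<phi> (fst z) (snd z)) \<in> borel_measurable (lebesgue_on (U \<times> unit_cell))"

lemma dominated_integrand_pairing:
  fixes v :: "real^'n \<Rightarrow> real"
  assumes "dominated_integrand q U \<phi> N" "1 < p" "1 < q" "1 / p + 1 / q = 1" "v \<in> Lp p U" "0 < \<tau>" "0 < e"
  shows "integrable (lebesgue_on U) (\<lambda>x. v x * \<phi> x (x /\<^sub>R e))"
    and "\<bar>\<integral>x. v x * \<phi> x (x /\<^sub>R e) \<partial>lebesgue_on U\<bar>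
      \<le> \<tau> * (\<integral>x. \<bar>v x\<bar> powr p \<partial>lebesgue_on U) + \<tau> powr (- q / p) * (\<integral>x. N x powr q \<partial>lebesgue_on U)"
proof -
  have N: "integrable (lebesgue_on U) (\<lambda>x. N x powr q)"
    and m: "(\<lambda>x. \<phi> x (x /\<^sub>R e)) \<in> borel_measurable (lebesgue_on U)"
    and b: "AE x in lebesgue_on U. \<bar>\<phi> x (x /\<^sub>R e)\<bar> \<le> N x"
    using assms unfolding dominated_integrand_def by (auto elim: eventually_mono)
  have vm: "v \<in> borel_measurable (lebesgue_on U)" "integrable (lebesgue_on U) (\<lambda>x. \<bar>v x\<bar> powr p)"
    using assms by (auto simp: Lp_def)
  show "integrable (lebesgue_on U) (\<lambda>x. v x * \<phi> x (x /\<^sub>R e))"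
    by (rule integral_pairing_bound(1)[OF assms(2-4,6) vm m N b])
  show "\<bar>\<integral>x. v x * \<phi> x (x /\<^sub>R e) \<partial>lebesgue_on U\<bar>
      \<le> \<tau> * (\<integral>x. \<bar>v x\<bar> powr p \<partial>lebesgue_on U) + \<tau> powr (- q / p) * (\<integral>x. N x powr q \<partial>lebesgue_on U)"
    by (rule integral_pairing_bound(2)[OF assms(2-4,6) vm m N b])
qed

lemma dominated_integrand_pairing_limit:
  fixes v0 :: "(real^'n) \<times> (real^'n) \<Rightarrow> real"
  assumes d: "dominated_integrand q U \<phi> N" and pq: "1 < p" "1 < q" "1 / p + 1 / q = 1"
    and v: "v0 \<in> Lp p (U \<times> unit_cell)" and \<tau>: "0 < \<tau>" and U: "U \<in> sets borel"
  shows "integrable (lebesgue_on (U \<times> unit_cell)) (\<lambda>z. v0 z * \<phi> (fst z) (snd z))"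
    and "\<bar>\<integral>z. v0 z * \<phi> (fst z) (snd z) \<partial>lebesgue_on (U \<times> unit_cell)\<bar>
      \<le> \<tau> * (\<integral>z. \<bar>v0 z\<bar> powr p \<partial>lebesgue_on (U \<times> unit_cell)) + \<tau> powr (- q / p) * (\<integral>x. N x powr q \<partial>lebesgue_on U)"
proof -
  have N: "integrable (lebesgue_on U) (\<lambda>x. N x powr q)" using d by (simp add: dominated_integrand_def)
  note N2 = integral_fst_lebesgue_on[OF U N, where 'm='n]
  have "AE x in lebesgue_on U. \<forall>y. \<bar>\<phi> x y\<bar> \<le> N x" using d by (simp add: dominated_integrand_def)
  from AE_fst_lebesgue_on[OF U unit_cell_borel this]
  have b: "AE z in lebesgue_on (U \<times> unit_cell). \<bar>\<phi> (fst z) (snd z)\<bar> \<le> N (fst z)"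
    by (rule eventually_mono) blast
  have m: "(\<lambda>z. \<phi> (fst z) (snd z)) \<in> borel_measurable (lebesgue_on (U \<times> unit_cell))"
    using d by (simp add: dominated_integrand_def)
  have vm: "v0 \<in> borel_measurable (lebesgue_on (U \<times> unit_cell))" "integrable (lebesgue_on (U \<times> unit_cell)) (\<lambda>z. \<bar>v0 z\<bar> powr p)"
    using v by (auto simp: Lp_def)
  show "integrable (lebesgue_on (U \<times> unit_cell)) (\<lambda>z. v0 z * \<phi> (fst z) (snd z))"
    by (rule integral_pairing_bound(1)[OF pq \<tau> vm m N2(1) b])
  show "\<bar>\<integral>z. v0 z * \<phi> (fst z) (snd z) \<partial>lebesgue_on (U \<times> unit_cell)\<bar>
      \<le> \<tau> * (\<integral>z. \<bar>v0 z\<bar> powr p \<partial>lebesgue_on (U \<times> unit_cell)) + \<tau> powr (- q / p) * (\<integral>x. N x powr q \<partial>lebesgue_on U)"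
    using integral_pairing_bound(2)[OF pq \<tau> vm m N2(1) b] by (simp add: N2(2))
qed

definition pairings_converge ::
  "(nat \<Rightarrow> real) \<Rightarrow> (real^'n) set \<Rightarrow> (nat \<Rightarrow> real^'n \<Rightarrow> real) \<Rightarrow> ((real^'n) \<times> (real^'n) \<Rightarrow> real) \<Rightarrow>
   (real^'n \<Rightarrow> real^'n \<Rightarrow> real) \<Rightarrow> bool" where
  "pairings_converge \<epsilon> U v v0 \<phi> \<longleftrightarrow>
     (\<lambda>n. \<integral>x. v n x * \<phi> x (x /\<^sub>R \<epsilon> n) \<partial>lebesgue_on U)
       \<longlonglongrightarrow> (\<integral>z. v0 z * \<phi> (fst z) (snd z) \<partial>lebesgue_on (U \<times> unit_cell))"

lemma LIMSEQ_by_approximation: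
  fixes a :: "nat \<Rightarrow> real"
  assumes "\<And>r. 0 < r \<Longrightarrow> \<exists>b B. b \<longlonglongrightarrow> B \<and> (\<forall>\<^sub>F n in sequentially. \<bar>a n - b n\<bar> \<le> r) \<and> \<bar>A - B\<bar> \<le> r"
  shows "a \<longlonglongrightarrow> A"
proof (rule tendstoI)
  fix r :: real assume "0 < r"
  then obtain b B where b: "b \<longlonglongrightarrow> B" "\<forall>\<^sub>F n in sequentially. \<bar>a n - b n\<bar> \<le> r / 4" "\<bar>A - B\<bar> \<le> r / 4"
    using assms[of "r / 4"] by auto
  have "\<forall>\<^sub>F n in sequentially. dist (b n) B < r / 4" using b(1) \<open>0 < r\<close> by (intro tendstoD) auto
  with b(2) show "\<forall>\<^sub>F n in sequentially. dist (a n) A < r"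
  proof eventually_elim
    case (elim n)
    then show ?case using b(3) \<open>0 < r\<close> unfolding dist_real_def by linarith
  qed
qed

text \<open>Only the approximation error in \<open>L\<^sup>q\<close> matters, because the sequence is bounded in \<open>L\<^sup>p\<close>.\<close>

lemma pairings_converge_limit:
  fixes v :: "nat \<Rightarrow> real^'n \<Rightarrow> real" and v0 :: "(real^'n) \<times> (real^'n) \<Rightarrow> real"
  assumes pq: "1 < p" "1 < q" "1 / p + 1 / q = 1" and U: "U \<in> sets borel"
    and \<epsilon>: "\<And>n. 0 < \<epsilon> n" and v: "\<And>n. v n \<in> Lp p U" and v0: "v0 \<in> Lp p (U \<times> unit_cell)"
    and K: "\<forall>\<^sub>F n in sequentially. (\<integral>x. \<bar>v n x\<bar> powr p \<partial>lebesgue_on U) \<le> K"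
    and c: "\<And>k. pairings_converge \<epsilon> U v v0 (\<psi> k)" and \<psi>: "\<And>k. dominated_integrand q U (\<psi> k) (N k)"
    and \<phi>: "dominated_integrand q U \<phi> N'"
    and d: "\<And>k. dominated_integrand q U (\<lambda>x y. \<phi> x y - \<psi> k x y) (d k)"
    and d0: "(\<lambda>k. \<integral>x. d k x powr q \<partial>lebesgue_on U) \<longlonglongrightarrow> 0"
  shows "pairings_converge \<epsilon> U v v0 \<phi>"
  unfolding pairings_converge_def
proof (rule LIMSEQ_by_approximation)
  fix r :: real assume r: "0 < r"
  let ?V = "\<integral>z. \<bar>v0 z\<bar> powr p \<partial>lebesgue_on (U \<times> unit_cell)"
  have V0: "0 \<le> ?V" by simp
  define L where "L = max K ?V + 1"
  have L: "K \<le> L" "?V \<le> L" by (auto simp: L_def)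
  have L0: "0 < L" using V0 max.cobounded2[of ?V K] unfolding L_def by linarith
  define \<tau> where "\<tau> = r / (2 * L)"
  have \<tau>: "0 < \<tau>" using r L0 by (simp add: \<tau>_def)
  define c where "c = \<tau> powr (- q / p)"
  have c0: "0 < c" using \<tau> by (simp add: c_def)
  have "\<forall>\<^sub>F k in sequentially. (\<integral>x. d k x powr q \<partial>lebesgue_on U) < r / (2 * c)"
    using d0 by (rule order_tendstoD) (use r c0 in simp)
  then obtain k where k: "(\<integral>x. d k x powr q \<partial>lebesgue_on U) < r / (2 * c)"
    unfolding eventually_sequentially by blast
  have ck: "c * (\<integral>x. d k x powr q \<partial>lebesgue_on U) \<le> r / 2"
    using mult_left_mono[OF less_imp_le[OF k], of c] c0 by (simp add: field_simps)
  have bound: "\<tau> * s + c * (\<integral>x. d k x powr q \<partial>lebesgue_on U) \<le> r" if "s \<le> L" for s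
  proof -
    have "\<tau> * s \<le> \<tau> * L" using that \<tau> by simp
    also have "\<dots> = r / 2" using L0 by (simp add: \<tau>_def)
    finally show ?thesis using ck by simp
  qed
  let ?I = "\<lambda>n \<phi>. \<integral>x. v n x * \<phi> x (x /\<^sub>R \<epsilon> n) \<partial>lebesgue_on U"
  let ?J = "\<lambda>\<phi>. \<integral>z. v0 z * \<phi> (fst z) (snd z) \<partial>lebesgue_on (U \<times> unit_cell)"
  have "\<forall>\<^sub>F n in sequentially. \<bar>?I n \<phi> - ?I n (\<psi> k)\<bar> \<le> r"
    using K
  proof eventually_elim
    case (elim n)
    have "?I n \<phi> - ?I n (\<psi> k) = ?I n (\<lambda>x y. \<phi> x y - \<psi> k x y)"
      using dominated_integrand_pairing(1)[OF \<phi> pq v \<tau> \<epsilon>] dominated_integrand_pairing(1)[OF \<psi> pq v \<tau> \<epsilon>]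
      by (simp add: right_diff_distrib)
    also have "\<bar>\<dots>\<bar> \<le> \<tau> * (\<integral>x. \<bar>v n x\<bar> powr p \<partial>lebesgue_on U) + c * (\<integral>x. d k x powr q \<partial>lebesgue_on U)"
      unfolding c_def by (rule dominated_integrand_pairing(2)[OF d pq v \<tau> \<epsilon>])
    also have "\<dots> \<le> r" by (rule bound) (use elim L in simp)
    finally show ?case .
  qed
  moreover have "\<bar>?J \<phi> - ?J (\<psi> k)\<bar> \<le> r"
  proof -
    have "?J \<phi> - ?J (\<psi> k) = ?J (\<lambda>x y. \<phi> x y - \<psi> k x y)"
      using dominated_integrand_pairing_limit(1)[OF \<phi> pq v0 \<tau> U] dominated_integrand_pairing_limit(1)[OF \<psi> pq v0 \<tau> U]
      by (simp add: right_diff_distrib)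
    also have "\<bar>\<dots>\<bar> \<le> \<tau> * ?V + c * (\<integral>x. d k x powr q \<partial>lebesgue_on U)"
      unfolding c_def by (rule dominated_integrand_pairing_limit(2)[OF d pq v0 \<tau> U])
    also have "\<dots> \<le> r" by (rule bound) (use L in simp)
    finally show ?thesis .
  qed
  ultimately show "\<exists>b B. b \<longlonglongrightarrow> B \<and> (\<forall>\<^sub>F n in sequentially. \<bar>?I n \<phi> - b n\<bar> \<le> r) \<and> \<bar>?J \<phi> - B\<bar> \<le> r"
    using assms(9)[of k] unfolding pairings_converge_def by blast
qed

section \<open>The norm of continuous periodic functions\<close>

abbreviation per_norm :: "(real^'n \<Rightarrow> real) \<Rightarrow> real" where
  "per_norm \<equiv> C_norm unit_cell"

lemma C_per_iff: "g \<in> C_per \<longleftrightarrow> continuous_on UNIV g \<and> cell_periodic g"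
  by (simp add: C_per_def cell_periodic_def)

lemma C_per_diff: "g \<in> C_per \<Longrightarrow> h \<in> C_per \<Longrightarrow> (\<lambda>y. g y - h y) \<in> C_per"
  by (auto simp: C_per_iff cell_periodic_def intro: continuous_intros)

lemma C_per_const: "(\<lambda>y. c) \<in> C_per"
  by (auto simp: C_per_iff cell_periodic_def)

lemma C_per_translate_into_cell:
  fixes g :: "real^'n \<Rightarrow> 'b" and y :: "real^'n"
  assumes "cell_periodic g"
  obtains y' where "y' \<in> unit_cell" "g y' = g y"
proof -
  let ?k = "(\<chi> i. of_int \<lfloor>y $ i\<rfloor>) :: real^'n"
  have "y - ?k \<in> half_open_cell"
    using half_open_cell_translate_iff[OF int_vecs_floor[of y], of y] by blast
  then have "y - ?k \<in> unit_cell" using half_open_cell_subset by blast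
  moreover have "g (y - ?k) = g y"
    using assms int_vecs_floor[of y] unfolding cell_periodic_def by (metis diff_add_cancel)
  ultimately show ?thesis using that by blast
qed

lemma C_per_bdd:
  assumes "g \<in> C_per"
  shows "bdd_above (insert 0 ((\<lambda>x. norm (g x)) ` unit_cell))"
proof -
  have "compact ((\<lambda>x. norm (g x)) ` unit_cell)"
    using assms by (intro compact_continuous_image continuous_on_norm)
      (auto simp: C_per_iff unit_cell_def intro: continuous_on_subset)
  then show ?thesis by (auto intro: compact_imp_bounded bounded_imp_bdd_above)
qed

lemma per_norm_upper: "g \<in> C_per \<Longrightarrow> \<bar>g y\<bar> \<le> per_norm g"
proof -
  assume g: "g \<in> C_per"
  then obtain y' where y': "y' \<in> unit_cell" "g y' = g y"
    by (metis C_per_iff C_per_translate_into_cell)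
  have "norm (g y') \<le> per_norm g"
    unfolding C_norm_def by (rule cSup_upper[OF _ C_per_bdd[OF g]]) (use y'(1) in blast)
  then show ?thesis using y' by simp
qed

lemma per_norm_nonneg: "g \<in> C_per \<Longrightarrow> 0 \<le> per_norm g"
  using per_norm_upper[of g 0] by linarith

lemma per_norm_le: "0 \<le> B \<Longrightarrow> (\<And>y. y \<in> unit_cell \<Longrightarrow> \<bar>g y\<bar> \<le> B) \<Longrightarrow> per_norm g \<le> B"
  unfolding C_norm_def by (rule cSup_least) auto

lemma per_norm_const: "per_norm (\<lambda>y::real^'n. c) = \<bar>c\<bar>"
proof (rule antisym)
  show "per_norm (\<lambda>y::real^'n. c) \<le> \<bar>c\<bar>" by (rule per_norm_le) auto
  show "\<bar>c\<bar> \<le> per_norm (\<lambda>y::real^'n. c)" by (rule per_norm_upper[OF C_per_const])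
qed

lemma per_norm_diff_le:
  assumes "g \<in> C_per" "h \<in> C_per"
  shows "\<bar>per_norm g - per_norm h\<bar> \<le> per_norm (\<lambda>y. g y - h y)"
proof -
  let ?D = "per_norm (\<lambda>y. g y - h y)"
  note D = per_norm_upper[OF C_per_diff[OF assms]] and D0 = per_norm_nonneg[OF C_per_diff[OF assms]]
  have "per_norm g \<le> per_norm h + ?D"
  proof (rule per_norm_le)
    show "0 \<le> per_norm h + ?D" using D0 per_norm_nonneg[OF assms(2)] by simp
    show "\<bar>g y\<bar> \<le> per_norm h + ?D" for y
      using D[of y] per_norm_upper[OF assms(2), of y] by linarith
  qed
  moreover have "per_norm h \<le> per_norm g + ?D"
  proof (rule per_norm_le)
    show "0 \<le> per_norm g + ?D" using D0 per_norm_nonneg[OF assms(1)] by simp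
    show "\<bar>h y\<bar> \<le> per_norm g + ?D" for y
      using D[of y] per_norm_upper[OF assms(1), of y] by linarith
  qed
  ultimately show ?thesis by linarith
qed

lemma per_norm_diff_commute: "per_norm (\<lambda>y. g y - h y) = per_norm (\<lambda>y. h y - g y)"
  unfolding C_norm_def by (simp add: abs_minus_commute)

section \<open>Elements of the Bochner space as dominated integrands\<close>

lemma test_function_section: "test_function \<phi> \<Longrightarrow> \<phi> x \<in> C_per"
proof -
  assume t: "test_function \<phi>"
  then have c: "continuous_on UNIV (\<lambda>z. \<phi> (fst z) (snd z))" by (simp add: test_function_def)
  have "continuous_on UNIV (\<lambda>y. \<phi> (fst (x, y)) (snd (x, y)))"
    by (rule continuous_on_compose2[OF c]) (intro continuous_intros, simp)
  then show ?thesis using t by (simp add: C_per_iff test_function_def)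
qed

lemma continuous_imp_measurable_lebesgue_on:
  assumes "continuous_on UNIV f"
  shows "f \<in> borel_measurable (lebesgue_on S)"
  using borel_measurable_continuous_onI[OF assms]
  by (intro measurable_restrict_space1 measurable_completion) simp

lemma test_function_measurable:
  fixes \<phi> :: "real^'n \<Rightarrow> real^'n \<Rightarrow> 'b::{t2_space, topological_space}"
  assumes "test_function \<phi>"
  shows "(\<lambda>x. \<phi> x (x /\<^sub>R e)) \<in> borel_measurable (lebesgue_on S)"
    and "(\<lambda>z. \<phi> (fst z) (snd z)) \<in> borel_measurable (lebesgue_on T)"
proof -
  have c: "continuous_on UNIV (\<lambda>z. \<phi> (fst z) (snd z))" using assms by (simp add: test_function_def)
  show "(\<lambda>z. \<phi> (fst z) (snd z)) \<in> borel_measurable (lebesgue_on T)"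
    by (rule continuous_imp_measurable_lebesgue_on[OF c])
  have "continuous_on UNIV (\<lambda>x. \<phi> (fst (x, x /\<^sub>R e)) (snd (x, x /\<^sub>R e)))"
    by (rule continuous_on_compose2[OF c]) (intro continuous_intros, simp)
  then show "(\<lambda>x. \<phi> x (x /\<^sub>R e)) \<in> borel_measurable (lebesgue_on S)"
    by (intro continuous_imp_measurable_lebesgue_on) simp
qed

lemma finite_measure_lebesgue_on:
  assumes "bounded U" "U \<in> sets lebesgue"
  shows "finite_measure (lebesgue_on U)"
proof
  have "emeasure lebesgue U < \<infinity>"
    using emeasure_bounded_finite[OF assms(1)] assms
    by (metis bounded_set_imp_lmeasurable fmeasurableD2 infinity_ennreal_def top.not_eq_extremum)
  then show "emeasure (lebesgue_on U) (space (lebesgue_on U)) \<noteq> \<infinity>"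
    using assms by (simp add: emeasure_restrict_space)
qed

text \<open>Rounding the slow variable down to a grid turns a test function into a simple function.\<close>

definition grid_round :: "nat \<Rightarrow> real^'n \<Rightarrow> real^'n" where
  "grid_round i x = (\<chi> j. of_int \<lfloor>real (Suc i) * x $ j\<rfloor> / real (Suc i))"

lemma norm_grid_round: "norm (grid_round i x - x) \<le> CARD('n) / real (Suc i)" for x :: "real^'n"
proof -
  have "\<bar>of_int \<lfloor>m * t\<rfloor> / m - t\<bar> \<le> 1 / m" if "0 < m" for m t :: real
  proof -
    have "of_int \<lfloor>m * t\<rfloor> \<le> m * t" "m * t < of_int \<lfloor>m * t\<rfloor> + 1" by linarith+
    then have "\<bar>of_int \<lfloor>m * t\<rfloor> - m * t\<bar> \<le> 1" by linarith
    moreover have "of_int \<lfloor>m * t\<rfloor> / m - t = (of_int \<lfloor>m * t\<rfloor> - m * t) / m" using that by (simp add: field_simps)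
    ultimately show ?thesis using that by (simp add: divide_right_mono)
  qed
  then have *: "\<bar>(grid_round i x - x) $ j\<bar> \<le> 1 / real (Suc i)" for j
    using of_nat_0_less_iff zero_less_Suc unfolding grid_round_def by (metis vec_lambda_beta vector_minus_component)
  have "norm (grid_round i x - x) \<le> (\<Sum>j\<in>UNIV. \<bar>(grid_round i x - x) $ j\<bar>)" by (rule norm_le_l1_cart)
  also have "\<dots> \<le> (\<Sum>j\<in>(UNIV :: 'n set). 1 / real (Suc i))" by (rule sum_mono) (rule *)
  finally show ?thesis by simp
qed

lemma grid_round_borel: "grid_round i \<in> borel_measurable borel"
proof -
  have "(\<lambda>x::real^'n. grid_round i x $ j) \<in> borel_measurable borel" for j
    unfolding grid_round_def by (simp, measurable)
  then show ?thesis
    by (subst borel_measurable_euclidean_space) (auto simp: Basis_vec_def inner_axis)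
qed

lemma simple_grid_round:
  assumes "bounded U"
  shows "simple_function (lebesgue_on U) (grid_round i :: real^'n \<Rightarrow> _)"
proof (rule simple_function_borel_measurable)
  have "grid_round i \<in> borel_measurable lborel" using grid_round_borel by simp
  then show "grid_round i \<in> borel_measurable (lebesgue_on U)"
    by (rule measurable_restrict_space1[OF measurable_completion])
  obtain B where B: "\<And>x. x \<in> U \<Longrightarrow> norm x \<le> B" using assms unfolding bounded_iff by auto
  let ?m = "real (Suc i)"
  let ?F = "(\<lambda>k. real_of_int k / ?m) ` {\<lfloor>- ?m * B\<rfloor>..\<lceil>?m * B\<rceil>}"
  have "grid_round i ` U \<subseteq> {x. \<forall>j. x $ j \<in> ?F}"
  proof safe
    fix x j assume x: "x \<in> U"
    have "\<bar>x $ j\<bar> \<le> B" using B[OF x] component_le_norm_cart[of x j] by linarith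
    then have "\<bar>?m * x $ j\<bar> \<le> ?m * B" by (simp add: abs_mult mult_left_mono del: of_nat_Suc)
    then have a: "- ?m * B \<le> ?m * x $ j" "?m * x $ j \<le> ?m * B" by (auto simp: abs_le_iff minus_le_iff simp del: of_nat_Suc)
    have "\<lfloor>- ?m * B\<rfloor> \<le> \<lfloor>?m * x $ j\<rfloor>" using a(1) by (rule floor_mono)
    moreover have "\<lfloor>?m * x $ j\<rfloor> \<le> \<lceil>?m * B\<rceil>" using a(2) by linarith
    ultimately show "grid_round i x $ j \<in> ?F" by (auto simp: grid_round_def simp del: of_nat_Suc)
  qed
  moreover have "finite {x :: real^'n. \<forall>j. x $ j \<in> ?F}"
  proof -
    have "{x :: real^'n. \<forall>j. x $ j \<in> ?F} \<subseteq> vec_lambda ` (Pi\<^sub>E UNIV (\<lambda>_. ?F))"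
    proof
      fix x :: "real^'n" assume "x \<in> {x. \<forall>j. x $ j \<in> ?F}"
      then have "vec_nth x \<in> Pi\<^sub>E UNIV (\<lambda>_. ?F)" by auto
      then show "x \<in> vec_lambda ` (Pi\<^sub>E UNIV (\<lambda>_. ?F))" by (metis image_eqI vec_nth_inverse)
    qed
    moreover have "finite (Pi\<^sub>E (UNIV :: 'n set) (\<lambda>_. ?F))" by (rule finite_PiE) auto
    ultimately show ?thesis by (meson finite_imageI finite_subset)
  qed
  ultimately show "finite (grid_round i ` space (lebesgue_on U))"
    by (simp add: finite_subset)
qed

text \<open>Only values near a bounded set matter in the slow variable, and one cell in the fast one, so
  compactness gives bounds and moduli uniform in both variables.\<close>

lemma test_function_uniform:
  fixes \<phi> :: "real^'n \<Rightarrow> real^'n \<Rightarrow> 'b::real_normed_vector"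
  assumes t: "test_function \<phi>" and U: "bounded U"
  shows "\<exists>B. \<forall>x\<in>U. \<forall>y. norm (\<phi> x y) \<le> B"
    and "0 < r \<Longrightarrow> \<exists>d>0. \<forall>x\<in>U. \<forall>x'. \<forall>y. norm (x' - x) < d \<longrightarrow> norm (\<phi> x' y - \<phi> x y) < r"
proof -
  let ?f = "\<lambda>z. \<phi> (fst z) (snd z)"
  have c: "continuous_on UNIV ?f" and per: "\<And>x. cell_periodic (\<phi> x)" using t by (auto simp: test_function_def)
  obtain R where R: "\<And>x. x \<in> U \<Longrightarrow> norm x \<le> R" using U unfolding bounded_iff by auto
  let ?K = "cball (0::real^'n) (R + 1) \<times> (unit_cell :: (real^'n) set)"
  have K: "compact ?K" by (intro compact_Times) (auto simp: unit_cell_def)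
  have cK: "continuous_on ?K ?f" by (rule continuous_on_subset[OF c]) simp
  have "bounded (?f ` ?K)" by (rule compact_imp_bounded[OF compact_continuous_image[OF cK K]])
  then obtain B where B: "\<And>z. z \<in> ?K \<Longrightarrow> norm (?f z) \<le> B" unfolding bounded_iff by blast
  show "\<exists>B. \<forall>x\<in>U. \<forall>y. norm (\<phi> x y) \<le> B"
  proof (intro exI ballI allI)
    fix x y assume "x \<in> U"
    obtain y' where y': "y' \<in> unit_cell" "\<phi> x y' = \<phi> x y" using C_per_translate_into_cell[OF per] by metis
    have "(x, y') \<in> ?K" using R[OF \<open>x \<in> U\<close>] y' by auto
    from B[OF this] y' show "norm (\<phi> x y) \<le> B" by simp
  qed
  assume "0 < r"
  have "uniformly_continuous_on ?K ?f" using compact_uniformly_continuous[OF cK K] .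
  then obtain d where d: "0 < d" "\<And>z z'. z \<in> ?K \<Longrightarrow> z' \<in> ?K \<Longrightarrow> dist z' z < d \<Longrightarrow> dist (?f z') (?f z) < r"
    unfolding uniformly_continuous_on_def using \<open>0 < r\<close> by metis
  show "\<exists>d>0. \<forall>x\<in>U. \<forall>x'. \<forall>y. norm (x' - x) < d \<longrightarrow> norm (\<phi> x' y - \<phi> x y) < r"
  proof (intro exI[of _ "min d 1"] conjI ballI allI impI)
    fix x x' y :: "real^'n" assume x: "x \<in> U" and n: "norm (x' - x) < min d 1"
    let ?k = "(\<chi> i. of_int \<lfloor>y $ i\<rfloor>) :: real^'n"
    let ?y = "y - ?k"
    have y': "?y \<in> unit_cell"
      using half_open_cell_translate_iff[OF int_vecs_floor[of y], of y] half_open_cell_subset by blast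
    have eq: "\<phi> a ?y = \<phi> a y" for a
      using per[of a] int_vecs_floor[of y] unfolding cell_periodic_def by (metis diff_add_cancel)
    have nx: "norm x \<le> R" by (rule R[OF x])
    moreover have "norm x' \<le> R + 1" using nx n norm_triangle_ineq[of "x' - x" x] by simp
    ultimately have "(x, ?y) \<in> ?K" "(x', ?y) \<in> ?K" using y' by auto
    moreover have "dist (x', ?y) (x, ?y) < d" using n by (simp add: dist_Pair_Pair dist_norm)
    ultimately have "dist (?f (x', ?y)) (?f (x, ?y)) < r" by (rule d(2))
    then show "norm (\<phi> x' y - \<phi> x y) < r" by (simp add: eq dist_norm)
  qed (use d in auto)
qed

lemma test_function_Bochner:
  fixes \<phi> :: "real^'n \<Rightarrow> real^'n \<Rightarrow> real"
  assumes t: "test_function \<phi>" and U: "bounded U" "U \<in> sets lebesgue" and q: "0 \<le> q"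
  shows "\<phi> \<in> Bochner_Lp q U C_per per_norm"
proof -
  have sp: "\<phi> x \<in> C_per" for x by (rule test_function_section[OF t])
  define s where "s = (\<lambda>i x. \<phi> (grid_round i x))"
  have simp: "simple_function (lebesgue_on U) (s i)" for i
    unfolding s_def by (rule simple_function_compose1[OF simple_grid_round[OF U(1)]])
  have conv: "(\<lambda>i. per_norm (\<lambda>y. s i x y - \<phi> x y)) \<longlonglongrightarrow> 0" if x: "x \<in> U" for x
  proof (rule LIMSEQ_I)
    fix r :: real assume r: "0 < r"
    obtain d where d: "0 < d" "\<And>x' y. norm (x' - x) < d \<Longrightarrow> norm (\<phi> x' y - \<phi> x y) < r / 2"
      using test_function_uniform(2)[OF t U(1), of "r / 2"] r x by (metis half_gt_zero)
    have "(\<lambda>i. CARD('n) / real (Suc i)) \<longlonglongrightarrow> 0" by (rule LIMSEQ_Suc[OF lim_const_over_n])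
    then have "\<forall>\<^sub>F i in sequentially. CARD('n) / real (Suc i) < d" using d(1) by (rule order_tendstoD)
    then obtain i0 where i0: "\<And>i. i0 \<le> i \<Longrightarrow> CARD('n) / real (Suc i) < d" unfolding eventually_sequentially by blast
    have "norm (per_norm (\<lambda>y. s i x y - \<phi> x y) - 0) < r" if "i0 \<le> i" for i
    proof -
      have "per_norm (\<lambda>y. s i x y - \<phi> x y) \<le> r / 2"
      proof (rule per_norm_le)
        fix y
        have "norm (grid_round i x - x) < d" using norm_grid_round[of i x] i0[OF that] by linarith
        from d(2)[OF this, of y] show "\<bar>s i x y - \<phi> x y\<bar> \<le> r / 2" by (simp add: s_def)
      qed (use r in simp)
      moreover have "0 \<le> per_norm (\<lambda>y. s i x y - \<phi> x y)"
        by (intro per_norm_nonneg C_per_diff) (auto simp: s_def sp)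
      ultimately show ?thesis using r by simp
    qed
    then show "\<exists>no. \<forall>i\<ge>no. norm (per_norm (\<lambda>y. s i x y - \<phi> x y) - 0) < r" by blast
  qed
  have sm: "strongly_measurable (lebesgue_on U) C_per per_norm \<phi>"
    unfolding strongly_measurable_def
    using simp conv sp by (intro conjI exI[of _ s] AE_I2) (auto simp: s_def)
  have meas: "(\<lambda>x. per_norm (\<phi> x)) \<in> borel_measurable (lebesgue_on U)"
  proof (rule borel_measurable_lebesgue_on_AE_limit[OF U(2)])
    show "(\<lambda>x. per_norm (s i x)) \<in> borel_measurable (lebesgue_on U)" for i
      using simp[of i] by (intro borel_measurable_simple_function simple_function_compose1[of _ "s i" per_norm])
    have "(\<lambda>i. per_norm (s i x)) \<longlonglongrightarrow> per_norm (\<phi> x)" if "x \<in> U" for x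
    proof -
      have "(\<lambda>i. per_norm (s i x) - per_norm (\<phi> x)) \<longlonglongrightarrow> 0"
        by (rule Lim_null_comparison[OF _ conv[OF that]])
           (auto intro!: always_eventually per_norm_diff_le simp: s_def sp)
      then show ?thesis by (simp add: LIM_zero_iff)
    qed
    then show "AE x in lebesgue_on U. (\<lambda>i. per_norm (s i x)) \<longlonglongrightarrow> per_norm (\<phi> x)" by (intro AE_I2) simp
  qed
  obtain B where B: "\<And>x y. x \<in> U \<Longrightarrow> norm (\<phi> x y) \<le> B" using test_function_uniform(1)[OF t U(1)] by blast
  have "integrable (lebesgue_on U) (\<lambda>x. per_norm (\<phi> x) powr q)"
  proof (rule finite_measure.integrable_const_bound[OF finite_measure_lebesgue_on[OF U]])
    show "AE x in lebesgue_on U. norm (per_norm (\<phi> x) powr q) \<le> (max B 0) powr q"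
    proof (intro AE_I2)
      fix x assume "x \<in> space (lebesgue_on U)"
      then have "per_norm (\<phi> x) \<le> max B 0" using B[of x] by (intro per_norm_le) (auto simp: le_max_iff_disj)
      then show "norm (per_norm (\<phi> x) powr q) \<le> (max B 0) powr q"
        using per_norm_nonneg[OF sp] q by (simp add: powr_mono2)
    qed
    show "(\<lambda>x. per_norm (\<phi> x) powr q) \<in> borel_measurable (lebesgue_on U)" using meas by measurable
  qed
  with sm show ?thesis by (simp add: Bochner_Lp_def)
qed

section \<open>Weak two-scale convergence is tested on products\<close>

lemma dominated_integrand_product:
  fixes f :: "real^'n \<Rightarrow> real"
  assumes U: "bounded U" "U \<in> sets borel" and f: "f \<in> borel_measurable (lebesgue_on U)"
    and C: "\<And>x. x \<in> U \<Longrightarrow> \<bar>f x\<bar> \<le> C" and g: "g \<in> C_per" and q: "0 \<le> q"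
  shows "dominated_integrand q U (\<lambda>x y. f x * g y) (\<lambda>x. \<bar>f x\<bar> * per_norm g)"
  unfolding dominated_integrand_def
proof (intro conjI allI impI)
  have Ul: "U \<in> sets lebesgue" using U by (simp add: sets_completionI_sets)
  have gc: "continuous_on UNIV g" using g by (simp add: C_per_iff)
  have N0: "0 \<le> per_norm g" by (rule per_norm_nonneg[OF g])
  show "integrable (lebesgue_on U) (\<lambda>x. (\<bar>f x\<bar> * per_norm g) powr q)"
  proof (rule finite_measure.integrable_const_bound[OF finite_measure_lebesgue_on[OF U(1) Ul]])
    show "AE x in lebesgue_on U. norm ((\<bar>f x\<bar> * per_norm g) powr q) \<le> (max C 0 * per_norm g) powr q"
    proof (intro AE_I2)
      fix x assume "x \<in> space (lebesgue_on U)"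
      then have "\<bar>f x\<bar> \<le> max C 0" using C[of x] by (simp add: le_max_iff_disj)
      then have "\<bar>f x\<bar> * per_norm g \<le> max C 0 * per_norm g" by (rule mult_right_mono[OF _ N0])
      then show "norm ((\<bar>f x\<bar> * per_norm g) powr q) \<le> (max C 0 * per_norm g) powr q"
        using N0 q by (simp add: powr_mono2)
    qed
    show "(\<lambda>x. (\<bar>f x\<bar> * per_norm g) powr q) \<in> borel_measurable (lebesgue_on U)" using f by measurable
  qed
  show "AE x in lebesgue_on U. \<forall>y. \<bar>f x * g y\<bar> \<le> \<bar>f x\<bar> * per_norm g"
    by (intro AE_I2 allI) (simp add: abs_mult mult_left_mono per_norm_upper[OF g])
  show "(\<lambda>x. f x * g (x /\<^sub>R e)) \<in> borel_measurable (lebesgue_on U)" for e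
  proof (rule borel_measurable_times[OF f])
    have "continuous_on UNIV (\<lambda>x. g (x /\<^sub>R e))"
      by (rule continuous_on_compose2[OF gc]) (intro continuous_intros, simp)
    then show "(\<lambda>x. g (x /\<^sub>R e)) \<in> borel_measurable (lebesgue_on U)"
      by (rule continuous_imp_measurable_lebesgue_on)
  qed
  show "(\<lambda>z. f (fst z) * g (snd z)) \<in> borel_measurable (lebesgue_on (U \<times> unit_cell))"
  proof (rule borel_measurable_times[OF measurable_fst_lebesgue_on[OF U(2) unit_cell_borel f]])
    have "continuous_on UNIV (\<lambda>z::(real^'n) \<times> (real^'n). g (snd z))"
      by (rule continuous_on_compose2[OF gc]) (intro continuous_intros, simp)
    then show "(\<lambda>z. g (snd z)) \<in> borel_measurable (lebesgue_on (U \<times> unit_cell))"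
      by (rule continuous_imp_measurable_lebesgue_on)
  qed
qed

lemma pairings_converge_cong:
  assumes "\<And>x y. x \<in> U \<Longrightarrow> \<phi> x y = \<psi> x y"
  shows "pairings_converge \<epsilon> U v v0 \<phi> \<longleftrightarrow> pairings_converge \<epsilon> U v v0 \<psi>"
proof -
  have "(\<integral>x. v n x * \<phi> x (x /\<^sub>R \<epsilon> n) \<partial>lebesgue_on U) = (\<integral>x. v n x * \<psi> x (x /\<^sub>R \<epsilon> n) \<partial>lebesgue_on U)" for n
    by (rule Bochner_Integration.integral_cong) (auto simp: assms)
  moreover have "(\<integral>z. v0 z * \<phi> (fst z) (snd z) \<partial>lebesgue_on (U \<times> unit_cell)) = (\<integral>z. v0 z * \<psi> (fst z) (snd z) \<partial>lebesgue_on (U \<times> unit_cell))"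
    by (rule Bochner_Integration.integral_cong) (auto simp: assms)
  ultimately show ?thesis unfolding pairings_converge_def by simp
qed

lemma pairings_converge_sum:
  fixes \<phi> :: "'i \<Rightarrow> real^'n \<Rightarrow> real^'n \<Rightarrow> real"
  assumes pq: "1 < p" "1 < q" "1 / p + 1 / q = 1" and U: "U \<in> sets borel"
    and \<epsilon>: "\<And>n. 0 < \<epsilon> n" and v: "\<And>n. v n \<in> Lp p U" and v0: "v0 \<in> Lp p (U \<times> unit_cell)"
    and d: "\<And>i. i \<in> I \<Longrightarrow> dominated_integrand q U (\<phi> i) (N i)"
    and c: "\<And>i. i \<in> I \<Longrightarrow> pairings_converge \<epsilon> U v v0 (\<phi> i)"
  shows "pairings_converge \<epsilon> U v v0 (\<lambda>x y. \<Sum>i\<in>I. \<phi> i x y)"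
proof -
  have "(\<integral>x. v n x * (\<Sum>i\<in>I. \<phi> i x (x /\<^sub>R \<epsilon> n)) \<partial>lebesgue_on U) = (\<Sum>i\<in>I. \<integral>x. v n x * \<phi> i x (x /\<^sub>R \<epsilon> n) \<partial>lebesgue_on U)" for n
    unfolding sum_distrib_left
    by (rule Bochner_Integration.integral_sum) (rule dominated_integrand_pairing(1)[OF d pq v zero_less_one \<epsilon>])
  moreover have "(\<integral>z. v0 z * (\<Sum>i\<in>I. \<phi> i (fst z) (snd z)) \<partial>lebesgue_on (U \<times> unit_cell))
      = (\<Sum>i\<in>I. \<integral>z. v0 z * \<phi> i (fst z) (snd z) \<partial>lebesgue_on (U \<times> unit_cell))"
    unfolding sum_distrib_left
    by (rule Bochner_Integration.integral_sum) (rule dominated_integrand_pairing_limit(1)[OF d pq v0 zero_less_one U])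
  ultimately show ?thesis
    using c unfolding pairings_converge_def by (simp only: tendsto_sum)
qed

text \<open>The distance to the complement cuts the approximating functions off at the boundary of \<open>U\<close>.\<close>

lemma indicator_approximation:
  fixes U A :: "(real^'n) set"
  assumes U: "open U" "bounded U" and A: "A \<in> sets lebesgue"
  obtains \<theta> :: "nat \<Rightarrow> real^'n \<Rightarrow> real" where
    "\<And>k. continuous_on UNIV (\<theta> k)" "\<And>k x. x \<notin> U \<Longrightarrow> \<theta> k x = 0" "\<And>k x. 0 \<le> \<theta> k x" "\<And>k x. \<theta> k x \<le> 1"
    "AE x in lebesgue_on U. (\<lambda>k. \<theta> k x) \<longlonglongrightarrow> indicator A x"
proof -
  have Ul: "U \<in> sets lebesgue" using U by auto
  have "(indicator A :: real^'n \<Rightarrow> real) \<in> borel_measurable (lebesgue_on UNIV)" using A by simp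
  then have "(indicator A :: real^'n \<Rightarrow> real) measurable_on UNIV"
    by (subst measurable_on_iff_borel_measurable) auto
  then obtain N g where N: "negligible N" and g: "\<And>k. continuous_on UNIV (g k)"
    and lim: "\<And>x. x \<notin> N \<Longrightarrow> (\<lambda>k. g k x) \<longlonglongrightarrow> (indicator A x :: real)"
    unfolding measurable_on_def by (auto split: if_splits)
  have ne: "- U \<noteq> {}" using U(2) not_bounded_UNIV by (metis Compl_UNIV_eq double_compl)
  define \<theta> where "\<theta> = (\<lambda>k x. max 0 (min 1 (g k x)) * min 1 (real k * infdist x (- U)))"
  have "continuous_on UNIV (\<theta> k)" for k
    unfolding \<theta>_def by (intro continuous_intros g)
  moreover have "\<theta> k x = 0" if "x \<notin> U" for k x
    using that by (simp add: \<theta>_def infdist_zero)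
  moreover have "0 \<le> \<theta> k x" for k x by (simp add: \<theta>_def infdist_nonneg)
  moreover have "\<theta> k x \<le> 1" for k x
    unfolding \<theta>_def by (intro mult_le_one) (auto simp: infdist_nonneg)
  moreover have "AE x in lebesgue_on U. (\<lambda>k. \<theta> k x) \<longlonglongrightarrow> indicator A x"
  proof -
    have "AE x in lebesgue. x \<notin> N" using N by (intro AE_not_in) (simp add: negligible_iff_null_sets)
    then have "AE x in lebesgue. x \<in> U \<longrightarrow> (\<lambda>k. \<theta> k x) \<longlonglongrightarrow> indicator A x"
    proof eventually_elim
      case (elim x)
      show ?case
      proof
        assume "x \<in> U"
        then have pos: "0 < infdist x (- U)" using U ne by (intro infdist_pos_not_in_closed) auto
        obtain K where K: "1 < real K * infdist x (- U)" using reals_Archimedean3[OF pos] by blast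
        have "min 1 (real k * infdist x (- U)) = 1" if "K \<le> k" for k
        proof -
          have "real K * infdist x (- U) \<le> real k * infdist x (- U)" using that pos by simp
          then show ?thesis using K by simp
        qed
        then have "\<forall>\<^sub>F k in sequentially. min 1 (real k * infdist x (- U)) = 1"
          unfolding eventually_sequentially by blast
        then have "(\<lambda>k. min 1 (real k * infdist x (- U))) \<longlonglongrightarrow> 1" by (rule tendsto_eventually)
        then have "(\<lambda>k. \<theta> k x) \<longlonglongrightarrow> max 0 (min 1 (indicator A x)) * 1"
          unfolding \<theta>_def by (intro tendsto_intros lim[OF elim])
        then show "(\<lambda>k. \<theta> k x) \<longlonglongrightarrow> indicator A x" by (simp add: indicator_def split: if_splits)
      qed
    qed
    then show ?thesis by (simp add: AE_lebesgue_on_iff[OF Ul])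
  qed
  ultimately show ?thesis using that by blast
qed

lemma simple_integrand_sum:
  assumes "simple_function (lebesgue_on U) s" "x \<in> U"
  shows "s x y = (\<Sum>g\<in>s ` U. indicator (s -` {g} \<inter> U) x * g y :: real)"
proof -
  have fin: "finite (s ` U)" using assms(1) by (simp add: simple_function_def)
  have "(\<Sum>g\<in>s ` U. indicator (s -` {g} \<inter> U) x * g y) = (\<Sum>g\<in>s ` U. if g = s x then g y else 0)"
    by (rule sum.cong) (use assms(2) in \<open>auto simp: indicator_def\<close>)
  also have "\<dots> = s x y" using fin assms(2) by simp
  finally show ?thesis ..
qed

lemma simple_integrand_level_sets:
  assumes "simple_function (lebesgue_on U) s" "U \<in> sets lebesgue"
  shows "s -` {g} \<inter> U \<in> sets (lebesgue_on U)" "s -` {g} \<inter> U \<in> sets lebesgue"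
proof -
  show *: "s -` {g} \<inter> U \<in> sets (lebesgue_on U)"
  proof (cases "g \<in> s ` U")
    case True then show ?thesis using assms(1) by (auto simp: simple_function_def)
  next
    case False
    then have "s -` {g} \<inter> U = {}" by auto
    then show ?thesis by simp
  qed
  then show "s -` {g} \<inter> U \<in> sets lebesgue" using assms(2) sets_restrict_space_iff[of U lebesgue] by auto
qed

lemma simple_integrand_measurable:
  fixes s :: "real^'n \<Rightarrow> real^'n \<Rightarrow> real"
  assumes U: "U \<in> sets borel" and s: "simple_function (lebesgue_on U) s" "\<And>x. x \<in> U \<Longrightarrow> s x \<in> C_per"
  shows "(\<lambda>x. s x (x /\<^sub>R e)) \<in> borel_measurable (lebesgue_on U)"
    and "(\<lambda>z. s (fst z) (snd z)) \<in> borel_measurable (lebesgue_on (U \<times> unit_cell))"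
proof -
  have Ul: "U \<in> sets lebesgue" using U by (simp add: sets_completionI_sets)
  let ?A = "\<lambda>g. s -` {g} \<inter> U"
  have iA: "(\<lambda>x. indicator (?A g) x :: real) \<in> borel_measurable (lebesgue_on U)" for g
    using simple_integrand_level_sets(1)[OF s(1) Ul] by (rule borel_measurable_indicator)
  have gc: "continuous_on UNIV g" if "g \<in> s ` U" for g using that s(2) by (auto simp: C_per_iff)
  have "(\<lambda>x. \<Sum>g\<in>s ` U. indicator (?A g) x * g (x /\<^sub>R e)) \<in> borel_measurable (lebesgue_on U)"
  proof (intro borel_measurable_sum borel_measurable_times iA continuous_imp_measurable_lebesgue_on)
    fix g assume "g \<in> s ` U"
    show "continuous_on UNIV (\<lambda>x. g (x /\<^sub>R e))"
      by (rule continuous_on_compose2[OF gc[OF \<open>g \<in> s ` U\<close>]]) (intro continuous_intros, simp)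
  qed
  then show "(\<lambda>x. s x (x /\<^sub>R e)) \<in> borel_measurable (lebesgue_on U)"
    by (rule measurable_cong[THEN iffD1, rotated]) (simp add: simple_integrand_sum[OF s(1), symmetric])
  have "(\<lambda>z. \<Sum>g\<in>s ` U. indicator (?A g) (fst z) * g (snd z)) \<in> borel_measurable (lebesgue_on (U \<times> unit_cell))"
  proof (rule borel_measurable_sum)
    fix g assume "g \<in> s ` U"
    then have "continuous_on UNIV (\<lambda>z::(real^'n) \<times> (real^'n). g (snd z))"
      by (intro continuous_on_compose2[OF gc]) (auto intro: continuous_intros)
    from borel_measurable_times[OF measurable_fst_lebesgue_on[OF U unit_cell_borel iA] continuous_imp_measurable_lebesgue_on[OF this]]
    show "(\<lambda>z. indicator (?A g) (fst z) * g (snd z)) \<in> borel_measurable (lebesgue_on (U \<times> unit_cell))" .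
  qed
  then show "(\<lambda>z. s (fst z) (snd z)) \<in> borel_measurable (lebesgue_on (U \<times> unit_cell))"
    by (rule measurable_cong[THEN iffD1, rotated]) (auto simp: simple_integrand_sum[OF s(1), symmetric])
qed

text \<open>Strong measurability provides simple functions converging almost everywhere only. Truncating them
  at twice the norm of the limit makes dominated convergence in \<open>L\<^sup>q\<close> available.\<close>

lemma Bochner_simple_approximation:
  fixes \<phi> :: "real^'n \<Rightarrow> real^'n \<Rightarrow> real"
  assumes U: "U \<in> sets borel" and \<phi>: "\<phi> \<in> Bochner_Lp q U C_per per_norm" and q: "0 < q"
  shows "dominated_integrand q U \<phi> (\<lambda>x. per_norm (\<phi> x))"
    and "\<exists>s. (\<forall>i. simple_function (lebesgue_on U) (s i) \<and> (\<forall>x\<in>U. s i x \<in> C_per) \<and>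
          dominated_integrand q U (\<lambda>x y. \<phi> x y - s i x y) (\<lambda>x. per_norm (\<lambda>y. \<phi> x y - s i x y))) \<and>
        (\<lambda>i. \<integral>x. per_norm (\<lambda>y. \<phi> x y - s i x y) powr q \<partial>lebesgue_on U) \<longlonglongrightarrow> 0"
proof -
  have Ul: "U \<in> sets lebesgue" using U by (simp add: sets_completionI_sets)
  have iN: "integrable (lebesgue_on U) (\<lambda>x. per_norm (\<phi> x) powr q)" using \<phi> by (simp add: Bochner_Lp_def)
  have aeC: "AE x in lebesgue_on U. \<phi> x \<in> C_per" using \<phi> by (simp add: Bochner_Lp_def strongly_measurable_def)
  obtain s where s: "\<And>i. simple_function (lebesgue_on U) (s i)" "\<And>i x. x \<in> U \<Longrightarrow> s i x \<in> C_per"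
    and slim: "AE x in lebesgue_on U. (\<lambda>i. per_norm (\<lambda>y. s i x y - \<phi> x y)) \<longlonglongrightarrow> 0"
    using \<phi> unfolding Bochner_Lp_def strongly_measurable_def by auto
  have sU: "AE x in lebesgue_on U. x \<in> U" by (intro AE_I2) simp
  have plim: "(\<lambda>i. f i x y) \<longlonglongrightarrow> \<phi> x y"
    if "\<And>i. f i x \<in> C_per" "\<phi> x \<in> C_per" "(\<lambda>i. per_norm (\<lambda>y. f i x y - \<phi> x y)) \<longlonglongrightarrow> 0" for f :: "nat \<Rightarrow> real^'n \<Rightarrow> real^'n \<Rightarrow> real" and x y
  proof -
    have "(\<lambda>i. f i x y - \<phi> x y) \<longlonglongrightarrow> 0"
      by (rule Lim_null_comparison[OF _ that(3)])
         (use per_norm_upper[OF C_per_diff[OF that(1,2)], of _ y] in \<open>auto intro!: always_eventually\<close>)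
    then show ?thesis by (simp add: LIM_zero_iff)
  qed
  have m1: "(\<lambda>x. \<phi> x (x /\<^sub>R e)) \<in> borel_measurable (lebesgue_on U)" for e
  proof (rule borel_measurable_lebesgue_on_AE_limit[OF Ul])
    show "(\<lambda>x. s i x (x /\<^sub>R e)) \<in> borel_measurable (lebesgue_on U)" for i
      by (rule simple_integrand_measurable(1)[OF U s])
    show "AE x in lebesgue_on U. (\<lambda>i. s i x (x /\<^sub>R e)) \<longlonglongrightarrow> \<phi> x (x /\<^sub>R e)"
      using aeC slim sU by eventually_elim (rule plim[OF s(2)])
  qed
  have m2: "(\<lambda>z. \<phi> (fst z) (snd z)) \<in> borel_measurable (lebesgue_on (U \<times> unit_cell))"
  proof (rule borel_measurable_lebesgue_on_AE_limit)
    show "U \<times> unit_cell \<in> sets lebesgue" by (rule borel_Times_lebesgue(1)[OF U unit_cell_borel])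
    show "(\<lambda>z. s i (fst z) (snd z)) \<in> borel_measurable (lebesgue_on (U \<times> unit_cell))" for i
      by (rule simple_integrand_measurable(2)[OF U s])
    have "AE x in lebesgue_on U. \<forall>y. (\<lambda>i. s i x y) \<longlonglongrightarrow> \<phi> x y"
      using aeC slim sU by eventually_elim (intro allI plim[OF s(2)])
    from AE_fst_lebesgue_on[OF U unit_cell_borel this]
    show "AE z in lebesgue_on (U \<times> unit_cell). (\<lambda>i. s i (fst z) (snd z)) \<longlonglongrightarrow> \<phi> (fst z) (snd z)"
      by (rule eventually_mono) blast
  qed
  show "dominated_integrand q U \<phi> (\<lambda>x. per_norm (\<phi> x))"
    unfolding dominated_integrand_def
    using iN m1 m2 aeC by (auto elim!: eventually_mono intro: per_norm_upper)
  have Nm: "(\<lambda>x. per_norm (\<phi> x)) \<in> borel_measurable (lebesgue_on U)"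
  proof (rule borel_measurable_lebesgue_on_AE_limit[OF Ul])
    show "(\<lambda>x. per_norm (s i x)) \<in> borel_measurable (lebesgue_on U)" for i
      by (intro borel_measurable_simple_function simple_function_compose1[OF s(1)])
    show "AE x in lebesgue_on U. (\<lambda>i. per_norm (s i x)) \<longlonglongrightarrow> per_norm (\<phi> x)"
      using aeC slim sU
    proof eventually_elim
      case (elim x)
      have "(\<lambda>i. per_norm (s i x) - per_norm (\<phi> x)) \<longlonglongrightarrow> 0"
        by (rule Lim_null_comparison[OF _ elim(2)])
           (use per_norm_diff_le[OF s(2)[OF elim(3)] elim(1)] in \<open>auto intro!: always_eventually\<close>)
      then show ?case by (simp add: LIM_zero_iff)
    qed
  qed
  \<comment> \<open>Truncation makes the approximation dominated by the limit.\<close>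
  define t where "t = (\<lambda>i x. if per_norm (s i x) \<le> 2 * per_norm (\<phi> x) then s i x else (\<lambda>y. 0))"
  have tC: "t i x \<in> C_per" if "x \<in> U" for i x by (simp add: t_def s(2)[OF that] C_per_const)
  have ts: "simple_function (lebesgue_on U) (t i)" for i
    unfolding t_def
  proof (rule simple_function_If[OF s(1) simple_function_const])
    have "(\<lambda>x. per_norm (s i x)) \<in> borel_measurable (lebesgue_on U)"
      by (intro borel_measurable_simple_function simple_function_compose1[OF s(1)])
    then show "{x \<in> space (lebesgue_on U). per_norm (s i x) \<le> 2 * per_norm (\<phi> x)} \<in> sets (lebesgue_on U)"
      using Nm by measurable
  qed
  let ?d = "\<lambda>i x. per_norm (\<lambda>y. \<phi> x y - t i x y)"
  have db: "?d i x \<le> 3 * per_norm (\<phi> x)" if "x \<in> U" "\<phi> x \<in> C_per" for i x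
  proof (rule per_norm_le)
    show "0 \<le> 3 * per_norm (\<phi> x)" using per_norm_nonneg[OF that(2)] by simp
    fix y
    have "\<bar>t i x y\<bar> \<le> 2 * per_norm (\<phi> x)"
      using per_norm_upper[OF s(2)[OF that(1)], of i y] per_norm_nonneg[OF that(2)] by (auto simp: t_def)
    then show "\<bar>\<phi> x y - t i x y\<bar> \<le> 3 * per_norm (\<phi> x)"
      using per_norm_upper[OF that(2), of y] by linarith
  qed
  have tlim: "AE x in lebesgue_on U. (\<lambda>i. ?d i x) \<longlonglongrightarrow> 0"
    using aeC slim sU
  proof eventually_elim
    case (elim x)
    have slim': "(\<lambda>i. per_norm (\<lambda>y. \<phi> x y - s i x y)) \<longlonglongrightarrow> 0"
      using elim(2) by (simp add: per_norm_diff_commute[of "\<phi> x"])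
    show ?case
    proof (cases "per_norm (\<phi> x) = 0")
      case True
      then have "?d i x = 0" for i
        using db[OF elim(3,1), of i] per_norm_nonneg[OF C_per_diff[OF elim(1) tC[OF elim(3)]], of i] by simp
      then show ?thesis by simp
    next
      case False
      then have pos: "0 < per_norm (\<phi> x)" using per_norm_nonneg[OF elim(1)] by simp
      have "\<forall>\<^sub>F i in sequentially. per_norm (\<lambda>y. s i x y - \<phi> x y) < per_norm (\<phi> x)"
        by (rule order_tendstoD(2)[OF elim(2) pos])
      then have ev: "\<forall>\<^sub>F i in sequentially. per_norm (\<lambda>y. \<phi> x y - s i x y) = ?d i x"
      proof eventually_elim
        case (elim i)
        have "per_norm (s i x) \<le> 2 * per_norm (\<phi> x)"
          using per_norm_diff_le[OF s(2)[OF \<open>x \<in> U\<close>] \<open>\<phi> x \<in> C_per\<close>, of i] elim by linarith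
        then show ?case by (simp add: t_def)
      qed
      show ?thesis by (rule iffD1[OF tendsto_cong[OF ev] slim'])
    qed
  qed
  have dm: "?d i \<in> borel_measurable (lebesgue_on U)" for i
  proof (rule borel_measurable_lebesgue_on_AE_limit[OF Ul])
    show "(\<lambda>x. per_norm (\<lambda>y. s j x y - t i x y)) \<in> borel_measurable (lebesgue_on U)" for j
      using simple_function_compose2[OF s(1) ts, of "\<lambda>a b. per_norm (\<lambda>y. a y - b y)" j i]
      by (rule borel_measurable_simple_function)
    show "AE x in lebesgue_on U. (\<lambda>j. per_norm (\<lambda>y. s j x y - t i x y)) \<longlonglongrightarrow> ?d i x"
      using aeC slim sU
    proof eventually_elim
      case (elim x)
      have "(\<lambda>j. per_norm (\<lambda>y. s j x y - t i x y) - ?d i x) \<longlonglongrightarrow> 0"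
      proof (rule Lim_null_comparison[OF _ elim(2)])
        have "norm (per_norm (\<lambda>y. s j x y - t i x y) - ?d i x) \<le> per_norm (\<lambda>y. s j x y - \<phi> x y)" for j
          using per_norm_diff_le[OF C_per_diff[OF s(2)[OF elim(3)] tC[OF elim(3)]] C_per_diff[OF elim(1) tC[OF elim(3)]], of j i i]
          by simp
        then show "\<forall>\<^sub>F j in sequentially. norm (per_norm (\<lambda>y. s j x y - t i x y) - ?d i x) \<le> per_norm (\<lambda>y. s j x y - \<phi> x y)"
          by simp
      qed
      then show ?case by (simp add: LIM_zero_iff)
    qed
  qed
  have dq: "AE x in lebesgue_on U. norm (?d i x powr q) \<le> 3 powr q * per_norm (\<phi> x) powr q" for i
    using aeC sU
  proof eventually_elim
    case (elim x)
    have "?d i x powr q \<le> (3 * per_norm (\<phi> x)) powr q"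
      using q db[OF elim(2,1)] per_norm_nonneg[OF C_per_diff[OF elim(1) tC[OF elim(2)]]] by (intro powr_mono2) auto
    then show ?case using per_norm_nonneg[OF elim(1)] by (simp add: powr_mult)
  qed
  have dqm: "(\<lambda>x. ?d i x powr q) \<in> borel_measurable (lebesgue_on U)" for i using dm by measurable
  have iN3: "integrable (lebesgue_on U) (\<lambda>x. 3 powr q * per_norm (\<phi> x) powr q)" using iN by simp
  have di: "integrable (lebesgue_on U) (\<lambda>x. ?d i x powr q)" for i
    by (rule Bochner_Integration.integrable_bound[OF iN3 dqm]) (rule eventually_mono[OF dq], simp)
  have "(\<lambda>i. \<integral>x. ?d i x powr q \<partial>lebesgue_on U) \<longlonglongrightarrow> (\<integral>x. 0 \<partial>lebesgue_on U)"
  proof (rule integral_dominated_convergence[OF _ dqm iN3 _ dq])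
    show "AE x in lebesgue_on U. (\<lambda>i. ?d i x powr q) \<longlonglongrightarrow> 0"
      using tlim aeC sU
    proof eventually_elim
      case (elim x)
      have "(\<lambda>i. ?d i x powr q) \<longlonglongrightarrow> 0 powr q"
        by (rule tendsto_powr'[OF elim(1) tendsto_const])
           (use q per_norm_nonneg[OF C_per_diff[OF elim(2) tC[OF elim(3)]]] in auto)
      then show ?case by simp
    qed
  qed simp
  moreover have "dominated_integrand q U (\<lambda>x y. \<phi> x y - t i x y) (?d i)" for i
    unfolding dominated_integrand_def
  proof (intro conjI allI impI)
    show "integrable (lebesgue_on U) (\<lambda>x. ?d i x powr q)" by (rule di)
    show "AE x in lebesgue_on U. \<forall>y. \<bar>\<phi> x y - t i x y\<bar> \<le> ?d i x"
      using aeC sU by eventually_elim (intro allI per_norm_upper C_per_diff tC)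
    show "(\<lambda>x. \<phi> x (x /\<^sub>R e) - t i x (x /\<^sub>R e)) \<in> borel_measurable (lebesgue_on U)" for e
      by (rule borel_measurable_diff[OF m1 simple_integrand_measurable(1)[OF U ts tC]])
    show "(\<lambda>z. \<phi> (fst z) (snd z) - t i (fst z) (snd z)) \<in> borel_measurable (lebesgue_on (U \<times> unit_cell))"
      by (rule borel_measurable_diff[OF m2 simple_integrand_measurable(2)[OF U ts tC]])
  qed
  ultimately show "\<exists>s. (\<forall>i. simple_function (lebesgue_on U) (s i) \<and> (\<forall>x\<in>U. s i x \<in> C_per) \<and>
          dominated_integrand q U (\<lambda>x y. \<phi> x y - s i x y) (\<lambda>x. per_norm (\<lambda>y. \<phi> x y - s i x y))) \<and>
        (\<lambda>i. \<integral>x. per_norm (\<lambda>y. \<phi> x y - s i x y) powr q \<partial>lebesgue_on U) \<longlonglongrightarrow> 0"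
    using ts tC by (intro exI[of _ t]) simp
qed

lemma conjugate_exponent:
  fixes p :: real
  assumes "1 < p"
  shows "1 < p / (p - 1)" "1 / p + 1 / (p / (p - 1)) = 1"
  using assms by (auto simp: field_simps)

lemma pairings_converge_Bochner:
  fixes v0 :: "(real^'n) \<times> (real^'n) \<Rightarrow> real"
  assumes pq: "1 < p" "1 < q" "1 / p + 1 / q = 1" and U: "U \<in> sets borel"
    and v0: "v0 \<in> Lp p (U \<times> unit_cell)" and \<phi>: "\<phi> \<in> Bochner_Lp q U C_per per_norm"
  shows "pairings_converge \<epsilon> U v v0 \<phi> \<longleftrightarrow>
    (\<lambda>n. \<integral>x. v n x * \<phi> x (x /\<^sub>R \<epsilon> n) \<partial>lebesgue_on U)
          \<longlonglongrightarrow> (\<integral>x. (\<integral>y. v0 (x, y) * \<phi> x y \<partial>lebesgue_on unit_cell) \<partial>lebesgue_on U)"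
proof -
  have "dominated_integrand q U \<phi> (\<lambda>x. per_norm (\<phi> x))"
    by (rule Bochner_simple_approximation(1)[OF U \<phi>]) (use pq in simp)
  from integral_lebesgue_on_Times[OF U unit_cell_borel dominated_integrand_pairing_limit(1)[OF this pq v0 zero_less_one U]]
  show ?thesis unfolding pairings_converge_def by simp
qed

lemma two_scale_weak_pairings_converge:
  assumes w: "two_scale_weak \<epsilon> p U v v0" and pq: "1 < p" "1 < q" "1 / p + 1 / q = 1" and U: "U \<in> sets borel"
    and \<phi>: "\<phi> \<in> Bochner_Lp q U C_per per_norm"
  shows "pairings_converge \<epsilon> U v v0 \<phi>"
proof -
  have "v0 \<in> Lp p (U \<times> unit_cell)" using w by (simp add: two_scale_weak_def)
  from pairings_converge_Bochner[OF pq U this \<phi>] w pq \<phi> show ?thesis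
    unfolding two_scale_weak_def by blast
qed

text \<open>For a sequence bounded in \<open>L\<^sup>p\<close>, weak two-scale convergence need only be tested on products
  of a continuous function vanishing outside \<open>U\<close> and a continuous periodic function: such products
  give indicators times periodic functions, hence simple functions, hence the whole Bochner space.\<close>

theorem two_scale_weakI:
  fixes v :: "nat \<Rightarrow> real^'n \<Rightarrow> real" and v0 :: "(real^'n) \<times> (real^'n) \<Rightarrow> real"
  assumes p: "1 < p" and U: "open U" "bounded U"
    and \<epsilon>: "\<And>n. 0 < \<epsilon> n" and v: "\<And>n. v n \<in> Lp p U" and v0: "v0 \<in> Lp p (U \<times> unit_cell)"
    and K: "\<forall>\<^sub>F n in sequentially. (\<integral>x. \<bar>v n x\<bar> powr p \<partial>lebesgue_on U) \<le> K"
    and c: "\<And>\<theta> g. continuous_on UNIV \<theta> \<Longrightarrow> (\<And>x. x \<notin> U \<Longrightarrow> \<theta> x = 0) \<Longrightarrow> g \<in> C_per \<Longrightarrow>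
      pairings_converge \<epsilon> U v v0 (\<lambda>x y. \<theta> x * g y)"
  shows "two_scale_weak \<epsilon> p U v v0"
proof -
  have Ub: "U \<in> sets borel" using U by simp
  have Ul: "U \<in> sets lebesgue" using Ub by (simp add: sets_completionI_sets)
  have "pairings_converge \<epsilon> U v v0 \<phi>"
    if q: "1 < q" "1 / p + 1 / q = 1" and \<phi>: "\<phi> \<in> Bochner_Lp q U C_per per_norm" for q \<phi>
  proof -
    have q0: "0 \<le> q" "0 < q" using q by auto
    have rect: "pairings_converge \<epsilon> U v v0 (\<lambda>x y. indicator A x * g y)"
      if A: "A \<in> sets lebesgue" and g: "g \<in> C_per" for A g
    proof -
      obtain \<theta> :: "nat \<Rightarrow> real^'n \<Rightarrow> real" where \<theta>: "\<And>k. continuous_on UNIV (\<theta> k)"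
        "\<And>k x. x \<notin> U \<Longrightarrow> \<theta> k x = 0" "\<And>k x. 0 \<le> \<theta> k x" "\<And>k x. \<theta> k x \<le> 1"
        and lim: "AE x in lebesgue_on U. (\<lambda>k. \<theta> k x) \<longlonglongrightarrow> indicator A x"
        using indicator_approximation[OF U A] by blast
      have iA: "(indicator A :: real^'n \<Rightarrow> real) \<in> borel_measurable (lebesgue_on U)"
        using A by (intro measurable_restrict_space1) simp
      have \<theta>m: "\<theta> k \<in> borel_measurable (lebesgue_on U)" for k
        by (rule continuous_imp_measurable_lebesgue_on[OF \<theta>(1)])
      let ?f = "\<lambda>k x. indicator A x - \<theta> k x"
      have fm: "?f k \<in> borel_measurable (lebesgue_on U)" for k using iA \<theta>m by (rule borel_measurable_diff)
      have fb: "\<bar>?f k x\<bar> \<le> 1" for k x using \<theta>(3,4)[of k x] by (auto simp: indicator_def)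
      let ?d = "\<lambda>k x. \<bar>?f k x\<bar> * per_norm g"
      have N0: "0 \<le> per_norm g" by (rule per_norm_nonneg[OF g])
      show ?thesis
      proof (rule pairings_converge_limit[OF p q Ub \<epsilon> v v0 K])
        show "pairings_converge \<epsilon> U v v0 (\<lambda>x y. \<theta> k x * g y)" for k
          by (rule c[OF \<theta>(1,2) g])
        show "dominated_integrand q U (\<lambda>x y. \<theta> k x * g y) (\<lambda>x. \<bar>\<theta> k x\<bar> * per_norm g)" for k
          by (rule dominated_integrand_product[OF U(2) Ub \<theta>m _ g q0(1), of _ 1]) (use \<theta>(3,4) in simp)
        show "dominated_integrand q U (\<lambda>x y. indicator A x * g y) (\<lambda>x. \<bar>indicator A x\<bar> * per_norm g)"
          by (rule dominated_integrand_product[OF U(2) Ub iA _ g q0(1), of 1]) (simp add: indicator_def)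
        show "dominated_integrand q U (\<lambda>x y. indicator A x * g y - \<theta> k x * g y) (?d k)" for k
          using dominated_integrand_product[OF U(2) Ub fm _ g q0(1), of k 1] fb by (simp add: left_diff_distrib)
        have "(\<lambda>k. \<integral>x. ?d k x powr q \<partial>lebesgue_on U) \<longlonglongrightarrow> (\<integral>x. 0 \<partial>lebesgue_on U)"
        proof (rule integral_dominated_convergence[where w="\<lambda>x. per_norm g powr q"])
          show "(\<lambda>x. ?d k x powr q) \<in> borel_measurable (lebesgue_on U)" for k using fm by measurable
          interpret finite_measure "lebesgue_on U" by (rule finite_measure_lebesgue_on[OF U(2) Ul])
          show "integrable (lebesgue_on U) (\<lambda>x. per_norm g powr q)" by simp
          show "AE x in lebesgue_on U. (\<lambda>k. ?d k x powr q) \<longlonglongrightarrow> 0"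
            using lim
          proof eventually_elim
            case (elim x)
            have "(\<lambda>k. ?d k x) \<longlonglongrightarrow> \<bar>indicator A x - indicator A x\<bar> * per_norm g"
              by (intro tendsto_intros elim)
            then have "(\<lambda>k. ?d k x) \<longlonglongrightarrow> 0" by simp
            then have "(\<lambda>k. ?d k x powr q) \<longlonglongrightarrow> 0 powr q"
              by (rule tendsto_powr'[OF _ tendsto_const]) (use q0 N0 in auto)
            then show ?case by simp
          qed
          show "AE x in lebesgue_on U. norm (?d k x powr q) \<le> per_norm g powr q" for k
          proof (intro AE_I2)
            fix x
            have "?d k x \<le> 1 * per_norm g" by (rule mult_right_mono[OF fb N0])
            then show "norm (?d k x powr q) \<le> per_norm g powr q" using N0 q0 by (simp add: powr_mono2)
          qed
        qed simp
        then show "(\<lambda>k. \<integral>x. ?d k x powr q \<partial>lebesgue_on U) \<longlonglongrightarrow> 0" by simp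
      qed
    qed
    have simp: "pairings_converge \<epsilon> U v v0 s"
      if s: "simple_function (lebesgue_on U) s" "\<And>x. x \<in> U \<Longrightarrow> s x \<in> C_per" for s
    proof -
      let ?A = "\<lambda>g. s -` {g} \<inter> U"
      have "pairings_converge \<epsilon> U v v0 (\<lambda>x y. \<Sum>g\<in>s ` U. indicator (?A g) x * g y)"
      proof (rule pairings_converge_sum[OF p q Ub \<epsilon> v v0])
        fix g assume "g \<in> s ` U"
        then have g: "g \<in> C_per" using s(2) by auto
        have A: "?A g \<in> sets lebesgue" by (rule simple_integrand_level_sets(2)[OF s(1) Ul])
        show "pairings_converge \<epsilon> U v v0 (\<lambda>x y. indicator (?A g) x * g y)" by (rule rect[OF A g])
        have "(indicator (?A g) :: real^'n \<Rightarrow> real) \<in> borel_measurable (lebesgue_on U)"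
          using A by (intro measurable_restrict_space1) simp
        then show "dominated_integrand q U (\<lambda>x y. indicator (?A g) x * g y) (\<lambda>x. \<bar>indicator (?A g) x\<bar> * per_norm g)"
          by (rule dominated_integrand_product[OF U(2) Ub _ _ g q0(1), of _ 1]) (simp add: indicator_def)
      qed
      then show ?thesis
        by (rule pairings_converge_cong[THEN iffD2, rotated]) (rule simple_integrand_sum[OF s(1)])
    qed
    obtain s where s: "\<And>i. simple_function (lebesgue_on U) (s i)" "\<And>i x. x \<in> U \<Longrightarrow> s i x \<in> C_per"
      and d: "\<And>i. dominated_integrand q U (\<lambda>x y. \<phi> x y - s i x y) (\<lambda>x. per_norm (\<lambda>y. \<phi> x y - s i x y))"
      and d0: "(\<lambda>i. \<integral>x. per_norm (\<lambda>y. \<phi> x y - s i x y) powr q \<partial>lebesgue_on U) \<longlonglongrightarrow> 0"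
      using Bochner_simple_approximation(2)[OF Ub \<phi> q0(2)] by blast
    have sd: "dominated_integrand q U (s i) (\<lambda>x. per_norm (s i x))" for i
    proof -
      have Nm: "(\<lambda>x. per_norm (s i x)) \<in> borel_measurable (lebesgue_on U)"
        by (intro borel_measurable_simple_function simple_function_compose1[OF s(1)])
      have fin: "finite ((\<lambda>x. per_norm (s i x)) ` U)"
        using s(1)[of i] by (simp add: simple_function_def image_image[symmetric, of per_norm "s i"])
      have "integrable (lebesgue_on U) (\<lambda>x. per_norm (s i x) powr q)"
      proof (rule finite_measure.integrable_const_bound[OF finite_measure_lebesgue_on[OF U(2) Ul]])
        let ?m = "Max (insert 0 ((\<lambda>x. per_norm (s i x)) ` U))"
        show "AE x in lebesgue_on U. norm (per_norm (s i x) powr q) \<le> ?m powr q"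
          using fin q0 per_norm_nonneg[OF s(2)] by (intro AE_I2) (auto intro!: powr_mono2 Max_ge)
        show "(\<lambda>x. per_norm (s i x) powr q) \<in> borel_measurable (lebesgue_on U)" using Nm by measurable
      qed
      then show ?thesis
        unfolding dominated_integrand_def
        using simple_integrand_measurable[OF Ub s] per_norm_upper[OF s(2)] by (auto intro!: AE_I2)
    qed
    show ?thesis
      by (rule pairings_converge_limit[OF p q Ub \<epsilon> v v0 K simp[OF s] sd
            Bochner_simple_approximation(1)[OF Ub \<phi> q0(2)] d d0])
  qed
  then show ?thesis
    unfolding two_scale_weak_def using v v0 pairings_converge_Bochner[OF p _ _ Ub v0] by blast
qed

section \<open>Weakly two-scale convergent sequences are bounded\<close>

lemma powr_conjugate:
  fixes p q :: real
  assumes "1 < p" "1 / p + 1 / q = 1" "1 < q"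
  shows "(p - 1) * q = p"
  using assms by (simp add: field_simps)

lemma Hoelder_factor_two:
  fixes v w :: "'a \<Rightarrow> real" and p q a :: real
  assumes pq: "1 < p" "1 < q" "1 / p + 1 / q = 1" and a: "0 < a"
    and v: "v \<in> borel_measurable M" "integrable M (\<lambda>x. \<bar>v x\<bar> powr p)" "(\<integral>x. \<bar>v x\<bar> powr p \<partial>M) = a powr p"
    and w: "w \<in> borel_measurable M" "integrable M (\<lambda>x. \<bar>w x\<bar> powr q)" "(\<integral>x. \<bar>w x\<bar> powr q \<partial>M) \<le> 1"
  shows "\<bar>\<integral>x. v x * w x \<partial>M\<bar> \<le> 2 * a"
proof -
  let ?\<tau> = "a powr (1 - p)"
  have \<tau>: "0 < ?\<tau>" using a by simp
  have e: "(1 - p) * (- q / p) = 1" using powr_conjugate[OF pq(1,3,2)] pq by (simp add: field_simps)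
  have "?\<tau> powr (- q / p) = a powr ((1 - p) * (- q / p))" by (simp add: powr_powr)
  then have e1: "?\<tau> powr (- q / p) = a" using e a by simp
  have e2: "?\<tau> * a powr p = a" using a by (simp flip: powr_add)
  have "\<bar>\<integral>x. v x * w x \<partial>M\<bar> \<le> ?\<tau> * (\<integral>x. \<bar>v x\<bar> powr p \<partial>M) + ?\<tau> powr (- q / p) * (\<integral>x. \<bar>w x\<bar> powr q \<partial>M)"
    by (rule integral_pairing_bound(2)[OF pq \<tau> v(1,2) w(1,2)]) simp
  also have "\<dots> \<le> a + a * 1"
    using v(3) e1 e2 mult_left_mono[OF w(3), of a] a by simp
  finally show ?thesis by simp
qed

text \<open>The extremal function in Hoelder's inequality.\<close>

lemma dual_function:
  fixes v :: "'a \<Rightarrow> real" and p q a :: real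
  assumes pq: "1 < p" "1 < q" "1 / p + 1 / q = 1" and a: "0 < a"
    and v: "v \<in> borel_measurable M" "integrable M (\<lambda>x. \<bar>v x\<bar> powr p)" "(\<integral>x. \<bar>v x\<bar> powr p \<partial>M) = a powr p"
  obtains w where "w \<in> borel_measurable M" "integrable M (\<lambda>x. \<bar>w x\<bar> powr q)" "(\<integral>x. \<bar>w x\<bar> powr q \<partial>M) = 1"
    "(\<integral>x. v x * w x \<partial>M) = a"
proof -
  define w where "w = (\<lambda>x. sgn (v x) * \<bar>v x\<bar> powr (p - 1) * a powr (1 - p))"
  have wq: "\<bar>w x\<bar> powr q = \<bar>v x\<bar> powr p * a powr (- p)" for x
  proof (cases "v x = 0")
    case True then show ?thesis using pq by (simp add: w_def)
  next
    case False
    have "\<bar>w x\<bar> = \<bar>v x\<bar> powr (p - 1) * a powr (1 - p)"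
      using False by (simp add: w_def abs_mult abs_sgn_eq)
    then have "\<bar>w x\<bar> powr q = \<bar>v x\<bar> powr ((p - 1) * q) * a powr ((1 - p) * q)"
      by (simp add: powr_mult powr_powr)
    moreover have "(1 - p) * q = - p" using powr_conjugate[OF pq(1,3,2)] by (simp add: algebra_simps)
    ultimately show ?thesis using powr_conjugate[OF pq(1,3,2)] by simp
  qed
  have vw: "v x * w x = \<bar>v x\<bar> powr p * a powr (1 - p)" for x
  proof (cases "v x = 0")
    case False
    have "v x * sgn (v x) = \<bar>v x\<bar>" by (simp add: abs_sgn)
    moreover have "\<bar>v x\<bar> * \<bar>v x\<bar> powr (p - 1) = \<bar>v x\<bar> powr p"
      using powr_mult_base[of "\<bar>v x\<bar>" "p - 1"] by simp
    ultimately show ?thesis unfolding w_def by (metis mult.assoc)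
  qed simp
  show ?thesis
  proof (rule that[of w])
    show "w \<in> borel_measurable M" unfolding w_def using v(1) by measurable
    show "integrable M (\<lambda>x. \<bar>w x\<bar> powr q)" unfolding wq using v(2) by simp
    show "(\<integral>x. \<bar>w x\<bar> powr q \<partial>M) = 1" unfolding wq using v(3) a by (simp flip: powr_add)
    show "(\<integral>x. v x * w x \<partial>M) = a" unfolding vw using v(3) a by (simp flip: powr_add)
  qed
qed

text \<open>A gliding hump replaces the uniform boundedness principle: if the norms were unbounded, a
  rapidly decreasing series of dual functions, with signs chosen to prevent cancellation, would
  be a test function with unbounded pairings.\<close>

theorem bounded_if_pairings_bounded:
  fixes v :: "nat \<Rightarrow> 'a \<Rightarrow> real" and p q :: real
  assumes pq: "1 < p" "1 < q" "1 / p + 1 / q = 1"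
    and v: "\<And>n. v n \<in> borel_measurable M" "\<And>n. integrable M (\<lambda>x. \<bar>v n x\<bar> powr p)"
    and b: "\<And>\<phi>. \<phi> \<in> borel_measurable M \<Longrightarrow> integrable M (\<lambda>x. \<bar>\<phi> x\<bar> powr q) \<Longrightarrow> Bseq (\<lambda>n. \<integral>x. v n x * \<phi> x \<partial>M)"
  shows "\<exists>K. \<forall>n. (\<integral>x. \<bar>v n x\<bar> powr p \<partial>M) \<le> K"
proof (rule ccontr)
  assume "\<nexists>K. \<forall>n. (\<integral>x. \<bar>v n x\<bar> powr p \<partial>M) \<le> K"
  then have "\<exists>n. (10 ^ k) powr p < (\<integral>x. \<bar>v n x\<bar> powr p \<partial>M)" for k by (meson not_le)
  then obtain m where m: "\<And>k. (10 ^ k) powr p < (\<integral>x. \<bar>v (m k) x\<bar> powr p \<partial>M)" by metis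
  define w where "w = (\<lambda>k. v (m k))"
  define a where "a = (\<lambda>k. (\<integral>x. \<bar>w k x\<bar> powr p \<partial>M) powr (1 / p))"
  have wm: "w k \<in> borel_measurable M" "integrable M (\<lambda>x. \<bar>w k x\<bar> powr p)" for k
    using v by (auto simp: w_def)
  have ak: "(\<integral>x. \<bar>w k x\<bar> powr p \<partial>M) = a k powr p" "10 ^ k \<le> a k" "0 < a k" for k
  proof -
    have "0 \<le> (\<integral>x. \<bar>w k x\<bar> powr p \<partial>M)" by simp
    then show "(\<integral>x. \<bar>w k x\<bar> powr p \<partial>M) = a k powr p" using pq by (simp add: a_def powr_powr)
    have "((10 ^ k) powr p) powr (1 / p) \<le> a k"
      unfolding a_def by (rule powr_mono2) (use m[of k] pq in \<open>auto simp: w_def\<close>)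
    then show "10 ^ k \<le> a k" using pq by (simp add: powr_powr)
    then show "0 < a k" using zero_less_power[of "10::real" k] by linarith
  qed
  have "\<exists>f. f \<in> borel_measurable M \<and> integrable M (\<lambda>x. \<bar>f x\<bar> powr q) \<and> (\<integral>x. \<bar>f x\<bar> powr q \<partial>M) = 1 \<and>
    (\<integral>x. w k x * f x \<partial>M) = a k" for k
    using dual_function[OF pq ak(3) wm ak(1)] by metis
  then obtain f where f: "\<And>k. f k \<in> borel_measurable M" "\<And>k. integrable M (\<lambda>x. \<bar>f k x\<bar> powr q)"
    "\<And>k. (\<integral>x. \<bar>f k x\<bar> powr q \<partial>M) = 1" "\<And>k. (\<integral>x. w k x * f k x \<partial>M) = a k"
    by metis
  \<comment> \<open>Ratio \<open>1/5\<close> against growth \<open>10 ^ k\<close>: the later terms cost at most half of the \<open>k\<close>-th hump.\<close>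
  define S where "S = rec_nat (\<lambda>x. 0) (\<lambda>k P. if a k / 5 ^ k \<le> \<bar>\<integral>x. w k x * (P x + f k x / 5 ^ k) \<partial>M\<bar>
      then (\<lambda>x. P x + f k x / 5 ^ k) else (\<lambda>x. P x - f k x / 5 ^ k))"
  have S0: "S 0 = (\<lambda>x. 0)" by (simp add: S_def)
  have S1: "S (Suc k) = (if a k / 5 ^ k \<le> \<bar>\<integral>x. w k x * (S k x + f k x / 5 ^ k) \<partial>M\<bar>
      then (\<lambda>x. S k x + f k x / 5 ^ k) else (\<lambda>x. S k x - f k x / 5 ^ k))" for k
    by (simp add: S_def)
  have step: "\<exists>\<sigma>. \<bar>\<sigma>\<bar> = 1 \<and> S (Suc k) = (\<lambda>x. S k x + \<sigma> * f k x / 5 ^ k)" for k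
    unfolding S1 by (cases "a k / 5 ^ k \<le> \<bar>\<integral>x. w k x * (S k x + f k x / 5 ^ k) \<partial>M\<bar>")
      (auto intro: exI[of _ 1] exI[of _ "-1"])
  then obtain \<sigma> where \<sigma>: "\<And>k. \<bar>\<sigma> k\<bar> = 1" "\<And>k. S (Suc k) = (\<lambda>x. S k x + \<sigma> k * f k x / 5 ^ k)" by metis
  have wf: "integrable M (\<lambda>x. w k x * f j x)" for k j
    by (rule integral_pairing_bound(1)[OF pq zero_less_one wm f(1)[of j] f(2)[of j]]) simp
  have wS: "integrable M (\<lambda>x. w k x * S j x)" for k j
  proof (induction j)
    case (Suc j)
    have "(\<lambda>x. w k x * S (Suc j) x) = (\<lambda>x. w k x * S j x + (\<sigma> j / 5 ^ j) * (w k x * f j x))"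
      by (auto simp: \<sigma>(2) fun_eq_iff field_simps)
    then show ?case using Suc wf by simp
  qed (simp add: S0)
  have Sm: "S j \<in> borel_measurable M" for j
  proof (induction j)
    case (Suc j)
    then show ?case unfolding \<sigma>(2) using f(1)[of j] by measurable
  qed (simp add: S0)
  have inc: "(\<integral>x. w k x * S (Suc j) x \<partial>M) = (\<integral>x. w k x * S j x \<partial>M) + (\<sigma> j / 5 ^ j) * (\<integral>x. w k x * f j x \<partial>M)" for k j
  proof -
    have "(\<lambda>x. w k x * S (Suc j) x) = (\<lambda>x. w k x * S j x + (\<sigma> j / 5 ^ j) * (w k x * f j x))"
      by (auto simp: \<sigma>(2) fun_eq_iff field_simps)
    then show ?thesis using wS wf by simp
  qed
  have hump: "a k / 5 ^ k \<le> \<bar>\<integral>x. w k x * S (Suc k) x \<partial>M\<bar>" for k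
  proof (cases "a k / 5 ^ k \<le> \<bar>\<integral>x. w k x * (S k x + f k x / 5 ^ k) \<partial>M\<bar>")
    case True then show ?thesis by (simp add: S1)
  next
    case False
    let ?P = "\<integral>x. w k x * S k x \<partial>M" and ?h = "a k / 5 ^ k"
    have 1: "(\<integral>x. w k x * (S k x + f k x / 5 ^ k) \<partial>M) = ?P + ?h"
    proof -
      have "(\<lambda>x. w k x * (S k x + f k x / 5 ^ k)) = (\<lambda>x. w k x * S k x + (1 / 5 ^ k) * (w k x * f k x))"
        by (auto simp: fun_eq_iff field_simps)
      then show ?thesis using wS[of k k] wf[of k k] f(4)[of k] by simp
    qed
    have 2: "(\<integral>x. w k x * S (Suc k) x \<partial>M) = ?P - ?h"
    proof -
      have "(\<lambda>x. w k x * S (Suc k) x) = (\<lambda>x. w k x * S k x - (1 / 5 ^ k) * (w k x * f k x))"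
        using False by (auto simp: S1 fun_eq_iff field_simps)
      then show ?thesis using wS[of k k] wf[of k k] f(4)[of k] by simp
    qed
    have "0 \<le> ?h" using ak(3)[of k] by simp
    then show ?thesis using False unfolding 1 2 by linarith
  qed
  have tail: "\<bar>(\<integral>x. w k x * S (Suc k + j) x \<partial>M) - (\<integral>x. w k x * S (Suc k) x \<partial>M)\<bar> \<le> a k / 5 ^ k / 2 * (1 - 1 / 5 ^ j)" for k j
  proof (induction j)
    case (Suc j)
    have "\<bar>\<integral>x. w k x * f (Suc k + j) x \<partial>M\<bar> \<le> 2 * a k"
      by (rule Hoelder_factor_two[OF pq ak(3) wm ak(1) f(1,2)]) (simp add: f(3))
    then have "\<bar>(\<sigma> (Suc k + j) / 5 ^ (Suc k + j)) * (\<integral>x. w k x * f (Suc k + j) x \<partial>M)\<bar> \<le> (1 / 5 ^ (Suc k + j)) * (2 * a k)"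
      unfolding abs_mult by (intro mult_mono) (auto simp: abs_divide \<sigma>(1))
    then have "\<bar>(\<integral>x. w k x * S (Suc k + Suc j) x \<partial>M) - (\<integral>x. w k x * S (Suc k) x \<partial>M)\<bar>
      \<le> a k / 5 ^ k / 2 * (1 - 1 / 5 ^ j) + (1 / 5 ^ (Suc k + j)) * (2 * a k)"
      using Suc unfolding add_Suc_right[of "Suc k" j] inc by linarith
    also have "\<dots> = a k / 5 ^ k / 2 * (1 - 1 / 5 ^ Suc j)"
      by (simp add: field_simps power_add)
    finally show ?case .
  qed simp
  \<comment> \<open>The sum \<open>H\<close> of these is integrable and dominates the series of dual functions geometrically.\<close>
  define h where "h = (\<lambda>k x. (2 / 5) powr (q * k) * \<bar>f k x\<bar> powr q)"
  have h0: "0 \<le> h k x" for k x by (simp add: h_def)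
  have hm: "h k \<in> borel_measurable M" for k unfolding h_def using f(1)[of k] by measurable
  have hi: "integrable M (h k)" for k unfolding h_def using f(2)[of k] by simp
  have hI: "(\<integral>x. h k x \<partial>M) = ((2 / 5) powr q) ^ k" for k
    unfolding h_def using f(3)[of k] by (simp add: powr_powr[symmetric] powr_realpow)
  have r: "\<bar>(2 / 5 :: real) powr q\<bar> < 1" using powr_less_mono2[of q "2 / 5" 1] pq by simp
  have sumI: "summable (\<lambda>k. \<integral>x. norm (h k x) \<partial>M)"
    using summable_geometric[of "(2 / 5) powr q"] r h0 by (simp add: hI)
  have aes: "AE x in M. summable (\<lambda>k. norm (h k x))"
  proof -
    have "(\<integral>\<^sup>+x. (\<Sum>k. ennreal (h k x)) \<partial>M) = (\<Sum>k. \<integral>\<^sup>+x. ennreal (h k x) \<partial>M)"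
      by (rule nn_integral_suminf) (use hm in measurable)
    also have "\<dots> = (\<Sum>k. ennreal (((2 / 5) powr q) ^ k))"
      using hI h0 by (intro suminf_cong) (simp add: nn_integral_eq_integral[OF hi])
    also have "\<dots> = ennreal (\<Sum>k. ((2 / 5) powr q) ^ k)"
      by (rule suminf_ennreal_eq[OF _ summable_sums]) (use summable_geometric[of "(2 / 5) powr q"] r in auto)
    finally have "(\<integral>\<^sup>+x. (\<Sum>k. ennreal (h k x)) \<partial>M) \<noteq> \<infinity>" by simp
    then have "AE x in M. (\<Sum>k. ennreal (h k x)) \<noteq> \<infinity>"
      by (intro nn_integral_PInf_AE) (use hm in measurable)
    then show ?thesis
      by (rule eventually_mono) (use h0 in \<open>auto intro: summable_suminf_not_top\<close>)
  qed
  define H where "H = (\<lambda>x. \<Sum>k. h k x)"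
  have Hi: "integrable M H" unfolding H_def by (rule integrable_suminf[OF hi aes sumI])
  have fb: "\<bar>f k x\<bar> / 5 ^ k \<le> (1 / 2) ^ k * H x powr (1 / q)" if "summable (\<lambda>k. norm (h k x))" for k x
  proof -
    have s: "summable (\<lambda>k. h k x)" using that h0 by simp
    have "h k x \<le> H x"
      unfolding H_def using sum_le_suminf[OF s, of "{k}"] h0 by simp
    then have "h k x powr (1 / q) \<le> H x powr (1 / q)" using h0 pq by (intro powr_mono2) auto
    moreover have "h k x powr (1 / q) = (2 / 5) ^ k * \<bar>f k x\<bar>"
      using pq by (simp add: h_def powr_mult powr_powr powr_realpow)
    ultimately have "(2 / 5) ^ k * \<bar>f k x\<bar> \<le> H x powr (1 / q)" by simp
    then have "(1 / 2) ^ k * ((2 / 5) ^ k * \<bar>f k x\<bar>) \<le> (1 / 2) ^ k * H x powr (1 / q)" by (rule mult_left_mono) simp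
    moreover have "(1 / 2) ^ k * ((2 / 5) ^ k * \<bar>f k x\<bar>) = \<bar>f k x\<bar> / 5 ^ k"
      by (simp add: power_divide)
    ultimately show ?thesis by simp
  qed
  have Ssum: "S j x = (\<Sum>i<j. \<sigma> i * f i x / 5 ^ i)" for j x
    by (induction j) (simp_all add: S0 \<sigma>(2))
  have geo: "summable (\<lambda>k. (1 / 2 :: real) ^ k * c)" "(\<Sum>k. (1 / 2 :: real) ^ k * c) = 2 * c" for c
    using summable_mult2[OF summable_geometric[of "1 / 2 :: real"]] suminf_mult2[OF summable_geometric[of "1 / 2 :: real"], of c, symmetric]
    by (auto simp: suminf_geometric)
  define L where "L = (\<lambda>x. lim (\<lambda>j. S j x))"
  have Lm: "L \<in> borel_measurable M" unfolding L_def by (rule borel_measurable_lim_metric[OF Sm])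
  have Sb: "\<bar>S j x\<bar> \<le> 2 * H x powr (1 / q)" if x: "summable (\<lambda>k. norm (h k x))" for j x
  proof -
    have "\<bar>S j x\<bar> \<le> (\<Sum>i<j. \<bar>\<sigma> i * f i x / 5 ^ i\<bar>)" unfolding Ssum by (rule sum_abs)
    also have "\<dots> \<le> (\<Sum>i<j. (1 / 2) ^ i * H x powr (1 / q))"
      by (rule sum_mono) (use fb[OF x] \<sigma>(1) in \<open>simp add: abs_mult abs_divide\<close>)
    also have "\<dots> \<le> (\<Sum>i. (1 / 2) ^ i * H x powr (1 / q))"
      by (rule sum_le_suminf[OF geo(1)]) auto
    finally show ?thesis by (simp add: geo(2))
  qed
  have SL: "(\<lambda>j. S j x) \<longlonglongrightarrow> L x" if x: "summable (\<lambda>k. norm (h k x))" for x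
  proof -
    have "summable (\<lambda>i. \<sigma> i * f i x / 5 ^ i)"
      by (rule summable_comparison_test'[OF geo(1)[of "H x powr (1 / q)"], of 0])
         (use fb[OF x] \<sigma>(1) in \<open>simp add: abs_mult abs_divide\<close>)
    then have "convergent (\<lambda>j. S j x)" unfolding Ssum by (simp add: summable_iff_convergent)
    then show ?thesis by (simp add: L_def convergent_LIMSEQ_iff)
  qed
  have Lb: "\<bar>L x\<bar> \<le> 2 * H x powr (1 / q)" if x: "summable (\<lambda>k. norm (h k x))" for x
    by (rule LIMSEQ_le_const2[OF tendsto_rabs[OF SL[OF x]]]) (use Sb[OF x] in blast)
  define N where "N = (\<lambda>x. 2 * \<bar>H x\<bar> powr (1 / q))"
  have H0: "0 \<le> H x" if x: "summable (\<lambda>k. norm (h k x))" for x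
    unfolding H_def using x h0 by (intro suminf_nonneg) auto
  have Nq: "N x powr q = 2 powr q * \<bar>H x\<bar>" for x
    using pq by (simp add: N_def powr_mult powr_powr)
  have Ni: "integrable M (\<lambda>x. N x powr q)" unfolding Nq using Hi by simp
  have LN: "AE x in M. \<bar>L x\<bar> \<le> N x"
    using aes by (rule eventually_mono) (use Lb H0 in \<open>simp add: N_def\<close>)
  have Li: "integrable M (\<lambda>x. \<bar>L x\<bar> powr q)"
  proof (rule Bochner_Integration.integrable_bound[OF Ni])
    show "(\<lambda>x. \<bar>L x\<bar> powr q) \<in> borel_measurable M" using Lm by measurable
    show "AE x in M. norm (\<bar>L x\<bar> powr q) \<le> norm (N x powr q)"
      using LN by (rule eventually_mono) (use pq in \<open>auto intro!: powr_mono2\<close>)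
  qed
  have lim: "(\<lambda>j. \<integral>x. w k x * S j x \<partial>M) \<longlonglongrightarrow> (\<integral>x. w k x * L x \<partial>M)" for k
  proof (rule integral_dominated_convergence[where w="\<lambda>x. \<bar>w k x * N x\<bar>"])
    show "(\<lambda>x. w k x * L x) \<in> borel_measurable M" using wm(1)[of k] Lm by measurable
    show "(\<lambda>x. w k x * S j x) \<in> borel_measurable M" for j using wm(1)[of k] Sm[of j] by measurable
    have "N \<in> borel_measurable M" unfolding N_def using Hi by measurable
    then show "integrable M (\<lambda>x. \<bar>w k x * N x\<bar>)"
      by (intro integrable_abs integral_pairing_bound(1)[OF pq zero_less_one wm _ Ni]) (simp_all add: N_def)
    show "AE x in M. (\<lambda>j. w k x * S j x) \<longlonglongrightarrow> w k x * L x"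
      using aes by (rule eventually_mono) (intro tendsto_intros SL)
    show "AE x in M. norm (w k x * S j x) \<le> \<bar>w k x * N x\<bar>" for j
      using aes by (rule eventually_mono) (use Sb H0 in \<open>auto simp: abs_mult N_def intro!: mult_left_mono\<close>)
  qed
  have big: "2 ^ k / 2 \<le> \<bar>\<integral>x. w k x * L x \<partial>M\<bar>" for k
  proof -
    have ev: "a k / 5 ^ k / 2 \<le> \<bar>\<integral>x. w k x * S (j + Suc k) x \<partial>M\<bar>" for j
    proof -
      have "a k / 5 ^ k / 2 * (1 - 1 / 5 ^ j) \<le> a k / 5 ^ k / 2 * 1"
        by (rule mult_left_mono) (use ak(3)[of k] in auto)
      note le = order_trans[OF tail[of k j] this]
      have "t / 2 \<le> \<bar>x\<bar>" if "\<bar>x - y\<bar> \<le> t / 2 * 1" "t \<le> \<bar>y\<bar>" for t x y :: real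
        using that by linarith
      from this[OF le hump[of k]] show ?thesis by (simp add: add.commute)
    qed
    have "a k / 5 ^ k / 2 \<le> \<bar>\<integral>x. w k x * L x \<partial>M\<bar>"
      by (rule LIMSEQ_le_const[OF tendsto_rabs[OF LIMSEQ_ignore_initial_segment[OF lim[of k], of "Suc k"]]]) (use ev in blast)
    moreover have "2 ^ k \<le> a k / 5 ^ k"
    proof -
      have "(10 :: real) ^ k = 2 ^ k * 5 ^ k" by (simp flip: power_mult_distrib)
      then show ?thesis using ak(2)[of k] by (simp add: pos_le_divide_eq)
    qed
    ultimately show ?thesis by (meson divide_right_mono order_trans zero_le_numeral)
  qed
  obtain B where B: "\<And>n. \<bar>\<integral>x. v n x * L x \<partial>M\<bar> \<le> B"
    using b[OF Lm Li] unfolding Bseq_def by auto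
  obtain k where "2 * B < 2 ^ k" using real_arch_pow[of 2 "2 * B"] by auto
  then show False using big[of k] B[of "m k"] by (simp add: w_def)
qed

lemma Bochner_slow:
  fixes f :: "real^'n \<Rightarrow> real"
  assumes "f \<in> borel_measurable (lebesgue_on U)" "integrable (lebesgue_on U) (\<lambda>x. \<bar>f x\<bar> powr q)"
  shows "(\<lambda>x y. f x) \<in> Bochner_Lp q U C_per per_norm"
proof -
  obtain s where s: "\<And>i. simple_function (lebesgue_on U) (s i)"
    "\<And>x. x \<in> space (lebesgue_on U) \<Longrightarrow> (\<lambda>i. s i x) \<longlonglongrightarrow> f x"
    using borel_measurable_implies_sequence_metric[OF assms(1), of 0] by blast
  have "(\<lambda>i. per_norm (\<lambda>y. s i x - f x)) \<longlonglongrightarrow> 0" if "x \<in> space (lebesgue_on U)" for x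
    using tendsto_rabs_zero[OF LIM_zero[OF s(2)[OF that]]] by (simp add: per_norm_const)
  then have "strongly_measurable (lebesgue_on U) C_per per_norm (\<lambda>x y. f x)"
    unfolding strongly_measurable_def using C_per_const
    by (intro conjI AE_I2 exI[of _ "\<lambda>i x y. s i x"]) (auto intro: simple_function_compose1[OF s(1)])
  then show ?thesis using assms(2) by (simp add: Bochner_Lp_def per_norm_const)
qed

corollary two_scale_weak_bounded:
  fixes v :: "nat \<Rightarrow> real^'n \<Rightarrow> real"
  assumes w: "two_scale_weak \<epsilon> p U v v0" and p: "1 < p" and U: "U \<in> sets borel"
  shows "\<exists>K. \<forall>n. (\<integral>x. \<bar>v n x\<bar> powr p \<partial>lebesgue_on U) \<le> K"
proof -
  define q where "q = p / (p - 1)"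
  have pq: "1 < p" "1 < q" "1 / p + 1 / q = 1" using conjugate_exponent[OF p] p by (auto simp: q_def)
  show ?thesis
  proof (rule bounded_if_pairings_bounded[OF pq])
    show "v n \<in> borel_measurable (lebesgue_on U)" "integrable (lebesgue_on U) (\<lambda>x. \<bar>v n x\<bar> powr p)" for n
      using w by (auto simp: two_scale_weak_def Lp_def)
    fix \<phi> assume "\<phi> \<in> borel_measurable (lebesgue_on U)" "integrable (lebesgue_on U) (\<lambda>x. \<bar>\<phi> x\<bar> powr q)"
    from two_scale_weak_pairings_converge[OF w pq U Bochner_slow[OF this]]
    show "Bseq (\<lambda>n. \<integral>x. v n x * \<phi> x \<partial>lebesgue_on U)"
      unfolding pairings_converge_def by (intro convergent_imp_Bseq) (auto simp: convergent_def)
  qed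
qed

section \<open>Uniqueness of the weak limit and oscillating functions\<close>

lemma Lp_integrable:
  assumes "v \<in> Lp p S" "1 \<le> p" "bounded S" "S \<in> sets lebesgue"
  shows "integrable (lebesgue_on S) v"
proof -
  interpret finite_measure "lebesgue_on S" by (rule finite_measure_lebesgue_on[OF assms(3,4)])
  have v: "v \<in> borel_measurable (lebesgue_on S)" "integrable (lebesgue_on S) (\<lambda>x. \<bar>v x\<bar> powr p)"
    using assms(1) by (auto simp: Lp_def)
  have i: "integrable (lebesgue_on S) (\<lambda>x. 1 + \<bar>v x\<bar> powr p)" using v(2) by simp
  have "\<bar>t\<bar> \<le> 1 + \<bar>t\<bar> powr p" for t :: real
  proof (cases "\<bar>t\<bar> \<le> 1")
    case True then show ?thesis using powr_ge_zero[of "\<bar>t\<bar>" p] by linarith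
  next
    case False
    then have "\<bar>t\<bar> powr 1 \<le> \<bar>t\<bar> powr p" using assms(2) by (intro powr_mono) auto
    then show ?thesis using False by simp
  qed
  then show ?thesis
    by (intro Bochner_Integration.integrable_bound[OF i v(1)] AE_I2) (simp add: abs_le_iff add_nonneg_nonneg)
qed

lemma bounded_in_Lp:
  assumes "f \<in> borel_measurable (lebesgue_on S)" "AE x in lebesgue_on S. \<bar>f x\<bar> \<le> C" "0 \<le> p" "bounded S" "S \<in> sets lebesgue"
  shows "f \<in> Lp p S"
proof -
  interpret finite_measure "lebesgue_on S" by (rule finite_measure_lebesgue_on[OF assms(4,5)])
  have "integrable (lebesgue_on S) (\<lambda>x. \<bar>f x\<bar> powr p)"
  proof (rule integrable_const_bound)
    show "AE x in lebesgue_on S. norm (\<bar>f x\<bar> powr p) \<le> C powr p"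
      using assms(2) by (rule eventually_mono) (use assms(3) in \<open>simp add: powr_mono2\<close>)
    show "(\<lambda>x. \<bar>f x\<bar> powr p) \<in> borel_measurable (lebesgue_on S)" using assms(1) by measurable
  qed
  then show ?thesis using assms(1) by (simp add: Lp_def)
qed

lemma bounded_integrable:
  fixes f :: "'a::euclidean_space \<Rightarrow> real"
  assumes "f \<in> borel_measurable (lebesgue_on S)" "AE x in lebesgue_on S. \<bar>f x\<bar> \<le> C" "bounded S" "S \<in> sets lebesgue"
  shows "integrable (lebesgue_on S) f"
  using Lp_integrable[OF bounded_in_Lp[OF assms(1,2) zero_le_one assms(3,4)] order_refl assms(3,4)] .

lemma slow_fast_domain:
  assumes "open U" "bounded (U :: (real^'n) set)"
  shows "U \<in> sets borel" "U \<in> sets lebesgue" "U \<times> (unit_cell :: (real^'n) set) \<in> sets lebesgue"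
    "bounded (U \<times> (unit_cell :: (real^'n) set))"
proof -
  show b: "U \<in> sets borel" using assms by simp
  then show "U \<in> sets lebesgue" by (simp add: sets_completionI_sets)
  show "U \<times> (unit_cell :: (real^'n) set) \<in> sets lebesgue" by (rule borel_Times_lebesgue(1)[OF b unit_cell_borel])
  show "bounded (U \<times> (unit_cell :: (real^'n) set))" using assms by (intro bounded_Times) (auto simp: unit_cell_def)
qed

lemma two_scale_weak_test_function:
  fixes \<phi> :: "real^'n \<Rightarrow> real^'n \<Rightarrow> real"
  assumes w: "two_scale_weak \<epsilon> p U v v0" and p: "1 < p" and U: "open U" "bounded U" and t: "test_function \<phi>"
  shows "(\<lambda>n. \<integral>x. v n x * \<phi> x (x /\<^sub>R \<epsilon> n) \<partial>lebesgue_on U)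
       \<longlonglongrightarrow> (\<integral>z. v0 z * \<phi> (fst z) (snd z) \<partial>lebesgue_on (U \<times> unit_cell))"
proof -
  define q where "q = p / (p - 1)"
  have pq: "1 < p" "1 < q" "1 / p + 1 / q = 1" using conjugate_exponent[OF p] p by (auto simp: q_def)
  have "\<phi> \<in> Bochner_Lp q U C_per per_norm"
    by (rule test_function_Bochner[OF t U(2) slow_fast_domain(2)[OF U]]) (use pq in simp)
  from two_scale_weak_pairings_converge[OF w pq slow_fast_domain(1)[OF U] this]
  show ?thesis by (simp add: pairings_converge_def)
qed

lemma test_function_bounded_on:
  fixes \<phi> :: "real^'n \<Rightarrow> real^'n \<Rightarrow> real"
  assumes "test_function \<phi>" "bounded U"
  obtains B where "\<And>x y. x \<in> U \<Longrightarrow> \<bar>\<phi> x y\<bar> \<le> B"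
  using test_function_uniform(1)[OF assms] by (metis real_norm_def)

lemma Lp_test_integrable:
  fixes v0 :: "(real^'n) \<times> (real^'n) \<Rightarrow> real"
  assumes "v0 \<in> Lp p (U \<times> unit_cell)" "1 < p" "open U" "bounded U" "test_function \<phi>"
  shows "integrable (lebesgue_on (U \<times> unit_cell)) (\<lambda>z. v0 z * \<phi> (fst z) (snd z))"
proof -
  note D = slow_fast_domain[OF assms(3,4)]
  obtain B where B: "\<And>x y. x \<in> U \<Longrightarrow> \<bar>\<phi> x y\<bar> \<le> B" using test_function_bounded_on[OF assms(5,4)] by blast
  have i: "integrable (lebesgue_on (U \<times> unit_cell)) v0" using Lp_integrable[OF assms(1) _ D(4,3)] assms(2) by simp
  have m: "(\<lambda>z. \<phi> (fst z) (snd z)) \<in> borel_measurable (lebesgue_on (U \<times> unit_cell))" by (rule test_function_measurable(2)[OF assms(5)])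
  show ?thesis
  proof (rule Bochner_Integration.integrable_bound[of _ "\<lambda>z. B * v0 z"])
    show "(\<lambda>z. v0 z * \<phi> (fst z) (snd z)) \<in> borel_measurable (lebesgue_on (U \<times> unit_cell))" using i m by measurable
    show "AE z in lebesgue_on (U \<times> unit_cell). norm (v0 z * \<phi> (fst z) (snd z)) \<le> norm (B * v0 z)"
    proof (intro AE_I2)
      fix z assume "z \<in> space (lebesgue_on (U \<times> (unit_cell :: (real^'n) set)))"
      then have "\<bar>\<phi> (fst z) (snd z)\<bar> \<le> \<bar>B\<bar>" using B[of "fst z" "snd z"] by auto
      then show "norm (v0 z * \<phi> (fst z) (snd z)) \<le> norm (B * v0 z)"
        using mult_right_mono[OF _ abs_ge_zero[of "v0 z"]] by (simp only: abs_mult mult.commute[of "\<bar>v0 z\<bar>"] real_norm_def)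
    qed
  qed (use i in simp)
qed

text \<open>Test functions approximate the sign of \<open>D\<close> boundedly, so that the integral of its modulus vanishes.\<close>

lemma zero_AE_if_test_integrals_zero:
  fixes D :: "(real^'n) \<times> (real^'n) \<Rightarrow> real"
  assumes U: "open U" "bounded U" and D: "integrable (lebesgue_on (U \<times> unit_cell)) D"
    and z: "\<And>\<phi>. test_function \<phi> \<Longrightarrow> (\<integral>z. D z * \<phi> (fst z) (snd z) \<partial>lebesgue_on (U \<times> unit_cell)) = 0"
  shows "AE z in lebesgue_on (U \<times> unit_cell). D z = 0"
proof -
  let ?M = "lebesgue_on (U \<times> (unit_cell :: (real^'n) set))"
  have Dm: "D \<in> borel_measurable ?M" using D by auto
  have sm: "(\<lambda>z. sgn (D z)) \<in> borel_measurable ?M" using Dm by measurable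
  have sb: "AE z in ?M. \<bar>sgn (D z)\<bar> \<le> 1" by (intro AE_I2) (simp add: abs_sgn_eq)
  obtain \<phi> :: "nat \<Rightarrow> real^'n \<Rightarrow> real^'n \<Rightarrow> real" where \<phi>: "\<And>k. test_function (\<phi> k)" "\<And>k x y. \<bar>\<phi> k x y\<bar> \<le> 1"
    and lim: "AE z in ?M. (\<lambda>k. \<phi> k (fst z) (snd z)) \<longlonglongrightarrow> sgn (D z)"
    using test_functions_dense[OF slow_fast_domain(1)[OF U] sm sb zero_le_one] by blast
  have \<phi>m: "(\<lambda>z. \<phi> k (fst z) (snd z)) \<in> borel_measurable ?M" for k by (rule test_function_measurable(2)[OF \<phi>(1)])
  have "(\<lambda>k. \<integral>z. D z * \<phi> k (fst z) (snd z) \<partial>?M) \<longlonglongrightarrow> (\<integral>z. D z * sgn (D z) \<partial>?M)"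
  proof (rule integral_dominated_convergence[where w="\<lambda>z. \<bar>D z\<bar>"])
    show "(\<lambda>z. D z * sgn (D z)) \<in> borel_measurable ?M" using Dm sm by measurable
    show "(\<lambda>z. D z * \<phi> k (fst z) (snd z)) \<in> borel_measurable ?M" for k using Dm \<phi>m[of k] by measurable
    show "integrable ?M (\<lambda>z. \<bar>D z\<bar>)" using D by simp
    show "AE z in ?M. (\<lambda>k. D z * \<phi> k (fst z) (snd z)) \<longlonglongrightarrow> D z * sgn (D z)"
      using lim by (rule eventually_mono) (intro tendsto_intros)
    show "AE z in ?M. norm (D z * \<phi> k (fst z) (snd z)) \<le> \<bar>D z\<bar>" for k
      using \<phi>(2) by (intro AE_I2) (simp add: abs_mult mult_left_le)
  qed
  then have "(\<integral>z. D z * sgn (D z) \<partial>?M) = 0" using z[OF \<phi>(1)] by (simp add: LIMSEQ_const_iff)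
  then have "(\<integral>z. \<bar>D z\<bar> \<partial>?M) = 0" by (simp add: abs_sgn)
  then have "AE z in ?M. \<bar>D z\<bar> = 0"
    using integral_nonneg_eq_0_iff_AE[of ?M "\<lambda>z. \<bar>D z\<bar>"] D by simp
  then show ?thesis by simp
qed

theorem two_scale_weak_unique:
  fixes v0 v0' :: "(real^'n) \<times> (real^'n) \<Rightarrow> real"
  assumes w: "two_scale_weak \<epsilon> p U v v0" "two_scale_weak \<epsilon> p U v v0'" and p: "1 < p" and U: "open U" "bounded U"
  shows "AE z in lebesgue_on (U \<times> unit_cell). v0 z = v0' z"
proof -
  note D = slow_fast_domain[OF U]
  have L: "v0 \<in> Lp p (U \<times> unit_cell)" "v0' \<in> Lp p (U \<times> unit_cell)" using w by (auto simp: two_scale_weak_def)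
  have i: "integrable (lebesgue_on (U \<times> unit_cell)) v0" "integrable (lebesgue_on (U \<times> unit_cell)) v0'"
    using Lp_integrable[OF _ _ D(4,3)] L p by auto
  have "AE z in lebesgue_on (U \<times> unit_cell). v0 z - v0' z = 0"
  proof (rule zero_AE_if_test_integrals_zero[OF U])
    show "integrable (lebesgue_on (U \<times> unit_cell)) (\<lambda>z. v0 z - v0' z)" using i by simp
    fix \<phi> :: "real^'n \<Rightarrow> real^'n \<Rightarrow> real" assume t: "test_function \<phi>"
    have "(\<integral>z. v0 z * \<phi> (fst z) (snd z) \<partial>lebesgue_on (U \<times> unit_cell)) = (\<integral>z. v0' z * \<phi> (fst z) (snd z) \<partial>lebesgue_on (U \<times> unit_cell))"
      by (rule LIMSEQ_unique[OF two_scale_weak_test_function[OF w(1) p U t] two_scale_weak_test_function[OF w(2) p U t]])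
    then show "(\<integral>z. (v0 z - v0' z) * \<phi> (fst z) (snd z) \<partial>lebesgue_on (U \<times> unit_cell)) = 0"
      using Lp_test_integrable[OF L(1) p U t] Lp_test_integrable[OF L(2) p U t] by (simp add: left_diff_distrib)
  qed
  then show ?thesis by simp
qed

text \<open>For measurable \<open>g\<close> the function \<open>x \<mapsto> g (x / \<epsilon> n)\<close> is not covered by the test functions, but its
  product with a continuous periodic function is again periodic and converges to its mean.\<close>

theorem two_scale_weak_oscillation:
  fixes g :: "real^'n \<Rightarrow> real"
  assumes g: "g \<in> borel_measurable borel" "cell_periodic g" "\<And>y. \<bar>g y\<bar> \<le> M"
    and p: "1 < p" and U: "open U" "bounded U" and \<epsilon>: "\<And>n. 0 < \<epsilon> n" "\<epsilon> \<longlonglongrightarrow> 0"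
  shows "two_scale_weak \<epsilon> p U (\<lambda>n x. g (x /\<^sub>R \<epsilon> n)) (\<lambda>z. g (snd z))"
proof -
  note D = slow_fast_domain[OF U]
  interpret finite_measure "lebesgue_on U" by (rule finite_measure_lebesgue_on[OF U(2) D(2)])
  have gm: "(\<lambda>x. g (x /\<^sub>R e)) \<in> borel_measurable (lebesgue_on S)" for e S
  proof -
    have "(\<lambda>x. g (x /\<^sub>R e)) \<in> borel_measurable lborel" using g(1) by measurable
    then show ?thesis by (rule measurable_restrict_space1[OF measurable_completion])
  qed
  have gm2: "(\<lambda>z. g (snd z)) \<in> borel_measurable (lebesgue_on (U \<times> unit_cell))"
  proof -
    have "(snd :: (real^'n) \<times> (real^'n) \<Rightarrow> real^'n) \<in> borel_measurable borel"
      by (intro borel_measurable_continuous_onI continuous_intros)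
    from measurable_compose[OF this g(1)] have "(\<lambda>z::(real^'n) \<times> (real^'n). g (snd z)) \<in> borel_measurable lborel" by simp
    then show ?thesis by (rule measurable_restrict_space1[OF measurable_completion])
  qed
  have gL: "(\<lambda>x. g (x /\<^sub>R \<epsilon> n)) \<in> Lp p U" for n
    by (rule bounded_in_Lp[OF gm _ _ U(2) D(2), of _ M]) (use g(3) p in auto)
  show ?thesis
  proof (rule two_scale_weakI[OF p U \<epsilon>(1) gL])
    show "(\<lambda>z. g (snd z)) \<in> Lp p (U \<times> unit_cell)"
      by (rule bounded_in_Lp[OF gm2 _ _ D(4,3), of M]) (use g(3) p in auto)
    have "(\<integral>x. \<bar>g (x /\<^sub>R \<epsilon> n)\<bar> powr p \<partial>lebesgue_on U) \<le> (\<integral>x. M powr p \<partial>lebesgue_on U)" for n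
    proof (rule integral_mono_AE)
      show "integrable (lebesgue_on U) (\<lambda>x. \<bar>g (x /\<^sub>R \<epsilon> n)\<bar> powr p)" using gL by (simp add: Lp_def)
      show "AE x in lebesgue_on U. \<bar>g (x /\<^sub>R \<epsilon> n)\<bar> powr p \<le> M powr p" using g(3) p by (intro AE_I2 powr_mono2) auto
    qed simp
    then show "\<forall>\<^sub>F n in sequentially. (\<integral>x. \<bar>g (x /\<^sub>R \<epsilon> n)\<bar> powr p \<partial>lebesgue_on U) \<le> (\<integral>x. M powr p \<partial>lebesgue_on U)" by simp
    fix \<theta> h :: "real^'n \<Rightarrow> real" assume \<theta>: "continuous_on UNIV \<theta>" "\<And>x. x \<notin> U \<Longrightarrow> \<theta> x = 0" and h: "h \<in> C_per"
    obtain R where R: "\<And>x. x \<in> U \<Longrightarrow> norm x \<le> R" using U(2) unfolding bounded_iff by auto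
    have hm: "h \<in> borel_measurable borel" using h by (intro borel_measurable_continuous_onI) (simp add: C_per_iff)
    have lim: "(\<lambda>n. \<integral>x. \<theta> x * (g (x /\<^sub>R \<epsilon> n) * h (x /\<^sub>R \<epsilon> n)) \<partial>lebesgue)
      \<longlonglongrightarrow> (\<integral>x. \<theta> x \<partial>lebesgue) * (\<integral>y. g y * h y \<partial>lebesgue_on unit_cell)"
    proof (rule periodic_mean_value[where R=R and M="M * per_norm h"])
      show "(\<lambda>y. g y * h y) \<in> borel_measurable borel" using g(1) hm by measurable
      show "cell_periodic (\<lambda>y. g y * h y)" using g(2) h by (simp add: cell_periodic_def C_per_iff)
      show "\<bar>g y * h y\<bar> \<le> M * per_norm h" for y
        unfolding abs_mult by (rule mult_mono'[OF g(3) per_norm_upper[OF h]]) auto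
      show "\<theta> x = 0" if "R < norm x" for x using \<theta>(2)[of x] R[of x] that by force
    qed (use \<theta>(1) \<epsilon> in auto)
    have l: "(\<integral>x. \<theta> x * k x \<partial>lebesgue) = (\<integral>x. k x * \<theta> x \<partial>lebesgue_on U)" for k
    proof -
      have "(\<integral>x. k x * \<theta> x \<partial>lebesgue_on U) = (\<integral>x. indicator U x *\<^sub>R (k x * \<theta> x) \<partial>lebesgue)"
        using D(2) by (subst integral_restrict_space) auto
      also have "\<dots> = (\<integral>x. \<theta> x * k x \<partial>lebesgue)"
        using \<theta>(2) by (intro Bochner_Integration.integral_cong) (auto simp: indicator_def)
      finally show ?thesis ..
    qed
    have \<theta>1: "(\<integral>x. \<theta> x \<partial>lebesgue) = (\<integral>x. \<theta> x \<partial>lebesgue_on U)" using l[of "\<lambda>_. 1"] by simp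
    have "pairings_converge \<epsilon> U (\<lambda>n x. g (x /\<^sub>R \<epsilon> n)) (\<lambda>z. g (snd z)) (\<lambda>x y. \<theta> x * h y)"
    proof -
      have i: "integrable (lebesgue_on (U \<times> unit_cell)) (\<lambda>z. g (snd z) * (\<theta> (fst z) * h (snd z)))"
      proof (rule Lp_test_integrable[OF _ p U])
        show "(\<lambda>z. g (snd z)) \<in> Lp p (U \<times> unit_cell)" by fact
        have hc: "continuous_on UNIV h" using h by (simp add: C_per_iff)
        show "test_function (\<lambda>x y. \<theta> x * h y)"
          using h unfolding test_function_def
          by (intro conjI allI continuous_intros continuous_on_compose2[OF \<theta>(1)] continuous_on_compose2[OF hc])
             (auto simp: cell_periodic_def C_per_iff)
      qed
      have "(\<integral>z. g (snd z) * (\<theta> (fst z) * h (snd z)) \<partial>lebesgue_on (U \<times> unit_cell))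
          = (\<integral>x. \<integral>y. g y * (\<theta> x * h y) \<partial>lebesgue_on unit_cell \<partial>lebesgue_on U)"
        using integral_lebesgue_on_Times[OF D(1) unit_cell_borel i] by simp
      also have "\<dots> = (\<integral>x. \<theta> x * (\<integral>y. g y * h y \<partial>lebesgue_on unit_cell) \<partial>lebesgue_on U)"
        by (simp add: mult.left_commute)
      also have "\<dots> = (\<integral>x. \<theta> x \<partial>lebesgue) * (\<integral>y. g y * h y \<partial>lebesgue_on unit_cell)" by (simp add: \<theta>1)
      finally show ?thesis
        using lim unfolding pairings_converge_def l by (simp add: ac_simps)
    qed
    then show "pairings_converge \<epsilon> U (\<lambda>n x. g (x /\<^sub>R \<epsilon> n)) (\<lambda>z. g (snd z)) (\<lambda>x y. \<theta> x * h y)" .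
  qed
qed

lemma test_function_mean_value:
  fixes \<phi> :: "real^'n \<Rightarrow> real^'n \<Rightarrow> real"
  assumes "test_function \<phi>" and U: "open U" "bounded U" and \<epsilon>: "\<And>n. 0 < \<epsilon> n" "\<epsilon> \<longlonglongrightarrow> 0"
  shows "(\<lambda>n. \<integral>x. \<phi> x (x /\<^sub>R \<epsilon> n) \<partial>lebesgue_on U) \<longlonglongrightarrow> (\<integral>z. \<phi> (fst z) (snd z) \<partial>lebesgue_on (U \<times> unit_cell))"
proof -
  have "two_scale_weak \<epsilon> 2 U (\<lambda>n x. 1) (\<lambda>z::(real^'n) \<times> (real^'n). 1)"
    by (rule two_scale_weak_oscillation[where g="\<lambda>y::real^'n. 1" and M=1]) (use assms in \<open>auto simp: cell_periodic_def\<close>)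
  from two_scale_weak_test_function[OF this _ U assms(1)] show ?thesis by simp
qed

section \<open>Strong two-scale convergence by approximation\<close>

text \<open>For bounded sequences, strong convergence means that one test function, evaluated along the
  oscillation, is close to the sequence and, as a function of two variables, close to the limit.
  Unlike convergence of norms, this is stable under nonlinear continuous operations.\<close>

definition strongly_approximable ::
  "(nat \<Rightarrow> real) \<Rightarrow> (real^'n) set \<Rightarrow> (nat \<Rightarrow> real^'n \<Rightarrow> 'b::euclidean_space) \<Rightarrow> ((real^'n) \<times> (real^'n) \<Rightarrow> 'b) \<Rightarrow> bool"
where
  "strongly_approximable \<epsilon> U w w0 \<longleftrightarrow>
    (\<forall>n. w n \<in> borel_measurable (lebesgue_on U)) \<and> w0 \<in> borel_measurable (lebesgue_on (U \<times> unit_cell)) \<and>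
    (\<exists>C. (\<forall>n. \<forall>x\<in>U. norm (w n x) \<le> C) \<and> (AE z in lebesgue_on (U \<times> unit_cell). norm (w0 z) \<le> C) \<and>
      (\<forall>\<eta>>0. \<exists>\<phi>. test_function \<phi> \<and> (\<forall>x\<in>U. \<forall>y. norm (\<phi> x y) \<le> C) \<and>
        (\<forall>\<^sub>F n in sequentially. (\<integral>x. norm (w n x - \<phi> x (x /\<^sub>R \<epsilon> n)) \<partial>lebesgue_on U) \<le> \<eta>) \<and>
        (\<integral>z. norm (w0 z - \<phi> (fst z) (snd z)) \<partial>lebesgue_on (U \<times> unit_cell)) \<le> \<eta>))"

text \<open>Pairing with squares of test functions preserves the inequality; these squares approximate the
  indicator of the set where it fails in the limit.\<close>

lemma weak_limit_upper_bound:
  fixes w0 :: "(real^'n) \<times> (real^'n) \<Rightarrow> real"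
  assumes w: "two_scale_weak \<epsilon> p U w w0" and p: "1 < p" and U: "open U" "bounded U"
    and \<epsilon>: "\<And>n. 0 < \<epsilon> n" "\<epsilon> \<longlonglongrightarrow> 0" and C: "\<And>n x. x \<in> U \<Longrightarrow> s * w n x \<le> C"
  shows "AE z in lebesgue_on (U \<times> unit_cell). s * w0 z \<le> C"
proof -
  note D = slow_fast_domain[OF U]
  let ?M = "lebesgue_on (U \<times> (unit_cell :: (real^'n) set))"
  have L0: "w0 \<in> Lp p (U \<times> unit_cell)" and L: "\<And>n. w n \<in> Lp p U" using w by (auto simp: two_scale_weak_def)
  have wi: "integrable (lebesgue_on U) (w n)" for n using Lp_integrable[OF L _ U(2) D(2)] p by simp
  have w0i: "integrable ?M w0" using Lp_integrable[OF L0 _ D(4,3)] p by simp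
  interpret F: finite_measure ?M by (rule finite_measure_lebesgue_on[OF D(4,3)])
  interpret G: finite_measure "lebesgue_on U" by (rule finite_measure_lebesgue_on[OF U(2) D(2)])
  let ?f = "\<lambda>z. if C < s * w0 z then 1 else 0 :: real"
  have fm: "?f \<in> borel_measurable ?M" using w0i by measurable
  obtain \<phi> :: "nat \<Rightarrow> real^'n \<Rightarrow> real^'n \<Rightarrow> real" where \<phi>: "\<And>k. test_function (\<phi> k)" "\<And>k x y. \<bar>\<phi> k x y\<bar> \<le> 1"
    and lim: "AE z in ?M. (\<lambda>k. \<phi> k (fst z) (snd z)) \<longlonglongrightarrow> ?f z"
    using test_functions_dense[OF D(1) fm _ zero_le_one] by (auto intro!: AE_I2)
  let ?\<psi> = "\<lambda>k x y. (\<phi> k x y)\<^sup>2"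
  have \<psi>: "test_function (?\<psi> k)" for k
    using \<phi>(1)[of k] by (auto simp: test_function_def cell_periodic_def intro: continuous_intros)
  have \<psi>b: "\<bar>?\<psi> k x y\<bar> \<le> 1" for k x y using \<phi>(2)[of k x y] by (simp add: abs_square_le_1)
  have \<psi>m: "(\<lambda>z. ?\<psi> k (fst z) (snd z)) \<in> borel_measurable ?M" "(\<lambda>x. ?\<psi> k x (x /\<^sub>R e)) \<in> borel_measurable (lebesgue_on U)" for k e
    by (rule test_function_measurable(2)[OF \<psi>], rule test_function_measurable(1)[OF \<psi>])
  have i1: "integrable (lebesgue_on U) (\<lambda>x. ?\<psi> k x (x /\<^sub>R e))" for k e
    by (rule bounded_integrable[OF \<psi>m(2) _ U(2) D(2), of _ _ 1]) (use \<psi>b in auto)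
  have i2: "integrable (lebesgue_on U) (\<lambda>x. w n x * ?\<psi> k x (x /\<^sub>R e))" for n k e
    by (rule Bochner_Integration.integrable_bound[OF wi[of n]])
       (use wi[of n] \<psi>m(2)[of k e] \<psi>b in \<open>auto intro!: AE_I2 borel_measurable_times simp: abs_mult mult_left_le\<close>)
  have i3: "integrable ?M (\<lambda>z. ?\<psi> k (fst z) (snd z))" for k
    by (rule bounded_integrable[OF \<psi>m(1) _ D(4,3), of _ 1]) (use \<psi>b in auto)
  note i4 = Lp_test_integrable[OF L0 p U \<psi>]
  have nonneg: "0 \<le> (\<integral>z. (C - s * w0 z) * ?\<psi> k (fst z) (snd z) \<partial>?M)" for k
  proof -
    have "(\<lambda>n. C * (\<integral>x. ?\<psi> k x (x /\<^sub>R \<epsilon> n) \<partial>lebesgue_on U) - s * (\<integral>x. w n x * ?\<psi> k x (x /\<^sub>R \<epsilon> n) \<partial>lebesgue_on U))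
        \<longlonglongrightarrow> C * (\<integral>z. ?\<psi> k (fst z) (snd z) \<partial>?M) - s * (\<integral>z. w0 z * ?\<psi> k (fst z) (snd z) \<partial>?M)"
      by (intro tendsto_intros test_function_mean_value[OF \<psi> U \<epsilon>] two_scale_weak_test_function[OF w p U \<psi>])
    moreover have "0 \<le> C * (\<integral>x. ?\<psi> k x (x /\<^sub>R \<epsilon> n) \<partial>lebesgue_on U) - s * (\<integral>x. w n x * ?\<psi> k x (x /\<^sub>R \<epsilon> n) \<partial>lebesgue_on U)" for n
    proof -
      have "0 \<le> (\<integral>x. (C - s * w n x) * ?\<psi> k x (x /\<^sub>R \<epsilon> n) \<partial>lebesgue_on U)"
        using C by (intro integral_nonneg_AE AE_I2) simp
      also have "(\<lambda>x. (C - s * w n x) * ?\<psi> k x (x /\<^sub>R \<epsilon> n)) = (\<lambda>x. C * ?\<psi> k x (x /\<^sub>R \<epsilon> n) - s * (w n x * ?\<psi> k x (x /\<^sub>R \<epsilon> n)))"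
        by (simp add: left_diff_distrib mult.assoc)
      finally show ?thesis using i1[of k "\<epsilon> n"] i2[of n k "\<epsilon> n"] by simp
    qed
    ultimately have "0 \<le> C * (\<integral>z. ?\<psi> k (fst z) (snd z) \<partial>?M) - s * (\<integral>z. w0 z * ?\<psi> k (fst z) (snd z) \<partial>?M)"
      by (intro LIMSEQ_le_const) auto
    also have "\<dots> = (\<integral>z. C * ?\<psi> k (fst z) (snd z) - s * (w0 z * ?\<psi> k (fst z) (snd z)) \<partial>?M)"
      using i3[of k] i4[of k] by simp
    also have "\<dots> = (\<integral>z. (C - s * w0 z) * ?\<psi> k (fst z) (snd z) \<partial>?M)" by (simp add: left_diff_distrib mult.assoc)
    finally show ?thesis .
  qed
  have ci: "integrable ?M (\<lambda>z. C - s * w0 z)" using w0i by simp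
  have "(\<lambda>k. \<integral>z. (C - s * w0 z) * ?\<psi> k (fst z) (snd z) \<partial>?M) \<longlonglongrightarrow> (\<integral>z. (C - s * w0 z) * (?f z)\<^sup>2 \<partial>?M)"
  proof (rule integral_dominated_convergence[where w="\<lambda>z. \<bar>C - s * w0 z\<bar>"])
    show "(\<lambda>z. (C - s * w0 z) * (?f z)\<^sup>2) \<in> borel_measurable ?M" using ci fm by measurable
    show "(\<lambda>z. (C - s * w0 z) * ?\<psi> k (fst z) (snd z)) \<in> borel_measurable ?M" for k
      by (rule borel_measurable_times[OF _ \<psi>m(1)]) (use ci in auto)
    show "integrable ?M (\<lambda>z. \<bar>C - s * w0 z\<bar>)" using ci by simp
    show "AE z in ?M. (\<lambda>k. (C - s * w0 z) * ?\<psi> k (fst z) (snd z)) \<longlonglongrightarrow> (C - s * w0 z) * (?f z)\<^sup>2"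
      using lim by (rule eventually_mono) (intro tendsto_intros)
    show "AE z in ?M. norm ((C - s * w0 z) * ?\<psi> k (fst z) (snd z)) \<le> \<bar>C - s * w0 z\<bar>" for k
      using \<psi>b by (intro AE_I2) (simp add: abs_mult mult_left_le)
  qed
  then have "0 \<le> (\<integral>z. (C - s * w0 z) * (?f z)\<^sup>2 \<partial>?M)" using nonneg by (intro LIMSEQ_le_const) auto
  moreover have i5: "integrable ?M (\<lambda>z. (s * w0 z - C) * (?f z)\<^sup>2)"
    by (rule Bochner_Integration.integrable_bound[OF ci]) (use ci fm w0i in \<open>auto intro!: AE_I2\<close>)
  moreover have neg: "0 \<le> (s * w0 z - C) * (?f z)\<^sup>2" for z by simp
  moreover have "(\<integral>z. (C - s * w0 z) * (?f z)\<^sup>2 \<partial>?M) = - (\<integral>z. (s * w0 z - C) * (?f z)\<^sup>2 \<partial>?M)"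
  proof -
    have "(\<lambda>z. (C - s * w0 z) * (?f z)\<^sup>2) = (\<lambda>z. - ((s * w0 z - C) * (?f z)\<^sup>2))" by auto
    then show ?thesis by simp
  qed
  moreover have "0 \<le> (\<integral>z. (s * w0 z - C) * (?f z)\<^sup>2 \<partial>?M)" by (intro integral_nonneg_AE AE_I2 neg)
  ultimately have "(\<integral>z. (s * w0 z - C) * (?f z)\<^sup>2 \<partial>?M) = 0" by linarith
  then have "AE z in ?M. (s * w0 z - C) * (?f z)\<^sup>2 = 0"
    using integral_nonneg_eq_0_iff_AE[OF i5] neg by simp
  then show ?thesis by (rule eventually_mono) (auto split: if_splits)
qed

lemma L1_from_L2:
  fixes d :: "'a \<Rightarrow> real"
  assumes "finite_measure M" and i: "integrable M (\<lambda>x. (d x)\<^sup>2)" and m: "d \<in> borel_measurable M"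
    and b: "(\<integral>x. (d x)\<^sup>2 \<partial>M) \<le> \<tau> * \<tau>" "measure M (space M) \<le> \<mu>" and \<tau>: "0 < \<tau>"
  shows "(\<integral>x. \<bar>d x\<bar> \<partial>M) \<le> \<tau> * (\<mu> + 1)"
proof -
  interpret finite_measure M by fact
  have i2: "integrable M (\<lambda>x. \<tau> + (d x)\<^sup>2 / \<tau>)" using i by simp
  have le: "\<bar>t\<bar> \<le> \<tau> + t\<^sup>2 / \<tau>" for t :: real
  proof (cases "\<bar>t\<bar> \<le> \<tau>")
    case True then show ?thesis using \<tau> by (simp add: add_increasing2)
  next
    case False
    then have "\<bar>t\<bar> * \<tau> \<le> \<bar>t\<bar> * \<bar>t\<bar>" using \<tau> by (intro mult_left_mono) auto
    then have "\<bar>t\<bar> \<le> t\<^sup>2 / \<tau>" using \<tau> by (simp add: pos_le_divide_eq power2_eq_square)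
    then show ?thesis using \<tau> by simp
  qed
  have i1: "integrable M (\<lambda>x. \<bar>d x\<bar>)"
    by (rule Bochner_Integration.integrable_bound[OF i2]) (use m le \<tau> in \<open>auto intro!: AE_I2 simp: abs_of_nonneg\<close>)
  have "(\<integral>x. \<bar>d x\<bar> \<partial>M) \<le> (\<integral>x. \<tau> + (d x)\<^sup>2 / \<tau> \<partial>M)"
    by (rule integral_mono_AE[OF i1 i2]) (intro AE_I2 le)
  also have "\<dots> = \<tau> * measure M (space M) + (\<integral>x. (d x)\<^sup>2 \<partial>M) / \<tau>" using i by simp
  also have "\<dots> \<le> \<tau> * \<mu> + \<tau>"
    using b \<tau> by (intro add_mono mult_left_mono) (auto simp: pos_divide_le_eq)
  finally show ?thesis by (simp add: distrib_left)
qed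

text \<open>Let \<open>\<phi> k\<close> be test functions tending to the limit. Expanding the square, the mean square distance
  of \<open>w n\<close> and \<open>\<phi> k\<close> tends, for fixed \<open>k\<close>, to that of \<open>w0\<close> and \<open>\<phi> k\<close> up to the possible defect
  between the limit of the norms and the norm of the limit.\<close>

definition approximants ::
  "(nat \<Rightarrow> real) \<Rightarrow> (real^'n) set \<Rightarrow> (nat \<Rightarrow> real^'n \<Rightarrow> real) \<Rightarrow> ((real^'n) \<times> (real^'n) \<Rightarrow> real) \<Rightarrow> real \<Rightarrow>
   real \<Rightarrow> (nat \<Rightarrow> real^'n \<Rightarrow> real^'n \<Rightarrow> real) \<Rightarrow> bool" where
  "approximants \<epsilon> U w w0 C l \<phi> \<longleftrightarrow>
    (AE z in lebesgue_on (U \<times> unit_cell). \<bar>w0 z\<bar> \<le> C) \<and>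
    (\<lambda>k. \<integral>z. (w0 z - \<phi> k (fst z) (snd z))\<^sup>2 \<partial>lebesgue_on (U \<times> unit_cell)) \<longlonglongrightarrow> 0 \<and>
    (\<forall>k. test_function (\<phi> k) \<and> (\<forall>x y. \<bar>\<phi> k x y\<bar> \<le> C) \<and>
      integrable (lebesgue_on (U \<times> unit_cell)) (\<lambda>z. (w0 z - \<phi> k (fst z) (snd z))\<^sup>2) \<and>
      (\<forall>n. integrable (lebesgue_on U) (\<lambda>x. (w n x - \<phi> k x (x /\<^sub>R \<epsilon> n))\<^sup>2)) \<and>
      (\<lambda>n. \<integral>x. (w n x - \<phi> k x (x /\<^sub>R \<epsilon> n))\<^sup>2 \<partial>lebesgue_on U) \<longlonglongrightarrow>
        l - (\<integral>z. (w0 z)\<^sup>2 \<partial>lebesgue_on (U \<times> unit_cell)) + (\<integral>z. (w0 z - \<phi> k (fst z) (snd z))\<^sup>2 \<partial>lebesgue_on (U \<times> unit_cell)))"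

lemma weak_limit_approximants:
  fixes w :: "nat \<Rightarrow> real^'n \<Rightarrow> real" and w0 :: "(real^'n) \<times> (real^'n) \<Rightarrow> real"
  assumes w: "two_scale_weak \<epsilon> 2 U w w0" and U: "open U" "bounded U"
    and \<epsilon>: "\<And>n. 0 < \<epsilon> n" "\<epsilon> \<longlonglongrightarrow> 0" and C: "\<And>n x. x \<in> U \<Longrightarrow> \<bar>w n x\<bar> \<le> C" and C0: "0 \<le> C"
    and norms: "(\<lambda>n. \<integral>x. (w n x)\<^sup>2 \<partial>lebesgue_on U) \<longlonglongrightarrow> l"
  shows "\<exists>\<phi>. approximants \<epsilon> U w w0 C l \<phi>"
proof -
  note D = slow_fast_domain[OF U]
  let ?M = "lebesgue_on (U \<times> (unit_cell :: (real^'n) set))"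
  have wm: "\<And>n. w n \<in> borel_measurable (lebesgue_on U)" and w0m: "w0 \<in> borel_measurable ?M"
    using w by (auto simp: two_scale_weak_def Lp_def)
  have p2: "(1::real) < 2" by simp
  have "AE z in ?M. 1 * w0 z \<le> C" "AE z in ?M. - 1 * w0 z \<le> C"
    by (rule weak_limit_upper_bound[OF w p2 U \<epsilon>]; use C in \<open>fastforce simp: abs_le_iff\<close>)+
  then have w0b: "AE z in ?M. \<bar>w0 z\<bar> \<le> C" by eventually_elim linarith
  obtain \<phi> :: "nat \<Rightarrow> real^'n \<Rightarrow> real^'n \<Rightarrow> real" where \<phi>: "\<And>k. test_function (\<phi> k)" "\<And>k x y. \<bar>\<phi> k x y\<bar> \<le> C"
    and lim: "AE z in ?M. (\<lambda>k. \<phi> k (fst z) (snd z)) \<longlonglongrightarrow> w0 z"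
    using test_functions_dense[OF D(1) w0m w0b C0] by blast
  interpret F: finite_measure ?M by (rule finite_measure_lebesgue_on[OF D(4,3)])
  have \<phi>m: "(\<lambda>z. \<phi> k (fst z) (snd z)) \<in> borel_measurable ?M" "(\<lambda>x. \<phi> k x (x /\<^sub>R e)) \<in> borel_measurable (lebesgue_on U)" for k e
    by (rule test_function_measurable(2)[OF \<phi>(1)], rule test_function_measurable(1)[OF \<phi>(1)])
  have bi: "integrable (lebesgue_on S) (\<lambda>x. f x * g x)"
    if "S \<in> sets lebesgue" "bounded S" "f \<in> borel_measurable (lebesgue_on S)" "g \<in> borel_measurable (lebesgue_on S)"
      "AE x in lebesgue_on S. \<bar>f x\<bar> \<le> C" "AE x in lebesgue_on S. \<bar>g x\<bar> \<le> C" for f g :: "'x::euclidean_space \<Rightarrow> real" and S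
  proof (rule bounded_integrable[OF borel_measurable_times[OF that(3,4)] _ that(2,1)])
    show "AE x in lebesgue_on S. \<bar>f x * g x\<bar> \<le> C * C"
      using that(5,6) by eventually_elim (auto simp: abs_mult intro!: mult_mono C0)
  qed
  have sq: "(a - b)\<^sup>2 = a * a - 2 * (a * b) + b * b" for a b :: real by (simp add: power2_eq_square algebra_simps)
  have expand: "integrable K (\<lambda>x. (f x - g x)\<^sup>2)"
    "(\<integral>x. (f x - g x)\<^sup>2 \<partial>K) = (\<integral>x. (f x)\<^sup>2 \<partial>K) - 2 * (\<integral>x. f x * g x \<partial>K) + (\<integral>x. (g x)\<^sup>2 \<partial>K)"
    if "integrable K (\<lambda>x. f x * f x)" "integrable K (\<lambda>x. f x * g x)" "integrable K (\<lambda>x. g x * g x)" for f g :: "'x \<Rightarrow> real" and K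
    unfolding sq using that by (simp_all add: power2_eq_square)
  have ae: "AE z in ?M. \<bar>\<phi> k (fst z) (snd z)\<bar> \<le> C" "AE x in lebesgue_on U. \<bar>\<phi> k x (x /\<^sub>R e)\<bar> \<le> C" "AE x in lebesgue_on U. \<bar>w n x\<bar> \<le> C" for k e n
    using \<phi>(2) C by (auto intro: AE_I2)
  note e0 = expand[OF bi[OF D(3,4) w0m w0m w0b w0b] bi[OF D(3,4) w0m \<phi>m(1) w0b ae(1)] bi[OF D(3,4) \<phi>m(1) \<phi>m(1) ae(1) ae(1)]]
  note e1 = expand[OF bi[OF D(2) U(2) wm wm ae(3) ae(3)] bi[OF D(2) U(2) wm \<phi>m(2) ae(3) ae(2)] bi[OF D(2) U(2) \<phi>m(2) \<phi>m(2) ae(2) ae(2)]]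
  have "(\<lambda>n. \<integral>x. (w n x - \<phi> k x (x /\<^sub>R \<epsilon> n))\<^sup>2 \<partial>lebesgue_on U) \<longlonglongrightarrow>
      l - (\<integral>z. (w0 z)\<^sup>2 \<partial>?M) + (\<integral>z. (w0 z - \<phi> k (fst z) (snd z))\<^sup>2 \<partial>?M)" for k
  proof -
    have t: "test_function (\<lambda>x y. (\<phi> k x y)\<^sup>2)"
      using \<phi>(1)[of k] by (auto simp: test_function_def cell_periodic_def intro: continuous_intros)
    have "(\<lambda>n. \<integral>x. (w n x - \<phi> k x (x /\<^sub>R \<epsilon> n))\<^sup>2 \<partial>lebesgue_on U) \<longlonglongrightarrow>
      l - 2 * (\<integral>z. w0 z * \<phi> k (fst z) (snd z) \<partial>?M) + (\<integral>z. (\<phi> k (fst z) (snd z))\<^sup>2 \<partial>?M)"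
      unfolding e1(2)
      by (intro tendsto_intros norms two_scale_weak_test_function[OF w p2 U \<phi>(1)] test_function_mean_value[OF t U \<epsilon>])
    then show ?thesis by (simp add: e0(2) algebra_simps)
  qed
  moreover have "(\<lambda>k. \<integral>z. (w0 z - \<phi> k (fst z) (snd z))\<^sup>2 \<partial>?M) \<longlonglongrightarrow> (\<integral>z. 0 \<partial>?M)"
  proof (rule integral_dominated_convergence[where w="\<lambda>z. (2 * C)\<^sup>2"])
    show "(\<lambda>z. (w0 z - \<phi> k (fst z) (snd z))\<^sup>2) \<in> borel_measurable ?M" for k by (rule borel_measurable_integrable[OF e0(1)])
    show "AE z in ?M. (\<lambda>k. (w0 z - \<phi> k (fst z) (snd z))\<^sup>2) \<longlonglongrightarrow> 0"
      using lim
    proof eventually_elim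
      case (elim z)
      show ?case using tendsto_power[OF tendsto_diff[OF tendsto_const[of "w0 z"] elim], of 2] by simp
    qed
    show "AE z in ?M. norm ((w0 z - \<phi> k (fst z) (snd z))\<^sup>2) \<le> (2 * C)\<^sup>2" for k
      using w0b
    proof eventually_elim
      case (elim z)
      then have "\<bar>w0 z - \<phi> k (fst z) (snd z)\<bar> \<le> \<bar>2 * C\<bar>" using \<phi>(2)[of k "fst z" "snd z"] by linarith
      then show ?case by (simp only: abs_le_square_iff real_norm_def abs_power2)
    qed
  qed auto
  ultimately show ?thesis using \<phi> w0b e0(1) e1(1) by (intro exI[of _ \<phi>]) (simp add: approximants_def)
qed

lemma strongly_approximable_if_norms_converge:
  fixes w :: "nat \<Rightarrow> real^'n \<Rightarrow> real" and w0 :: "(real^'n) \<times> (real^'n) \<Rightarrow> real"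
  assumes w: "two_scale_weak \<epsilon> 2 U w w0" and U: "open U" "bounded U"
    and \<epsilon>: "\<And>n. 0 < \<epsilon> n" "\<epsilon> \<longlonglongrightarrow> 0" and C: "\<And>n x. x \<in> U \<Longrightarrow> \<bar>w n x\<bar> \<le> C"
    and norms: "(\<lambda>n. \<integral>x. (w n x)\<^sup>2 \<partial>lebesgue_on U) \<longlonglongrightarrow> (\<integral>z. (w0 z)\<^sup>2 \<partial>lebesgue_on (U \<times> unit_cell))"
  shows "strongly_approximable \<epsilon> U w w0"
proof -
  note D = slow_fast_domain[OF U]
  let ?M = "lebesgue_on (U \<times> (unit_cell :: (real^'n) set))" and ?N = "lebesgue_on U" and ?C = "max C 0"
  have wm: "\<And>n. w n \<in> borel_measurable ?N" and w0m: "w0 \<in> borel_measurable ?M"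
    using w by (auto simp: two_scale_weak_def Lp_def)
  have C': "\<bar>w n x\<bar> \<le> ?C" if "x \<in> U" for n x using C[OF that, of n] by (simp add: le_max_iff_disj)
  obtain \<phi> where ap: "approximants \<epsilon> U w w0 ?C (\<integral>z. (w0 z)\<^sup>2 \<partial>?M) \<phi>"
    using weak_limit_approximants[OF w U \<epsilon> C' max.cobounded2 norms] by blast
  have \<phi>: "test_function (\<phi> k)" "\<bar>\<phi> k x y\<bar> \<le> ?C" and w0b: "AE z in ?M. \<bar>w0 z\<bar> \<le> ?C"
    and i0: "integrable ?M (\<lambda>z. (w0 z - \<phi> k (fst z) (snd z))\<^sup>2)"
    and i1: "integrable ?N (\<lambda>x. (w n x - \<phi> k x (x /\<^sub>R \<epsilon> n))\<^sup>2)"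
    and ek: "(\<lambda>k. \<integral>z. (w0 z - \<phi> k (fst z) (snd z))\<^sup>2 \<partial>?M) \<longlonglongrightarrow> 0"
    and conv: "(\<lambda>n. \<integral>x. (w n x - \<phi> k x (x /\<^sub>R \<epsilon> n))\<^sup>2 \<partial>?N) \<longlonglongrightarrow> (\<integral>z. (w0 z - \<phi> k (fst z) (snd z))\<^sup>2 \<partial>?M)" for k n x y
    using ap by (simp_all add: approximants_def)
  have "\<exists>\<phi>. test_function \<phi> \<and> (\<forall>x\<in>U. \<forall>y. norm (\<phi> x y) \<le> ?C) \<and>
        (\<forall>\<^sub>F n in sequentially. (\<integral>x. norm (w n x - \<phi> x (x /\<^sub>R \<epsilon> n)) \<partial>?N) \<le> \<eta>) \<and>
        (\<integral>z. norm (w0 z - \<phi> (fst z) (snd z)) \<partial>?M) \<le> \<eta>" if \<eta>: "0 < \<eta>" for \<eta>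
  proof -
    define \<mu> where "\<mu> = measure ?M (space ?M) + measure ?N (space ?N)"
    have \<mu>: "measure ?M (space ?M) \<le> \<mu>" "measure ?N (space ?N) \<le> \<mu>" "0 \<le> \<mu>"
      unfolding \<mu>_def by simp_all
    define \<tau> where "\<tau> = \<eta> / (\<mu> + 1)"
    have \<tau>: "0 < \<tau>" "\<tau> * (\<mu> + 1) = \<eta>" using \<eta> \<mu>(3) by (auto simp: \<tau>_def)
    have "\<forall>\<^sub>F k in sequentially. (\<integral>z. (w0 z - \<phi> k (fst z) (snd z))\<^sup>2 \<partial>?M) < \<tau> * \<tau>"
      by (rule order_tendstoD(2)[OF ek]) (use \<tau> in simp)
    then obtain k where k: "(\<integral>z. (w0 z - \<phi> k (fst z) (snd z))\<^sup>2 \<partial>?M) < \<tau> * \<tau>" unfolding eventually_sequentially by blast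
    have "(\<integral>z. \<bar>w0 z - \<phi> k (fst z) (snd z)\<bar> \<partial>?M) \<le> \<tau> * (\<mu> + 1)"
      by (rule L1_from_L2[OF finite_measure_lebesgue_on[OF D(4,3)] i0 _ less_imp_le[OF k] \<mu>(1) \<tau>(1)])
         (intro borel_measurable_diff w0m test_function_measurable(2)[OF \<phi>(1)])
    moreover have "\<forall>\<^sub>F n in sequentially. (\<integral>x. (w n x - \<phi> k x (x /\<^sub>R \<epsilon> n))\<^sup>2 \<partial>?N) < \<tau> * \<tau>"
      by (rule order_tendstoD(2)[OF conv]) (use k in simp)
    then have "\<forall>\<^sub>F n in sequentially. (\<integral>x. \<bar>w n x - \<phi> k x (x /\<^sub>R \<epsilon> n)\<bar> \<partial>?N) \<le> \<tau> * (\<mu> + 1)"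
      by eventually_elim
        (rule L1_from_L2[OF finite_measure_lebesgue_on[OF U(2) D(2)] i1
          borel_measurable_diff[OF wm test_function_measurable(1)[OF \<phi>(1)]] less_imp_le \<mu>(2) \<tau>(1)])
    ultimately show ?thesis using \<phi> \<tau>(2) by (intro exI[of _ "\<phi> k"]) simp
  qed
  then show ?thesis
    unfolding strongly_approximable_def
    using wm w0m w0b C' by (intro conjI allI exI[of _ ?C]) auto
qed

lemma Lp_norm_two_square: "(Lp_norm 2 S f)\<^sup>2 = (\<integral>x. (f x)\<^sup>2 \<partial>lebesgue_on S)"
proof -
  have sq: "\<bar>t\<bar> powr 2 = t\<^sup>2" for t :: real by (cases "t = 0") auto
  show ?thesis unfolding Lp_norm_def sq by (simp add: powr_half_sqrt)
qed

lemma two_scale_strong_approximable: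
  fixes w :: "nat \<Rightarrow> real^'n \<Rightarrow> real" and w0 :: "(real^'n) \<times> (real^'n) \<Rightarrow> real"
  assumes w: "two_scale_strong \<epsilon> 2 U w w0" and U: "open U" "bounded U"
    and \<epsilon>: "\<And>n. 0 < \<epsilon> n" "\<epsilon> \<longlonglongrightarrow> 0" and C: "\<And>n x. x \<in> U \<Longrightarrow> \<bar>w n x\<bar> \<le> C"
  shows "strongly_approximable \<epsilon> U w w0"
proof (rule strongly_approximable_if_norms_converge[OF _ U \<epsilon> C])
  show "two_scale_weak \<epsilon> 2 U w w0" using w by (simp add: two_scale_strong_def)
  have "(\<lambda>n. (Lp_norm 2 U (w n))\<^sup>2) \<longlonglongrightarrow> (Lp_norm 2 (U \<times> unit_cell) w0)\<^sup>2"
    using w by (intro tendsto_intros) (simp add: two_scale_strong_def)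
  then show "(\<lambda>n. \<integral>x. (w n x)\<^sup>2 \<partial>lebesgue_on U) \<longlonglongrightarrow> (\<integral>z. (w0 z)\<^sup>2 \<partial>lebesgue_on (U \<times> unit_cell))"
    by (simp add: Lp_norm_two_square)
qed

text \<open>Weak lower semicontinuity of the norm: the limiting mean square distances in the lemma
  on approximants are nonnegative.\<close>

lemma weak_limit_norm_le:
  fixes w :: "nat \<Rightarrow> real^'n \<Rightarrow> real" and w0 :: "(real^'n) \<times> (real^'n) \<Rightarrow> real"
  assumes w: "two_scale_weak \<epsilon> 2 U w w0" and U: "open U" "bounded U"
    and \<epsilon>: "\<And>n. 0 < \<epsilon> n" "\<epsilon> \<longlonglongrightarrow> 0" and C: "\<And>n x. x \<in> U \<Longrightarrow> \<bar>w n x\<bar> \<le> C"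
    and norms: "(\<lambda>n. \<integral>x. (w n x)\<^sup>2 \<partial>lebesgue_on U) \<longlonglongrightarrow> l"
  shows "(\<integral>z. (w0 z)\<^sup>2 \<partial>lebesgue_on (U \<times> unit_cell)) \<le> l"
proof -
  let ?M = "lebesgue_on (U \<times> (unit_cell :: (real^'n) set))"
  have C': "\<bar>w n x\<bar> \<le> max C 0" if "x \<in> U" for n x using C[OF that, of n] by (simp add: le_max_iff_disj)
  obtain \<phi> where ap: "approximants \<epsilon> U w w0 (max C 0) l \<phi>"
    using weak_limit_approximants[OF w U \<epsilon> C' max.cobounded2 norms] by blast
  have ek: "(\<lambda>k. \<integral>z. (w0 z - \<phi> k (fst z) (snd z))\<^sup>2 \<partial>?M) \<longlonglongrightarrow> 0"
    and conv: "(\<lambda>n. \<integral>x. (w n x - \<phi> k x (x /\<^sub>R \<epsilon> n))\<^sup>2 \<partial>lebesgue_on U) \<longlonglongrightarrow>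
      l - (\<integral>z. (w0 z)\<^sup>2 \<partial>?M) + (\<integral>z. (w0 z - \<phi> k (fst z) (snd z))\<^sup>2 \<partial>?M)" for k
    using ap by (simp_all add: approximants_def)
  have "0 \<le> l - (\<integral>z. (w0 z)\<^sup>2 \<partial>?M) + (\<integral>z. (w0 z - \<phi> k (fst z) (snd z))\<^sup>2 \<partial>?M)" for k
    by (rule LIMSEQ_le_const[OF conv[of k]]) simp
  then have "0 \<le> l - (\<integral>z. (w0 z)\<^sup>2 \<partial>?M) + 0"
    by (intro LIMSEQ_le_const[OF tendsto_add[OF tendsto_const ek]]) blast
  then show ?thesis by simp
qed

section \<open>Pairing a weakly with a strongly convergent sequence\<close>

lemma integrable_norm_diff:
  fixes f g :: "'a::euclidean_space \<Rightarrow> 'b::euclidean_space"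
  assumes "f \<in> borel_measurable (lebesgue_on S)" "g \<in> borel_measurable (lebesgue_on S)"
    and b: "AE x in lebesgue_on S. norm (f x) \<le> C" "AE x in lebesgue_on S. norm (g x) \<le> C"
    and S: "bounded S" "S \<in> sets lebesgue"
  shows "integrable (lebesgue_on S) (\<lambda>x. norm (f x - g x))"
proof (rule bounded_integrable[OF measurable_compose[OF borel_measurable_diff[OF assms(1,2)] borel_measurable_norm] _ S])
  show "AE x in lebesgue_on S. \<bar>norm (f x - g x)\<bar> \<le> 2 * C"
    using b
  proof eventually_elim
    case (elim x)
    then show ?case using norm_triangle_ineq4[of "f x" "g x"] by simp
  qed
qed

lemma strongly_approximable_componentwise:
  fixes w :: "nat \<Rightarrow> real^'n \<Rightarrow> 'b::euclidean_space" and w0 :: "(real^'n) \<times> (real^'n) \<Rightarrow> 'b"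
  assumes U: "open U" "bounded U"
    and c: "\<And>b. b \<in> Basis \<Longrightarrow> strongly_approximable \<epsilon> U (\<lambda>n x. w n x \<bullet> b) (\<lambda>z. w0 z \<bullet> b)"
  shows "strongly_approximable \<epsilon> U w w0"
proof -
  note D = slow_fast_domain[OF U]
  let ?M = "lebesgue_on (U \<times> (unit_cell :: (real^'n) set))" and ?N = "lebesgue_on U"
  have "\<exists>C. \<forall>b\<in>Basis. (\<forall>n. \<forall>x\<in>U. norm (w n x \<bullet> b) \<le> C b) \<and> (AE z in ?M. norm (w0 z \<bullet> b) \<le> C b) \<and>
      (\<forall>\<eta>>0. \<exists>\<phi>. test_function \<phi> \<and> (\<forall>x\<in>U. \<forall>y. norm (\<phi> x y) \<le> C b) \<and>
        (\<forall>\<^sub>F n in sequentially. (\<integral>x. norm (w n x \<bullet> b - \<phi> x (x /\<^sub>R \<epsilon> n)) \<partial>?N) \<le> \<eta>) \<and>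
        (\<integral>z. norm (w0 z \<bullet> b - \<phi> (fst z) (snd z)) \<partial>?M) \<le> \<eta>)"
    using c unfolding strongly_approximable_def by (intro bchoice) blast
  then obtain C where Cw: "\<And>b n x. b \<in> Basis \<Longrightarrow> x \<in> U \<Longrightarrow> \<bar>w n x \<bullet> b\<bar> \<le> C b"
    and Cw0: "\<And>b. b \<in> Basis \<Longrightarrow> AE z in ?M. \<bar>w0 z \<bullet> b\<bar> \<le> C b"
    and ap: "\<And>b \<eta>. b \<in> Basis \<Longrightarrow> 0 < \<eta> \<Longrightarrow> \<exists>\<phi>. test_function \<phi> \<and> (\<forall>x\<in>U. \<forall>y. \<bar>\<phi> x y\<bar> \<le> C b) \<and>
        (\<forall>\<^sub>F n in sequentially. (\<integral>x. \<bar>w n x \<bullet> b - \<phi> x (x /\<^sub>R \<epsilon> n)\<bar> \<partial>?N) \<le> \<eta>) \<and>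
        (\<integral>z. \<bar>w0 z \<bullet> b - \<phi> (fst z) (snd z)\<bar> \<partial>?M) \<le> \<eta>"
    by fastforce
  have cm: "(\<lambda>x. w n x \<bullet> b) \<in> borel_measurable ?N" "(\<lambda>z. w0 z \<bullet> b) \<in> borel_measurable ?M" if "b \<in> Basis" for n b
    using c[OF that] by (auto simp: strongly_approximable_def)
  have wm: "w n \<in> borel_measurable ?N" for n
    by (subst borel_measurable_euclidean_space) (use cm(1) in blast)
  have w0m: "w0 \<in> borel_measurable ?M"
    by (subst borel_measurable_euclidean_space) (use cm(2) in blast)
  let ?C = "\<Sum>b\<in>Basis. C b"
  have l1: "norm v \<le> ?C" if "\<And>b. b \<in> Basis \<Longrightarrow> \<bar>v \<bullet> b\<bar> \<le> C b" for v :: 'b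
    using order_trans[OF norm_le_l1 sum_mono[OF that]] by blast
  have "AE z in ?M. \<forall>b\<in>Basis. \<bar>w0 z \<bullet> b\<bar> \<le> C b"
    using Cw0 by (simp add: AE_finite_all)
  then have w0b: "AE z in ?M. norm (w0 z) \<le> ?C" by (rule eventually_mono) (use l1 in blast)
  have "\<exists>\<phi>. test_function \<phi> \<and> (\<forall>x\<in>U. \<forall>y. norm (\<phi> x y) \<le> ?C) \<and>
        (\<forall>\<^sub>F n in sequentially. (\<integral>x. norm (w n x - \<phi> x (x /\<^sub>R \<epsilon> n)) \<partial>?N) \<le> \<eta>) \<and>
        (\<integral>z. norm (w0 z - \<phi> (fst z) (snd z)) \<partial>?M) \<le> \<eta>" if \<eta>: "0 < \<eta>" for \<eta>
  proof -
    let ?\<eta> = "\<eta> / DIM('b)"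
    have \<eta>': "0 < ?\<eta>" using \<eta> by simp
    have "\<exists>\<phi>. \<forall>b\<in>Basis. test_function (\<phi> b) \<and> (\<forall>x\<in>U. \<forall>y. \<bar>\<phi> b x y\<bar> \<le> C b) \<and>
        (\<forall>\<^sub>F n in sequentially. (\<integral>x. \<bar>w n x \<bullet> b - \<phi> b x (x /\<^sub>R \<epsilon> n)\<bar> \<partial>?N) \<le> ?\<eta>) \<and>
        (\<integral>z. \<bar>w0 z \<bullet> b - \<phi> b (fst z) (snd z)\<bar> \<partial>?M) \<le> ?\<eta>"
      using ap[OF _ \<eta>'] by (intro bchoice) blast
    then obtain \<phi> where \<phi>: "\<forall>b\<in>Basis. test_function (\<phi> b) \<and> (\<forall>x\<in>U. \<forall>y. \<bar>\<phi> b x y\<bar> \<le> C b) \<and>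
        (\<forall>\<^sub>F n in sequentially. (\<integral>x. \<bar>w n x \<bullet> b - \<phi> b x (x /\<^sub>R \<epsilon> n)\<bar> \<partial>?N) \<le> ?\<eta>) \<and>
        (\<integral>z. \<bar>w0 z \<bullet> b - \<phi> b (fst z) (snd z)\<bar> \<partial>?M) \<le> ?\<eta>" ..
    have t: "test_function (\<phi> b)" if "b \<in> Basis" for b
      using \<phi> that by blast
    have \<phi>b: "\<bar>\<phi> b x y\<bar> \<le> C b" if "b \<in> Basis" "x \<in> U" for b x y
      using \<phi> that by blast
    have e1: "\<forall>\<^sub>F n in sequentially. (\<integral>x. \<bar>w n x \<bullet> b - \<phi> b x (x /\<^sub>R \<epsilon> n)\<bar> \<partial>?N) \<le> ?\<eta>" if "b \<in> Basis" for b
      using \<phi> that by blast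
    have e2: "(\<integral>z. \<bar>w0 z \<bullet> b - \<phi> b (fst z) (snd z)\<bar> \<partial>?M) \<le> ?\<eta>" if "b \<in> Basis" for b
      using \<phi> that by blast
    let ?\<phi> = "\<lambda>x y. \<Sum>b\<in>Basis. \<phi> b x y *\<^sub>R b"
    have \<phi>i: "?\<phi> x y \<bullet> b = \<phi> b x y" if "b \<in> Basis" for x y b using that by simp
    have tt: "test_function ?\<phi>"
      using t by (auto simp: test_function_def cell_periodic_def intro!: continuous_intros)
    have \<phi>m: "(\<lambda>x. \<phi> b x (x /\<^sub>R e)) \<in> borel_measurable ?N" "(\<lambda>z. \<phi> b (fst z) (snd z)) \<in> borel_measurable ?M" if "b \<in> Basis" for b e
      by (rule test_function_measurable(1)[OF t[OF that]], rule test_function_measurable(2)[OF t[OF that]])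
    have i1: "integrable ?N (\<lambda>x. \<bar>w n x \<bullet> b - \<phi> b x (x /\<^sub>R \<epsilon> n)\<bar>)" if b: "b \<in> Basis" for b n
      unfolding real_norm_def[symmetric]
      by (rule integrable_norm_diff[OF cm(1)[OF b] \<phi>m(1)[OF b] _ _ U(2) D(2), of _ "C b"])
         (use Cw[OF b] \<phi>b[OF b] in \<open>auto intro!: AE_I2\<close>)
    have i2: "integrable ?M (\<lambda>z. \<bar>w0 z \<bullet> b - \<phi> b (fst z) (snd z)\<bar>)" if b: "b \<in> Basis" for b
      unfolding real_norm_def[symmetric]
      by (rule integrable_norm_diff[OF cm(2)[OF b] \<phi>m(2)[OF b] _ _ D(4,3), of "C b"])
         (use Cw0[OF b] \<phi>b[OF b] in \<open>auto intro!: AE_I2\<close>)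
    have sum_le: "(\<integral>x. norm (f x - g x) \<partial>K) \<le> \<eta>"
      if "\<And>b. b \<in> Basis \<Longrightarrow> integrable K (\<lambda>x. \<bar>f x \<bullet> b - g x \<bullet> b\<bar>)" "\<And>b. b \<in> Basis \<Longrightarrow> (\<integral>x. \<bar>f x \<bullet> b - g x \<bullet> b\<bar> \<partial>K) \<le> ?\<eta>"
      for f g :: "'x \<Rightarrow> 'b" and K
    proof -
      have "(\<integral>x. norm (f x - g x) \<partial>K) \<le> (\<integral>x. (\<Sum>b\<in>Basis. \<bar>f x \<bullet> b - g x \<bullet> b\<bar>) \<partial>K)"
      proof (rule integral_mono')
        show "integrable K (\<lambda>x. \<Sum>b\<in>Basis. \<bar>f x \<bullet> b - g x \<bullet> b\<bar>)" using that(1) by simp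
        show "norm (f x - g x) \<le> (\<Sum>b\<in>Basis. \<bar>f x \<bullet> b - g x \<bullet> b\<bar>)" for x
          using norm_le_l1[of "f x - g x"] by (simp add: inner_diff_left)
      qed (auto intro: sum_nonneg)
      also have "\<dots> = (\<Sum>b\<in>Basis. \<integral>x. \<bar>f x \<bullet> b - g x \<bullet> b\<bar> \<partial>K)" using that(1) by (rule Bochner_Integration.integral_sum)
      also have "\<dots> \<le> (\<Sum>b\<in>(Basis :: 'b set). ?\<eta>)" by (rule sum_mono) (rule that(2))
      finally show ?thesis by simp
    qed
    have "\<forall>\<^sub>F n in sequentially. \<forall>b\<in>Basis. (\<integral>x. \<bar>w n x \<bullet> b - \<phi> b x (x /\<^sub>R \<epsilon> n)\<bar> \<partial>?N) \<le> ?\<eta>"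
      using e1 by (simp add: eventually_ball_finite)
    then have "\<forall>\<^sub>F n in sequentially. (\<integral>x. norm (w n x - ?\<phi> x (x /\<^sub>R \<epsilon> n)) \<partial>?N) \<le> \<eta>"
    proof eventually_elim
      case (elim n)
      show ?case by (rule sum_le) (use i1 elim in \<open>simp_all add: \<phi>i del: inner_sum_left_Basis\<close>)
    qed
    moreover have "(\<integral>z. norm (w0 z - ?\<phi> (fst z) (snd z)) \<partial>?M) \<le> \<eta>"
      by (rule sum_le) (use i2 e2 in \<open>simp_all add: \<phi>i del: inner_sum_left_Basis\<close>)
    moreover have "norm (?\<phi> x y) \<le> ?C" if "x \<in> U" for x y
      by (rule l1) (simp only: \<phi>i \<phi>b[OF _ that])
    ultimately show ?thesis using tt by (intro exI[of _ ?\<phi>]) blast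
  qed
  then show ?thesis
    unfolding strongly_approximable_def
    using wm w0m w0b Cw l1 by (intro conjI allI exI[of _ ?C]) blast+
qed

lemma Basis_prod_inner:
  assumes "b \<in> (Basis :: ('a::euclidean_space \<times> 'b::euclidean_space) set)"
  obtains b1 where "b1 \<in> Basis" "\<And>u v. (u :: 'a, v :: 'b) \<bullet> b = u \<bullet> b1"
    | b2 where "b2 \<in> Basis" "\<And>u v. (u :: 'a, v :: 'b) \<bullet> b = v \<bullet> b2"
  using assms unfolding Basis_prod_def by (auto simp: inner_prod_def)

lemma strongly_approximable_Pair:
  fixes w :: "nat \<Rightarrow> real^'n \<Rightarrow> 'b::euclidean_space" and w' :: "nat \<Rightarrow> real^'n \<Rightarrow> 'c::euclidean_space"
  assumes "\<And>b. b \<in> Basis \<Longrightarrow> strongly_approximable \<epsilon> U (\<lambda>n x. w n x \<bullet> b) (\<lambda>z. w0 z \<bullet> b)"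
    and "\<And>b. b \<in> Basis \<Longrightarrow> strongly_approximable \<epsilon> U (\<lambda>n x. w' n x \<bullet> b) (\<lambda>z. w0' z \<bullet> b)" and "b \<in> Basis"
  shows "strongly_approximable \<epsilon> U (\<lambda>n x. (w n x, w' n x) \<bullet> b) (\<lambda>z. (w0 z, w0' z) \<bullet> b)"
  using assms(3) by (rule Basis_prod_inner) (auto intro: assms(1,2))

lemma strongly_approximable_uniform:
  fixes w :: "nat \<Rightarrow> real^'n \<Rightarrow> 'b::euclidean_space"
  assumes U: "open U" "bounded U" and t: "test_function \<phi>"
    and m: "\<And>n. w n \<in> borel_measurable (lebesgue_on U)" and C: "\<And>n x. x \<in> U \<Longrightarrow> norm (w n x) \<le> C"
    and u: "\<And>\<eta>. 0 < \<eta> \<Longrightarrow> \<forall>\<^sub>F n in sequentially. \<forall>x\<in>U. norm (w n x - \<phi> x (x /\<^sub>R \<epsilon> n)) \<le> \<eta>"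
  shows "strongly_approximable \<epsilon> U w (\<lambda>z. \<phi> (fst z) (snd z))"
proof -
  note D = slow_fast_domain[OF U]
  let ?M = "lebesgue_on (U \<times> (unit_cell :: (real^'n) set))" and ?N = "lebesgue_on U"
  interpret G: finite_measure ?N by (rule finite_measure_lebesgue_on[OF U(2) D(2)])
  obtain B where B: "\<And>x y. x \<in> U \<Longrightarrow> norm (\<phi> x y) \<le> B" using test_function_uniform(1)[OF t U(2)] by blast
  let ?C = "max B C"
  have ap: "\<exists>\<phi>'. test_function \<phi>' \<and> (\<forall>x\<in>U. \<forall>y. norm (\<phi>' x y) \<le> ?C) \<and>
        (\<forall>\<^sub>F n in sequentially. (\<integral>x. norm (w n x - \<phi>' x (x /\<^sub>R \<epsilon> n)) \<partial>?N) \<le> \<eta>) \<and>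
        (\<integral>z. norm (\<phi> (fst z) (snd z) - \<phi>' (fst z) (snd z)) \<partial>?M) \<le> \<eta>" if \<eta>: "0 < \<eta>" for \<eta>
  proof -
    let ?m = "measure ?N (space ?N)"
    let ?\<eta> = "\<eta> / (?m + 1)"
    have m0: "0 \<le> ?m" by simp
    have "0 < ?\<eta>" using \<eta> m0 by (intro divide_pos_pos) linarith+
    from u[OF this] have "\<forall>\<^sub>F n in sequentially. (\<integral>x. norm (w n x - \<phi> x (x /\<^sub>R \<epsilon> n)) \<partial>?N) \<le> \<eta>"
    proof eventually_elim
      case (elim n)
      have "(\<integral>x. norm (w n x - \<phi> x (x /\<^sub>R \<epsilon> n)) \<partial>?N) \<le> (\<integral>x. ?\<eta> \<partial>?N)"
        by (rule integral_mono') (use elim \<open>0 < ?\<eta>\<close> in auto)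
      also have "\<dots> = ?m * ?\<eta>" by simp
      also have "\<dots> \<le> (?m + 1) * ?\<eta>" using \<open>0 < ?\<eta>\<close> by (intro mult_right_mono) auto
      also have "\<dots> = \<eta>" using m0 by (simp add: add_nonneg_eq_0_iff)
      finally show ?case .
    qed
    then show ?thesis using t B \<eta> by (intro exI[of _ \<phi>]) (auto simp: le_max_iff_disj)
  qed
  moreover have "AE z in ?M. norm (\<phi> (fst z) (snd z)) \<le> ?C" using B by (intro AE_I2) (auto simp: le_max_iff_disj)
  moreover have "norm (w n x) \<le> ?C" if "x \<in> U" for n x using C[OF that, of n] by (simp add: le_max_iff_disj)
  ultimately show ?thesis
    unfolding strongly_approximable_def using m test_function_measurable(2)[OF t]
    by (intro conjI allI exI[of _ ?C]) blast+
qed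

text \<open>A uniform bound handles the set where \<open>v\<close> is large, smallness in mean the rest.\<close>

lemma truncated_pairing_bound:
  fixes v D e :: "'a \<Rightarrow> real" and p T B L \<eta> K \<kappa> \<mu> :: real
  assumes fin: "finite_measure M" "measure M (space M) \<le> \<mu>" and p: "1 < p"
    and v: "v \<in> borel_measurable M" "integrable M (\<lambda>x. \<bar>v x\<bar> powr p)" "(\<integral>x. \<bar>v x\<bar> powr p \<partial>M) \<le> K"
    and pos: "0 < T" "0 \<le> B" "0 \<le> \<eta>" "0 \<le> L"
    and Dm: "D \<in> borel_measurable M" and DB: "AE x in M. \<bar>D x\<bar> \<le> B" and De: "AE x in M. \<bar>D x\<bar> \<le> \<eta> + L * e x"
    and e: "integrable M e" "(\<integral>x. e x \<partial>M) \<le> \<kappa>"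
  shows "integrable M (\<lambda>x. v x * D x)"
    and "\<bar>\<integral>x. v x * D x \<partial>M\<bar> \<le> B * T powr (1 - p) * K + T * (\<eta> * \<mu> + L * \<kappa>)"
proof -
  interpret finite_measure M by (rule fin(1))
  let ?b = "\<lambda>x. B * T powr (1 - p) * \<bar>v x\<bar> powr p + T * (\<eta> + L * e x)"
  have i: "integrable M ?b" using v(2) e(1) by simp
  have b: "AE x in M. norm (v x * D x) \<le> ?b x"
    using DB De
  proof eventually_elim
    case (elim x)
    have pe: "0 \<le> T * (\<eta> + L * e x)" using pos elim(2) abs_ge_zero[of "D x"] by (intro mult_nonneg_nonneg) linarith+
    have pv: "0 \<le> B * T powr (1 - p) * \<bar>v x\<bar> powr p" using pos by simp
    show ?case
    proof (cases "\<bar>v x\<bar> \<le> T")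
      case True
      have "\<bar>v x\<bar> * \<bar>D x\<bar> \<le> T * (\<eta> + L * e x)" using True elim(2) pos by (intro mult_mono) auto
      then show ?thesis using pv by (simp add: abs_mult)
    next
      case False
      have "\<bar>v x\<bar> = \<bar>v x\<bar> powr (1 - p) * \<bar>v x\<bar> powr p" using False pos by (simp flip: powr_add)
      also have "\<dots> \<le> T powr (1 - p) * \<bar>v x\<bar> powr p"
        using False pos p by (intro mult_right_mono powr_mono2') auto
      finally have "\<bar>v x\<bar> * \<bar>D x\<bar> \<le> (T powr (1 - p) * \<bar>v x\<bar> powr p) * B"
        using elim(1) by (intro mult_mono) auto
      then show ?thesis using pe by (simp add: abs_mult ac_simps)
    qed
  qed
  show *: "integrable M (\<lambda>x. v x * D x)"
  proof (rule Bochner_Integration.integrable_bound[OF i borel_measurable_times[OF v(1) Dm]])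
    show "AE x in M. norm (v x * D x) \<le> norm (?b x)"
      using b by (rule eventually_mono) (metis abs_ge_self order_trans real_norm_def)
  qed
  have "\<bar>\<integral>x. v x * D x \<partial>M\<bar> \<le> (\<integral>x. ?b x \<partial>M)"
    by (rule order_trans[OF integral_abs_bound integral_mono_AE[OF integrable_abs[OF *] i]]) (use b in simp)
  also have "\<dots> = B * T powr (1 - p) * (\<integral>x. \<bar>v x\<bar> powr p \<partial>M) + T * (\<eta> * measure M (space M) + L * (\<integral>x. e x \<partial>M))"
    using v(2) e(1) by (simp add: mult.commute)
  also have "\<dots> \<le> B * T powr (1 - p) * K + T * (\<eta> * \<mu> + L * \<kappa>)"
    using pos v(3) e(2) fin(2) by (intro add_mono mult_left_mono mult_nonneg_nonneg) auto
  finally show "\<bar>\<integral>x. v x * D x \<partial>M\<bar> \<le> B * T powr (1 - p) * K + T * (\<eta> * \<mu> + L * \<kappa>)" .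
qed

text \<open>Quantified uniform continuity on a bounded set of values.\<close>

lemma periodic_modulus:
  fixes G :: "real^'n \<Rightarrow> 'b::euclidean_space \<Rightarrow> real"
  assumes G: "continuous_on UNIV (\<lambda>z. G (fst z) (snd z))" and per: "\<And>b. cell_periodic (\<lambda>y. G y b)"
  obtains B where "0 \<le> B" "\<And>y b. norm b \<le> C \<Longrightarrow> \<bar>G y b\<bar> \<le> B"
    "\<And>\<eta>. 0 < \<eta> \<Longrightarrow> \<exists>L\<ge>0. \<forall>y a b. norm a \<le> C \<longrightarrow> norm b \<le> C \<longrightarrow> \<bar>G y a - G y b\<bar> \<le> \<eta> + L * norm (a - b)"
proof -
  let ?f = "\<lambda>z. G (fst z) (snd z)"
  let ?K = "(unit_cell :: (real^'n) set) \<times> cball (0::'b) C"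
  have K: "compact ?K" by (intro compact_Times) (auto simp: unit_cell_def)
  have cK: "continuous_on ?K ?f" by (rule continuous_on_subset[OF G]) simp
  have "bounded (?f ` ?K)" by (rule compact_imp_bounded[OF compact_continuous_image[OF cK K]])
  then obtain B0 where B0': "\<forall>t\<in>?f ` ?K. norm t \<le> B0" unfolding bounded_iff by blast
  have B0: "\<bar>?f z\<bar> \<le> B0" if "z \<in> ?K" for z
    using bspec[OF B0' imageI[OF that]] by (simp only: real_norm_def)
  define B where "B = max B0 0"
  have tr: "\<exists>y'\<in>unit_cell. \<forall>b. G y' b = G y b" for y
  proof -
    let ?k = "(\<chi> i. of_int \<lfloor>y $ i\<rfloor>) :: real^'n"
    have "y - ?k \<in> half_open_cell"
      by (subst half_open_cell_translate_iff[OF int_vecs_floor[of y]]) (rule refl)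
    then have "y - ?k \<in> unit_cell" by (rule subsetD[OF half_open_cell_subset(2)])
    moreover have "G (y - ?k) b = G y b" for b
      using per[of b] int_vecs_floor[of y] unfolding cell_periodic_def by (metis diff_add_cancel)
    ultimately show ?thesis by blast
  qed
  have Bb: "\<bar>G y b\<bar> \<le> B" if "norm b \<le> C" for y b
  proof -
    obtain y' where "y' \<in> unit_cell" "\<forall>b. G y' b = G y b" using tr by blast
    then have "(y', b) \<in> ?K" "G y' b = G y b" using that by auto
    then show ?thesis using B0[of "(y', b)"] by (simp add: B_def le_max_iff_disj)
  qed
  have "\<exists>L\<ge>0. \<forall>y a b. norm a \<le> C \<longrightarrow> norm b \<le> C \<longrightarrow> \<bar>G y a - G y b\<bar> \<le> \<eta> + L * norm (a - b)" if \<eta>: "0 < \<eta>" for \<eta>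
  proof -
    have "uniformly_continuous_on ?K ?f" using compact_uniformly_continuous[OF cK K] .
    then obtain d where d: "0 < d" "\<And>z z'. z \<in> ?K \<Longrightarrow> z' \<in> ?K \<Longrightarrow> dist z' z < d \<Longrightarrow> dist (?f z') (?f z) < \<eta>"
      unfolding uniformly_continuous_on_def using \<eta> by metis
    have "\<bar>G y a - G y b\<bar> \<le> \<eta> + 2 * B / d * norm (a - b)" if ab: "norm a \<le> C" "norm b \<le> C" for y a b
    proof (cases "norm (a - b) < d")
      case True
      obtain y' where y': "y' \<in> unit_cell" "\<forall>b. G y' b = G y b" using tr by blast
      have "dist (?f (y', a)) (?f (y', b)) < \<eta>"
        using y' ab True by (intro d(2)) (auto simp: dist_Pair_Pair dist_norm)
      then have "\<bar>G y a - G y b\<bar> \<le> \<eta>" using y'(2) by (simp add: dist_real_def)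
      moreover have "0 \<le> 2 * B / d * norm (a - b)" using d(1) by (simp add: B_def)
      ultimately show ?thesis by linarith
    next
      case False
      then have "1 \<le> norm (a - b) / d" using d(1) by (simp add: pos_le_divide_eq)
      then have "2 * B * 1 \<le> 2 * B * (norm (a - b) / d)" by (rule mult_left_mono) (simp add: B_def)
      moreover have "\<bar>G y a - G y b\<bar> \<le> 2 * B" using Bb[OF ab(1), of y] Bb[OF ab(2), of y] by linarith
      ultimately show ?thesis using \<eta> by simp
    qed
    moreover have "0 \<le> 2 * B / d" using d(1) by (simp add: B_def)
    ultimately show ?thesis by blast
  qed
  then show ?thesis using that[of B] Bb by (simp add: B_def)
qed

text \<open>The strongly convergent argument is replaced by a test function, for which convergence holds by
  definition. The error is small in mean and bounded, and the powers of \<open>v\<close> are bounded in mean.\<close>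

theorem weak_strong_pairing:
  fixes G :: "real^'n \<Rightarrow> 'b::euclidean_space \<Rightarrow> real"
  assumes v: "two_scale_weak \<epsilon> p U v v0" and w: "strongly_approximable \<epsilon> U w w0"
    and G: "continuous_on UNIV (\<lambda>z. G (fst z) (snd z))" and per: "\<And>b. cell_periodic (\<lambda>y. G y b)"
    and p: "1 < p" and U: "open U" "bounded U"
  shows "(\<lambda>n. \<integral>x. v n x * G (x /\<^sub>R \<epsilon> n) (w n x) \<partial>lebesgue_on U)
    \<longlonglongrightarrow> (\<integral>z. v0 z * G (snd z) (w0 z) \<partial>lebesgue_on (U \<times> unit_cell))"
    and "integrable (lebesgue_on (U \<times> unit_cell)) (\<lambda>z. v0 z * G (snd z) (w0 z))"
proof -
  note D = slow_fast_domain[OF U]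
  let ?M = "lebesgue_on (U \<times> (unit_cell :: (real^'n) set))" and ?N = "lebesgue_on U"
  have finM: "finite_measure ?M" by (rule finite_measure_lebesgue_on[OF D(4,3)])
  have finN: "finite_measure ?N" by (rule finite_measure_lebesgue_on[OF U(2) D(2)])
  have vm: "\<And>n. v n \<in> borel_measurable ?N" "\<And>n. integrable ?N (\<lambda>x. \<bar>v n x\<bar> powr p)"
    "v0 \<in> borel_measurable ?M" "integrable ?M (\<lambda>x. \<bar>v0 x\<bar> powr p)"
    using v by (auto simp: two_scale_weak_def Lp_def)
  have wm: "\<And>n. w n \<in> borel_measurable ?N" "w0 \<in> borel_measurable ?M" using w by (auto simp: strongly_approximable_def)
  obtain C where Cw: "\<And>n x. x \<in> U \<Longrightarrow> norm (w n x) \<le> C" and Cw0: "AE z in ?M. norm (w0 z) \<le> C"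
    and ap: "\<And>\<eta>. 0 < \<eta> \<Longrightarrow> \<exists>\<phi>. test_function \<phi> \<and> (\<forall>x\<in>U. \<forall>y. norm (\<phi> x y) \<le> C) \<and>
        (\<forall>\<^sub>F n in sequentially. (\<integral>x. norm (w n x - \<phi> x (x /\<^sub>R \<epsilon> n)) \<partial>?N) \<le> \<eta>) \<and>
        (\<integral>z. norm (w0 z - \<phi> (fst z) (snd z)) \<partial>?M) \<le> \<eta>"
    using w unfolding strongly_approximable_def by blast
  obtain B where B: "0 \<le> B" "\<And>y b. norm b \<le> C \<Longrightarrow> \<bar>G y b\<bar> \<le> B"
    and mod: "\<And>\<eta>. 0 < \<eta> \<Longrightarrow> \<exists>L\<ge>0. \<forall>y a b. norm a \<le> C \<longrightarrow> norm b \<le> C \<longrightarrow> \<bar>G y a - G y b\<bar> \<le> \<eta> + L * norm (a - b)"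
    using periodic_modulus[OF G per, of C] by blast
  have Gm: "(\<lambda>x. G (f x) (h x)) \<in> borel_measurable K" if "f \<in> borel_measurable K" "h \<in> borel_measurable K" for f h and K :: "'x measure"
    using measurable_compose[OF borel_measurable_Pair[OF that] borel_measurable_continuous_onI[OF G]] by simp
  have xm: "(\<lambda>x. x /\<^sub>R e) \<in> borel_measurable ?N" for e
    by (rule continuous_imp_measurable_lebesgue_on) (intro continuous_intros)
  have sm: "snd \<in> borel_measurable ?M" by (rule continuous_imp_measurable_lebesgue_on) (intro continuous_intros)
  have inM: "AE z in ?M. fst z \<in> U" by (intro AE_I2) auto
  obtain K where K: "\<And>n. (\<integral>x. \<bar>v n x\<bar> powr p \<partial>?N) \<le> K" using two_scale_weak_bounded[OF v p D(1)] by blast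
  show *: "integrable ?M (\<lambda>z. v0 z * G (snd z) (w0 z))"
  proof (rule truncated_pairing_bound(1)[where e="\<lambda>_. 0" and \<kappa>=0, OF finM order_refl p vm(3,4) order_refl zero_less_one B(1) B(1) order_refl])
    show "(\<lambda>z. G (snd z) (w0 z)) \<in> borel_measurable ?M" by (rule Gm[OF sm wm(2)])
    show "AE z in ?M. \<bar>G (snd z) (w0 z)\<bar> \<le> B" "AE z in ?M. \<bar>G (snd z) (w0 z)\<bar> \<le> B + 0 * 0"
      using Cw0 B(2) by (auto elim!: eventually_mono)
  qed auto
  have iN: "integrable ?N (\<lambda>x. v n x * G (x /\<^sub>R \<epsilon> n) (w n x))" for n
  proof (rule truncated_pairing_bound(1)[where e="\<lambda>_. 0" and \<kappa>=0, OF finN order_refl p vm(1,2) order_refl zero_less_one B(1) B(1) order_refl])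
    show "(\<lambda>x. G (x /\<^sub>R \<epsilon> n) (w n x)) \<in> borel_measurable ?N" by (rule Gm[OF xm wm(1)])
    show "AE x in ?N. \<bar>G (x /\<^sub>R \<epsilon> n) (w n x)\<bar> \<le> B" "AE x in ?N. \<bar>G (x /\<^sub>R \<epsilon> n) (w n x)\<bar> \<le> B + 0 * 0"
      using Cw B(2) by (auto intro!: AE_I2)
  qed auto
  show "(\<lambda>n. \<integral>x. v n x * G (x /\<^sub>R \<epsilon> n) (w n x) \<partial>?N) \<longlonglongrightarrow> (\<integral>z. v0 z * G (snd z) (w0 z) \<partial>?M)"
  proof (rule LIMSEQ_by_approximation)
    fix r :: real assume r: "0 < r"
    define K' where "K' = max K (\<integral>z. \<bar>v0 z\<bar> powr p \<partial>?M) + 1"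
    define \<mu> where "\<mu> = measure ?M (space ?M) + measure ?N (space ?N) + 1"
    have nn: "0 \<le> (\<integral>z. \<bar>v0 z\<bar> powr p \<partial>?M)" "0 \<le> measure ?M (space ?M)" "0 \<le> measure ?N (space ?N)" by simp_all
    have K': "K \<le> K'" "(\<integral>z. \<bar>v0 z\<bar> powr p \<partial>?M) \<le> K'" by (auto simp: K'_def)
    have K0: "0 < K'" using nn(1) max.cobounded2[of "\<integral>z. \<bar>v0 z\<bar> powr p \<partial>?M" K] unfolding K'_def by linarith
    have \<mu>: "measure ?M (space ?M) \<le> \<mu>" "measure ?N (space ?N) \<le> \<mu>" "0 < \<mu>" using nn unfolding \<mu>_def by linarith+
    \<comment> \<open>The level \<open>T\<close>, the continuity gap \<open>\<eta>\<close> and the approximation error \<open>\<kappa>\<close> each cost a third of \<open>r\<close>.\<close>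
    let ?B = "2 * B + 1"
    define T where "T = (r / (3 * ?B * K')) powr (1 / (1 - p))"
    have qpos: "0 < r / (3 * ?B * K')" using r B(1) K0 by simp
    have T: "0 < T" using qpos unfolding T_def by (simp only: powr_gt_zero less_imp_neq)
    have TK: "?B * T powr (1 - p) * K' = r / 3"
    proof -
      have "1 / (1 - p) * (1 - p) = 1" using p by simp
      then have "T powr (1 - p) = r / (3 * ?B * K')"
        unfolding T_def powr_powr using powr_one[OF less_imp_le[OF qpos]] by metis
      moreover have "b * (r / (3 * b * k)) * k = r / 3" if "0 < b" "0 < k" for b k :: real
        using that by simp
      moreover have "0 < ?B" using B(1) by linarith
      ultimately show ?thesis using K0 by metis
    qed
    define \<eta> where "\<eta> = r / (3 * T * \<mu>)"
    have \<eta>: "0 < \<eta>" "T * (\<eta> * \<mu>) = r / 3" using r T \<mu>(3) by (auto simp: \<eta>_def)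
    obtain L where L: "0 \<le> L" "\<And>y a b. norm a \<le> C \<Longrightarrow> norm b \<le> C \<Longrightarrow> \<bar>G y a - G y b\<bar> \<le> \<eta> + L * norm (a - b)"
      using mod[OF \<eta>(1)] by blast
    define \<kappa> where "\<kappa> = r / (3 * T * (L + 1))"
    have \<kappa>0: "0 < \<kappa>" using r T L(1) by (simp add: \<kappa>_def)
    have \<kappa>: "T * (L * \<kappa>) \<le> r / 3"
    proof -
      have "T * (L * \<kappa>) \<le> T * ((L + 1) * \<kappa>)" using T \<kappa>0 by simp
      also have "\<dots> = r / 3"
      proof -
        have "t * (l * (r / (3 * t * l))) = r / 3" if "0 < t" "0 < l" for t l :: real
          using that by simp
        moreover have "0 < L + 1" using L(1) by linarith
        ultimately show ?thesis unfolding \<kappa>_def using T by blast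
      qed
      finally show ?thesis .
    qed
    have total: "?B * T powr (1 - p) * K' + T * (\<eta> * \<mu> + L * \<kappa>) \<le> r"
      using TK \<eta>(2) \<kappa> unfolding distrib_left by linarith
    obtain \<phi> where t: "test_function \<phi>" and \<phi>b: "\<And>x y. x \<in> U \<Longrightarrow> norm (\<phi> x y) \<le> C"
      and e1: "\<forall>\<^sub>F n in sequentially. (\<integral>x. norm (w n x - \<phi> x (x /\<^sub>R \<epsilon> n)) \<partial>?N) \<le> \<kappa>"
      and e2: "(\<integral>z. norm (w0 z - \<phi> (fst z) (snd z)) \<partial>?M) \<le> \<kappa>"
      using ap[OF \<kappa>0] by blast
    have \<phi>m: "(\<lambda>x. \<phi> x (x /\<^sub>R e)) \<in> borel_measurable ?N" "(\<lambda>z. \<phi> (fst z) (snd z)) \<in> borel_measurable ?M" for e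
      by (rule test_function_measurable(1)[OF t], rule test_function_measurable(2)[OF t])
    have ni1: "integrable ?N (\<lambda>x. norm (w n x - \<phi> x (x /\<^sub>R \<epsilon> n)))" for n
      by (rule integrable_norm_diff[OF wm(1) \<phi>m(1) _ _ U(2) D(2), of _ C]) (use Cw \<phi>b in \<open>auto intro!: AE_I2\<close>)
    have ni2: "integrable ?M (\<lambda>z. norm (w0 z - \<phi> (fst z) (snd z)))"
      by (rule integrable_norm_diff[OF wm(2) \<phi>m(2) Cw0 _ D(4,3)]) (use \<phi>b in \<open>auto intro!: AE_I2\<close>)
    have tG: "test_function (\<lambda>x y. G y (\<phi> x y))"
    proof -
      have c: "continuous_on UNIV (\<lambda>z. \<phi> (fst z) (snd z))" using t by (simp add: test_function_def)
      have "continuous_on UNIV (\<lambda>z. G (fst (snd z, \<phi> (fst z) (snd z))) (snd (snd z, \<phi> (fst z) (snd z))))"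
        by (rule continuous_on_compose2[OF G]) (intro continuous_intros c, simp)
      moreover have "cell_periodic (\<lambda>y. G y (\<phi> x y))" for x
        using per t by (simp add: cell_periodic_def test_function_def)
      ultimately show ?thesis by (simp add: test_function_def)
    qed
    let ?G\<phi> = "\<lambda>x y. G y (\<phi> x y)"
    have lim: "(\<lambda>n. \<integral>x. v n x * ?G\<phi> x (x /\<^sub>R \<epsilon> n) \<partial>?N) \<longlonglongrightarrow> (\<integral>z. v0 z * ?G\<phi> (fst z) (snd z) \<partial>?M)"
      by (rule two_scale_weak_test_function[OF v p U tG])
    have B1: "0 \<le> ?B" using B(1) by simp
    have dB: "\<bar>G y a - G y b\<bar> \<le> ?B" if "norm a \<le> C" "norm b \<le> C" for y a b
      using B(2)[OF that(1), of y] B(2)[OF that(2), of y] by linarith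
    have b1: "\<bar>(\<integral>x. v n x * G (x /\<^sub>R \<epsilon> n) (w n x) \<partial>?N) - (\<integral>x. v n x * ?G\<phi> x (x /\<^sub>R \<epsilon> n) \<partial>?N)\<bar> \<le> r"
      if e: "(\<integral>x. norm (w n x - \<phi> x (x /\<^sub>R \<epsilon> n)) \<partial>?N) \<le> \<kappa>" for n
    proof -
      let ?D = "\<lambda>x. G (x /\<^sub>R \<epsilon> n) (w n x) - ?G\<phi> x (x /\<^sub>R \<epsilon> n)"
      have Dm: "?D \<in> borel_measurable ?N" by (intro borel_measurable_diff Gm xm wm \<phi>m)
      have D1: "AE x in ?N. \<bar>?D x\<bar> \<le> ?B" using dB Cw \<phi>b by (intro AE_I2) simp
      have D2: "AE x in ?N. \<bar>?D x\<bar> \<le> \<eta> + L * norm (w n x - \<phi> x (x /\<^sub>R \<epsilon> n))" using L(2) Cw \<phi>b by (intro AE_I2) simp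
      note tp = truncated_pairing_bound[OF finN \<mu>(2) p vm(1)[of n] vm(2)[of n] order_trans[OF K K'(1)] T B1 less_imp_le[OF \<eta>(1)] L(1) Dm D1 D2 ni1[of n] e]
      have "integrable ?N (\<lambda>x. v n x * G (x /\<^sub>R \<epsilon> n) (w n x) - v n x * ?D x)" by (rule Bochner_Integration.integrable_diff[OF iN tp(1)])
      then have i2: "integrable ?N (\<lambda>x. v n x * ?G\<phi> x (x /\<^sub>R \<epsilon> n))" by (simp add: right_diff_distrib)
      have "(\<integral>x. v n x * G (x /\<^sub>R \<epsilon> n) (w n x) \<partial>?N) - (\<integral>x. v n x * ?G\<phi> x (x /\<^sub>R \<epsilon> n) \<partial>?N) = (\<integral>x. v n x * ?D x \<partial>?N)"
        using iN[of n] i2 by (simp add: right_diff_distrib)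
      then show ?thesis using tp(2) total by linarith
    qed
    have b2: "\<bar>(\<integral>z. v0 z * G (snd z) (w0 z) \<partial>?M) - (\<integral>z. v0 z * ?G\<phi> (fst z) (snd z) \<partial>?M)\<bar> \<le> r"
    proof -
      let ?D = "\<lambda>z. G (snd z) (w0 z) - ?G\<phi> (fst z) (snd z)"
      have Dm: "?D \<in> borel_measurable ?M" by (intro borel_measurable_diff Gm sm wm \<phi>m)
      have D1: "AE z in ?M. \<bar>?D z\<bar> \<le> ?B" using Cw0 inM by eventually_elim (use dB \<phi>b in simp)
      have D2: "AE z in ?M. \<bar>?D z\<bar> \<le> \<eta> + L * norm (w0 z - \<phi> (fst z) (snd z))" using Cw0 inM by eventually_elim (use L(2) \<phi>b in simp)
      note tp = truncated_pairing_bound[OF finM \<mu>(1) p vm(3,4) K'(2) T B1 less_imp_le[OF \<eta>(1)] L(1) Dm D1 D2 ni2 e2]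
      have "integrable ?M (\<lambda>z. v0 z * G (snd z) (w0 z) - v0 z * ?D z)" by (rule Bochner_Integration.integrable_diff[OF * tp(1)])
      then have i2: "integrable ?M (\<lambda>z. v0 z * ?G\<phi> (fst z) (snd z))" by (simp add: right_diff_distrib)
      have "(\<integral>z. v0 z * G (snd z) (w0 z) \<partial>?M) - (\<integral>z. v0 z * ?G\<phi> (fst z) (snd z) \<partial>?M) = (\<integral>z. v0 z * ?D z \<partial>?M)"
        using * i2 by (simp add: right_diff_distrib)
      then show ?thesis using tp(2) total by linarith
    qed
    show "\<exists>b B. b \<longlonglongrightarrow> B \<and> (\<forall>\<^sub>F n in sequentially. \<bar>(\<integral>x. v n x * G (x /\<^sub>R \<epsilon> n) (w n x) \<partial>?N) - b n\<bar> \<le> r) \<and>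
        \<bar>(\<integral>z. v0 z * G (snd z) (w0 z) \<partial>?M) - B\<bar> \<le> r"
    proof (intro exI conjI)
      show "\<forall>\<^sub>F n in sequentially. \<bar>(\<integral>x. v n x * G (x /\<^sub>R \<epsilon> n) (w n x) \<partial>?N) - (\<integral>x. v n x * ?G\<phi> x (x /\<^sub>R \<epsilon> n) \<partial>?N)\<bar> \<le> r"
        using e1 by (rule eventually_mono) (rule b1)
    qed (rule lim, rule b2)
  qed
qed

section \<open>The limit transformation\<close>

lemma borel_representative:
  fixes f :: "'a::euclidean_space \<Rightarrow> real"
  assumes S: "S \<in> sets lebesgue" and f: "f \<in> borel_measurable (lebesgue_on S)"
  obtains g where "g \<in> borel_measurable borel" "AE x in lebesgue_on S. f x = g x"
proof -
  have "(\<lambda>x. if x \<in> S then f x else 0) \<in> borel_measurable lebesgue" using f S by (simp add: borel_measurable_if)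
  then obtain g where g: "g \<in> borel_measurable lborel" "AE x in lborel. (if x \<in> S then f x else 0) = g x"
    using completion_ex_borel_measurable_real by blast
  have "AE x in lebesgue_on S. f x = g x"
    unfolding AE_lebesgue_on_iff[OF S] using AE_completion[OF g(2)] by (rule eventually_mono) auto
  then show ?thesis using that g(1) by simp
qed

lemma AE_sections_measurable:
  fixes f :: "'a::euclidean_space \<times> 'b::euclidean_space \<Rightarrow> real"
  assumes A: "A \<in> sets borel" and B: "B \<in> sets borel" and f: "f \<in> borel_measurable (lebesgue_on (A \<times> B))"
  shows "AE x in lebesgue_on A. (\<lambda>y. f (x, y)) \<in> borel_measurable (lebesgue_on B)"
    and "AE y in lebesgue_on B. (\<lambda>x. f (x, y)) \<in> borel_measurable (lebesgue_on A)"
proof -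
  have S: "A \<times> B \<in> sets lebesgue" "A \<in> sets lebesgue" "B \<in> sets lebesgue" using borel_Times_lebesgue A B by auto
  obtain g where gb: "g \<in> borel_measurable borel" and "AE z in lebesgue_on (A \<times> B). f z = g z"
    using borel_representative[OF S(1) f] by blast
  then have ae: "AE z in lebesgue_on (A \<times> B). g z = f z" by (auto elim: eventually_mono)
  have s1: "(\<lambda>y. g (x, y)) \<in> borel_measurable (lebesgue_on B)" for x
  proof -
    have "(\<lambda>y::'b. (x, y)) \<in> borel_measurable borel" by (intro borel_measurable_continuous_onI continuous_intros)
    from measurable_compose[OF this gb] have "(\<lambda>y. g (x, y)) \<in> borel_measurable lborel" by simp
    then show ?thesis by (rule measurable_restrict_space1[OF measurable_completion])
  qed
  have s2: "(\<lambda>x. g (x, y)) \<in> borel_measurable (lebesgue_on A)" for y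
  proof -
    have "(\<lambda>x::'a. (x, y)) \<in> borel_measurable borel" by (intro borel_measurable_continuous_onI continuous_intros)
    from measurable_compose[OF this gb] have "(\<lambda>x. g (x, y)) \<in> borel_measurable lborel" by simp
    then show ?thesis by (rule measurable_restrict_space1[OF measurable_completion])
  qed
  show "AE x in lebesgue_on A. (\<lambda>y. f (x, y)) \<in> borel_measurable (lebesgue_on B)"
    using AE_lebesgue_on_Times(1)[OF A B ae] by (rule eventually_mono) (rule borel_measurable_lebesgue_on_AE[OF S(3) s1])
  show "AE y in lebesgue_on B. (\<lambda>x. f (x, y)) \<in> borel_measurable (lebesgue_on A)"
    using AE_lebesgue_on_Times(2)[OF A B ae] by (rule eventually_mono) (rule borel_measurable_lebesgue_on_AE[OF S(2) s2])
qed

text \<open>Lebesgue measurability is insensitive to null sets, in particular to exceptional fibres.\<close>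

lemma sets_lebesgue_modulo_null:
  assumes "A \<in> sets lebesgue" "AE z in lebesgue. z \<in> A \<longleftrightarrow> z \<in> B"
  shows "(B :: 'a::euclidean_space set) \<in> sets lebesgue"
proof -
  have "(indicator B :: 'a \<Rightarrow> real) \<in> borel_measurable lebesgue"
    by (rule borel_measurable_AE[of "indicator A"]) (use assms in \<open>auto simp: indicator_def elim: eventually_mono\<close>)
  then show ?thesis by (simp add: borel_measurable_indicator_iff)
qed

lemma open_countable_cballs:
  fixes B :: "'a::euclidean_space set"
  assumes "open B"
  obtains P :: "('a \<times> real) set" where "countable P" "\<And>c r. (c, r) \<in> P \<Longrightarrow> 0 < r" "(\<Union>(c, r)\<in>P. cball c r) = B"
proof -
  have "\<exists>r>0. cball x r \<subseteq> B" if "x \<in> B" for x using assms that by (simp add: open_contains_cball)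
  then obtain r where r: "\<And>x. x \<in> B \<Longrightarrow> 0 < r x" "\<And>x. x \<in> B \<Longrightarrow> cball x (r x) \<subseteq> B" by metis
  let ?F = "(\<lambda>x. ball x (r x)) ` B"
  obtain F' where F': "F' \<subseteq> ?F" "countable F'" "\<Union>F' = \<Union>?F"
    using Lindelof[of ?F] by auto
  obtain X where X: "X \<subseteq> B" "countable X" "F' = (\<lambda>x. ball x (r x)) ` X"
    using countable_subset_image[of F' "\<lambda>x. ball x (r x)" B] F'(1,2) by auto
  let ?P = "(\<lambda>x. (x, r x)) ` X"
  have "B \<subseteq> (\<Union>x\<in>X. cball x (r x))"
  proof
    fix b assume "b \<in> B"
    then have "b \<in> \<Union>?F" using r(1)[of b] by (intro UnionI[of "ball b (r b)"]) auto
    then have "b \<in> \<Union>F'" by (simp only: F'(3))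
    then obtain x where "x \<in> X" "b \<in> ball x (r x)" unfolding X(3) by blast
    then show "b \<in> (\<Union>x\<in>X. cball x (r x))" using ball_subset_cball[of x "r x"] by blast
  qed
  moreover have "(\<Union>x\<in>X. cball x (r x)) \<subseteq> B" using r(2) X(1) by blast
  ultimately have "(\<Union>(c, r)\<in>?P. cball c r) = B" by auto
  moreover have "countable ?P" using X(2) by simp
  moreover have "0 < s" if "(c, s) \<in> ?P" for c s using that r(1) X(1) by auto
  ultimately show ?thesis using that by blast
qed

text \<open>The hypotheses express measurability of the limit transformation as a function of two variables;
  they come from its being a two-scale limit.\<close>

locale limit_transformation =
  fixes \<Omega> Ys :: "(real^'n) set" and \<psi>0 :: "real^'n \<Rightarrow> real^'n \<Rightarrow> real^'n" and c :: real
  assumes open_\<Omega>: "open \<Omega>" and bounded_\<Omega>: "bounded \<Omega>" and open_Ys: "open Ys" and Ys_cell: "Ys \<subseteq> unit_cell"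
    and diffeo: "AE x in lebesgue_on \<Omega>. C1_diffeo_cl Ys (\<psi>0 x) \<and> \<psi>0 x ` Ys \<subseteq> unit_cell"
    and meas: "\<And>i. (\<lambda>z. \<psi>0 (fst z) (snd z) $ i) \<in> borel_measurable (lebesgue_on (\<Omega> \<times> Ys))"
    and det_meas: "(\<lambda>z. det (jacobian (\<psi>0 (fst z)) (at (snd z)))) \<in> borel_measurable (lebesgue_on (\<Omega> \<times> Ys))"
    and det_ge: "AE z in lebesgue_on (\<Omega> \<times> Ys). c \<le> det (jacobian (\<psi>0 (fst z)) (at (snd z)))"
    and c_pos: "0 < c"
begin

abbreviation "cells \<equiv> transformed_cells \<Omega> Ys \<psi>0"

definition "J0 z = det (jacobian (\<psi>0 (fst z)) (at (snd z)))"

definition "transf z = (fst z, \<psi>0 (fst z) (snd z))"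

definition "back z = (fst z, inv_transf Ys \<psi>0 (fst z) (snd z))"

lemma domains:
  "\<Omega> \<in> sets borel" "\<Omega> \<in> sets lebesgue" "Ys \<in> sets borel" "Ys \<in> sets lebesgue" "\<Omega> \<times> Ys \<in> sets lebesgue"
  "bounded (\<Omega> \<times> Ys)" "bounded Ys" "\<Omega> \<times> Ys \<subseteq> \<Omega> \<times> unit_cell"
proof -
  show b: "\<Omega> \<in> sets borel" "Ys \<in> sets borel" using open_\<Omega> open_Ys by auto
  show "\<Omega> \<in> sets lebesgue" "Ys \<in> sets lebesgue" "\<Omega> \<times> Ys \<in> sets lebesgue" using b borel_Times_lebesgue by auto
  show y: "bounded Ys" using Ys_cell by (rule bounded_subset[rotated]) (simp add: unit_cell_def)
  show "bounded (\<Omega> \<times> Ys)" by (rule bounded_Times[OF bounded_\<Omega> y])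
  show "\<Omega> \<times> Ys \<subseteq> \<Omega> \<times> unit_cell" using Ys_cell by auto
qed

lemma C1_diffeo_facts:
  assumes "C1_diffeo_cl Ys f"
  shows "inj_on f (closure Ys)" "continuous_on (closure Ys) f" "inj_on f Ys"
    "\<And>y. y \<in> Ys \<Longrightarrow> (f has_derivative (\<lambda>h. jacobian f (at y) *v h)) (at y)"
    "\<And>y. y \<in> Ys \<Longrightarrow> inv_into (closure Ys) f (f y) = y"
proof -
  show i: "inj_on f (closure Ys)" using assms by (auto simp: C1_diffeo_cl_def bij_betw_def)
  show "continuous_on (closure Ys) f" using assms by (auto simp: C1_diffeo_cl_def C1_cl_def)
  show "inj_on f Ys" using i by (rule inj_on_subset) (rule closure_subset)
  show "(f has_derivative (\<lambda>h. jacobian f (at y) *v h)) (at y)" if "y \<in> Ys" for y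
    using assms that by (auto simp: C1_diffeo_cl_def C1_cl_def jacobian_works[symmetric])
  show "inv_into (closure Ys) f (f y) = y" if "y \<in> Ys" for y
    using inv_into_f_f[OF i] that closure_subset by blast
qed

definition "good x \<longleftrightarrow> C1_diffeo_cl Ys (\<psi>0 x) \<and> \<psi>0 x ` Ys \<subseteq> unit_cell"

lemma AE_good: "AE x in lebesgue_on \<Omega>. good x"
  using diffeo by (simp add: good_def)

lemma AE_good_pair: "AE z in (lebesgue :: ((real^'n) \<times> (real^'n)) measure). fst z \<in> \<Omega> \<longrightarrow> good (fst z)"
proof -
  have "AE z in lebesgue_on (\<Omega> \<times> (UNIV :: (real^'n) set)). good (fst z)"
    by (rule AE_fst_lebesgue_on[OF domains(1) _ AE_good]) simp
  moreover have "\<Omega> \<times> (UNIV :: (real^'n) set) \<in> sets lebesgue" by (rule borel_Times_lebesgue(1)[OF domains(1)]) simp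
  ultimately show ?thesis by (subst (asm) AE_lebesgue_on_iff) (auto elim: eventually_mono)
qed

definition "image_graph B = {z. fst z \<in> \<Omega> \<and> snd z \<in> \<psi>0 (fst z) ` B}"

text \<open>By compactness, membership in the image of a closed ball can be tested on a countable dense
  subset of the ball, for whose points the transformation is a measurable function of \<open>x\<close>.\<close>

lemma image_graph_cball:
  assumes r: "0 < r" and sub: "cball a r \<subseteq> Ys"
  shows "image_graph (cball a r) \<in> sets lebesgue"
proof -
  have "AE y in lebesgue_on Ys. \<forall>i. (\<lambda>x. \<psi>0 x y $ i) \<in> borel_measurable (lebesgue_on \<Omega>)"
    using AE_sections_measurable(2)[OF domains(1,3) meas] by (simp add: AE_all_countable)
  then have ae: "AE y in lebesgue. y \<in> Ys \<longrightarrow> (\<forall>i. (\<lambda>x. \<psi>0 x y $ i) \<in> borel_measurable (lebesgue_on \<Omega>))"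
    by (simp add: AE_lebesgue_on_iff[OF domains(4)])
  define R where "R = {y \<in> ball a r. \<forall>i. (\<lambda>x. \<psi>0 x y $ i) \<in> borel_measurable (lebesgue_on \<Omega>)}"
  have Rcl: "ball a r \<subseteq> closure R"
  proof
    fix y assume y: "y \<in> ball a r"
    show "y \<in> closure R"
    proof (rule ccontr)
      assume n: "y \<notin> closure R"
      let ?O = "ball a r - closure R"
      have "open ?O" by (intro open_Diff) auto
      moreover have "?O \<noteq> {}" using y n by blast
      moreover have "AE u in lebesgue. u \<notin> ?O"
      proof (rule eventually_mono[OF ae], rule notI)
        fix u assume m: "u \<in> Ys \<longrightarrow> (\<forall>i. (\<lambda>x. \<psi>0 x u $ i) \<in> borel_measurable (lebesgue_on \<Omega>))" and u: "u \<in> ?O"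
        have b: "u \<in> ball a r" using u by (rule DiffD1)
        then have "u \<in> Ys" using sub ball_subset_cball[of a r] by blast
        then have "u \<in> R" using m b by (simp add: R_def)
        then show False using u closure_subset[of R] by blast
      qed
      moreover have "?O \<in> sets lebesgue" by (intro lborelD borel_open sets_completionI_sets) (auto intro!: open_Diff)
      ultimately have "negligible ?O"
        by (simp only: negligible_iff_null_sets AE_iff_null_sets)
      with \<open>open ?O\<close> \<open>?O \<noteq> {}\<close> show False using open_not_negligible[of ?O] by blast
    qed
  qed
  obtain D where D: "countable D" "D \<subseteq> R" "R \<subseteq> closure D" using separable[of R] by blast
  have clD: "closure D = cball a r"
  proof
    have "D \<subseteq> ball a r" using D(2) by (auto simp: R_def)
    then have "closure D \<subseteq> closure (ball a r)" by (rule closure_mono)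
    then show "closure D \<subseteq> cball a r" using r by simp
    have "closure R \<subseteq> closure D" using D(3) closure_minimal by blast
    then have "closure (ball a r) \<subseteq> closure D" using Rcl by (meson closed_closure closure_minimal order_trans)
    then show "cball a r \<subseteq> closure D" using r by simp
  qed
  have img: "\<psi>0 x ` cball a r = closure (\<psi>0 x ` D)" if "good x" for x
  proof
    have cont: "continuous_on (closure D) (\<psi>0 x)"
      using C1_diffeo_facts(2) that sub clD closure_subset by (metis continuous_on_subset good_def order_trans)
    show "\<psi>0 x ` cball a r \<subseteq> closure (\<psi>0 x ` D)"
      unfolding clD[symmetric] by (rule image_closure_subset[OF cont closed_closure closure_subset])
    have "closed (\<psi>0 x ` cball a r)"
      using cont unfolding clD by (intro compact_imp_closed compact_continuous_image) auto
    moreover have "\<psi>0 x ` D \<subseteq> \<psi>0 x ` cball a r" using closure_subset[of D] unfolding clD by blast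
    ultimately show "closure (\<psi>0 x ` D) \<subseteq> \<psi>0 x ` cball a r" by (rule closure_minimal[rotated])
  qed
  let ?E = "\<lambda>k d. {z \<in> \<Omega> \<times> (UNIV :: (real^'n) set). (\<Sum>i\<in>UNIV. \<bar>\<psi>0 (fst z) d $ i - snd z $ i\<bar>) < 1 / real (Suc k)}"
  have S: "\<Omega> \<times> (UNIV :: (real^'n) set) \<in> sets lebesgue" by (rule borel_Times_lebesgue(1)[OF domains(1)]) simp
  have Em: "?E k d \<in> sets lebesgue" if "d \<in> D" for k d
  proof -
    have dR: "(\<lambda>x. \<psi>0 x d $ i) \<in> borel_measurable (lebesgue_on \<Omega>)" for i using that D(2) by (auto simp: R_def)
    have "(\<lambda>z. \<psi>0 (fst z) d $ i) \<in> borel_measurable (lebesgue_on (\<Omega> \<times> (UNIV :: (real^'n) set)))" for i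
      by (rule measurable_fst_lebesgue_on[OF domains(1) _ dR]) simp
    moreover have "(\<lambda>z. snd z $ i) \<in> borel_measurable (lebesgue_on (\<Omega> \<times> (UNIV :: (real^'n) set)))" for i
      by (rule continuous_imp_measurable_lebesgue_on) (intro continuous_intros)
    ultimately have "(\<lambda>z. \<Sum>i\<in>UNIV. \<bar>\<psi>0 (fst z) d $ i - snd z $ i\<bar>) \<in> borel_measurable (lebesgue_on (\<Omega> \<times> (UNIV :: (real^'n) set)))"
      by (intro borel_measurable_sum borel_measurable_abs borel_measurable_diff)
    then have "{z \<in> space (lebesgue_on (\<Omega> \<times> (UNIV :: (real^'n) set))). (\<Sum>i\<in>UNIV. \<bar>\<psi>0 (fst z) d $ i - snd z $ i\<bar>) < 1 / real (Suc k)} \<in> sets (lebesgue_on (\<Omega> \<times> (UNIV :: (real^'n) set)))"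
      by measurable
    then have "?E k d \<in> sets (lebesgue_on (\<Omega> \<times> (UNIV :: (real^'n) set)))" by simp
    then show ?thesis using sets_restrict_space_iff[of "\<Omega> \<times> (UNIV :: (real^'n) set)" lebesgue] S by auto
  qed
  have "(\<Inter>k. \<Union>d\<in>D. ?E k d) \<in> sets lebesgue"
    using D(1) Em by (intro sets.countable_INT'' sets.countable_UN') auto
  moreover have "AE z in lebesgue. z \<in> (\<Inter>k. \<Union>d\<in>D. ?E k d) \<longleftrightarrow> z \<in> image_graph (cball a r)"
    using AE_good_pair
  proof eventually_elim
    case (elim z)
    have near: "(\<forall>k. \<exists>d\<in>D. (\<Sum>i\<in>UNIV. \<bar>\<psi>0 x d $ i - y $ i\<bar>) < 1 / real (Suc k)) \<longleftrightarrow> y \<in> closure (\<psi>0 x ` D)" for x y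
    proof
      assume L: "\<forall>k. \<exists>d\<in>D. (\<Sum>i\<in>UNIV. \<bar>\<psi>0 x d $ i - y $ i\<bar>) < 1 / real (Suc k)"
      show "y \<in> closure (\<psi>0 x ` D)"
        unfolding closure_approachable
      proof (intro allI impI)
        fix e :: real assume "0 < e"
        then obtain k where k: "1 / real (Suc k) < e" using nat_approx_posE by blast
        obtain d where d: "d \<in> D" "(\<Sum>i\<in>UNIV. \<bar>\<psi>0 x d $ i - y $ i\<bar>) < 1 / real (Suc k)" using L by blast
        have "dist (\<psi>0 x d) y < e" using norm_le_l1_cart[of "\<psi>0 x d - y"] d(2) k by (simp add: dist_norm)
        then show "\<exists>u\<in>\<psi>0 x ` D. dist u y < e" using d(1) by blast
      qed
    next
      assume R: "y \<in> closure (\<psi>0 x ` D)"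
      show "\<forall>k. \<exists>d\<in>D. (\<Sum>i\<in>UNIV. \<bar>\<psi>0 x d $ i - y $ i\<bar>) < 1 / real (Suc k)"
      proof
        fix k
        have "0 < 1 / real (Suc k) / CARD('n)" by simp
        then obtain d where d: "d \<in> D" "dist (\<psi>0 x d) y < 1 / real (Suc k) / CARD('n)"
          using R unfolding closure_approachable by blast
        have "(\<Sum>i\<in>UNIV. \<bar>\<psi>0 x d $ i - y $ i\<bar>) \<le> (\<Sum>i\<in>(UNIV :: 'n set). dist (\<psi>0 x d) y)"
        proof (rule sum_mono)
          fix i show "\<bar>\<psi>0 x d $ i - y $ i\<bar> \<le> dist (\<psi>0 x d) y"
            using component_le_norm_cart[of "\<psi>0 x d - y" i] by (simp add: dist_norm)
        qed
        also have "\<dots> = CARD('n) * dist (\<psi>0 x d) y" by simp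
        also have "\<dots> < 1 / real (Suc k)" using d(2)
          by (subst mult.commute) (simp only: pos_less_divide_eq of_nat_0_less_iff zero_less_card_finite)
        finally show "\<exists>d\<in>D. (\<Sum>i\<in>UNIV. \<bar>\<psi>0 x d $ i - y $ i\<bar>) < 1 / real (Suc k)" using d(1) by blast
      qed
    qed
    show ?case
    proof (cases "fst z \<in> \<Omega>")
      case True
      then have "z \<in> image_graph (cball a r) \<longleftrightarrow> snd z \<in> closure (\<psi>0 (fst z) ` D)"
        using elim img by (simp add: image_graph_def)
      moreover have "z \<in> (\<Inter>k. \<Union>d\<in>D. ?E k d) \<longleftrightarrow> (\<forall>k. \<exists>d\<in>D. (\<Sum>i\<in>UNIV. \<bar>\<psi>0 (fst z) d $ i - snd z $ i\<bar>) < 1 / real (Suc k))"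
        using True by (auto simp: mem_Times_iff)
      ultimately show ?thesis using near by simp
    qed (auto simp: image_graph_def)
  qed
  ultimately show ?thesis by (rule sets_lebesgue_modulo_null)
qed

text \<open>An open set is a countable union of closed balls, whose images are measurable.\<close>

lemma image_graph_open:
  assumes "open B" "B \<subseteq> Ys"
  shows "image_graph B \<in> sets lebesgue"
proof -
  obtain P :: "((real^'n) \<times> real) set" where P: "countable P" "\<And>c r. (c, r) \<in> P \<Longrightarrow> 0 < r" "(\<Union>(c, r)\<in>P. cball c r) = B"
    using open_countable_cballs[OF assms(1)] by blast
  have "image_graph B = (\<Union>q\<in>P. image_graph (cball (fst q) (snd q)))"
    unfolding P(3)[symmetric] by (auto simp: image_graph_def split_beta image_UN)
  moreover have "image_graph (cball (fst q) (snd q)) \<in> sets lebesgue" if "q \<in> P" for q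
  proof (rule image_graph_cball)
    show "0 < snd q" using P(2)[of "fst q" "snd q"] that by simp
    show "cball (fst q) (snd q) \<subseteq> Ys" using P(3) assms(2) that by fastforce
  qed
  ultimately show ?thesis using P(1) by (auto intro: sets.countable_UN')
qed

lemma cells_iff_good: "fst z \<in> \<Omega> \<Longrightarrow> good (fst z) \<Longrightarrow> z \<in> cells \<longleftrightarrow> z \<in> image_graph Ys"
  by (cases z) (auto simp: transformed_cells_def image_graph_def good_def)

lemma cells_measurable: "cells \<in> sets lebesgue"
proof (rule sets_lebesgue_modulo_null[OF image_graph_open[OF open_Ys order_refl]])
  show "AE z in lebesgue. z \<in> image_graph Ys \<longleftrightarrow> z \<in> cells"
    using AE_good_pair
  proof eventually_elim
    case (elim z)
    show ?case
      by (cases "fst z \<in> \<Omega>") (use elim cells_iff_good[of z] in \<open>auto simp: image_graph_def transformed_cells_def\<close>)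
  qed
qed

lemma cells_subset: "cells \<subseteq> \<Omega> \<times> unit_cell"
  by (auto simp: transformed_cells_def)

lemma cells_bounded: "bounded cells"
  by (rule bounded_subset[OF _ cells_subset]) (intro bounded_Times bounded_\<Omega>, simp add: unit_cell_def)

lemma transf_back_good:
  assumes "good (fst z)"
  shows "z \<in> \<Omega> \<times> Ys \<Longrightarrow> transf z \<in> cells \<and> back (transf z) = z"
    and "z \<in> cells \<Longrightarrow> back z \<in> \<Omega> \<times> Ys \<and> transf (back z) = z"
proof -
  obtain x y where z: "z = (x, y)" by (cases z)
  have g: "C1_diffeo_cl Ys (\<psi>0 x)" "\<psi>0 x ` Ys \<subseteq> unit_cell" using assms by (auto simp: good_def z)
  note inv = C1_diffeo_facts(5)[OF g(1)]
  show "z \<in> \<Omega> \<times> Ys \<Longrightarrow> transf z \<in> cells \<and> back (transf z) = z"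
    using inv g(2) by (auto simp: z transf_def back_def inv_transf_def transformed_cells_def)
  show "z \<in> cells \<Longrightarrow> back z \<in> \<Omega> \<times> Ys \<and> transf (back z) = z"
    using inv by (auto simp: z transf_def back_def inv_transf_def transformed_cells_def)
qed

lemma AE_good_on:
  fixes S :: "((real^'n) \<times> (real^'n)) set"
  assumes "S \<in> sets lebesgue" "S \<subseteq> \<Omega> \<times> UNIV"
  shows "AE z in lebesgue_on S. good (fst z) \<and> z \<in> S"
  unfolding AE_lebesgue_on_iff[OF assms(1)] using AE_good_pair
  by (rule eventually_mono) (use assms(2) in auto)

lemma AE_back: "AE z in lebesgue_on cells. back z \<in> \<Omega> \<times> Ys \<and> transf (back z) = z"
proof -
  have "AE z in lebesgue_on cells. good (fst z) \<and> z \<in> cells"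
    by (rule AE_good_on[OF cells_measurable]) (use cells_subset in auto)
  then show ?thesis by (rule eventually_mono) (use transf_back_good(2) in blast)
qed

lemma AE_transf: "AE z in lebesgue_on (\<Omega> \<times> Ys). transf z \<in> cells \<and> back (transf z) = z"
proof -
  have "AE z in lebesgue_on (\<Omega> \<times> Ys). good (fst z) \<and> z \<in> \<Omega> \<times> Ys" by (rule AE_good_on[OF domains(5)]) auto
  then show ?thesis by (rule eventually_mono) (use transf_back_good(1) in blast)
qed

lemma back_measurable: "back \<in> borel_measurable (lebesgue_on cells)"
proof (rule borel_measurableI)
  fix S :: "((real^'n) \<times> (real^'n)) set" assume S: "open S"
  \<comment> \<open>Open sets of pairs are countable unions of products of open sets.\<close>
  obtain F where F: "countable F" "\<And>W. W \<in> F \<Longrightarrow> \<exists>a b a' b'. W = box a b \<times> box a' b'" "S = \<Union>F"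
  proof -
    obtain D where D: "countable D" "D \<subseteq> Pow S" "\<And>X. X \<in> D \<Longrightarrow> \<exists>a b. X = box a b" "\<Union>D = S"
      using open_countable_Union_open_box[OF S] by metis
    have "\<exists>a b a' b'. W = box a b \<times> box a' b'" if "W \<in> D" for W :: "((real^'n) \<times> (real^'n)) set"
    proof -
      obtain u v where "W = box u v" using D(3) \<open>W \<in> D\<close> by blast
      then have "W = box (fst u) (fst v) \<times> box (snd u) (snd v)" by (cases u; cases v) (auto simp: Basis_prod_def ball_Un box_def)
      then show ?thesis by blast
    qed
    then show ?thesis using that[of D] D by simp
  qed
  have W: "back -` W \<inter> cells \<in> sets lebesgue" if WF: "W \<in> F" for W
  proof -
    obtain a b a' b' where Wb: "W = box a b \<times> box a' b'" using F(2)[OF WF] by blast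
    let ?B = "box a b \<times> (UNIV :: (real^'n) set)"
    have "?B \<in> sets lebesgue" by (rule borel_Times_lebesgue(1)) auto
    then have "?B \<inter> image_graph (Ys \<inter> box a' b') \<in> sets lebesgue"
      using image_graph_open[of "Ys \<inter> box a' b'"] open_Ys by (intro sets.Int) auto
    moreover have "AE z in lebesgue. z \<in> ?B \<inter> image_graph (Ys \<inter> box a' b') \<longleftrightarrow> z \<in> back -` W \<inter> cells"
      using AE_good_pair
    proof eventually_elim
      case (elim z)
      obtain x y where z: "z = (x, y)" by (cases z)
      show ?case
      proof (cases "x \<in> \<Omega>")
        case True
        then have g: "C1_diffeo_cl Ys (\<psi>0 x)" "\<psi>0 x ` Ys \<subseteq> unit_cell" using elim by (auto simp: good_def z)
        note inv = C1_diffeo_facts(5)[OF g(1)]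
        show ?thesis
          using True inv g(2) by (auto simp: z Wb back_def inv_transf_def transformed_cells_def image_graph_def)
      qed (auto simp: z image_graph_def transformed_cells_def)
    qed
    ultimately show ?thesis by (rule sets_lebesgue_modulo_null)
  qed
  have "back -` S \<inter> cells = (\<Union>W\<in>F. back -` W \<inter> cells)" using F(3) by auto
  moreover have "\<dots> \<in> sets lebesgue" using F(1) W by (intro sets.countable_UN') auto
  ultimately show "back -` S \<inter> space (lebesgue_on cells) \<in> sets (lebesgue_on cells)"
    using sets_restrict_space_iff[of cells lebesgue] cells_measurable by auto
qed

lemma J0_measurable: "J0 \<in> borel_measurable (lebesgue_on (\<Omega> \<times> Ys))"
  using det_meas by (simp add: J0_def[abs_def])

lemma J0_ge: "AE z in lebesgue_on (\<Omega> \<times> Ys). c \<le> J0 z"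
  using det_ge by (simp add: J0_def)

lemma transf_measurable: "transf \<in> borel_measurable (lebesgue_on (\<Omega> \<times> Ys))"
proof -
  have "fst \<in> borel_measurable (lebesgue_on (\<Omega> \<times> Ys))"
    by (rule continuous_imp_measurable_lebesgue_on) (intro continuous_intros)
  moreover have "(\<lambda>z. \<psi>0 (fst z) (snd z)) \<in> borel_measurable (lebesgue_on (\<Omega> \<times> Ys))"
    by (subst borel_measurable_euclidean_space) (auto simp: Basis_vec_def inner_axis meas)
  ultimately show ?thesis unfolding transf_def[abs_def] by (rule borel_measurable_Pair)
qed

text \<open>On almost every fibre this is the change of variables formula.\<close>

lemma distr_back:
  "distr (lebesgue_on cells) borel back = distr (density (lebesgue_on (\<Omega> \<times> Ys)) (\<lambda>z. ennreal (J0 z))) borel (\<lambda>z. z)"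
proof (rule measure_eqI)
  fix B :: "((real^'n) \<times> (real^'n)) set" assume "B \<in> sets (distr (lebesgue_on cells) borel back)"
  then have B: "B \<in> sets borel" by simp
  have Bl: "B \<in> sets lebesgue" using B by (simp add: sets_completionI_sets)
  have idm: "(\<lambda>z. z) \<in> borel_measurable (density (lebesgue_on (\<Omega> \<times> Ys)) (\<lambda>z. ennreal (J0 z)))"
    using continuous_imp_measurable_lebesgue_on[of "\<lambda>z::(real^'n) \<times> (real^'n). z" "\<Omega> \<times> Ys"]
    by (simp add: measurable_density_eq1 continuous_on_id)
  let ?A = "back -` B \<inter> cells"
  have As: "?A \<in> sets (lebesgue_on cells)" using measurable_sets[OF back_measurable B] by simp
  then have A: "?A \<in> sets lebesgue" using sets_restrict_space_iff[of cells lebesgue] cells_measurable by auto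
  have Bs: "B \<inter> (\<Omega> \<times> Ys) \<in> sets (lebesgue_on (\<Omega> \<times> Ys))"
    using Bl domains(5) sets_restrict_space_iff[of "\<Omega> \<times> Ys" lebesgue] by auto
  let ?S = "\<lambda>x. {y \<in> Ys. (x, y) \<in> B}"
  have Sm: "?S x \<in> sets lebesgue" for x
  proof -
    have "(\<lambda>y. (x, y)) \<in> borel_measurable (borel :: (real^'n) measure)" by (intro borel_measurable_continuous_onI continuous_intros)
    from measurable_sets[OF this B] have "{y. (x, y) \<in> B} \<in> sets borel" by (simp add: vimage_def)
    then have "Ys \<inter> {y. (x, y) \<in> B} \<in> sets borel" using domains(3) by (intro sets.Int) auto
    moreover have "Ys \<inter> {y. (x, y) \<in> B} = ?S x" by auto
    ultimately show ?thesis by (simp add: sets_completionI_sets)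
  qed
  have "emeasure (distr (lebesgue_on cells) borel back) B = emeasure lebesgue ?A"
    using back_measurable B As cells_measurable by (subst emeasure_distr) (auto simp: emeasure_restrict_space)
  also have "\<dots> = (\<integral>\<^sup>+z. indicator ?A z \<partial>lebesgue)" using A by simp
  also have "\<dots> = (\<integral>\<^sup>+x. \<integral>\<^sup>+y. indicator ?A (x, y) \<partial>lebesgue \<partial>lebesgue)"
    by (rule nn_integral_lebesgue_pair) (use A in simp)
  also have "\<dots> = (\<integral>\<^sup>+x. indicator \<Omega> x * (\<integral>\<^sup>+y. indicator (?S x) y * ennreal (J0 (x, y)) \<partial>lebesgue) \<partial>lebesgue)"
  proof (rule nn_integral_cong_AE)
    have secm: "AE x in lebesgue. {y. (x, y) \<in> ?A} \<in> sets lebesgue"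
    proof -
      have "AE x in lebesgue_on UNIV. (\<lambda>y. indicator ?A (x, y) :: real) \<in> borel_measurable (lebesgue_on UNIV)"
        by (rule AE_sections_measurable(1)) (use A in simp_all)
      then have "AE x in lebesgue. (\<lambda>y. indicator ?A (x, y) :: real) \<in> borel_measurable lebesgue"
      proof -
        have u: "f \<in> borel_measurable (lebesgue_on UNIV) \<longleftrightarrow> f \<in> borel_measurable lebesgue" for f :: "real^'n \<Rightarrow> real"
          using borel_measurable_if[of UNIV f] by simp
        show "AE x in lebesgue_on UNIV. (\<lambda>y. indicator ?A (x, y) :: real) \<in> borel_measurable (lebesgue_on UNIV) \<Longrightarrow> ?thesis"
          by (simp add: AE_lebesgue_on_iff u)
      qed
      then show ?thesis
      proof (rule eventually_mono)
        fix x assume "(\<lambda>y. indicator ?A (x, y) :: real) \<in> borel_measurable lebesgue"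
        moreover have "(\<lambda>y. indicator ?A (x, y) :: real) = indicator {y. (x, y) \<in> ?A}"
          by (auto simp: indicator_def fun_eq_iff)
        ultimately have "(indicator {y. (x, y) \<in> ?A} :: _ \<Rightarrow> real) \<in> borel_measurable lebesgue" by metis
        then show "{y. (x, y) \<in> ?A} \<in> sets lebesgue" by (simp add: borel_measurable_indicator_iff)
      qed
    qed
    have Jm: "AE x in lebesgue. x \<in> \<Omega> \<longrightarrow> (AE y in lebesgue. y \<in> Ys \<longrightarrow> c \<le> J0 (x, y))"
      using AE_lebesgue_on_Times(1)[OF domains(1,3) J0_ge] by (simp add: AE_lebesgue_on_iff domains)
    have gd: "AE x in lebesgue. x \<in> \<Omega> \<longrightarrow> good x" using AE_good by (simp add: AE_lebesgue_on_iff domains)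
    show "AE x in lebesgue. (\<integral>\<^sup>+y. indicator ?A (x, y) \<partial>lebesgue) = indicator \<Omega> x * (\<integral>\<^sup>+y. indicator (?S x) y * ennreal (J0 (x, y)) \<partial>lebesgue)"
      using secm Jm gd
    proof eventually_elim
      case (elim x)
      show ?case
      proof (cases "x \<in> \<Omega>")
        case False
        then have "indicator ?A (x, y) = (0::ennreal)" for y by (auto simp: transformed_cells_def indicator_def)
        then show ?thesis using False by simp
      next
        case True
        then have g: "C1_diffeo_cl Ys (\<psi>0 x)" "\<psi>0 x ` Ys \<subseteq> unit_cell" using elim by (auto simp: good_def)
        let ?I = "\<psi>0 x ` ?S x"
        have sec: "{y. (x, y) \<in> ?A} = ?I"
          using True C1_diffeo_facts(5)[OF g(1)] g(2)
          by (auto simp: back_def inv_transf_def transformed_cells_def)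
        have Im: "?I \<in> sets lebesgue" using elim(1) sec by simp
        have "bounded ?I" by (rule bounded_subset[of unit_cell]) (use g(2) in \<open>auto simp: unit_cell_def\<close>)
        then have lm: "?I \<in> lmeasurable" using Im by (simp add: bounded_set_imp_lmeasurable)
        then have one: "(\<lambda>y. 1 :: real) absolutely_integrable_on ?I"
          by (simp add: absolutely_integrable_on_const)
        have der: "(\<psi>0 x has_derivative (\<lambda>h. jacobian (\<psi>0 x) (at y) *v h)) (at y within ?S x)" if "y \<in> ?S x" for y
          using C1_diffeo_facts(4)[OF g(1)] that by (auto intro: has_derivative_at_withinI)
        have inj: "inj_on (\<psi>0 x) (?S x)" using C1_diffeo_facts(3)[OF g(1)] by (rule inj_on_subset) auto
        have J1: "\<bar>det (jacobian (\<psi>0 x) (at y))\<bar> = \<bar>J0 (x, y)\<bar>" for y by (simp add: J0_def)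
        have ai: "(\<lambda>y. \<bar>J0 (x, y)\<bar> * 1) absolutely_integrable_on ?S x"
          using integrable_change_of_variables(1)[OF Sm _ inj, of "\<lambda>y. jacobian (\<psi>0 x) (at y)" "\<lambda>_. 1"] der one
          unfolding J1 by blast
        have eqI: "set_lebesgue_integral lebesgue ?I (\<lambda>_. 1) = set_lebesgue_integral lebesgue (?S x) (\<lambda>y. \<bar>J0 (x, y)\<bar> * 1)"
          using integrable_change_of_variables(2)[OF Sm _ inj, of "\<lambda>y. jacobian (\<psi>0 x) (at y)" "\<lambda>_. 1"] der one
          unfolding J1 by blast
        have "(\<integral>\<^sup>+y. indicator ?A (x, y) \<partial>lebesgue) = (\<integral>\<^sup>+y. indicator ?I y \<partial>lebesgue)"
          unfolding sec[symmetric] by (rule nn_integral_cong) (simp add: indicator_def)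
        also have "\<dots> = emeasure lebesgue ?I" using Im by simp
        also have "\<dots> = ennreal (measure lebesgue ?I)" using lm by (simp add: emeasure_eq_measure2)
        also have "measure lebesgue ?I = set_lebesgue_integral lebesgue ?I (\<lambda>_. 1)"
          using lm by (simp add: set_lebesgue_integral_def)
        also have "\<dots> = (\<integral>y. indicator (?S x) y * \<bar>J0 (x, y)\<bar> \<partial>lebesgue)" unfolding eqI by (simp add: set_lebesgue_integral_def)
        also have "ennreal \<dots> = (\<integral>\<^sup>+y. ennreal (indicator (?S x) y * \<bar>J0 (x, y)\<bar>) \<partial>lebesgue)"
          by (rule nn_integral_eq_integral[symmetric]) (use ai in \<open>auto simp: set_integrable_def\<close>)
        also have "\<dots> = (\<integral>\<^sup>+y. indicator (?S x) y * ennreal (J0 (x, y)) \<partial>lebesgue)"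
        proof (rule nn_integral_cong_AE)
          have "AE y in lebesgue. y \<in> Ys \<longrightarrow> c \<le> J0 (x, y)" using elim(2) True by blast
          then show "AE y in lebesgue. ennreal (indicator (?S x) y * \<bar>J0 (x, y)\<bar>) = indicator (?S x) y * ennreal (J0 (x, y))"
            by (rule eventually_mono) (use c_pos in \<open>auto simp: indicator_def\<close>)
        qed
        finally show ?thesis using True by simp
      qed
    qed
  qed
  also have "\<dots> = (\<integral>\<^sup>+x. \<integral>\<^sup>+y. ennreal (J0 (x, y)) * indicator B (x, y) \<partial>lebesgue_on Ys \<partial>lebesgue_on \<Omega>)"
  proof -
    have 1: "(\<integral>\<^sup>+y. ennreal (J0 (x, y)) * indicator B (x, y) \<partial>lebesgue_on Ys) = (\<integral>\<^sup>+y. indicator (?S x) y * ennreal (J0 (x, y)) \<partial>lebesgue)" for x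
      using domains(4) by (subst nn_integral_restrict_space) (auto intro!: nn_integral_cong simp: indicator_def)
    show ?thesis unfolding 1 using domains(2) by (subst nn_integral_restrict_space) (auto intro!: nn_integral_cong simp: indicator_def)
  qed
  also have "\<dots> = (\<integral>\<^sup>+z. ennreal (J0 z) * indicator B z \<partial>lebesgue_on (\<Omega> \<times> Ys))"
  proof (rule nn_integral_lebesgue_on_Times[OF domains(1,3), of "\<lambda>z. ennreal (J0 z) * indicator B z"])
    have "(indicator B :: _ \<Rightarrow> ennreal) \<in> borel_measurable (lebesgue_on (\<Omega> \<times> Ys))"
      using Bl by (intro measurable_restrict_space1) simp
    then show "(\<lambda>z. ennreal (J0 z) * indicator B z) \<in> borel_measurable (lebesgue_on (\<Omega> \<times> Ys))"
      using J0_measurable by measurable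
  qed
  also have "\<dots> = (\<integral>\<^sup>+z. ennreal (J0 z) * indicator (B \<inter> (\<Omega> \<times> Ys)) z \<partial>lebesgue_on (\<Omega> \<times> Ys))"
    by (rule nn_integral_cong) (auto simp: indicator_def)
  also have "\<dots> = emeasure (density (lebesgue_on (\<Omega> \<times> Ys)) (\<lambda>z. ennreal (J0 z))) (B \<inter> (\<Omega> \<times> Ys))"
    using Bs J0_measurable by (subst emeasure_density) auto
  also have "\<dots> = emeasure (distr (density (lebesgue_on (\<Omega> \<times> Ys)) (\<lambda>z. ennreal (J0 z))) borel (\<lambda>z. z)) B"
    using idm B by (subst emeasure_distr) auto
  finally show "emeasure (distr (lebesgue_on cells) borel back) B = emeasure (distr (density (lebesgue_on (\<Omega> \<times> Ys)) (\<lambda>z. ennreal (J0 z))) borel (\<lambda>z. z)) B" .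
qed simp


lemma integral_back_borel:
  fixes h :: "(real^'n) \<times> (real^'n) \<Rightarrow> real"
  assumes h: "h \<in> borel_measurable borel"
  shows "integrable (lebesgue_on cells) (\<lambda>q. h (back q)) \<longleftrightarrow> integrable (lebesgue_on (\<Omega> \<times> Ys)) (\<lambda>z. J0 z * h z)"
    and "(\<integral>q. h (back q) \<partial>lebesgue_on cells) = (\<integral>z. J0 z * h z \<partial>lebesgue_on (\<Omega> \<times> Ys))"
proof -
  let ?D = "density (lebesgue_on (\<Omega> \<times> Ys)) (\<lambda>z. ennreal (J0 z))"
  have idm: "(\<lambda>z. z) \<in> borel_measurable ?D"
    using continuous_imp_measurable_lebesgue_on[of "\<lambda>z::(real^'n) \<times> (real^'n). z" "\<Omega> \<times> Ys"]
    by (simp add: measurable_density_eq1 continuous_on_id)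
  have hm: "h \<in> borel_measurable (lebesgue_on (\<Omega> \<times> Ys))"
    using h by (intro measurable_restrict_space1 measurable_completion) simp
  have J0: "AE z in lebesgue_on (\<Omega> \<times> Ys). 0 \<le> J0 z" using J0_ge by (rule eventually_mono) (use c_pos in simp)
  have "integrable (lebesgue_on cells) (\<lambda>q. h (back q)) \<longleftrightarrow> integrable (distr (lebesgue_on cells) borel back) h"
    by (rule integrable_distr_eq[OF back_measurable h, symmetric])
  also have "\<dots> \<longleftrightarrow> integrable ?D h"
    unfolding distr_back by (rule integrable_distr_eq[OF idm h])
  also have "\<dots> \<longleftrightarrow> integrable (lebesgue_on (\<Omega> \<times> Ys)) (\<lambda>z. J0 z * h z)"
    using integrable_density[OF hm J0_measurable J0] by simp
  finally show "integrable (lebesgue_on cells) (\<lambda>q. h (back q)) \<longleftrightarrow> integrable (lebesgue_on (\<Omega> \<times> Ys)) (\<lambda>z. J0 z * h z)" .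
  have "(\<integral>q. h (back q) \<partial>lebesgue_on cells) = integral\<^sup>L (distr (lebesgue_on cells) borel back) h"
    by (rule integral_distr[OF back_measurable h, symmetric])
  also have "\<dots> = integral\<^sup>L ?D h"
    unfolding distr_back by (rule integral_distr[OF idm h])
  also have "\<dots> = (\<integral>z. J0 z * h z \<partial>lebesgue_on (\<Omega> \<times> Ys))"
    using integral_density[OF hm J0_measurable J0] by simp
  finally show "(\<integral>q. h (back q) \<partial>lebesgue_on cells) = (\<integral>z. J0 z * h z \<partial>lebesgue_on (\<Omega> \<times> Ys))" .
qed

text \<open>A Borel null set has image measure zero by the change of variables formula, so composition
  with the inverse respects null sets.\<close>

lemma AE_compose_back:
  assumes "AE z in lebesgue_on (\<Omega> \<times> Ys). P z"
  shows "AE q in lebesgue_on cells. P (back q)"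
proof -
  have "AE z in lborel. z \<in> \<Omega> \<times> Ys \<longrightarrow> P z"
    using assms unfolding AE_lebesgue_on_iff[OF domains(5)] AE_completion_iff .
  then obtain N where N: "{z \<in> space lborel. \<not> (z \<in> \<Omega> \<times> Ys \<longrightarrow> P z)} \<subseteq> N" "emeasure lborel N = 0" "N \<in> sets lborel"
    by (rule AE_E)
  have "N \<in> null_sets lebesgue" using N by (intro null_sets_completionI) auto
  from AE_not_in[OF this] have Nz: "AE z in lebesgue_on (\<Omega> \<times> Ys). z \<notin> N"
    unfolding AE_lebesgue_on_iff[OF domains(5)] by (rule eventually_mono) simp
  let ?h = "indicator N :: (real^'n) \<times> (real^'n) \<Rightarrow> real"
  have h: "?h \<in> borel_measurable borel" using N(3) by simp
  have z: "AE z in lebesgue_on (\<Omega> \<times> Ys). J0 z * ?h z = 0" using Nz by (rule eventually_mono) simp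
  have Jm: "(\<lambda>z. J0 z * ?h z) \<in> borel_measurable (lebesgue_on (\<Omega> \<times> Ys))"
  proof (rule borel_measurable_times[OF J0_measurable])
    show "?h \<in> borel_measurable (lebesgue_on (\<Omega> \<times> Ys))"
      using h by (intro measurable_restrict_space1 measurable_completion) simp
  qed
  have "integrable (lebesgue_on (\<Omega> \<times> Ys)) (\<lambda>z. J0 z * ?h z)"
    using integrable_cong_AE[OF Jm borel_measurable_const[of 0] z] by simp
  then have i: "integrable (lebesgue_on cells) (\<lambda>q. ?h (back q))" using integral_back_borel(1)[OF h] by simp
  have "(\<integral>q. ?h (back q) \<partial>lebesgue_on cells) = 0"
    unfolding integral_back_borel(2)[OF h] by (rule integral_eq_zero_AE[OF z])
  then have "AE q in lebesgue_on cells. ?h (back q) = 0"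
    using integral_nonneg_eq_0_iff_AE[OF i] by simp
  then show ?thesis
    using AE_back
  proof eventually_elim
    case (elim q)
    then have "back q \<notin> N" by (simp add: indicator_def split: if_splits)
    then show ?case using N(1) elim(2) by auto
  qed
qed

lemma measurable_compose_back:
  fixes h :: "(real^'n) \<times> (real^'n) \<Rightarrow> real"
  assumes h: "h \<in> borel_measurable (lebesgue_on (\<Omega> \<times> Ys))"
  shows "(\<lambda>q. h (back q)) \<in> borel_measurable (lebesgue_on cells)"
proof -
  obtain g where g: "g \<in> borel_measurable borel" "AE z in lebesgue_on (\<Omega> \<times> Ys). h z = g z"
    using borel_representative[OF domains(5) h] by blast
  have "AE q in lebesgue_on cells. g (back q) = h (back q)" using AE_compose_back[OF g(2)] by (rule eventually_mono) simp
  then show ?thesis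
    by (rule borel_measurable_lebesgue_on_AE[OF cells_measurable measurable_compose[OF back_measurable g(1)]])
qed

lemma integral_back:
  fixes h :: "(real^'n) \<times> (real^'n) \<Rightarrow> real"
  assumes h: "h \<in> borel_measurable (lebesgue_on (\<Omega> \<times> Ys))"
  shows "integrable (lebesgue_on cells) (\<lambda>q. h (back q)) \<longleftrightarrow> integrable (lebesgue_on (\<Omega> \<times> Ys)) (\<lambda>z. J0 z * h z)"
    and "(\<integral>q. h (back q) \<partial>lebesgue_on cells) = (\<integral>z. J0 z * h z \<partial>lebesgue_on (\<Omega> \<times> Ys))"
proof -
  obtain g where g: "g \<in> borel_measurable borel" "AE z in lebesgue_on (\<Omega> \<times> Ys). h z = g z"
    using borel_representative[OF domains(5) h] by blast
  have gm: "g \<in> borel_measurable (lebesgue_on (\<Omega> \<times> Ys))"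
    using g(1) by (intro measurable_restrict_space1 measurable_completion) simp
  have ae1: "AE q in lebesgue_on cells. h (back q) = g (back q)" by (rule AE_compose_back[OF g(2)])
  have ae2: "AE z in lebesgue_on (\<Omega> \<times> Ys). J0 z * h z = J0 z * g z" using g(2) by (rule eventually_mono) simp
  note m1 = measurable_compose_back[OF h] measurable_compose[OF back_measurable g(1)]
  note m2 = borel_measurable_times[OF J0_measurable h] borel_measurable_times[OF J0_measurable gm]
  show "integrable (lebesgue_on cells) (\<lambda>q. h (back q)) \<longleftrightarrow> integrable (lebesgue_on (\<Omega> \<times> Ys)) (\<lambda>z. J0 z * h z)"
    using integrable_cong_AE[OF m1 ae1] integrable_cong_AE[OF m2 ae2] integral_back_borel(1)[OF g(1)] by simp
  show "(\<integral>q. h (back q) \<partial>lebesgue_on cells) = (\<integral>z. J0 z * h z \<partial>lebesgue_on (\<Omega> \<times> Ys))"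
    using integral_cong_AE[OF m1 ae1] integral_cong_AE[OF m2 ae2] integral_back_borel(2)[OF g(1)] by simp
qed

lemma AE_compose_transf:
  assumes "AE q in lebesgue_on cells. P q"
  shows "AE z in lebesgue_on (\<Omega> \<times> Ys). P (transf z)"
proof -
  have "AE z in lborel. z \<in> cells \<longrightarrow> P z"
    using assms unfolding AE_lebesgue_on_iff[OF cells_measurable] AE_completion_iff .
  then obtain N where N: "{z \<in> space lborel. \<not> (z \<in> cells \<longrightarrow> P z)} \<subseteq> N" "emeasure lborel N = 0" "N \<in> sets lborel"
    by (rule AE_E)
  have "N \<in> null_sets lebesgue" using N by (intro null_sets_completionI) auto
  from AE_not_in[OF this] have Nz: "AE q in lebesgue_on cells. q \<notin> N"
    unfolding AE_lebesgue_on_iff[OF cells_measurable] by (rule eventually_mono) simp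
  let ?h = "\<lambda>z. indicator N (transf z) :: real"
  have "(indicator N :: _ \<Rightarrow> real) \<in> borel_measurable borel" using N(3) by simp
  from measurable_compose[OF transf_measurable this] have h: "?h \<in> borel_measurable (lebesgue_on (\<Omega> \<times> Ys))" .
  have z: "AE q in lebesgue_on cells. ?h (back q) = 0" using Nz AE_back by eventually_elim simp
  have "integrable (lebesgue_on cells) (\<lambda>q. ?h (back q))"
    using integrable_cong_AE[OF measurable_compose_back[OF h] borel_measurable_const[of 0] z] by simp
  then have i: "integrable (lebesgue_on (\<Omega> \<times> Ys)) (\<lambda>z. J0 z * ?h z)" using integral_back(1)[OF h] by simp
  have "(\<integral>z. J0 z * ?h z \<partial>lebesgue_on (\<Omega> \<times> Ys)) = 0"
    unfolding integral_back(2)[OF h, symmetric] by (rule integral_eq_zero_AE[OF z])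
  moreover have "AE z in lebesgue_on (\<Omega> \<times> Ys). 0 \<le> J0 z * ?h z"
    using J0_ge by (rule eventually_mono) (use c_pos in simp)
  ultimately have "AE z in lebesgue_on (\<Omega> \<times> Ys). J0 z * ?h z = 0"
    using integral_nonneg_eq_0_iff_AE[OF i] by simp
  then show ?thesis
    using J0_ge AE_transf
  proof eventually_elim
    case (elim z)
    then have "transf z \<notin> N" using c_pos by (auto simp: indicator_def)
    then show ?case using N(1) elim(3) by auto
  qed
qed

end

section \<open>Perforated domains and their transformations\<close>

lemma zero_ext_measurable:
  fixes f :: "'a::euclidean_space \<Rightarrow> real"
  assumes "S \<in> sets lebesgue" "f \<in> borel_measurable (lebesgue_on S)"
  shows "zero_ext S f \<in> borel_measurable (lebesgue_on U)"
  unfolding zero_ext_def using borel_measurable_if_I[OF assms(2,1)] by (rule measurable_restrict_space1)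

lemma integral_zero_ext:
  fixes f k :: "'a::euclidean_space \<Rightarrow> real"
  assumes "S \<in> sets lebesgue" "U \<in> sets lebesgue" "S \<subseteq> U"
  shows "(\<integral>x. zero_ext S f x * k x \<partial>lebesgue_on U) = (\<integral>x. f x * k x \<partial>lebesgue_on S)"
    and "integrable (lebesgue_on U) (\<lambda>x. zero_ext S f x * k x) \<longleftrightarrow> integrable (lebesgue_on S) (\<lambda>x. f x * k x)"
proof -
  have eq: "indicator U x *\<^sub>R (zero_ext S f x * k x) = indicator S x *\<^sub>R (f x * k x)" for x
    using assms(3) by (auto simp: zero_ext_def indicator_def)
  show "(\<integral>x. zero_ext S f x * k x \<partial>lebesgue_on U) = (\<integral>x. f x * k x \<partial>lebesgue_on S)"
    using assms(1,2) by (simp only: integral_restrict_space sets.Int_space_eq2 eq)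
  show "integrable (lebesgue_on U) (\<lambda>x. zero_ext S f x * k x) \<longleftrightarrow> integrable (lebesgue_on S) (\<lambda>x. f x * k x)"
    using assms(1,2) by (simp only: integrable_restrict_space sets.Int_space_eq2 eq)
qed

lemma zero_ext_Lp:
  fixes f :: "'a::euclidean_space \<Rightarrow> real"
  assumes S: "S \<in> sets lebesgue" and U: "U \<in> sets lebesgue" and f: "f \<in> Lp p S" and p: "0 < p"
  shows "zero_ext S f \<in> Lp p U"
proof -
  have m: "f \<in> borel_measurable (lebesgue_on S)" "integrable (lebesgue_on S) (\<lambda>x. \<bar>f x\<bar> powr p)" using f by (auto simp: Lp_def)
  have eq: "indicator S x *\<^sub>R (\<bar>f x\<bar> powr p) = \<bar>zero_ext S f x\<bar> powr p" for x using p by (simp add: zero_ext_def)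
  have "integrable lebesgue (\<lambda>x. indicator S x *\<^sub>R (\<bar>f x\<bar> powr p))"
    using m(2) S by (simp add: integrable_restrict_space)
  then have "integrable lebesgue (\<lambda>x. indicator U x *\<^sub>R (\<bar>zero_ext S f x\<bar> powr p))"
    unfolding eq by (rule integrable_mult_indicator[OF U])
  then have "integrable (lebesgue_on U) (\<lambda>x. \<bar>zero_ext S f x\<bar> powr p)" using U by (simp add: integrable_restrict_space)
  then show ?thesis using zero_ext_measurable[OF S m(1)] by (simp add: Lp_def)
qed

lemma integral_zero_ext_powr:
  fixes f :: "'a::euclidean_space \<Rightarrow> real"
  assumes "S \<in> sets lebesgue" "U \<in> sets lebesgue" "S \<subseteq> U" "0 < p"
  shows "(\<integral>x. \<bar>zero_ext S f x\<bar> powr p \<partial>lebesgue_on U) = (\<integral>x. \<bar>f x\<bar> powr p \<partial>lebesgue_on S)"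
proof -
  have "\<bar>zero_ext S f x\<bar> powr p = zero_ext S (\<lambda>x. \<bar>f x\<bar> powr p) x * 1" for x using assms(4) by (simp add: zero_ext_def)
  then show ?thesis using integral_zero_ext(1)[OF assms(1-3), of "\<lambda>x. \<bar>f x\<bar> powr p" "\<lambda>_. 1"] by simp
qed

lemma jacobian_minus_id:
  fixes f :: "real^'n \<Rightarrow> real^'n"
  assumes "f differentiable (at x)"
  shows "jacobian (\<lambda>x. f x - x) (at x) = jacobian f (at x) - mat 1"
proof -
  have "(f has_derivative (\<lambda>h. jacobian f (at x) *v h)) (at x)" using assms jacobian_works by blast
  then have "((\<lambda>x. f x - x) has_derivative (\<lambda>h. jacobian f (at x) *v h - h)) (at x)"
    by (intro derivative_intros)
  also have "(\<lambda>h. jacobian f (at x) *v h - h) = (*v) (jacobian f (at x) - mat 1)"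
    by (simp add: fun_eq_iff matrix_vector_mult_diff_rdistrib)
  finally have "frechet_derivative (\<lambda>x. f x - x) (at x) = (*v) (jacobian f (at x) - mat 1)"
    by (rule frechet_derivative_at[symmetric])
  then show ?thesis by (simp add: jacobian_def[of "\<lambda>x. f x - x"])
qed

text \<open>On the boundary the Jacobian is a limit, to which the differentiation rule passes.\<close>

lemma jacobian_cl_minus_id:
  fixes f :: "real^'n \<Rightarrow> real^'n"
  assumes S: "open S" and f: "f \<in> C1_cl S" and x: "x \<in> closure S"
  shows "jacobian_cl S (\<lambda>x. f x - x) x = jacobian_cl S f x - mat 1"
proof (cases "x \<in> S")
  case True
  then show ?thesis using f by (simp add: jacobian_cl_def C1_cl_def jacobian_minus_id)
next
  case False
  have "at x within S \<noteq> bot"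
    using x False by (simp add: trivial_limit_within closure_def)
  moreover have "((\<lambda>z. jacobian (\<lambda>x. f x - x) (at z)) \<longlongrightarrow> jacobian_cl S f x - mat 1) (at x within S)"
  proof -
    have "continuous (at x within closure S) (jacobian_cl S f)"
      using f x by (simp add: C1_cl_def continuous_on_eq_continuous_within)
    then have "(jacobian_cl S f \<longlongrightarrow> jacobian_cl S f x) (at x within S)"
      unfolding continuous_within by (rule tendsto_within_subset) (rule closure_subset)
    then have "((\<lambda>z. jacobian_cl S f z - mat 1) \<longlongrightarrow> jacobian_cl S f x - mat 1) (at x within S)"
      by (intro tendsto_intros)
    then show ?thesis
      by (rule Lim_transform_eventually)
         (use f in \<open>auto simp: eventually_at_filter jacobian_cl_def C1_cl_def jacobian_minus_id\<close>)
  qed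
  ultimately show ?thesis using False unfolding jacobian_cl_def[of S "\<lambda>x. f x - x"] by (simp add: tendsto_Lim)
qed

lemma C_norm_upper:
  assumes "compact K" "continuous_on K f"
  shows "0 \<le> C_norm K f" "x \<in> K \<Longrightarrow> norm (f x) \<le> C_norm K f"
proof -
  have "bdd_above ((\<lambda>x. norm (f x)) ` K)"
    using assms by (intro bounded_imp_bdd_above compact_imp_bounded compact_continuous_image continuous_on_norm)
  then have b: "bdd_above (insert 0 ((\<lambda>x. norm (f x)) ` K))" by simp
  show "0 \<le> C_norm K f" unfolding C_norm_def by (rule cSup_upper[OF _ b]) simp
  show "x \<in> K \<Longrightarrow> norm (f x) \<le> C_norm K f" unfolding C_norm_def by (rule cSup_upper[OF _ b]) simp
qed

lemma continuous_det_plus_id: "continuous_on UNIV (\<lambda>b::real^'n^'n. det (mat 1 + b))"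
  unfolding det_def by (intro continuous_intros)

lemma periodic_hull_open: "open (periodic_hull Ys)"
  by (simp add: periodic_hull_def)

lemma subset_periodic_hull:
  assumes "open Ys"
  shows "Ys \<subseteq> periodic_hull Ys"
  unfolding periodic_hull_def
proof (rule interior_maximal[OF _ assms])
  have "0 \<in> int_vecs" by (simp add: int_vecs_def)
  moreover have "Ys \<subseteq> (\<lambda>y. 0 + y) ` closure Ys" using closure_subset by auto
  ultimately show "Ys \<subseteq> (\<Union>k\<in>int_vecs. (\<lambda>y. k + y) ` closure Ys)" by blast
qed

lemma periodic_hull_periodic:
  assumes k: "k \<in> int_vecs"
  shows "y + k \<in> periodic_hull Ys \<longleftrightarrow> y \<in> periodic_hull Ys"
proof -
  let ?H = "\<Union>k\<in>int_vecs. (\<lambda>y. k + y) ` closure Ys"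
  have sub: "(\<lambda>y. k + y) ` ?H \<subseteq> ?H" if "k \<in> int_vecs" for k
  proof -
    have "k + j \<in> int_vecs" if "j \<in> int_vecs" for j using that \<open>k \<in> int_vecs\<close> by (auto simp: int_vecs_def)
    moreover have "(\<lambda>y. k + y) ` (\<lambda>y. j + y) ` closure Ys = (\<lambda>y. (k + j) + y) ` closure Ys" for j
      by (simp add: image_image add.assoc)
    ultimately show ?thesis by (simp only: image_UN) blast
  qed
  have imp: "z + j \<in> interior ?H" if "z \<in> interior ?H" "j \<in> int_vecs" for z j
  proof -
    have "(\<lambda>y. j + y) ` interior ?H = interior ((\<lambda>y. j + y) ` ?H)" by (rule interior_translation[symmetric])
    also have "\<dots> \<subseteq> interior ?H" by (rule interior_mono[OF sub[OF that(2)]])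
    finally show ?thesis using that(1) by (auto simp: add.commute)
  qed
  have "- k \<in> int_vecs" using k by (auto simp: int_vecs_def)
  then show ?thesis unfolding periodic_hull_def using imp[of y k] imp[of "y + k" "- k"] k by auto
qed

locale transformed_domains =
  fixes \<epsilon> :: "nat \<Rightarrow> real" and \<Omega> Ys :: "(real^'n) set"
    and \<psi> :: "nat \<Rightarrow> real^'n \<Rightarrow> real^'n" and \<psi>0 :: "real^'n \<Rightarrow> real^'n \<Rightarrow> real^'n" and \<delta> :: real
  assumes \<epsilon>: "\<And>n. 0 < \<epsilon> n" "\<epsilon> \<longlonglongrightarrow> 0"
    and \<Omega>: "open \<Omega>" "bounded \<Omega>" and Ys: "open Ys" "Ys \<subseteq> unit_cell" and \<delta>: "0 < \<delta>"
    and lpt: "locally_periodic_transformations \<epsilon> \<Omega> Ys \<psi> \<psi>0"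
begin

abbreviation "tiling \<equiv> periodic_hull Ys"

definition "\<Omega>h n = perforated (\<epsilon> n) \<Omega> Ys"

definition "\<Omega>e n = \<psi> n ` \<Omega>h n"

definition "U = neighbourhood \<delta> \<Omega>"

definition "J n x = det (jacobian (\<psi> n) (at x))"

definition "disp n x = (if x \<in> \<Omega>h n then inverse (\<epsilon> n) *\<^sub>R (\<psi> n x - x) else 0)"

definition "disp0 z = (if z \<in> \<Omega> \<times> Ys then \<psi>0 (fst z) (snd z) - snd z else 0)"

definition "grad n x = (if x \<in> \<Omega>h n then jacobian_cl (\<Omega>h n) (\<lambda>x. \<psi> n x - x) x else 0)"

definition "grad0 z = (if z \<in> \<Omega> \<times> Ys then jacobian_cl Ys (\<lambda>y. \<psi>0 (fst z) y - y) (snd z) else 0)"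

lemma mem_\<Omega>h_iff: "x \<in> \<Omega>h n \<longleftrightarrow> x \<in> \<Omega> \<and> x /\<^sub>R \<epsilon> n \<in> tiling"
proof -
  have "x \<in> (\<lambda>y. \<epsilon> n *\<^sub>R y) ` tiling \<longleftrightarrow> x /\<^sub>R \<epsilon> n \<in> tiling"
    using \<epsilon>(1)[of n] by (auto simp: image_iff intro!: bexI[of _ "x /\<^sub>R \<epsilon> n"])
  then show ?thesis by (simp add: \<Omega>h_def perforated_def)
qed

lemma \<Omega>h: "open (\<Omega>h n)" "\<Omega>h n \<subseteq> \<Omega>" "bounded (\<Omega>h n)" "\<Omega>h n \<in> sets lebesgue" "compact (closure (\<Omega>h n))"
proof -
  show o: "open (\<Omega>h n)" unfolding \<Omega>h_def perforated_def
    using \<epsilon>(1)[of n] by (intro open_Int \<Omega>(1) open_scaling periodic_hull_open) simp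
  show s: "\<Omega>h n \<subseteq> \<Omega>" by (auto simp: mem_\<Omega>h_iff)
  show b: "bounded (\<Omega>h n)" by (rule bounded_subset[OF \<Omega>(2) s])
  show "\<Omega>h n \<in> sets lebesgue" using o by (simp add: sets_completionI_sets)
  show "compact (closure (\<Omega>h n))" using b by simp
qed

lemmas domain = slow_fast_domain[OF \<Omega>]

lemma U: "open U" "bounded U" "\<Omega> \<subseteq> U"
proof -
  have eq: "U = {x. infdist x \<Omega> < \<delta>}" if "\<Omega> \<noteq> {}" using that by (simp add: U_def neighbourhood_def)
  have e: "U = {}" if "\<Omega> = {}" unfolding U_def neighbourhood_def using that by simp
  have "open {x. infdist x \<Omega> < \<delta>}" by (intro open_Collect_less continuous_intros)
  then show "open U" using eq e by (cases "\<Omega> = {}") auto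
  show "\<Omega> \<subseteq> U" using \<delta> by (cases "\<Omega> = {}") (auto simp: eq)
  show "bounded U"
  proof (cases "\<Omega> = {}")
    case False
    obtain R where R: "\<And>x. x \<in> \<Omega> \<Longrightarrow> norm x \<le> R" using \<Omega>(2) unfolding bounded_iff by auto
    have "norm x \<le> R + \<delta>" if "x \<in> U" for x
    proof -
      have "infdist x \<Omega> < \<delta>" using that eq[OF False] by simp
      then obtain y where y: "y \<in> \<Omega>" "dist x y < \<delta>" using cInf_lessD[of "(dist x) ` \<Omega>" \<delta>] False by (auto simp: infdist_notempty)
      then show ?thesis using R[OF y(1)] norm_triangle_ineq[of "x - y" y] by (simp add: dist_norm)
    qed
    then show ?thesis unfolding bounded_iff by blast
  next
    case True
    have "U = {}" by (rule e[OF True])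
    then show ?thesis by (simp only: bounded_empty)
  qed
qed

lemmas domainU = slow_fast_domain[OF U(1,2)]

lemma diffeo_n: "C1_diffeo_cl (\<Omega>h n) (\<psi> n)"
  using lpt by (simp add: locally_periodic_transformations_def Let_def \<Omega>h_def)

lemma diffeo_n_facts:
  "\<psi> n \<in> C1_cl (\<Omega>h n)" "inj_on (\<psi> n) (\<Omega>h n)" "continuous_on (\<Omega>h n) (\<psi> n)"
  "x \<in> \<Omega>h n \<Longrightarrow> (\<psi> n has_derivative (\<lambda>h. jacobian (\<psi> n) (at x) *v h)) (at x)"
  "x \<in> \<Omega>h n \<Longrightarrow> grad n x = jacobian (\<psi> n) (at x) - mat 1" "x \<in> \<Omega>h n \<Longrightarrow> J n x = det (mat 1 + grad n x)"
proof -
  show c: "\<psi> n \<in> C1_cl (\<Omega>h n)" using diffeo_n by (simp add: C1_diffeo_cl_def)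
  have "inj_on (\<psi> n) (closure (\<Omega>h n))" using diffeo_n by (auto simp: C1_diffeo_cl_def bij_betw_def)
  then show "inj_on (\<psi> n) (\<Omega>h n)" by (rule inj_on_subset) (rule closure_subset)
  show "continuous_on (\<Omega>h n) (\<psi> n)" using c closure_subset by (auto simp: C1_cl_def intro: continuous_on_subset)
  show "x \<in> \<Omega>h n \<Longrightarrow> (\<psi> n has_derivative (\<lambda>h. jacobian (\<psi> n) (at x) *v h)) (at x)"
    using c by (simp add: C1_cl_def jacobian_works[symmetric])
  show g: "x \<in> \<Omega>h n \<Longrightarrow> grad n x = jacobian (\<psi> n) (at x) - mat 1"
    using c by (simp add: grad_def jacobian_cl_def C1_cl_def jacobian_minus_id)
  then show "x \<in> \<Omega>h n \<Longrightarrow> J n x = det (mat 1 + grad n x)" by (simp add: J_def)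
qed

lemma jacobian_lower_bound: "\<exists>c>0. c \<le> 1 \<and> (\<forall>n. \<forall>x\<in>\<Omega>h n. c \<le> J n x)"
proof -
  obtain c where c: "0 < c" "\<And>n x. x \<in> closure (\<Omega>h n) \<Longrightarrow> c \<le> det (jacobian_cl (\<Omega>h n) (\<psi> n) x)"
    using lpt by (auto simp: locally_periodic_transformations_def Let_def \<Omega>h_def)
  have "c \<le> J n x" if "x \<in> \<Omega>h n" for n x
    using c(2)[of x n] that closure_subset by (auto simp: J_def jacobian_cl_def)
  then show ?thesis using c(1) by (intro exI[of _ "min c 1"]) force
qed

text \<open>The bound \<open>cJ \<le> 1\<close> makes truncation at \<open>cJ\<close> harmless where the transformation is the identity.\<close>

definition "cJ = (SOME c. 0 < c \<and> c \<le> 1 \<and> (\<forall>n. \<forall>x\<in>\<Omega>h n. c \<le> J n x))"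

lemma cJ: "0 < cJ" "cJ \<le> 1" "x \<in> \<Omega>h n \<Longrightarrow> cJ \<le> J n x"
proof -
  have "0 < cJ \<and> cJ \<le> 1 \<and> (\<forall>n. \<forall>x\<in>\<Omega>h n. cJ \<le> J n x)"
    unfolding cJ_def by (rule someI_ex) (use jacobian_lower_bound in blast)
  then show "0 < cJ" "cJ \<le> 1" "x \<in> \<Omega>h n \<Longrightarrow> cJ \<le> J n x" by auto
qed

lemma displacement_bound: "\<exists>C>0. (\<forall>n. \<forall>x\<in>\<Omega>h n. norm (\<psi> n x - x) \<le> C * \<epsilon> n) \<and> (\<forall>n x. norm (disp n x) \<le> C) \<and> (\<forall>n x. norm (grad n x) \<le> C)"
proof -
  obtain C where C: "0 < C" "\<And>n. inverse (\<epsilon> n) * C_norm (closure (\<Omega>h n)) (\<lambda>x. \<psi> n x - x) +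
            C_norm (closure (\<Omega>h n)) (jacobian_cl (\<Omega>h n) (\<lambda>x. \<psi> n x - x)) \<le> C"
    using lpt by (auto simp: locally_periodic_transformations_def Let_def \<Omega>h_def)
  have c1: "continuous_on (closure (\<Omega>h n)) (\<lambda>x. \<psi> n x - x)" for n
    using diffeo_n_facts(1)[of n] by (auto simp: C1_cl_def intro: continuous_intros)
  have c2: "continuous_on (closure (\<Omega>h n)) (jacobian_cl (\<Omega>h n) (\<lambda>x. \<psi> n x - x))" for n
  proof -
    have "continuous_on (closure (\<Omega>h n)) (\<lambda>x. jacobian_cl (\<Omega>h n) (\<psi> n) x - mat 1)"
      using diffeo_n_facts(1)[of n] by (auto simp: C1_cl_def intro: continuous_intros)
    then show ?thesis
      by (rule continuous_on_eq) (simp add: jacobian_cl_minus_id[OF \<Omega>h(1) diffeo_n_facts(1)])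
  qed
  note n1 = C_norm_upper[OF \<Omega>h(5) c1] and n2 = C_norm_upper[OF \<Omega>h(5) c2]
  have a: "inverse (\<epsilon> n) * norm (\<psi> n x - x) \<le> C" and b: "norm (jacobian_cl (\<Omega>h n) (\<lambda>x. \<psi> n x - x) x) \<le> C"
    if "x \<in> \<Omega>h n" for n x
  proof -
    have x: "x \<in> closure (\<Omega>h n)" using that closure_subset by blast
    have i: "0 \<le> inverse (\<epsilon> n)" using \<epsilon>(1)[of n] by simp
    show "inverse (\<epsilon> n) * norm (\<psi> n x - x) \<le> C"
      using mult_left_mono[OF n1(2)[OF x] i] n2(1)[of n] C(2)[of n] by linarith
    show "norm (jacobian_cl (\<Omega>h n) (\<lambda>x. \<psi> n x - x) x) \<le> C"
      using mult_nonneg_nonneg[OF i n1(1)[of n]] n2(2)[OF x] C(2)[of n] by linarith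
  qed
  have "norm (\<psi> n x - x) \<le> C * \<epsilon> n" if "x \<in> \<Omega>h n" for n x
    using a[OF that] \<epsilon>(1)[of n] by (simp add: field_simps)
  moreover have "norm (disp n x) \<le> C" for n x
    using a[of x n] C(1) \<epsilon>(1)[of n] by (auto simp: disp_def)
  moreover have "norm (grad n x) \<le> C" for n x
    using b[of x n] C(1) by (auto simp: grad_def)
  ultimately show ?thesis using C(1) by blast
qed

lemma eventually_displacement_small:
  assumes "0 < r"
  shows "\<forall>\<^sub>F n in sequentially. \<forall>x\<in>\<Omega>h n. norm (\<psi> n x - x) < r"
proof -
  obtain C where C: "0 < C" "\<And>n x. x \<in> \<Omega>h n \<Longrightarrow> norm (\<psi> n x - x) \<le> C * \<epsilon> n" using displacement_bound by blast
  have "(\<lambda>n. C * \<epsilon> n) \<longlonglongrightarrow> C * 0" by (intro tendsto_intros \<epsilon>(2))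
  then have "\<forall>\<^sub>F n in sequentially. C * \<epsilon> n < r" using assms by (intro order_tendstoD(2)) auto
  then show ?thesis by (rule eventually_mono) (use C(2) in fastforce)
qed

lemma eventually_\<Omega>e_subset: "\<forall>\<^sub>F n in sequentially. \<Omega>e n \<subseteq> U"
  using eventually_displacement_small[OF \<delta>]
proof eventually_elim
  case (elim n)
  show ?case
  proof
    fix y assume "y \<in> \<Omega>e n"
    then obtain x where x: "x \<in> \<Omega>h n" "y = \<psi> n x" by (auto simp: \<Omega>e_def)
    have "x \<in> \<Omega>" using x \<Omega>h(2) by blast
    moreover have "dist y x < \<delta>" using elim x by (simp add: dist_norm)
    ultimately have "infdist y \<Omega> < \<delta>" using infdist_le[of x \<Omega> y] by simp
    then show "y \<in> U" using \<open>x \<in> \<Omega>\<close> by (auto simp: U_def neighbourhood_def)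
  qed
qed

lemma grad_measurable: "grad n \<in> borel_measurable (lebesgue_on S)"
proof -
  have "continuous_on (\<Omega>h n) (\<lambda>x. jacobian_cl (\<Omega>h n) (\<psi> n) x - mat 1)"
    using diffeo_n_facts(1)[of n] closure_subset by (auto simp: C1_cl_def intro!: continuous_intros intro: continuous_on_subset)
  then have "continuous_on (\<Omega>h n) (jacobian_cl (\<Omega>h n) (\<lambda>x. \<psi> n x - x))"
    by (rule continuous_on_eq) (simp add: jacobian_cl_minus_id[OF \<Omega>h(1) diffeo_n_facts(1) subsetD[OF closure_subset]])
  then have "jacobian_cl (\<Omega>h n) (\<lambda>x. \<psi> n x - x) \<in> borel_measurable (lebesgue_on (\<Omega>h n))"
    by (rule continuous_imp_measurable_on_sets_lebesgue[OF _ \<Omega>h(4)])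
  from borel_measurable_if_I[OF this \<Omega>h(4)] show ?thesis
    unfolding grad_def[abs_def] by (rule measurable_restrict_space1)
qed

lemma J_measurable: "J n \<in> borel_measurable (lebesgue_on (\<Omega>h n))"
proof -
  have "(\<lambda>x. det (mat 1 + grad n x)) \<in> borel_measurable (lebesgue_on (\<Omega>h n))"
    by (rule measurable_compose[OF grad_measurable borel_measurable_continuous_onI[OF continuous_det_plus_id]])
  then show ?thesis by (rule measurable_cong[THEN iffD1, rotated]) (simp add: diffeo_n_facts(6))
qed

lemma compose_\<psi>_measurable:
  assumes "continuous_on UNIV \<Theta>"
  shows "(\<lambda>x. \<Theta> (\<psi> n x) :: real) \<in> borel_measurable (lebesgue_on (\<Omega>h n))"
  by (rule continuous_imp_measurable_on_sets_lebesgue[OF continuous_on_compose2[OF assms diffeo_n_facts(3)] \<Omega>h(4)]) simp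

lemma determinant_bound:
  obtains M where "0 < M" "\<And>b::real^'n^'n. norm b \<le> C \<Longrightarrow> \<bar>det (mat 1 + b)\<bar> \<le> M"
proof -
  have "bounded ((\<lambda>b::real^'n^'n. det (mat 1 + b)) ` cball 0 C)"
    by (intro compact_imp_bounded compact_continuous_image continuous_on_subset[OF continuous_det_plus_id]) auto
  then obtain M where M: "\<forall>t\<in>(\<lambda>b::real^'n^'n. det (mat 1 + b)) ` cball 0 C. norm t \<le> M" unfolding bounded_iff by blast
  have "\<bar>det (mat 1 + b)\<bar> \<le> max M 1" if "norm b \<le> C" for b :: "real^'n^'n"
  proof -
    have "norm (det (mat 1 + b)) \<le> M" by (rule bspec[OF M imageI]) (use that in simp)
    then show ?thesis by (simp add: le_max_iff_disj)
  qed
  then show ?thesis using that[of "max M 1"] by simp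
qed

lemma J_bounded: obtains M where "0 < M" "\<And>n x. x \<in> \<Omega>h n \<Longrightarrow> J n x \<le> M"
proof -
  obtain C where C: "\<And>n x. norm (grad n x) \<le> C" using displacement_bound by blast
  obtain M where M: "0 < M" "\<And>b::real^'n^'n. norm b \<le> C \<Longrightarrow> \<bar>det (mat 1 + b)\<bar> \<le> M" using determinant_bound by blast
  have "J n x \<le> M" if "x \<in> \<Omega>h n" for n x using M(2)[OF C, of n x] diffeo_n_facts(6)[OF that] by simp
  then show ?thesis using that M(1) by blast
qed

lemma set_integrable_lebesgue_on:
  "S \<in> sets lebesgue \<Longrightarrow> f absolutely_integrable_on S \<longleftrightarrow> integrable (lebesgue_on S) (f :: real^'n \<Rightarrow> real)"
  "S \<in> sets lebesgue \<Longrightarrow> set_lebesgue_integral lebesgue S f = (\<integral>x. f x \<partial>lebesgue_on S)"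
  by (simp_all add: set_integrable_def set_lebesgue_integral_def integrable_restrict_space integral_restrict_space)

text \<open>Measurability of the transformed domain is itself a consequence of the change of variables, applied
  to the constant \<open>1\<close>.\<close>

lemma change_of_variables_n:
  fixes f :: "real^'n \<Rightarrow> real"
  shows "\<Omega>e n \<in> sets lebesgue" "bounded (\<Omega>e n)"
    and "integrable (lebesgue_on (\<Omega>e n)) f \<longleftrightarrow> integrable (lebesgue_on (\<Omega>h n)) (\<lambda>x. J n x * f (\<psi> n x))"
    and "(\<integral>y. f y \<partial>lebesgue_on (\<Omega>e n)) = (\<integral>x. J n x * f (\<psi> n x) \<partial>lebesgue_on (\<Omega>h n))"
proof -
  have der: "\<And>x. x \<in> \<Omega>h n \<Longrightarrow> (\<psi> n has_derivative (\<lambda>h. jacobian (\<psi> n) (at x) *v h)) (at x within \<Omega>h n)"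
    by (rule has_derivative_at_withinI[OF diffeo_n_facts(4)])
  have cv1: "f absolutely_integrable_on \<Omega>e n \<longleftrightarrow> (\<lambda>x. \<bar>det (jacobian (\<psi> n) (at x))\<bar> * f (\<psi> n x)) absolutely_integrable_on \<Omega>h n" for f :: "real^'n \<Rightarrow> real"
    unfolding \<Omega>e_def by (rule integrable_change_of_variables(1)[OF \<Omega>h(4) der diffeo_n_facts(2)])
  have cv2: "set_lebesgue_integral lebesgue (\<Omega>e n) f = set_lebesgue_integral lebesgue (\<Omega>h n) (\<lambda>x. \<bar>det (jacobian (\<psi> n) (at x))\<bar> * f (\<psi> n x))"
    if "f absolutely_integrable_on \<Omega>e n" for f :: "real^'n \<Rightarrow> real"
    unfolding \<Omega>e_def by (rule integrable_change_of_variables(2)[OF \<Omega>h(4) der diffeo_n_facts(2)]) (use that in \<open>simp_all add: \<Omega>e_def\<close>)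
  have absJ: "\<bar>det (jacobian (\<psi> n) (at x))\<bar> = J n x" if "x \<in> \<Omega>h n" for x
    using cJ(3)[OF that] cJ(1) by (simp add: J_def)
  obtain M where M: "\<And>n x. x \<in> \<Omega>h n \<Longrightarrow> J n x \<le> M" using J_bounded by blast
  have "integrable (lebesgue_on (\<Omega>h n)) (J n)"
    by (rule bounded_integrable[OF J_measurable _ \<Omega>h(3,4), of _ M])
       (use M cJ order_trans[OF less_imp_le[OF cJ(1)] cJ(3)] in \<open>auto intro!: AE_I2\<close>)
  also have "integrable (lebesgue_on (\<Omega>h n)) (J n) \<longleftrightarrow> integrable (lebesgue_on (\<Omega>h n)) (\<lambda>x. \<bar>det (jacobian (\<psi> n) (at x))\<bar> * 1)"
    by (rule Bochner_Integration.integrable_cong) (simp_all add: absJ)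
  finally have "integrable (lebesgue_on (\<Omega>h n)) (\<lambda>x. \<bar>det (jacobian (\<psi> n) (at x))\<bar> * 1)" .
  then have "(\<lambda>_. 1 :: real) absolutely_integrable_on \<Omega>e n"
    using cv1[of "\<lambda>_. 1"] set_integrable_lebesgue_on(1)[OF \<Omega>h(4)] by simp
  then have "(indicator (\<Omega>e n) :: _ \<Rightarrow> real) \<in> borel_measurable lebesgue"
    unfolding set_integrable_def by (auto dest: borel_measurable_integrable)
  then show m: "\<Omega>e n \<in> sets lebesgue" by (simp add: borel_measurable_indicator_iff)
  have "compact (\<psi> n ` closure (\<Omega>h n))"
    using diffeo_n_facts(1)[of n] by (intro compact_continuous_image \<Omega>h(5)) (simp add: C1_cl_def)
  then show "bounded (\<Omega>e n)"
    by (rule bounded_subset[OF compact_imp_bounded]) (use closure_subset in \<open>auto simp: \<Omega>e_def\<close>)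
  have c1: "integrable (lebesgue_on (\<Omega>h n)) (\<lambda>x. \<bar>det (jacobian (\<psi> n) (at x))\<bar> * f (\<psi> n x)) \<longleftrightarrow> integrable (lebesgue_on (\<Omega>h n)) (\<lambda>x. J n x * f (\<psi> n x))"
    by (rule Bochner_Integration.integrable_cong) (simp_all add: absJ)
  show iff: "integrable (lebesgue_on (\<Omega>e n)) f \<longleftrightarrow> integrable (lebesgue_on (\<Omega>h n)) (\<lambda>x. J n x * f (\<psi> n x))"
    using cv1[of f] c1 by (simp add: set_integrable_lebesgue_on(1)[OF m] set_integrable_lebesgue_on(1)[OF \<Omega>h(4)])
  show "(\<integral>y. f y \<partial>lebesgue_on (\<Omega>e n)) = (\<integral>x. J n x * f (\<psi> n x) \<partial>lebesgue_on (\<Omega>h n))"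
  proof (cases "integrable (lebesgue_on (\<Omega>e n)) f")
    case True
    then have "f absolutely_integrable_on \<Omega>e n" using set_integrable_lebesgue_on(1)[OF m] by simp
    from cv2[OF this] have "(\<integral>y. f y \<partial>lebesgue_on (\<Omega>e n)) = (\<integral>x. \<bar>det (jacobian (\<psi> n) (at x))\<bar> * f (\<psi> n x) \<partial>lebesgue_on (\<Omega>h n))"
      by (simp add: set_integrable_lebesgue_on(2)[OF m] set_integrable_lebesgue_on(2)[OF \<Omega>h(4)])
    also have "\<dots> = (\<integral>x. J n x * f (\<psi> n x) \<partial>lebesgue_on (\<Omega>h n))"
      by (rule Bochner_Integration.integral_cong) (simp_all add: absJ)
    finally show ?thesis .
  next
    case False
    then show ?thesis using iff by (simp add: not_integrable_integral_eq)
  qed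
qed

section \<open>Strong convergence of the transformation data\<close>

lemma disp_components:
  assumes "b \<in> Basis"
  shows "strongly_approximable \<epsilon> \<Omega> (\<lambda>n x. disp n x \<bullet> b) (\<lambda>z. disp0 z \<bullet> b)"
proof -
  obtain i where b: "b = axis i 1" using assms by (auto simp: Basis_vec_def)
  have "\<forall>q>1. \<forall>i. two_scale_strong \<epsilon> q \<Omega>
              (\<lambda>n. zero_ext (\<Omega>h n) (\<lambda>x. inverse (\<epsilon> n) * (\<psi> n x - x) $ i))
              (zero_ext (\<Omega> \<times> Ys) (\<lambda>(x, y). (\<psi>0 x y - y) $ i))"
    using lpt by (simp add: locally_periodic_transformations_def Let_def \<Omega>h_def)
  then have "two_scale_strong \<epsilon> 2 \<Omega> (\<lambda>n. zero_ext (\<Omega>h n) (\<lambda>x. inverse (\<epsilon> n) * (\<psi> n x - x) $ i))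
              (zero_ext (\<Omega> \<times> Ys) (\<lambda>(x, y). (\<psi>0 x y - y) $ i))" by simp
  also have "(\<lambda>n. zero_ext (\<Omega>h n) (\<lambda>x. inverse (\<epsilon> n) * (\<psi> n x - x) $ i)) = (\<lambda>n x. disp n x \<bullet> b)"
    by (auto simp: fun_eq_iff zero_ext_def disp_def b inner_axis)
  also have "(zero_ext (\<Omega> \<times> Ys) (\<lambda>(x, y). (\<psi>0 x y - y) $ i)) = (\<lambda>z. disp0 z \<bullet> b)"
    by (auto simp: fun_eq_iff zero_ext_def disp0_def b inner_axis)
  finally have s: "two_scale_strong \<epsilon> 2 \<Omega> (\<lambda>n x. disp n x \<bullet> b) (\<lambda>z. disp0 z \<bullet> b)" .
  obtain C where "\<And>n x. norm (disp n x) \<le> C" using displacement_bound by blast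
  then have "\<bar>disp n x \<bullet> b\<bar> \<le> C" for n x using order_trans[OF Basis_le_norm[OF assms]] by blast
  then show ?thesis by (rule two_scale_strong_approximable[OF s \<Omega> \<epsilon>])
qed

lemma grad_components:
  assumes "b \<in> Basis"
  shows "strongly_approximable \<epsilon> \<Omega> (\<lambda>n x. grad n x \<bullet> b) (\<lambda>z. grad0 z \<bullet> b)"
proof -
  obtain i j where b: "b = axis i (axis j 1)" using assms by (auto simp: Basis_vec_def)
  have "\<forall>q>1. \<forall>i j. two_scale_strong \<epsilon> q \<Omega>
              (\<lambda>n. zero_ext (\<Omega>h n) (\<lambda>x. jacobian_cl (\<Omega>h n) (\<lambda>x. \<psi> n x - x) x $ i $ j))
              (zero_ext (\<Omega> \<times> Ys) (\<lambda>(x, y). jacobian_cl Ys (\<lambda>y. \<psi>0 x y - y) y $ i $ j))"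
    using lpt by (simp add: locally_periodic_transformations_def Let_def \<Omega>h_def)
  then have "two_scale_strong \<epsilon> 2 \<Omega> (\<lambda>n. zero_ext (\<Omega>h n) (\<lambda>x. jacobian_cl (\<Omega>h n) (\<lambda>x. \<psi> n x - x) x $ i $ j))
              (zero_ext (\<Omega> \<times> Ys) (\<lambda>(x, y). jacobian_cl Ys (\<lambda>y. \<psi>0 x y - y) y $ i $ j))" by simp
  also have "(\<lambda>n. zero_ext (\<Omega>h n) (\<lambda>x. jacobian_cl (\<Omega>h n) (\<lambda>x. \<psi> n x - x) x $ i $ j)) = (\<lambda>n x. grad n x \<bullet> b)"
    by (auto simp: fun_eq_iff zero_ext_def grad_def b inner_axis)
  also have "(zero_ext (\<Omega> \<times> Ys) (\<lambda>(x, y). jacobian_cl Ys (\<lambda>y. \<psi>0 x y - y) y $ i $ j)) = (\<lambda>z. grad0 z \<bullet> b)"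
    by (auto simp: fun_eq_iff zero_ext_def grad0_def b inner_axis)
  finally have s: "two_scale_strong \<epsilon> 2 \<Omega> (\<lambda>n x. grad n x \<bullet> b) (\<lambda>z. grad0 z \<bullet> b)" .
  obtain C where "\<And>n x. norm (grad n x) \<le> C" using displacement_bound by blast
  then have "\<bar>grad n x \<bullet> b\<bar> \<le> C" for n x using order_trans[OF Basis_le_norm[OF assms]] by blast
  then show ?thesis by (rule two_scale_strong_approximable[OF s \<Omega> \<epsilon>])
qed

lemmas strongly_approximable_disp = strongly_approximable_componentwise[OF \<Omega> disp_components]

lemmas strongly_approximable_grad = strongly_approximable_componentwise[OF \<Omega> grad_components]

lemma slow_test_function: "continuous_on UNIV \<Theta> \<Longrightarrow> test_function (\<lambda>x y. \<Theta> x)"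
  by (auto simp: test_function_def cell_periodic_def intro!: continuous_on_compose2[of UNIV \<Theta> _ fst] continuous_on_fst continuous_on_id)

lemma vanishing_imp_bounded:
  fixes \<Theta> :: "real^'n \<Rightarrow> real"
  assumes "continuous_on UNIV \<Theta>" "bounded W" "\<And>x. x \<notin> W \<Longrightarrow> \<Theta> x = 0"
  obtains B where "0 \<le> B" "\<And>x. \<bar>\<Theta> x\<bar> \<le> B"
proof -
  have "bounded (\<Theta> ` closure W)"
    using assms(2) by (intro compact_imp_bounded compact_continuous_image continuous_on_subset[OF assms(1)]) auto
  then obtain B where B: "\<forall>t\<in>\<Theta> ` closure W. norm t \<le> B" unfolding bounded_iff by blast
  have "\<bar>\<Theta> x\<bar> \<le> max B 0" for x
  proof (cases "x \<in> W")
    case True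
    then have "norm (\<Theta> x) \<le> B" using B closure_subset by blast
    then show ?thesis by (simp add: le_max_iff_disj)
  qed (simp add: assms(3))
  then show ?thesis using that[of "max B 0"] by simp
qed

text \<open>Extended by \<open>\<Theta>\<close> itself outside the perforated domain, where \<open>\<psi> n\<close> has no meaning, so that it is
  uniformly close to \<open>\<Theta>\<close> on all of \<open>\<Omega>\<close>.\<close>

definition "moved \<Theta> n x = (if x \<in> \<Omega>h n then \<Theta> (\<psi> n x) else \<Theta> x :: real)"

lemma strongly_approximable_moved:
  assumes c: "continuous_on UNIV \<Theta>" and W: "bounded W" "\<And>x. x \<notin> W \<Longrightarrow> \<Theta> x = 0"
  shows "strongly_approximable \<epsilon> \<Omega> (moved \<Theta>) (\<lambda>z. \<Theta> (fst z))"
proof -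
  obtain B where B: "\<And>x. \<bar>\<Theta> x\<bar> \<le> B" using vanishing_imp_bounded[OF c W] by blast
  note t = slow_test_function[OF c]
  show ?thesis
  proof (rule strongly_approximable_uniform[OF \<Omega> t, where C=B])
    show "moved \<Theta> n \<in> borel_measurable (lebesgue_on \<Omega>)" for n
    proof -
      have "(\<lambda>x. \<Theta> (\<psi> n x) - \<Theta> x) \<in> borel_measurable (lebesgue_on (\<Omega>h n))"
        by (rule borel_measurable_diff[OF compose_\<psi>_measurable[OF c] continuous_imp_measurable_lebesgue_on[OF c]])
      from borel_measurable_add[OF zero_ext_measurable[OF \<Omega>h(4) this] continuous_imp_measurable_lebesgue_on[OF c]]
      have "(\<lambda>x. zero_ext (\<Omega>h n) (\<lambda>x. \<Theta> (\<psi> n x) - \<Theta> x) x + \<Theta> x) \<in> borel_measurable (lebesgue_on \<Omega>)" .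
      also have "(\<lambda>x. zero_ext (\<Omega>h n) (\<lambda>x. \<Theta> (\<psi> n x) - \<Theta> x) x + \<Theta> x) = moved \<Theta> n"
        by (auto simp: zero_ext_def moved_def)
      finally show ?thesis .
    qed
    show "norm (moved \<Theta> n x) \<le> B" for n x using B by (simp add: moved_def)
    fix \<eta> :: real assume \<eta>: "0 < \<eta>"
    obtain d where d: "0 < d" "\<And>x x'. x \<in> \<Omega> \<Longrightarrow> norm (x' - x) < d \<Longrightarrow> norm (\<Theta> x' - \<Theta> x) < \<eta>"
      using test_function_uniform(2)[OF t \<Omega>(2) \<eta>] by blast
    show "\<forall>\<^sub>F n in sequentially. \<forall>x\<in>\<Omega>. norm (moved \<Theta> n x - \<Theta> x) \<le> \<eta>"
      using eventually_displacement_small[OF d(1)]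
    proof eventually_elim
      case (elim n)
      show ?case
      proof
        fix x assume "x \<in> \<Omega>"
        then show "norm (moved \<Theta> n x - \<Theta> x) \<le> \<eta>"
          using d(2)[of x "\<psi> n x"] elim \<eta> by (auto simp: moved_def less_imp_le)
      qed
    qed
  qed
qed

abbreviation "tiling_ind \<equiv> indicator tiling :: real^'n \<Rightarrow> real"

lemma tiling_ind: "tiling_ind \<in> borel_measurable borel" "cell_periodic tiling_ind" "\<And>y. \<bar>tiling_ind y\<bar> \<le> 1"
proof -
  show "tiling_ind \<in> borel_measurable borel" by (intro borel_measurable_indicator borel_open periodic_hull_open)
  show "cell_periodic tiling_ind" using periodic_hull_periodic by (auto simp: cell_periodic_def indicator_def)
qed (simp add: indicator_def)

lemma tiling_two_scale_weak: "two_scale_weak \<epsilon> 2 \<Omega> (\<lambda>n x. tiling_ind (x /\<^sub>R \<epsilon> n)) (\<lambda>z. tiling_ind (snd z))"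
  by (rule two_scale_weak_oscillation[OF tiling_ind _ \<Omega> \<epsilon>]) simp

text \<open>The negative part of \<open>det - cJ\<close> vanishes along the sequence on the tiling; pair it with the
  indicator of the tiling, which converges weakly.\<close>

lemma limit_jacobian_ge: "AE z in lebesgue_on (\<Omega> \<times> unit_cell). snd z \<in> tiling \<longrightarrow> cJ \<le> det (mat 1 + grad0 z)"
proof -
  let ?M = "lebesgue_on (\<Omega> \<times> (unit_cell :: (real^'n) set))"
  let ?G = "\<lambda>(y::real^'n) (b::real^'n^'n). max 0 (cJ - det (mat 1 + b))"
  have p2: "(1::real) < 2" by simp
  have G: "continuous_on UNIV (\<lambda>z. ?G (fst z) (snd z))"
    by (intro continuous_intros continuous_on_compose2[OF continuous_det_plus_id]) auto
  have per: "cell_periodic (\<lambda>y. ?G y b)" for b by (simp add: cell_periodic_def)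
  note lim = weak_strong_pairing[OF tiling_two_scale_weak strongly_approximable_grad G per p2 \<Omega>]
  have "(\<integral>x. tiling_ind (x /\<^sub>R \<epsilon> n) * ?G (x /\<^sub>R \<epsilon> n) (grad n x) \<partial>lebesgue_on \<Omega>) = 0" for n
  proof (rule integral_eq_zero_AE, rule AE_I2)
    fix x assume "x \<in> space (lebesgue_on \<Omega>)"
    then show "tiling_ind (x /\<^sub>R \<epsilon> n) * ?G (x /\<^sub>R \<epsilon> n) (grad n x) = 0"
      using cJ(3)[of x n] diffeo_n_facts(6)[of x n] by (auto simp: mem_\<Omega>h_iff indicator_def)
  qed
  then have "(\<integral>z. tiling_ind (snd z) * ?G (snd z) (grad0 z) \<partial>?M) = 0"
    using lim(1) by (simp add: LIMSEQ_const_iff)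
  then have "AE z in ?M. tiling_ind (snd z) * ?G (snd z) (grad0 z) = 0"
    using integral_nonneg_eq_0_iff_AE[OF lim(2)] by (simp add: indicator_def)
  then show ?thesis by (rule eventually_mono) (auto simp: indicator_def max_def split: if_splits)
qed

lemma Ys_tiling: "Ys \<subseteq> tiling"
  by (rule subset_periodic_hull[OF Ys(1)])

lemma limit_diffeo: "AE x in lebesgue_on \<Omega>. C1_diffeo_cl Ys (\<psi>0 x) \<and> \<psi>0 x ` Ys \<subseteq> unit_cell"
  using lpt by (simp add: locally_periodic_transformations_def Let_def)

lemma restrict_measurable:
  assumes "f \<in> borel_measurable (lebesgue_on (\<Omega> \<times> unit_cell))"
  shows "f \<in> borel_measurable (lebesgue_on (\<Omega> \<times> Ys))"
  using assms by (rule measurable_restrict_mono) (use Ys in auto)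

lemma AE_restrict_Ys:
  assumes "AE z in lebesgue_on (\<Omega> \<times> unit_cell). P z"
  shows "AE z in lebesgue_on (\<Omega> \<times> Ys). P z"
proof -
  have "\<Omega> \<times> Ys \<in> sets lebesgue" by (rule borel_Times_lebesgue(1)[OF domain(1)]) (use Ys in simp)
  then show ?thesis using assms domain(3) Ys(2) by (auto simp: AE_lebesgue_on_iff elim: eventually_mono)
qed

lemma grad0_on_Ys:
  "AE z in lebesgue_on (\<Omega> \<times> Ys). grad0 z = jacobian (\<psi>0 (fst z)) (at (snd z)) - mat 1"
proof -
  have S: "\<Omega> \<times> Ys \<in> sets lebesgue" by (rule borel_Times_lebesgue(1)[OF domain(1)]) (use Ys in simp)
  have "AE z in lebesgue_on (\<Omega> \<times> Ys). C1_diffeo_cl Ys (\<psi>0 (fst z)) \<and> \<psi>0 (fst z) ` Ys \<subseteq> unit_cell"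
    by (rule AE_fst_lebesgue_on[OF domain(1) _ limit_diffeo]) (use Ys in simp)
  then show ?thesis unfolding AE_lebesgue_on_iff[OF S]
    by (rule eventually_mono) (auto simp: grad0_def jacobian_cl_def C1_diffeo_cl_def C1_cl_def jacobian_minus_id)
qed

sublocale limit_transformation \<Omega> Ys \<psi>0 cJ
proof
  show "open \<Omega>" "bounded \<Omega>" "open Ys" "Ys \<subseteq> unit_cell" by (fact \<Omega> Ys)+
  show "AE x in lebesgue_on \<Omega>. C1_diffeo_cl Ys (\<psi>0 x) \<and> \<psi>0 x ` Ys \<subseteq> unit_cell" by (rule limit_diffeo)
  have S: "\<Omega> \<times> Ys \<in> sets lebesgue" by (rule borel_Times_lebesgue(1)[OF domain(1)]) (use Ys in simp)
  have d0: "disp0 \<in> borel_measurable (lebesgue_on (\<Omega> \<times> Ys))" and g0: "grad0 \<in> borel_measurable (lebesgue_on (\<Omega> \<times> Ys))"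
    using strongly_approximable_disp strongly_approximable_grad
    by (auto simp: strongly_approximable_def intro: restrict_measurable)
  show "(\<lambda>z. \<psi>0 (fst z) (snd z) $ i) \<in> borel_measurable (lebesgue_on (\<Omega> \<times> Ys))" for i
  proof -
    have "(\<lambda>z. disp0 z \<bullet> axis i 1 + snd z $ i) \<in> borel_measurable (lebesgue_on (\<Omega> \<times> Ys))"
      by (rule borel_measurable_add[OF borel_measurable_inner[OF d0 borel_measurable_const]])
         (rule continuous_imp_measurable_lebesgue_on, intro continuous_intros)
    then show ?thesis by (rule measurable_cong[THEN iffD1, rotated]) (auto simp: disp0_def inner_axis)
  qed
  have eq: "AE z in lebesgue_on (\<Omega> \<times> Ys). det (mat 1 + grad0 z) = det (jacobian (\<psi>0 (fst z)) (at (snd z)))"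
    using grad0_on_Ys by (rule eventually_mono) simp
  have "(\<lambda>z. det (mat 1 + grad0 z)) \<in> borel_measurable (lebesgue_on (\<Omega> \<times> Ys))"
    by (rule measurable_compose[OF g0 borel_measurable_continuous_onI[OF continuous_det_plus_id]])
  then show "(\<lambda>z. det (jacobian (\<psi>0 (fst z)) (at (snd z)))) \<in> borel_measurable (lebesgue_on (\<Omega> \<times> Ys))"
    by (rule borel_measurable_lebesgue_on_AE[OF S _ eq])
  show "AE z in lebesgue_on (\<Omega> \<times> Ys). cJ \<le> det (jacobian (\<psi>0 (fst z)) (at (snd z)))"
  proof -
    have inS: "AE z in lebesgue_on (\<Omega> \<times> Ys). z \<in> \<Omega> \<times> Ys" by (intro AE_I2) simp
    show ?thesis using AE_restrict_Ys[OF limit_jacobian_ge] eq inS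
      by eventually_elim (use Ys_tiling in auto)
  qed
  show "0 < cJ" by (rule cJ)
qed

lemma J0_eq: "AE z in lebesgue_on (\<Omega> \<times> Ys). J0 z = det (mat 1 + grad0 z)"
  using grad0_on_Ys by (rule eventually_mono) (simp add: J0_def)

lemma J0_bounded: obtains M where "0 < M" "AE z in lebesgue_on (\<Omega> \<times> Ys). J0 z \<le> M"
proof -
  obtain C where C: "AE z in lebesgue_on (\<Omega> \<times> unit_cell). norm (grad0 z) \<le> C"
    using strongly_approximable_grad unfolding strongly_approximable_def by blast
  obtain M where M: "0 < M" "\<And>b::real^'n^'n. norm b \<le> C \<Longrightarrow> \<bar>det (mat 1 + b)\<bar> \<le> M" using determinant_bound by blast
  have "AE z in lebesgue_on (\<Omega> \<times> Ys). J0 z \<le> M"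
    using AE_restrict_Ys[OF C] J0_eq by eventually_elim (use M(2) abs_le_D1 in fastforce)
  then show ?thesis using that M(1) by blast
qed

end

section \<open>The two-scale limit of the transported sequence\<close>

lemma Lp_add:
  assumes f: "f \<in> Lp p S" and g: "g \<in> Lp p S" and p: "0 < p"
  shows "(\<lambda>x. f x + g x) \<in> Lp p S"
proof -
  have m: "f \<in> borel_measurable (lebesgue_on S)" "g \<in> borel_measurable (lebesgue_on S)"
    and i: "integrable (lebesgue_on S) (\<lambda>x. \<bar>f x\<bar> powr p)" "integrable (lebesgue_on S) (\<lambda>x. \<bar>g x\<bar> powr p)"
    using f g by (auto simp: Lp_def)
  have le: "\<bar>a + b\<bar> powr p \<le> 2 powr p * (\<bar>a\<bar> powr p + \<bar>b\<bar> powr p)" for a b :: real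
  proof -
    have "\<bar>a + b\<bar> powr p \<le> (2 * max \<bar>a\<bar> \<bar>b\<bar>) powr p" using p by (intro powr_mono2) auto
    also have "\<dots> = 2 powr p * max \<bar>a\<bar> \<bar>b\<bar> powr p" by (rule powr_mult)
    also have "max \<bar>a\<bar> \<bar>b\<bar> powr p \<le> \<bar>a\<bar> powr p + \<bar>b\<bar> powr p" by (auto simp: max_def)
    finally show ?thesis by simp
  qed
  have "integrable (lebesgue_on S) (\<lambda>x. \<bar>f x + g x\<bar> powr p)"
  proof (rule Bochner_Integration.integrable_bound)
    show "integrable (lebesgue_on S) (\<lambda>x. 2 powr p * (\<bar>f x\<bar> powr p + \<bar>g x\<bar> powr p))"
      by (intro integrable_mult_right Bochner_Integration.integrable_add i)
    show "(\<lambda>x. \<bar>f x + g x\<bar> powr p) \<in> borel_measurable (lebesgue_on S)" using m by measurable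
    show "AE x in lebesgue_on S. norm (\<bar>f x + g x\<bar> powr p) \<le> norm (2 powr p * (\<bar>f x\<bar> powr p + \<bar>g x\<bar> powr p))"
      using le by (intro AE_I2) simp
  qed
  then show ?thesis using m by (simp add: Lp_def)
qed

lemma integral_zero_ext_const:
  fixes f :: "'a::euclidean_space \<Rightarrow> real"
  assumes "S \<in> sets lebesgue" "U \<in> sets lebesgue" "S \<subseteq> U"
  shows "(\<integral>x. zero_ext S f x \<partial>lebesgue_on U) = (\<integral>x. f x \<partial>lebesgue_on S)"
    and "integrable (lebesgue_on U) (zero_ext S f) \<longleftrightarrow> integrable (lebesgue_on S) f"
  using integral_zero_ext[OF assms, of f "\<lambda>_. 1"] by simp_all

lemma integrable_lebesgue_on_subset:
  fixes f :: "'a::euclidean_space \<Rightarrow> real"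
  assumes f: "integrable (lebesgue_on U) f" and S: "S \<in> sets lebesgue" "U \<in> sets lebesgue" "S \<subseteq> U"
  shows "integrable (lebesgue_on S) f"
proof -
  have "integrable lebesgue (\<lambda>x. indicator S x *\<^sub>R (indicator U x *\<^sub>R f x))"
    by (rule integrable_mult_indicator) (use f S in \<open>simp_all add: integrable_restrict_space\<close>)
  moreover have "(\<lambda>x. indicator S x *\<^sub>R (indicator U x *\<^sub>R f x)) = (\<lambda>x. indicator S x *\<^sub>R f x)"
    using S(3) by (auto simp: fun_eq_iff indicator_def)
  ultimately show ?thesis using S by (simp add: integrable_restrict_space)
qed

lemma integral_split:
  fixes f g h :: "'a::euclidean_space \<Rightarrow> real"
  assumes "A \<in> sets lebesgue" "B \<in> sets lebesgue" "U \<in> sets lebesgue" "A \<subseteq> U" "B \<subseteq> U"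
    and "integrable (lebesgue_on A) f" "integrable (lebesgue_on B) g"
    and eq: "\<And>x. x \<in> U \<Longrightarrow> h x = zero_ext A f x + zero_ext B g x"
  shows "(\<integral>x. h x \<partial>lebesgue_on U) = (\<integral>x. f x \<partial>lebesgue_on A) + (\<integral>x. g x \<partial>lebesgue_on B)"
proof -
  have "(\<integral>x. h x \<partial>lebesgue_on U) = (\<integral>x. zero_ext A f x + zero_ext B g x \<partial>lebesgue_on U)"
    by (rule Bochner_Integration.integral_cong) (simp_all add: eq)
  also have "\<dots> = (\<integral>x. zero_ext A f x \<partial>lebesgue_on U) + (\<integral>x. zero_ext B g x \<partial>lebesgue_on U)"
    by (rule Bochner_Integration.integral_add) (simp_all add: integral_zero_ext_const assms)
  finally show ?thesis by (simp add: integral_zero_ext_const assms)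
qed

context transformed_domains
begin

abbreviation "leftover \<equiv> \<Omega> \<times> (unit_cell - Ys)"

lemma leftover: "leftover \<in> sets lebesgue" "leftover \<subseteq> \<Omega> \<times> unit_cell" "bounded leftover"
proof -
  show "leftover \<in> sets lebesgue" by (rule borel_Times_lebesgue(1)[OF domain(1)]) (use Ys in simp)
  show s: "leftover \<subseteq> \<Omega> \<times> unit_cell" by auto
  show "bounded leftover" by (rule bounded_subset[OF domain(4) s])
qed

lemma subset_U: "cells \<subseteq> U \<times> unit_cell" "leftover \<subseteq> U \<times> unit_cell"
  using cells_subset U(3) by auto

text \<open>The expected limit on the transformed domain: what lives on \<open>Ys\<close> moves with \<open>\<psi>0\<close>, while on the rest
  of the cell the displacement vanishes and nothing moves.\<close>

definition "push v0 z = zero_ext cells (\<lambda>q. v0 (back q)) z + zero_ext leftover v0 z"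

abbreviation "D0 z \<equiv> det (mat 1 + grad0 z)"

lemma D0_measurable: "D0 \<in> borel_measurable (lebesgue_on (\<Omega> \<times> unit_cell))"
proof -
  have "grad0 \<in> borel_measurable (lebesgue_on (\<Omega> \<times> unit_cell))"
    using strongly_approximable_grad unfolding strongly_approximable_def by blast
  then show ?thesis by (rule measurable_compose[OF _ borel_measurable_continuous_onI[OF continuous_det_plus_id]])
qed

lemma integrable_J0_times:
  assumes "integrable (lebesgue_on (\<Omega> \<times> Ys)) f"
  shows "integrable (lebesgue_on (\<Omega> \<times> Ys)) (\<lambda>z. J0 z * f z)"
proof -
  obtain M where M: "0 < M" "AE z in lebesgue_on (\<Omega> \<times> Ys). J0 z \<le> M" using J0_bounded by blast
  show ?thesis
  proof (rule Bochner_Integration.integrable_bound)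
    show "integrable (lebesgue_on (\<Omega> \<times> Ys)) (\<lambda>z. M * f z)" using assms by simp
    show "(\<lambda>z. J0 z * f z) \<in> borel_measurable (lebesgue_on (\<Omega> \<times> Ys))"
      by (rule borel_measurable_times[OF J0_measurable borel_measurable_integrable[OF assms]])
    show "AE z in lebesgue_on (\<Omega> \<times> Ys). norm (J0 z * f z) \<le> norm (M * f z)"
      using M(2) J0_ge
    proof eventually_elim
      case (elim z)
      then have "\<bar>J0 z\<bar> \<le> \<bar>M\<bar>" using cJ(1) by linarith
      then show ?case by (simp add: abs_mult mult_right_mono)
    qed
  qed
qed

lemma Lp_compose_back:
  assumes "f \<in> Lp p (\<Omega> \<times> Ys)"
  shows "(\<lambda>q. f (back q)) \<in> Lp p cells"
proof -
  have m: "f \<in> borel_measurable (lebesgue_on (\<Omega> \<times> Ys))" and i: "integrable (lebesgue_on (\<Omega> \<times> Ys)) (\<lambda>z. \<bar>f z\<bar> powr p)"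
    using assms by (auto simp: Lp_def)
  have "(\<lambda>z. \<bar>f z\<bar> powr p) \<in> borel_measurable (lebesgue_on (\<Omega> \<times> Ys))" by (rule borel_measurable_integrable[OF i])
  from integral_back(1)[OF this] integrable_J0_times[OF i]
  have "integrable (lebesgue_on cells) (\<lambda>q. \<bar>f (back q)\<bar> powr p)" by simp
  then show ?thesis using measurable_compose_back[OF m] by (simp add: Lp_def)
qed

lemma Lp_restrict:
  fixes f :: "(real^'n) \<times> (real^'n) \<Rightarrow> real"
  assumes "f \<in> Lp p (\<Omega> \<times> unit_cell)" "S \<in> sets lebesgue" "S \<subseteq> \<Omega> \<times> unit_cell"
  shows "f \<in> Lp p S"
proof -
  have i: "integrable (lebesgue_on (\<Omega> \<times> unit_cell)) (\<lambda>x. \<bar>f x\<bar> powr p)" and m: "f \<in> borel_measurable (lebesgue_on (\<Omega> \<times> unit_cell))"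
    using assms(1) by (auto simp: Lp_def)
  have "integrable (lebesgue_on S) (\<lambda>x. \<bar>f x\<bar> powr p)" by (rule integrable_lebesgue_on_subset[OF i assms(2) domain(3) assms(3)])
  moreover have "f \<in> borel_measurable (lebesgue_on S)" by (rule measurable_restrict_mono[OF m assms(3)])
  ultimately show ?thesis by (simp add: Lp_def)
qed

lemma push_Lp:
  assumes "v0 \<in> Lp p (\<Omega> \<times> unit_cell)" "0 < p"
  shows "push v0 \<in> Lp p (U \<times> unit_cell)"
  unfolding push_def[abs_def]
  by (intro Lp_add zero_ext_Lp Lp_compose_back Lp_restrict[OF assms(1)] cells_measurable leftover domainU(3) domains assms(2))

text \<open>On \<open>\<Omega> \<times> Ys\<close> this is the change of variables by \<open>\<psi>0 x\<close>; elsewhere the determinant is \<open>1\<close>.\<close>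

lemma push_pairing:
  assumes v0: "v0 \<in> borel_measurable (lebesgue_on (\<Omega> \<times> unit_cell))" and k: "continuous_on UNIV k"
    and i: "integrable (lebesgue_on (\<Omega> \<times> unit_cell)) (\<lambda>z. v0 z * (k (fst z, snd z + disp0 z) * D0 z))"
  shows "(\<integral>z. push v0 z * k z \<partial>lebesgue_on (U \<times> unit_cell))
    = (\<integral>z. v0 z * (k (fst z, snd z + disp0 z) * D0 z) \<partial>lebesgue_on (\<Omega> \<times> unit_cell))"
proof -
  let ?F = "\<lambda>z. v0 z * (k (fst z, snd z + disp0 z) * D0 z)"
  let ?h = "\<lambda>z. v0 z * k (transf z)"
  have h: "?h \<in> borel_measurable (lebesgue_on (\<Omega> \<times> Ys))"
    by (rule borel_measurable_times[OF restrict_measurable[OF v0] measurable_compose[OF transf_measurable borel_measurable_continuous_onI[OF k]]])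
  have FA: "integrable (lebesgue_on (\<Omega> \<times> Ys)) ?F" and FB: "integrable (lebesgue_on leftover) ?F"
    by (rule integrable_lebesgue_on_subset[OF i]; use domains(5,8) domain(3) leftover in simp)+
  have Feq: "AE z in lebesgue_on (\<Omega> \<times> Ys). ?F z = J0 z * ?h z"
  proof -
    have "AE z in lebesgue_on (\<Omega> \<times> Ys). z \<in> \<Omega> \<times> Ys" by (rule AE_I2) simp
    with J0_eq show ?thesis by eventually_elim (auto simp: disp0_def transf_def)
  qed
  have Jm: "(\<lambda>z. J0 z * ?h z) \<in> borel_measurable (lebesgue_on (\<Omega> \<times> Ys))" by (rule borel_measurable_times[OF J0_measurable h])
  have Ji: "integrable (lebesgue_on (\<Omega> \<times> Ys)) (\<lambda>z. J0 z * ?h z)"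
    using integrable_cong_AE[OF borel_measurable_integrable[OF FA] Jm Feq] FA by simp
  have B: "AE q in lebesgue_on cells. ?h (back q) = v0 (back q) * k q" using AE_back by (rule eventually_mono) simp
  have hb: "integrable (lebesgue_on cells) (\<lambda>q. ?h (back q))" using integral_back(1)[OF h] Ji by simp
  have bm: "(\<lambda>q. v0 (back q) * k q) \<in> borel_measurable (lebesgue_on cells)"
    by (rule borel_measurable_times[OF measurable_compose_back[OF restrict_measurable[OF v0]] continuous_imp_measurable_lebesgue_on[OF k]])
  have bi: "integrable (lebesgue_on cells) (\<lambda>q. v0 (back q) * k q)"
    using integrable_cong_AE[OF borel_measurable_integrable[OF hb] bm B] hb by simp
  \<comment> \<open>Outside \<open>Ys\<close> the displacement and its gradient vanish, so that the two integrands agree.\<close>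
  have oeq: "v0 z * k z = ?F z" if "z \<in> leftover" for z
    using that by (auto simp: disp0_def grad0_def)
  have oi: "integrable (lebesgue_on leftover) (\<lambda>z. v0 z * k z)"
    using FB by (rule Bochner_Integration.integrable_cong[THEN iffD1, rotated 2]) (simp_all add: oeq)
  have "(\<integral>z. push v0 z * k z \<partial>lebesgue_on (U \<times> unit_cell))
    = (\<integral>q. v0 (back q) * k q \<partial>lebesgue_on cells) + (\<integral>z. v0 z * k z \<partial>lebesgue_on leftover)"
    by (rule integral_split[OF cells_measurable leftover(1) domainU(3) subset_U bi oi])
       (simp add: push_def zero_ext_def algebra_simps)
  also have "(\<integral>q. v0 (back q) * k q \<partial>lebesgue_on cells) = (\<integral>q. ?h (back q) \<partial>lebesgue_on cells)"
    by (rule integral_cong_AE[OF bm borel_measurable_integrable[OF hb]]) (rule eventually_mono[OF B], erule sym)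
  also have "\<dots> = (\<integral>z. J0 z * ?h z \<partial>lebesgue_on (\<Omega> \<times> Ys))" by (rule integral_back(2)[OF h])
  also have "\<dots> = (\<integral>z. ?F z \<partial>lebesgue_on (\<Omega> \<times> Ys))"
    by (rule integral_cong_AE[OF Jm borel_measurable_integrable[OF FA]]) (rule eventually_mono[OF Feq], erule sym)
  also have "(\<integral>z. v0 z * k z \<partial>lebesgue_on leftover) = (\<integral>z. ?F z \<partial>lebesgue_on leftover)"
    by (rule Bochner_Integration.integral_cong) (simp_all only: space_restrict_space oeq Int_iff UNIV_I space_completion space_lborel)
  also have "(\<integral>z. ?F z \<partial>lebesgue_on (\<Omega> \<times> Ys)) + (\<integral>z. ?F z \<partial>lebesgue_on leftover) = (\<integral>z. ?F z \<partial>lebesgue_on (\<Omega> \<times> unit_cell))"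
    by (rule integral_split[OF domains(5) leftover(1) domain(3) domains(8) leftover(2) FA FB, symmetric])
       (use Ys(2) in \<open>auto simp: zero_ext_def\<close>)
  finally show ?thesis .
qed

theorem push_forward_two_scale:
  assumes p: "1 < p" and u: "\<And>n. u n \<in> Lp p (\<Omega>e n)"
    and w: "two_scale_weak \<epsilon> p \<Omega> (\<lambda>n. zero_ext (\<Omega>h n) (u n \<circ> \<psi> n)) v0"
  shows "two_scale_weak \<epsilon> p U (\<lambda>n. zero_ext (\<Omega>e n) (u n)) (push v0)"
proof -
  have v0: "v0 \<in> Lp p (\<Omega> \<times> unit_cell)" and uh: "\<And>n. zero_ext (\<Omega>h n) (u n \<circ> \<psi> n) \<in> Lp p \<Omega>"
    using w by (auto simp: two_scale_weak_def)
  have v0m: "v0 \<in> borel_measurable (lebesgue_on (\<Omega> \<times> unit_cell))" using v0 by (simp add: Lp_def)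
  obtain K where K: "\<And>n. (\<integral>x. \<bar>zero_ext (\<Omega>h n) (u n \<circ> \<psi> n) x\<bar> powr p \<partial>lebesgue_on \<Omega>) \<le> K"
    using two_scale_weak_bounded[OF w p domain(1)] by blast
  obtain M where M: "0 < M" "\<And>n x. x \<in> \<Omega>h n \<Longrightarrow> J n x \<le> M" using J_bounded by blast
  have p0: "0 < p" using p by simp
  show ?thesis
  proof (rule two_scale_weakI[OF p U(1,2) \<epsilon>(1) _ push_Lp[OF v0 p0], where K="M * K"])
    show "zero_ext (\<Omega>e n) (u n) \<in> Lp p U" for n by (rule zero_ext_Lp[OF change_of_variables_n(1) domainU(2) u p0])
    show "\<forall>\<^sub>F n in sequentially. (\<integral>x. \<bar>zero_ext (\<Omega>e n) (u n) x\<bar> powr p \<partial>lebesgue_on U) \<le> M * K"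
      using eventually_\<Omega>e_subset
    proof eventually_elim
      case (elim n)
      let ?f = "\<lambda>x. \<bar>(u n \<circ> \<psi> n) x\<bar> powr p"
      have i1: "integrable (lebesgue_on (\<Omega>e n)) (\<lambda>x. \<bar>u n x\<bar> powr p)" using u[of n] by (simp add: Lp_def)
      have i2: "integrable (lebesgue_on (\<Omega>h n)) (\<lambda>x. J n x * ?f x)" using i1 by (simp add: change_of_variables_n(3))
      have "integrable (lebesgue_on \<Omega>) (\<lambda>x. \<bar>zero_ext (\<Omega>h n) (u n \<circ> \<psi> n) x\<bar> powr p)" using uh[of n] by (simp add: Lp_def)
      also have "(\<lambda>x. \<bar>zero_ext (\<Omega>h n) (u n \<circ> \<psi> n) x\<bar> powr p) = zero_ext (\<Omega>h n) ?f"
        using p0 by (simp add: fun_eq_iff zero_ext_def)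
      finally have i3: "integrable (lebesgue_on (\<Omega>h n)) ?f"
        using integral_zero_ext_const(2)[OF \<Omega>h(4) domain(2) \<Omega>h(2)] by blast
      have "(\<integral>x. \<bar>zero_ext (\<Omega>e n) (u n) x\<bar> powr p \<partial>lebesgue_on U) = (\<integral>x. \<bar>u n x\<bar> powr p \<partial>lebesgue_on (\<Omega>e n))"
        by (rule integral_zero_ext_powr[OF change_of_variables_n(1) domainU(2) elim p0])
      also have "\<dots> = (\<integral>x. J n x * ?f x \<partial>lebesgue_on (\<Omega>h n))" by (simp add: change_of_variables_n(4))
      also have "\<dots> \<le> (\<integral>x. M * ?f x \<partial>lebesgue_on (\<Omega>h n))"
        by (rule integral_mono_AE[OF i2]) (use i3 M in \<open>auto intro!: AE_I2 mult_right_mono\<close>)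
      also have "\<dots> = M * (\<integral>x. ?f x \<partial>lebesgue_on (\<Omega>h n))" by simp
      also have "(\<integral>x. ?f x \<partial>lebesgue_on (\<Omega>h n)) = (\<integral>x. \<bar>zero_ext (\<Omega>h n) (u n \<circ> \<psi> n) x\<bar> powr p \<partial>lebesgue_on \<Omega>)"
        by (rule integral_zero_ext_powr[OF \<Omega>h(4) domain(2) \<Omega>h(2) p0, symmetric])
      also have "M * \<dots> \<le> M * K" using K[of n] M(1) by simp
      finally show ?case .
    qed
    fix \<Theta> g :: "real^'n \<Rightarrow> real"
    assume \<Theta>: "continuous_on UNIV \<Theta>" "\<And>x. x \<notin> U \<Longrightarrow> \<Theta> x = 0" and g: "g \<in> C_per"
    let ?w = "\<lambda>n x. (moved \<Theta> n x, disp n x, grad n x)"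
    let ?a = "\<lambda>z. (\<Theta> (fst z), disp0 z, grad0 z)"
    let ?G = "\<lambda>(y::real^'n) (b :: real \<times> (real^'n) \<times> (real^'n^'n)). fst b * g (y + fst (snd b)) * det (mat 1 + snd (snd b))"
    have gc: "continuous_on UNIV g" and gp: "cell_periodic g" using g by (auto simp: C_per_iff)
    have "strongly_approximable \<epsilon> \<Omega> (\<lambda>n x. moved \<Theta> n x \<bullet> b) (\<lambda>z. \<Theta> (fst z) \<bullet> b)" if "b \<in> Basis" for b
      using strongly_approximable_moved[OF \<Theta>(1) U(2) \<Theta>(2)] that by simp
    note w' = strongly_approximable_componentwise[OF \<Omega> strongly_approximable_Pair[OF this
        strongly_approximable_Pair[OF disp_components grad_components]], simplified]
    have G: "continuous_on UNIV (\<lambda>z. ?G (fst z) (snd z))"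
      by (intro continuous_intros continuous_on_compose2[OF gc] continuous_on_compose2[OF continuous_det_plus_id]) auto
    have per: "cell_periodic (\<lambda>y. ?G y b)" for b
    proof -
      have "g (y + k + a) = g (y + a)" if "k \<in> int_vecs" for y k a
      proof -
        have "g ((y + a) + k) = g (y + a)" using gp that by (simp add: cell_periodic_def)
        then show ?thesis by (simp add: ac_simps)
      qed
      then show ?thesis by (simp add: cell_periodic_def)
    qed
    note lim = weak_strong_pairing[OF w w' G per p \<Omega>]
    let ?k = "\<lambda>z. \<Theta> (fst z) * g (snd z)"
    have k: "continuous_on UNIV ?k"
      by (intro continuous_intros continuous_on_compose2[OF gc] continuous_on_compose2[OF \<Theta>(1)]) auto
    have "(\<integral>z. push v0 z * ?k z \<partial>lebesgue_on (U \<times> unit_cell))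
      = (\<integral>z. v0 z * ?G (snd z) (?a z) \<partial>lebesgue_on (\<Omega> \<times> unit_cell))"
      using push_pairing[OF v0m k] lim(2) by simp
    moreover have "\<forall>\<^sub>F n in sequentially. (\<integral>x. zero_ext (\<Omega>h n) (u n \<circ> \<psi> n) x * ?G (x /\<^sub>R \<epsilon> n) (?w n x) \<partial>lebesgue_on \<Omega>)
      = (\<integral>x. zero_ext (\<Omega>e n) (u n) x * (\<Theta> x * g (x /\<^sub>R \<epsilon> n)) \<partial>lebesgue_on U)"
      using eventually_\<Omega>e_subset
    proof eventually_elim
      case (elim n)
      have eq: "J n x * (u n (\<psi> n x) * (\<Theta> (\<psi> n x) * g (\<psi> n x /\<^sub>R \<epsilon> n))) = (u n \<circ> \<psi> n) x * ?G (x /\<^sub>R \<epsilon> n) (?w n x)"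
        if x: "x \<in> \<Omega>h n" for x
      proof -
        have "x /\<^sub>R \<epsilon> n + disp n x = \<psi> n x /\<^sub>R \<epsilon> n" using x by (simp add: disp_def scaleR_diff_right)
        then show ?thesis using x by (simp add: moved_def diffeo_n_facts(6) mult_ac)
      qed
      have "(\<integral>x. zero_ext (\<Omega>e n) (u n) x * (\<Theta> x * g (x /\<^sub>R \<epsilon> n)) \<partial>lebesgue_on U)
        = (\<integral>x. u n x * (\<Theta> x * g (x /\<^sub>R \<epsilon> n)) \<partial>lebesgue_on (\<Omega>e n))"
        by (rule integral_zero_ext(1)[OF change_of_variables_n(1) domainU(2) elim])
      also have "\<dots> = (\<integral>x. J n x * (u n (\<psi> n x) * (\<Theta> (\<psi> n x) * g (\<psi> n x /\<^sub>R \<epsilon> n))) \<partial>lebesgue_on (\<Omega>h n))"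
        by (rule change_of_variables_n(4))
      also have "\<dots> = (\<integral>x. (u n \<circ> \<psi> n) x * ?G (x /\<^sub>R \<epsilon> n) (?w n x) \<partial>lebesgue_on (\<Omega>h n))"
        by (rule Bochner_Integration.integral_cong[OF refl]) (rule eq, simp)
      also have "\<dots> = (\<integral>x. zero_ext (\<Omega>h n) (u n \<circ> \<psi> n) x * ?G (x /\<^sub>R \<epsilon> n) (?w n x) \<partial>lebesgue_on \<Omega>)"
        by (rule integral_zero_ext(1)[OF \<Omega>h(4) domain(2) \<Omega>h(2), symmetric])
      finally show ?case by simp
    qed
    ultimately show "pairings_converge \<epsilon> U (\<lambda>n. zero_ext (\<Omega>e n) (u n)) (push v0) (\<lambda>x y. \<Theta> x * g y)"
      unfolding pairings_converge_def using Lim_transform_eventually[OF lim(1)] by simp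
  qed
qed

end

section \<open>Strong convergence of the inverse Jacobian weights\<close>

context transformed_domains
begin

lemma strongly_approximable_slow:
  assumes c: "continuous_on UNIV \<Theta>" and z: "\<And>x. x \<notin> \<Omega> \<Longrightarrow> \<Theta> x = 0"
  shows "strongly_approximable \<epsilon> \<Omega> (\<lambda>n x. \<Theta> x :: real) (\<lambda>z. \<Theta> (fst z))"
proof -
  obtain B where B: "\<And>x. \<bar>\<Theta> x\<bar> \<le> B" using vanishing_imp_bounded[OF c \<Omega>(2) z] by blast
  show ?thesis
    by (rule strongly_approximable_uniform[OF \<Omega> slow_test_function[OF c], where C=B])
       (use B in \<open>auto intro: continuous_imp_measurable_lebesgue_on[OF c]\<close>)
qed

text \<open>The function on the transformed domain whose pullback, multiplied by the Jacobian, is the product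
  test function \<open>\<theta> x * g (x / \<epsilon> n)\<close>.\<close>

definition "weight \<theta> g n y = (let x = inv_into (\<Omega>h n) (\<psi> n) y in \<theta> x * g (x /\<^sub>R \<epsilon> n) / J n x :: real)"

text \<open>The truncation at \<open>cJ\<close> keeps the expression continuous in \<open>grad0\<close> and is inactive on the tiling.\<close>

definition "weight0 \<theta> g z = tiling_ind (snd z) * (\<theta> (fst z) * g (snd z) / max cJ (D0 z))"

lemma weight_\<psi>: "x \<in> \<Omega>h n \<Longrightarrow> weight \<theta> g n (\<psi> n x) = \<theta> x * g (x /\<^sub>R \<epsilon> n) / J n x"
  by (simp add: weight_def inv_into_f_f[OF diffeo_n_facts(2)])

lemma J_eq_max: "x \<in> \<Omega>h n \<Longrightarrow> J n x = max cJ (det (mat 1 + grad n x))"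
  using cJ(3)[of x n] by (simp add: diffeo_n_facts(6) max_def)

text \<open>With the indicator of the tiling as the weakly convergent factor, the remaining expression is
  continuous in the strongly convergent gradient.\<close>

lemma weights_converge:
  assumes \<theta>: "continuous_on UNIV \<theta>" "\<And>x. x \<notin> \<Omega> \<Longrightarrow> \<theta> x = 0" and g: "g \<in> C_per"
  shows "(\<lambda>n. \<integral>x. \<theta> x * g (x /\<^sub>R \<epsilon> n) / J n x \<partial>lebesgue_on (\<Omega>h n))
      \<longlonglongrightarrow> (\<integral>z. weight0 \<theta> g z \<partial>lebesgue_on (\<Omega> \<times> unit_cell))"
    and "integrable (lebesgue_on (\<Omega> \<times> unit_cell)) (weight0 \<theta> g)"
proof -
  let ?G = "\<lambda>(y::real^'n) (b :: real \<times> (real^'n^'n)). fst b * g y / max cJ (det (mat 1 + snd b))"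
  have gc: "continuous_on UNIV g" and gp: "cell_periodic g" using g by (auto simp: C_per_iff)
  have p2: "(1::real) < 2" by simp
  have ne: "max cJ t \<noteq> 0" for t using cJ(1) by (simp add: max_def)
  have G: "continuous_on UNIV (\<lambda>z. ?G (fst z) (snd z))"
    by (intro continuous_intros continuous_on_compose2[OF gc] continuous_on_compose2[OF continuous_det_plus_id]) (use ne in auto)
  have per: "cell_periodic (\<lambda>y. ?G y b)" for b using gp by (simp add: cell_periodic_def)
  have "strongly_approximable \<epsilon> \<Omega> (\<lambda>n x. \<theta> x \<bullet> b) (\<lambda>z. \<theta> (fst z) \<bullet> b)" if "b \<in> Basis" for b
    using strongly_approximable_slow[OF \<theta>] that by simp
  note s = strongly_approximable_componentwise[OF \<Omega> strongly_approximable_Pair[OF this grad_components], simplified]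
  note lim = weak_strong_pairing[OF tiling_two_scale_weak s G per p2 \<Omega>]
  have eq: "(\<integral>x. tiling_ind (x /\<^sub>R \<epsilon> n) * ?G (x /\<^sub>R \<epsilon> n) (\<theta> x, grad n x) \<partial>lebesgue_on \<Omega>)
    = (\<integral>x. \<theta> x * g (x /\<^sub>R \<epsilon> n) / J n x \<partial>lebesgue_on (\<Omega>h n))" for n
  proof -
    have "(\<integral>x. tiling_ind (x /\<^sub>R \<epsilon> n) * ?G (x /\<^sub>R \<epsilon> n) (\<theta> x, grad n x) \<partial>lebesgue_on \<Omega>)
      = (\<integral>x. zero_ext (\<Omega>h n) (\<lambda>x. \<theta> x * g (x /\<^sub>R \<epsilon> n) / J n x) x \<partial>lebesgue_on \<Omega>)"
      by (rule Bochner_Integration.integral_cong[OF refl])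
         (simp add: zero_ext_def J_eq_max, simp add: mem_\<Omega>h_iff indicator_def)
    then show ?thesis by (simp add: integral_zero_ext_const(1)[OF \<Omega>h(4) domain(2) \<Omega>h(2)])
  qed
  have eq0: "(\<lambda>z. tiling_ind (snd z) * ?G (snd z) (\<theta> (fst z), grad0 z)) = weight0 \<theta> g" by (simp add: fun_eq_iff weight0_def)
  show "(\<lambda>n. \<integral>x. \<theta> x * g (x /\<^sub>R \<epsilon> n) / J n x \<partial>lebesgue_on (\<Omega>h n))
      \<longlonglongrightarrow> (\<integral>z. weight0 \<theta> g z \<partial>lebesgue_on (\<Omega> \<times> unit_cell))" using lim(1) unfolding eq eq0 .
  show "integrable (lebesgue_on (\<Omega> \<times> unit_cell)) (weight0 \<theta> g)" using lim(2) unfolding eq0 .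
qed

lemma pullback_Lp:
  assumes u: "u \<in> Lp p (\<Omega>e n)" and p: "1 \<le> p"
  shows "u \<circ> \<psi> n \<in> Lp p (\<Omega>h n)"
proof -
  have "integrable (lebesgue_on (\<Omega>e n)) u" by (rule Lp_integrable[OF u p change_of_variables_n(2,1)])
  then have "(\<lambda>x. J n x * u (\<psi> n x)) \<in> borel_measurable (lebesgue_on (\<Omega>h n))"
    unfolding change_of_variables_n(3) by (rule borel_measurable_integrable)
  from borel_measurable_divide[OF this J_measurable]
  have m: "u \<circ> \<psi> n \<in> borel_measurable (lebesgue_on (\<Omega>h n))"
    by (rule measurable_cong[THEN iffD1, rotated]) (use cJ(1,3) in fastforce)
  have i: "integrable (lebesgue_on (\<Omega>h n)) (\<lambda>x. J n x * \<bar>u (\<psi> n x)\<bar> powr p)"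
    using u change_of_variables_n(3)[of n "\<lambda>y. \<bar>u y\<bar> powr p"] by (simp add: Lp_def)
  have "integrable (lebesgue_on (\<Omega>h n)) (\<lambda>x. \<bar>(u \<circ> \<psi> n) x\<bar> powr p)"
  proof (rule Bochner_Integration.integrable_bound)
    show "integrable (lebesgue_on (\<Omega>h n)) (\<lambda>x. (1 / cJ) * (J n x * \<bar>u (\<psi> n x)\<bar> powr p))"
      by (rule integrable_mult_right) (rule i)
    show "(\<lambda>x. \<bar>(u \<circ> \<psi> n) x\<bar> powr p) \<in> borel_measurable (lebesgue_on (\<Omega>h n))" using m by measurable
    show "AE x in lebesgue_on (\<Omega>h n). norm (\<bar>(u \<circ> \<psi> n) x\<bar> powr p) \<le> norm ((1 / cJ) * (J n x * \<bar>u (\<psi> n x)\<bar> powr p))"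
    proof (rule AE_I2)
      fix x assume "x \<in> space (lebesgue_on (\<Omega>h n))"
      then have "1 \<le> J n x / cJ" using cJ(1) cJ(3)[of x n] by simp
      from mult_right_mono[OF this, of "\<bar>u (\<psi> n x)\<bar> powr p"]
      have "\<bar>u (\<psi> n x)\<bar> powr p \<le> (1 / cJ) * (J n x * \<bar>u (\<psi> n x)\<bar> powr p)" by simp
      also have "\<dots> \<le> norm ((1 / cJ) * (J n x * \<bar>u (\<psi> n x)\<bar> powr p))" by (simp only: real_norm_def abs_ge_self)
      finally show "norm (\<bar>(u \<circ> \<psi> n) x\<bar> powr p) \<le> norm ((1 / cJ) * (J n x * \<bar>u (\<psi> n x)\<bar> powr p))"
        by (simp only: real_norm_def abs_of_nonneg powr_ge_zero comp_apply)
    qed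
  qed
  then show ?thesis using m by (simp add: Lp_def)
qed

lemma products:
  assumes "continuous_on UNIV \<theta>" "\<And>x. x \<notin> \<Omega> \<Longrightarrow> \<theta> x = 0" "g \<in> C_per" "continuous_on UNIV \<theta>'" "g' \<in> C_per"
  shows "continuous_on UNIV (\<lambda>x. \<theta> x * \<theta>' x :: real)" "\<And>x. x \<notin> \<Omega> \<Longrightarrow> \<theta> x * \<theta>' x = 0" "(\<lambda>y. g y * g' y) \<in> C_per"
  using assms by (auto simp: C_per_iff cell_periodic_def intro!: continuous_intros)

context
  fixes \<theta> g :: "real^'n \<Rightarrow> real"
  assumes \<theta>: "continuous_on UNIV \<theta>" "\<And>x. x \<notin> \<Omega> \<Longrightarrow> \<theta> x = 0" and g: "g \<in> C_per"
begin

definition "weight_bound = (SOME B. 0 \<le> B \<and> (\<forall>x y. \<bar>\<theta> x * g y\<bar> \<le> B))"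

lemma weight_bound: "0 \<le> weight_bound" "\<bar>\<theta> x * g y\<bar> \<le> weight_bound"
proof -
  obtain B where B: "0 \<le> B" "\<And>x. \<bar>\<theta> x\<bar> \<le> B" using vanishing_imp_bounded[OF \<theta>(1) \<Omega>(2) \<theta>(2)] by blast
  have "\<bar>\<theta> x * g y\<bar> \<le> B * per_norm g" for x y
    unfolding abs_mult by (intro mult_mono B per_norm_upper[OF g]) auto
  then have "\<exists>B. 0 \<le> B \<and> (\<forall>x y. \<bar>\<theta> x * g y\<bar> \<le> B)"
    using mult_nonneg_nonneg[OF B(1) per_norm_nonneg[OF g]] by blast
  from someI_ex[OF this] show "0 \<le> weight_bound" "\<bar>\<theta> x * g y\<bar> \<le> weight_bound"
    unfolding weight_bound_def by blast+
qed

lemma weight_le: "y \<in> \<Omega>e n \<Longrightarrow> \<bar>weight \<theta> g n y\<bar> \<le> weight_bound / cJ"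
proof -
  assume "y \<in> \<Omega>e n"
  then obtain x where x: "x \<in> \<Omega>h n" "y = \<psi> n x" by (auto simp: \<Omega>e_def)
  have "\<bar>\<theta> x * g (x /\<^sub>R \<epsilon> n)\<bar> / \<bar>J n x\<bar> \<le> weight_bound / cJ"
    using weight_bound cJ(1) cJ(3)[OF x(1)] by (intro frac_le) auto
  then show ?thesis using x by (simp add: weight_\<psi>)
qed

lemma weight0_le: "\<bar>weight0 \<theta> g z\<bar> \<le> weight_bound / cJ"
proof -
  have "\<bar>tiling_ind (snd z)\<bar> * (\<bar>\<theta> (fst z) * g (snd z)\<bar> / \<bar>max cJ (D0 z)\<bar>) \<le> 1 * (weight_bound / cJ)"
    using weight_bound cJ(1) by (intro mult_mono frac_le tiling_ind) auto
  then show ?thesis by (simp add: weight0_def abs_mult)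
qed

lemma weight_Lp: "weight \<theta> g n \<in> Lp 2 (\<Omega>e n)"
proof (rule bounded_in_Lp)
  have "integrable (lebesgue_on (\<Omega>h n)) (\<lambda>x. \<theta> x * g (x /\<^sub>R \<epsilon> n))"
  proof (rule bounded_integrable[OF _ _ \<Omega>h(3,4)])
    have "continuous_on UNIV (\<lambda>x. \<theta> x * g (x /\<^sub>R \<epsilon> n))"
    proof (rule continuous_on_mult[OF \<theta>(1)])
      have "continuous_on UNIV g" using g by (simp add: C_per_iff)
      then show "continuous_on UNIV (\<lambda>x. g (x /\<^sub>R \<epsilon> n))" by (rule continuous_on_compose2) (auto intro!: continuous_intros)
    qed
    then show "(\<lambda>x. \<theta> x * g (x /\<^sub>R \<epsilon> n)) \<in> borel_measurable (lebesgue_on (\<Omega>h n))" by (rule continuous_imp_measurable_lebesgue_on)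
    show "AE x in lebesgue_on (\<Omega>h n). \<bar>\<theta> x * g (x /\<^sub>R \<epsilon> n)\<bar> \<le> weight_bound" by (rule AE_I2) (rule weight_bound)
  qed
  also have "?this \<longleftrightarrow> integrable (lebesgue_on (\<Omega>h n)) (\<lambda>x. J n x * weight \<theta> g n (\<psi> n x))"
  proof (rule Bochner_Integration.integrable_cong[OF refl])
    fix x assume "x \<in> space (lebesgue_on (\<Omega>h n))"
    then have x: "x \<in> \<Omega>h n" by simp
    then have "J n x \<noteq> 0" using cJ(1) cJ(3)[OF x] by linarith
    then show "\<theta> x * g (x /\<^sub>R \<epsilon> n) = J n x * weight \<theta> g n (\<psi> n x)" by (simp add: weight_\<psi>[OF x])
  qed
  finally show "weight \<theta> g n \<in> borel_measurable (lebesgue_on (\<Omega>e n))"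
    unfolding change_of_variables_n(3)[symmetric] by (rule borel_measurable_integrable)
  show "AE y in lebesgue_on (\<Omega>e n). \<bar>weight \<theta> g n y\<bar> \<le> weight_bound / cJ" by (rule AE_I2) (simp add: weight_le)
qed (use change_of_variables_n in auto)

lemma weight0_in_L2:
  shows "weight0 \<theta> g \<in> borel_measurable (lebesgue_on (\<Omega> \<times> unit_cell))" "weight0 \<theta> g \<in> Lp 2 (\<Omega> \<times> unit_cell)"
proof -
  show m: "weight0 \<theta> g \<in> borel_measurable (lebesgue_on (\<Omega> \<times> unit_cell))"
    by (rule borel_measurable_integrable[OF weights_converge(2)[OF \<theta> g]])
  show "weight0 \<theta> g \<in> Lp 2 (\<Omega> \<times> unit_cell)"
    by (rule bounded_in_Lp[OF m AE_I2 _ domain(4,3)]) (use weight0_le in auto)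
qed

lemma weight_two_scale: "two_scale_weak \<epsilon> 2 \<Omega> (\<lambda>n. zero_ext (\<Omega>h n) (weight \<theta> g n \<circ> \<psi> n)) (weight0 \<theta> g)"
proof (rule two_scale_weakI[OF _ \<Omega> \<epsilon>(1) _ weight0_in_L2(2), where K="\<integral>x. (weight_bound / cJ) powr 2 \<partial>lebesgue_on \<Omega>"])
  have L: "zero_ext (\<Omega>h n) (weight \<theta> g n \<circ> \<psi> n) \<in> Lp 2 \<Omega>" for n
    by (rule zero_ext_Lp[OF \<Omega>h(4) domain(2) pullback_Lp[OF weight_Lp]]) auto
  then show "zero_ext (\<Omega>h n) (weight \<theta> g n \<circ> \<psi> n) \<in> Lp 2 \<Omega>" for n .
  have b: "\<bar>zero_ext (\<Omega>h n) (weight \<theta> g n \<circ> \<psi> n) x\<bar> \<le> weight_bound / cJ" for n x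
    using weight_le[of "\<psi> n x" n] weight_bound(1) cJ(1) by (auto simp: zero_ext_def \<Omega>e_def)
  interpret finite_measure "lebesgue_on \<Omega>" by (rule finite_measure_lebesgue_on[OF \<Omega>(2) domain(2)])
  show "\<forall>\<^sub>F n in sequentially. (\<integral>x. \<bar>zero_ext (\<Omega>h n) (weight \<theta> g n \<circ> \<psi> n) x\<bar> powr 2 \<partial>lebesgue_on \<Omega>)
      \<le> (\<integral>x. (weight_bound / cJ) powr 2 \<partial>lebesgue_on \<Omega>)"
  proof (rule always_eventually, rule allI, rule integral_mono_AE)
    show "integrable (lebesgue_on \<Omega>) (\<lambda>x. \<bar>zero_ext (\<Omega>h n) (weight \<theta> g n \<circ> \<psi> n) x\<bar> powr 2)" for n
      using L[of n] unfolding Lp_def by blast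
    show "AE x in lebesgue_on \<Omega>. \<bar>zero_ext (\<Omega>h n) (weight \<theta> g n \<circ> \<psi> n) x\<bar> powr 2 \<le> (weight_bound / cJ) powr 2" for n
      by (rule AE_I2) (intro powr_mono2 b; simp)
  qed simp
  fix \<theta>' g' :: "real^'n \<Rightarrow> real"
  assume t: "continuous_on UNIV \<theta>'" "\<And>x. x \<notin> \<Omega> \<Longrightarrow> \<theta>' x = 0" "g' \<in> C_per"
  note pr = products[OF \<theta> g t(1,3)]
  have "(\<integral>x. (\<theta> x * \<theta>' x) * (g (x /\<^sub>R \<epsilon> n) * g' (x /\<^sub>R \<epsilon> n)) / J n x \<partial>lebesgue_on (\<Omega>h n))
    = (\<integral>x. zero_ext (\<Omega>h n) (weight \<theta> g n \<circ> \<psi> n) x * (\<theta>' x * g' (x /\<^sub>R \<epsilon> n)) \<partial>lebesgue_on \<Omega>)" for n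
    unfolding integral_zero_ext(1)[OF \<Omega>h(4) domain(2) \<Omega>h(2)]
    by (rule Bochner_Integration.integral_cong[OF refl]) (simp add: weight_\<psi>)
  moreover have "weight0 (\<lambda>x. \<theta> x * \<theta>' x) (\<lambda>y. g y * g' y) = (\<lambda>z. weight0 \<theta> g z * (\<theta>' (fst z) * g' (snd z)))"
    by (simp add: fun_eq_iff weight0_def)
  ultimately show "pairings_converge \<epsilon> \<Omega> (\<lambda>n. zero_ext (\<Omega>h n) (weight \<theta> g n \<circ> \<psi> n)) (weight0 \<theta> g) (\<lambda>x y. \<theta>' x * g' y)"
    using weights_converge(1)[OF pr] by (simp add: pairings_converge_def)
qed simp

lemma pushed_weight_two_scale:
  "two_scale_weak \<epsilon> 2 U (\<lambda>n. zero_ext (\<Omega>e n) (weight \<theta> g n)) (push (weight0 \<theta> g))"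
  by (rule push_forward_two_scale[OF _ weight_Lp weight_two_scale]) simp

lemma weight_norms_converge:
  "(\<lambda>n. \<integral>y. (zero_ext (\<Omega>e n) (weight \<theta> g n) y)\<^sup>2 \<partial>lebesgue_on U)
     \<longlonglongrightarrow> (\<integral>z. (weight0 \<theta> g z)\<^sup>2 * D0 z \<partial>lebesgue_on (\<Omega> \<times> unit_cell))"
proof -
  note pr = products[OF \<theta> g \<theta>(1) g]
  have ae: "AE z in lebesgue_on (\<Omega> \<times> unit_cell). (weight0 \<theta> g z)\<^sup>2 * D0 z = weight0 (\<lambda>x. \<theta> x * \<theta> x) (\<lambda>y. g y * g y) z"
    using limit_jacobian_ge
  proof eventually_elim
    case (elim z)
    show ?case
    proof (cases "snd z \<in> tiling")
      case True
      then have "max cJ (D0 z) = D0 z" "D0 z \<noteq> 0" using elim cJ(1) by auto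
      then show ?thesis using True by (simp add: weight0_def power2_eq_square field_simps)
    qed (simp add: weight0_def)
  qed
  have lim: "(\<integral>z. (weight0 \<theta> g z)\<^sup>2 * D0 z \<partial>lebesgue_on (\<Omega> \<times> unit_cell))
    = (\<integral>z. weight0 (\<lambda>x. \<theta> x * \<theta> x) (\<lambda>y. g y * g y) z \<partial>lebesgue_on (\<Omega> \<times> unit_cell))"
    by (rule integral_cong_AE[OF _ _ ae])
       (rule borel_measurable_times[OF borel_measurable_power[OF weight0_in_L2(1)] D0_measurable],
        rule borel_measurable_integrable[OF weights_converge(2)[OF pr]])
  have "\<forall>\<^sub>F n in sequentially. (\<integral>x. (\<theta> x * \<theta> x) * (g (x /\<^sub>R \<epsilon> n) * g (x /\<^sub>R \<epsilon> n)) / J n x \<partial>lebesgue_on (\<Omega>h n))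
    = (\<integral>y. (zero_ext (\<Omega>e n) (weight \<theta> g n) y)\<^sup>2 \<partial>lebesgue_on U)"
    using eventually_\<Omega>e_subset
  proof eventually_elim
    case (elim n)
    have "(\<lambda>y. (zero_ext (\<Omega>e n) (weight \<theta> g n) y)\<^sup>2) = zero_ext (\<Omega>e n) (\<lambda>y. (weight \<theta> g n y)\<^sup>2)"
      by (simp add: fun_eq_iff zero_ext_def)
    then have "(\<integral>y. (zero_ext (\<Omega>e n) (weight \<theta> g n) y)\<^sup>2 \<partial>lebesgue_on U) = (\<integral>y. (weight \<theta> g n y)\<^sup>2 \<partial>lebesgue_on (\<Omega>e n))"
      by (simp only: integral_zero_ext_const(1)[OF change_of_variables_n(1) domainU(2) elim])
    also have "\<dots> = (\<integral>x. J n x * (weight \<theta> g n (\<psi> n x))\<^sup>2 \<partial>lebesgue_on (\<Omega>h n))" by (rule change_of_variables_n(4))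
    also have "\<dots> = (\<integral>x. (\<theta> x * \<theta> x) * (g (x /\<^sub>R \<epsilon> n) * g (x /\<^sub>R \<epsilon> n)) / J n x \<partial>lebesgue_on (\<Omega>h n))"
    proof (rule Bochner_Integration.integral_cong[OF refl])
      fix x assume "x \<in> space (lebesgue_on (\<Omega>h n))"
      then have x: "x \<in> \<Omega>h n" by simp
      then have "J n x \<noteq> 0" using cJ(1) cJ(3)[OF x] by linarith
      then show "J n x * (weight \<theta> g n (\<psi> n x))\<^sup>2 = (\<theta> x * \<theta> x) * (g (x /\<^sub>R \<epsilon> n) * g (x /\<^sub>R \<epsilon> n)) / J n x"
        by (simp add: weight_\<psi>[OF x] power2_eq_square field_simps)
    qed
    finally show ?case by simp
  qed
  from Lim_transform_eventually[OF weights_converge(1)[OF pr] this] show ?thesis unfolding lim .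
qed

text \<open>The norm of the limit exceeds the limit of the norms by twice the integral over the overlap.\<close>

lemma pushed_weight_norm:
  "(\<integral>z. (push (weight0 \<theta> g) z)\<^sup>2 \<partial>lebesgue_on (U \<times> unit_cell))
    = (\<integral>z. (weight0 \<theta> g z)\<^sup>2 * D0 z \<partial>lebesgue_on (\<Omega> \<times> unit_cell))
      + 2 * (\<integral>z. weight0 \<theta> g (back z) * weight0 \<theta> g z \<partial>lebesgue_on (cells \<inter> leftover))"
  and pushed_weight_overlap_integrable:
  "integrable (lebesgue_on (cells \<inter> leftover)) (\<lambda>z. weight0 \<theta> g (back z) * weight0 \<theta> g z)"
proof -
  let ?v = "weight0 \<theta> g" and ?B = "weight_bound / cJ"
  note vm = weight0_in_L2(1)
  have vb: "(\<lambda>z. ?v (back z)) \<in> borel_measurable (lebesgue_on cells)" by (rule measurable_compose_back[OF restrict_measurable[OF vm]])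
  have vl: "?v \<in> borel_measurable (lebesgue_on leftover)" by (rule measurable_restrict_mono[OF vm leftover(2)])
  have O: "cells \<inter> leftover \<in> sets lebesgue" "bounded (cells \<inter> leftover)" "cells \<inter> leftover \<subseteq> U \<times> unit_cell"
    using cells_measurable leftover bounded_subset[OF cells_bounded] subset_U by auto
  have B0: "0 \<le> ?B" using weight_bound(1) cJ(1) by simp
  have sq: "\<bar>(?v z)\<^sup>2\<bar> \<le> ?B\<^sup>2" for z using power_mono[OF weight0_le[of z] abs_ge_zero, of 2] by simp
  have om: "(\<lambda>z. ?v (back z) * ?v z) \<in> borel_measurable (lebesgue_on (cells \<inter> leftover))"
    by (rule borel_measurable_times[OF measurable_restrict_mono[OF vb] measurable_restrict_mono[OF vl]]) auto
  show over_i: "integrable (lebesgue_on (cells \<inter> leftover)) (\<lambda>z. ?v (back z) * ?v z)"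
  proof (rule bounded_integrable[OF om AE_I2 O(2,1)])
    show "\<bar>?v (back z) * ?v z\<bar> \<le> ?B * ?B" for z unfolding abs_mult by (intro mult_mono weight0_le B0) auto
  qed
  have sqm: "(\<lambda>z. (?v z)\<^sup>2) \<in> borel_measurable (lebesgue_on (\<Omega> \<times> unit_cell))" by (rule borel_measurable_power[OF vm])
  have FA: "integrable (lebesgue_on (\<Omega> \<times> unit_cell)) (\<lambda>z. (?v z)\<^sup>2 * (1 * D0 z))"
  proof -
    obtain C where C: "AE z in lebesgue_on (\<Omega> \<times> unit_cell). norm (grad0 z) \<le> C"
      using strongly_approximable_grad unfolding strongly_approximable_def by blast
    obtain M where M: "0 < M" "\<And>b::real^'n^'n. norm b \<le> C \<Longrightarrow> \<bar>det (mat 1 + b)\<bar> \<le> M" using determinant_bound by blast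
    show ?thesis unfolding mult_1
    proof (rule bounded_integrable[OF borel_measurable_times[OF sqm D0_measurable] _ domain(4,3)])
      show "AE z in lebesgue_on (\<Omega> \<times> unit_cell). \<bar>(?v z)\<^sup>2 * D0 z\<bar> \<le> ?B\<^sup>2 * M"
        using C
      proof eventually_elim
        case (elim z)
        show ?case unfolding abs_mult using M(2)[OF elim] by (intro mult_mono sq) auto
      qed
    qed
  qed
  have "(\<lambda>z. (?v z)\<^sup>2) \<in> Lp 1 (\<Omega> \<times> unit_cell)" by (rule bounded_in_Lp[OF sqm AE_I2[OF sq] zero_le_one domain(4,3)])
  from Lp_integrable[OF push_Lp[OF this zero_less_one] order_refl domainU(4,3)]
  have "integrable (lebesgue_on (U \<times> unit_cell)) (push (\<lambda>z. (?v z)\<^sup>2))" .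
  moreover have "integrable (lebesgue_on (U \<times> unit_cell)) (zero_ext (cells \<inter> leftover) (\<lambda>z. ?v (back z) * ?v z))"
    using over_i by (simp add: integral_zero_ext_const(2)[OF O(1) domainU(3) O(3)])
  \<comment> \<open>Only the cross terms make the square of the sum differ from the sum of the squares.\<close>
  moreover have "(push ?v z)\<^sup>2 = push (\<lambda>z. (?v z)\<^sup>2) z + 2 * zero_ext (cells \<inter> leftover) (\<lambda>z. ?v (back z) * ?v z) z" for z
    by (simp add: push_def zero_ext_def power2_eq_square algebra_simps)
  ultimately have "(\<integral>z. (push ?v z)\<^sup>2 \<partial>lebesgue_on (U \<times> unit_cell))
    = (\<integral>z. push (\<lambda>z. (?v z)\<^sup>2) z \<partial>lebesgue_on (U \<times> unit_cell)) + 2 * (\<integral>z. ?v (back z) * ?v z \<partial>lebesgue_on (cells \<inter> leftover))"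
    by (simp add: integral_zero_ext_const(1)[OF O(1) domainU(3) O(3)])
  also have "(\<integral>z. push (\<lambda>z. (?v z)\<^sup>2) z \<partial>lebesgue_on (U \<times> unit_cell)) = (\<integral>z. (?v z)\<^sup>2 * D0 z \<partial>lebesgue_on (\<Omega> \<times> unit_cell))"
    using push_pairing[OF sqm continuous_on_const FA] by simp
  finally show "(\<integral>z. (push ?v z)\<^sup>2 \<partial>lebesgue_on (U \<times> unit_cell))
    = (\<integral>z. (?v z)\<^sup>2 * D0 z \<partial>lebesgue_on (\<Omega> \<times> unit_cell)) + 2 * (\<integral>z. ?v (back z) * ?v z \<partial>lebesgue_on (cells \<inter> leftover))" .
qed

lemma zero_ext_weight_le: "\<bar>zero_ext (\<Omega>e n) (weight \<theta> g n) y\<bar> \<le> weight_bound / cJ"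
  using weight_le[of y n] weight_bound(1) cJ(1) by (auto simp: zero_ext_def)

lemma overlap_integral_nonpos:
  "(\<integral>z. weight0 \<theta> g (back z) * weight0 \<theta> g z \<partial>lebesgue_on (cells \<inter> leftover)) \<le> 0"
  using weak_limit_norm_le[OF pushed_weight_two_scale U(1,2) \<epsilon> zero_ext_weight_le weight_norms_converge]
  unfolding pushed_weight_norm by simp

end

end

context transformed_domains
begin

text \<open>For a weight that is positive on \<open>\<Omega> \<times> tiling\<close>, the integrand of the nonpositive overlap integral
  is nonnegative, so the overlap is null.\<close>

lemma transformed_cells_avoid_other_material:
  "AE z in lebesgue_on cells. snd z \<in> tiling \<longrightarrow> snd z \<in> Ys"
proof -
  \<comment> \<open>Continuous, vanishing off \<open>\<Omega>\<close> and positive on it.\<close>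
  let ?\<theta> = "\<lambda>x. infdist x (- \<Omega>)" and ?g = "\<lambda>y :: real^'n. 1 :: real"
  let ?v = "weight0 ?\<theta> ?g"
  have \<theta>: "continuous_on UNIV ?\<theta>" "\<And>x. x \<notin> \<Omega> \<Longrightarrow> ?\<theta> x = 0" and g: "?g \<in> C_per"
    by (auto intro: continuous_intros C_per_const)
  have ne: "- \<Omega> \<noteq> {}" using \<Omega>(2) not_bounded_UNIV[where 'a="real^'n"] by (metis double_compl Compl_empty_eq)
  have \<theta>pos: "0 < ?\<theta> x" if "x \<in> \<Omega>" for x
  proof -
    have "?\<theta> x \<noteq> 0" using in_closed_iff_infdist_zero[OF _ ne, of x] \<Omega>(1) that by (simp add: closed_def)
    then show ?thesis using infdist_nonneg[of x "- \<Omega>"] by linarith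
  qed
  have mx: "0 < max cJ t" for t using cJ(1) by (simp add: max_def)
  have nonneg: "0 \<le> ?v z" for z
    using mx[of "D0 z"] infdist_nonneg[of "fst z" "- \<Omega>"] by (simp add: weight0_def indicator_def)
  have pos: "0 < ?v z" if "fst z \<in> \<Omega>" "snd z \<in> tiling" for z
    using mx[of "D0 z"] \<theta>pos[OF that(1)] that(2) by (simp add: weight0_def)
  have O: "cells \<inter> leftover \<in> sets lebesgue" using cells_measurable leftover by auto
  note i = pushed_weight_overlap_integrable[OF \<theta> g]
  have nn: "AE z in lebesgue_on (cells \<inter> leftover). 0 \<le> ?v (back z) * ?v z"
    by (rule AE_I2) (intro mult_nonneg_nonneg nonneg)
  have "(\<integral>z. ?v (back z) * ?v z \<partial>lebesgue_on (cells \<inter> leftover)) = 0"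
    using overlap_integral_nonpos[OF \<theta> g] integral_nonneg_AE[OF nn] by linarith
  then have "AE z in lebesgue_on (cells \<inter> leftover). ?v (back z) * ?v z = 0"
    using integral_nonneg_eq_0_iff_AE[OF i nn] by simp
  then have z: "AE z in lebesgue. z \<in> cells \<inter> leftover \<longrightarrow> ?v (back z) * ?v z = 0"
    unfolding AE_lebesgue_on_iff[OF O] .
  have b: "AE z in lebesgue. z \<in> cells \<longrightarrow> back z \<in> \<Omega> \<times> Ys \<and> transf (back z) = z"
    using AE_back unfolding AE_lebesgue_on_iff[OF cells_measurable] .
  show ?thesis
    unfolding AE_lebesgue_on_iff[OF cells_measurable]
    using z b
  proof eventually_elim
    case (elim z)
    show ?case
    proof (intro impI, rule ccontr)
      assume a: "z \<in> cells" "snd z \<in> tiling" "snd z \<notin> Ys"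
      then have "z \<in> \<Omega> \<times> unit_cell" using cells_subset by blast
      then have l: "z \<in> leftover" "fst z \<in> \<Omega>" using a(3) by (auto simp: mem_Times_iff)
      have "back z \<in> \<Omega> \<times> Ys" using elim(2) a(1) by blast
      then have "0 < ?v (back z)" using Ys_tiling by (intro pos) (auto simp: mem_Times_iff)
      moreover have "0 < ?v z" by (rule pos[OF l(2) a(2)])
      ultimately show False using elim(1) a(1) l(1) by auto
    qed
  qed
qed

lemma weight0_outside_tiling: "snd z \<notin> tiling \<Longrightarrow> weight0 \<theta> g z = 0"
  by (simp add: weight0_def)

lemma pushed_weight_on_cells: "AE z in lebesgue_on cells. push (weight0 \<theta> g) z = weight0 \<theta> g (back z)"
proof -
  have "AE z in lebesgue_on cells. z \<in> cells" by (rule AE_I2) simp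
  with transformed_cells_avoid_other_material show ?thesis
    by eventually_elim (auto simp: push_def zero_ext_def weight0_outside_tiling)
qed

text \<open>Without overlap the norm of the limit is the limit of the norms.\<close>

lemma strongly_approximable_weight:
  assumes \<theta>: "continuous_on UNIV \<theta>" "\<And>x. x \<notin> \<Omega> \<Longrightarrow> \<theta> x = 0" and g: "g \<in> C_per"
  shows "strongly_approximable \<epsilon> U (\<lambda>n. zero_ext (\<Omega>e n) (weight \<theta> g n)) (push (weight0 \<theta> g))"
proof (rule strongly_approximable_if_norms_converge[OF pushed_weight_two_scale[OF \<theta> g] U(1,2) \<epsilon> zero_ext_weight_le[OF \<theta> g]])
  have O: "cells \<inter> leftover \<in> sets lebesgue" using cells_measurable leftover by auto
  have "AE z in lebesgue_on (cells \<inter> leftover). weight0 \<theta> g (back z) * weight0 \<theta> g z = 0"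
    using transformed_cells_avoid_other_material unfolding AE_lebesgue_on_iff[OF O] AE_lebesgue_on_iff[OF cells_measurable]
    by (rule eventually_mono) (auto simp: weight0_outside_tiling)
  then have "(\<integral>z. weight0 \<theta> g (back z) * weight0 \<theta> g z \<partial>lebesgue_on (cells \<inter> leftover)) = 0"
    by (rule integral_eq_zero_AE)
  then show "(\<lambda>n. \<integral>x. (zero_ext (\<Omega>e n) (weight \<theta> g n) x)\<^sup>2 \<partial>lebesgue_on U)
      \<longlonglongrightarrow> (\<integral>z. (push (weight0 \<theta> g) z)\<^sup>2 \<partial>lebesgue_on (U \<times> unit_cell))"
    using weight_norms_converge[OF \<theta> g] pushed_weight_norm[OF \<theta> g] by simp
qed

section \<open>The equivalence\<close>

text \<open>Pairings with a product test function on the reference domain are pairings with its weight on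
  the transformed domain, where both factors converge, one of them strongly.\<close>

theorem pull_back_two_scale:
  assumes p: "1 < p" and u: "\<And>n. u n \<in> Lp p (\<Omega>e n)" and f: "f \<in> Lp p (\<Omega> \<times> Ys)"
    and u0: "AE q in lebesgue_on cells. u0 q = f (back q)"
    and w: "two_scale_weak \<epsilon> p U (\<lambda>n. zero_ext (\<Omega>e n) (u n)) (zero_ext cells u0)"
  shows "two_scale_weak \<epsilon> p \<Omega> (\<lambda>n. zero_ext (\<Omega>h n) (u n \<circ> \<psi> n)) (zero_ext (\<Omega> \<times> Ys) f)"
proof -
  obtain K where K: "\<And>n. (\<integral>x. \<bar>zero_ext (\<Omega>e n) (u n) x\<bar> powr p \<partial>lebesgue_on U) \<le> K"
    using two_scale_weak_bounded[OF w p domainU(1)] by blast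
  have p0: "0 < p" using p by simp
  have uh: "u n \<circ> \<psi> n \<in> Lp p (\<Omega>h n)" for n by (rule pullback_Lp[OF u]) (use p in simp)
  have fm: "f \<in> borel_measurable (lebesgue_on (\<Omega> \<times> Ys))" using f by (simp add: Lp_def)
  have u0m: "u0 \<in> borel_measurable (lebesgue_on cells)"
    by (rule borel_measurable_lebesgue_on_AE[OF cells_measurable measurable_compose_back[OF fm]])
       (use u0 in \<open>rule eventually_mono, simp\<close>)
  show ?thesis
  proof (rule two_scale_weakI[OF p \<Omega> \<epsilon>(1), where K="K / cJ"])
    show "zero_ext (\<Omega>h n) (u n \<circ> \<psi> n) \<in> Lp p \<Omega>" for n by (rule zero_ext_Lp[OF \<Omega>h(4) domain(2) uh p0])
    show "zero_ext (\<Omega> \<times> Ys) f \<in> Lp p (\<Omega> \<times> unit_cell)" by (rule zero_ext_Lp[OF domains(5) domain(3) f p0])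
    show "\<forall>\<^sub>F n in sequentially. (\<integral>x. \<bar>zero_ext (\<Omega>h n) (u n \<circ> \<psi> n) x\<bar> powr p \<partial>lebesgue_on \<Omega>) \<le> K / cJ"
      using eventually_\<Omega>e_subset
    proof eventually_elim
      case (elim n)
      let ?f = "\<lambda>x. \<bar>(u n \<circ> \<psi> n) x\<bar> powr p"
      have i1: "integrable (lebesgue_on (\<Omega>e n)) (\<lambda>x. \<bar>u n x\<bar> powr p)" using u[of n] by (simp add: Lp_def)
      have i2: "integrable (lebesgue_on (\<Omega>h n)) (\<lambda>x. J n x * ?f x)" using i1 by (simp add: change_of_variables_n(3))
      have i3: "integrable (lebesgue_on (\<Omega>h n)) ?f" using uh[of n] unfolding Lp_def by blast
      have "cJ * (\<integral>x. \<bar>zero_ext (\<Omega>h n) (u n \<circ> \<psi> n) x\<bar> powr p \<partial>lebesgue_on \<Omega>) = (\<integral>x. cJ * ?f x \<partial>lebesgue_on (\<Omega>h n))"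
        by (simp only: integral_zero_ext_powr[OF \<Omega>h(4) domain(2) \<Omega>h(2) p0] integral_mult_right_zero)
      also have "\<dots> \<le> (\<integral>x. J n x * ?f x \<partial>lebesgue_on (\<Omega>h n))"
        by (rule integral_mono_AE[OF integrable_mult_right[OF i3] i2]) (use cJ in \<open>auto intro!: AE_I2 mult_right_mono\<close>)
      also have "\<dots> = (\<integral>x. \<bar>u n x\<bar> powr p \<partial>lebesgue_on (\<Omega>e n))" by (simp add: change_of_variables_n(4))
      also have "\<dots> = (\<integral>x. \<bar>zero_ext (\<Omega>e n) (u n) x\<bar> powr p \<partial>lebesgue_on U)"
        by (rule integral_zero_ext_powr[OF change_of_variables_n(1) domainU(2) elim p0, symmetric])
      also have "\<dots> \<le> K" by (rule K)
      finally show ?case using cJ(1) by (simp add: field_simps)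
    qed
    fix \<theta> g :: "real^'n \<Rightarrow> real"
    assume \<theta>: "continuous_on UNIV \<theta>" "\<And>x. x \<notin> \<Omega> \<Longrightarrow> \<theta> x = 0" and g: "g \<in> C_per"
    let ?k = "\<lambda>z. \<theta> (fst z) * g (snd z)" and ?v = "weight0 \<theta> g"
    have gc: "continuous_on UNIV g" using g by (simp add: C_per_iff)
    have k: "continuous_on UNIV ?k"
      by (intro continuous_intros continuous_on_compose2[OF gc] continuous_on_compose2[OF \<theta>(1)]) auto
    have vm: "?v \<in> borel_measurable (lebesgue_on (\<Omega> \<times> Ys))" by (rule restrict_measurable[OF weight0_in_L2(1)[OF \<theta> g]])
    have pm: "push ?v \<in> borel_measurable (lebesgue_on cells)"
    proof (rule measurable_restrict_mono[OF _ subset_U(1)])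
      show "push ?v \<in> borel_measurable (lebesgue_on (U \<times> unit_cell))"
        using push_Lp[OF weight0_in_L2(2)[OF \<theta> g]] by (simp add: Lp_def)
    qed
    have fv: "(\<lambda>z. f z * ?v z) \<in> borel_measurable (lebesgue_on (\<Omega> \<times> Ys))" by (rule borel_measurable_times[OF fm vm])
    let ?G = "\<lambda>(y::real^'n) (b::real). b"
    have G: "continuous_on UNIV (\<lambda>z. ?G (fst z) (snd z))" by (intro continuous_intros)
    have per: "cell_periodic (\<lambda>y. ?G y b)" for b by (simp add: cell_periodic_def)
    note lim = weak_strong_pairing(1)[OF w strongly_approximable_weight[OF \<theta> g] G per p U(1,2)]
    have "(\<integral>z. zero_ext cells u0 z * push ?v z \<partial>lebesgue_on (U \<times> unit_cell)) = (\<integral>z. u0 z * push ?v z \<partial>lebesgue_on cells)"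
      by (rule integral_zero_ext(1)[OF cells_measurable domainU(3) subset_U(1)])
    also have "\<dots> = (\<integral>q. f (back q) * ?v (back q) \<partial>lebesgue_on cells)"
    proof (rule integral_cong_AE[OF borel_measurable_times[OF u0m pm] measurable_compose_back[OF fv]])
      show "AE z in lebesgue_on cells. u0 z * push ?v z = f (back z) * ?v (back z)"
        using u0 pushed_weight_on_cells[of \<theta> g] by eventually_elim simp
    qed
    also have "\<dots> = (\<integral>z. J0 z * (f z * ?v z) \<partial>lebesgue_on (\<Omega> \<times> Ys))" by (rule integral_back(2)[OF fv])
    also have "\<dots> = (\<integral>z. f z * ?k z \<partial>lebesgue_on (\<Omega> \<times> Ys))"
    proof (rule integral_cong_AE[OF borel_measurable_times[OF J0_measurable fv] borel_measurable_times[OF fm continuous_imp_measurable_lebesgue_on[OF k]]])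
      have "AE z in lebesgue_on (\<Omega> \<times> Ys). z \<in> \<Omega> \<times> Ys" by (rule AE_I2) simp
      with J0_eq J0_ge show "AE z in lebesgue_on (\<Omega> \<times> Ys). J0 z * (f z * ?v z) = f z * ?k z"
      proof eventually_elim
        case (elim z)
        then have "max cJ (D0 z) = J0 z" "J0 z \<noteq> 0" "snd z \<in> tiling" using cJ(1) Ys_tiling by auto
        then show ?case by (simp add: weight0_def)
      qed
    qed
    also have "\<dots> = (\<integral>z. zero_ext (\<Omega> \<times> Ys) f z * ?k z \<partial>lebesgue_on (\<Omega> \<times> unit_cell))"
      by (rule integral_zero_ext(1)[OF domains(5) domain(3) domains(8), symmetric])
    finally have limit: "(\<integral>z. zero_ext cells u0 z * push ?v z \<partial>lebesgue_on (U \<times> unit_cell))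
      = (\<integral>z. zero_ext (\<Omega> \<times> Ys) f z * ?k z \<partial>lebesgue_on (\<Omega> \<times> unit_cell))" .
    have "\<forall>\<^sub>F n in sequentially. (\<integral>x. zero_ext (\<Omega>e n) (u n) x * zero_ext (\<Omega>e n) (weight \<theta> g n) x \<partial>lebesgue_on U)
      = (\<integral>x. zero_ext (\<Omega>h n) (u n \<circ> \<psi> n) x * (\<theta> x * g (x /\<^sub>R \<epsilon> n)) \<partial>lebesgue_on \<Omega>)"
      using eventually_\<Omega>e_subset
    proof eventually_elim
      case (elim n)
      have "(\<integral>x. zero_ext (\<Omega>e n) (u n) x * zero_ext (\<Omega>e n) (weight \<theta> g n) x \<partial>lebesgue_on U)
        = (\<integral>x. u n x * zero_ext (\<Omega>e n) (weight \<theta> g n) x \<partial>lebesgue_on (\<Omega>e n))"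
        by (rule integral_zero_ext(1)[OF change_of_variables_n(1) domainU(2) elim])
      also have "\<dots> = (\<integral>x. J n x * (u n (\<psi> n x) * zero_ext (\<Omega>e n) (weight \<theta> g n) (\<psi> n x)) \<partial>lebesgue_on (\<Omega>h n))"
        by (rule change_of_variables_n(4))
      also have "\<dots> = (\<integral>x. (u n \<circ> \<psi> n) x * (\<theta> x * g (x /\<^sub>R \<epsilon> n)) \<partial>lebesgue_on (\<Omega>h n))"
      proof (rule Bochner_Integration.integral_cong[OF refl])
        fix x assume "x \<in> space (lebesgue_on (\<Omega>h n))"
        then have x: "x \<in> \<Omega>h n" "\<psi> n x \<in> \<Omega>e n" by (auto simp: \<Omega>e_def)
        then have "J n x \<noteq> 0" using cJ(1) cJ(3)[OF x(1)] by linarith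
        then show "J n x * (u n (\<psi> n x) * zero_ext (\<Omega>e n) (weight \<theta> g n) (\<psi> n x)) = (u n \<circ> \<psi> n) x * (\<theta> x * g (x /\<^sub>R \<epsilon> n))"
          using x by (simp add: weight_\<psi> zero_ext_def)
      qed
      also have "\<dots> = (\<integral>x. zero_ext (\<Omega>h n) (u n \<circ> \<psi> n) x * (\<theta> x * g (x /\<^sub>R \<epsilon> n)) \<partial>lebesgue_on \<Omega>)"
        by (rule integral_zero_ext(1)[OF \<Omega>h(4) domain(2) \<Omega>h(2), symmetric])
      finally show ?case .
    qed
    from Lim_transform_eventually[OF lim this]
    show "pairings_converge \<epsilon> \<Omega> (\<lambda>n. zero_ext (\<Omega>h n) (u n \<circ> \<psi> n)) (zero_ext (\<Omega> \<times> Ys) f) (\<lambda>x y. \<theta> x * g y)"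
      unfolding pairings_converge_def limit .
  qed
qed

lemma push_zero_ext: "push (zero_ext (\<Omega> \<times> Ys) f) = zero_ext cells (\<lambda>q. zero_ext (\<Omega> \<times> Ys) f (back q))"
  by (auto simp: fun_eq_iff push_def zero_ext_def)

lemma mem_Lp_transf_iff:
  "u0 \<in> Lp_transf p \<Omega> Ys \<psi>0 \<longleftrightarrow> (\<exists>f \<in> Lp p (\<Omega> \<times> Ys). AE q in lebesgue_on cells. u0 q = f (back q))"
  by (simp add: Lp_transf_def back_def split_beta)

lemma zero_ext_Lp_self: "f \<in> Lp p (\<Omega> \<times> Ys) \<Longrightarrow> 0 < p \<Longrightarrow> zero_ext (\<Omega> \<times> Ys) f \<in> Lp p (\<Omega> \<times> Ys)"
  by (rule zero_ext_Lp[OF domains(5,5)])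

text \<open>The pushed limit of the pulled back sequence is a limit of the original one, so uniqueness
  identifies the two on the transformed cells; the transformation carries this back to \<open>\<Omega> \<times> Ys\<close>.\<close>

theorem limits_correspond:
  assumes p: "1 < p" and u: "\<And>n. u n \<in> Lp p (\<Omega>e n)"
    and w: "two_scale_weak \<epsilon> p U (\<lambda>n. zero_ext (\<Omega>e n) (u n)) (zero_ext cells u0)"
    and wh: "two_scale_weak \<epsilon> p \<Omega> (\<lambda>n. zero_ext (\<Omega>h n) (u n \<circ> \<psi> n)) (zero_ext (\<Omega> \<times> Ys) uh0)"
  shows "AE q in lebesgue_on cells. u0 q = uh0 (back q)"
    and "AE z in lebesgue_on (\<Omega> \<times> Ys). uh0 z = u0 (transf z)"
proof -
  from two_scale_weak_unique[OF w push_forward_two_scale[OF p u wh, unfolded push_zero_ext] p U(1,2)]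
  have "AE q in lebesgue_on cells. zero_ext cells u0 q = zero_ext cells (\<lambda>q. zero_ext (\<Omega> \<times> Ys) uh0 (back q)) q"
    unfolding AE_lebesgue_on_iff[OF cells_measurable] AE_lebesgue_on_iff[OF domainU(3)]
    by (rule eventually_mono) (use subset_U(1) in blast)
  moreover have "AE q in lebesgue_on cells. q \<in> cells" by (rule AE_I2) simp
  ultimately show q: "AE q in lebesgue_on cells. u0 q = uh0 (back q)"
    using AE_back by eventually_elim (simp add: zero_ext_def)
  show "AE z in lebesgue_on (\<Omega> \<times> Ys). uh0 z = u0 (transf z)"
    using AE_compose_transf[OF q] AE_transf by eventually_elim simp
qed

end

theorem theorem3p8:
  fixes \<epsilon> :: "nat \<Rightarrow> real"
    and Ys \<Omega> :: "(real^'n) set"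
    and \<psi> :: "nat \<Rightarrow> real^'n \<Rightarrow> real^'n"
    and \<psi>0 :: "real^'n \<Rightarrow> real^'n \<Rightarrow> real^'n"
    and u :: "nat \<Rightarrow> real^'n \<Rightarrow> real"
    and p \<delta> :: real
  defines "\<Omega>h \<equiv> \<lambda>n. perforated (\<epsilon> n) \<Omega> Ys"
    and "\<Omega>e \<equiv> \<lambda>n. \<psi> n ` perforated (\<epsilon> n) \<Omega> Ys"
    and "Q \<equiv> transformed_cells \<Omega> Ys \<psi>0"
  assumes "\<And>n. \<epsilon> n > 0" and "\<epsilon> \<longlonglongrightarrow> 0"
    and "open Ys" and "Ys \<subseteq> unit_cell" and "lipschitz_boundary (periodic_hull Ys)"
    and "bounded \<Omega>" and "open \<Omega>" and "lipschitz_boundary \<Omega>"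
    and "\<delta> > 0"
    and "locally_periodic_transformations \<epsilon> \<Omega> Ys \<psi> \<psi>0"
    and "1 < p"
    and "\<And>n. u n \<in> Lp p (\<Omega>e n)"
  shows "((\<exists>u0 \<in> Lp_transf p \<Omega> Ys \<psi>0.
             two_scale_weak \<epsilon> p (neighbourhood \<delta> \<Omega>) (\<lambda>n. zero_ext (\<Omega>e n) (u n)) (zero_ext Q u0))
          \<longleftrightarrow>
          (\<exists>uh0 \<in> Lp p (\<Omega> \<times> Ys).
             two_scale_weak \<epsilon> p \<Omega> (\<lambda>n. zero_ext (\<Omega>h n) (u n \<circ> \<psi> n)) (zero_ext (\<Omega> \<times> Ys) uh0)))
       \<and>
         (\<forall>u0 \<in> Lp_transf p \<Omega> Ys \<psi>0. \<forall>uh0 \<in> Lp p (\<Omega> \<times> Ys).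
            two_scale_weak \<epsilon> p (neighbourhood \<delta> \<Omega>) (\<lambda>n. zero_ext (\<Omega>e n) (u n)) (zero_ext Q u0) \<and>
            two_scale_weak \<epsilon> p \<Omega> (\<lambda>n. zero_ext (\<Omega>h n) (u n \<circ> \<psi> n)) (zero_ext (\<Omega> \<times> Ys) uh0)
            \<longrightarrow>
            (AE (x, y) in lebesgue_on (\<Omega> \<times> Ys). uh0 (x, y) = u0 (x, \<psi>0 x y)) \<and>
            (AE (x, y) in lebesgue_on Q. u0 (x, y) = uh0 (x, inv_transf Ys \<psi>0 x y)))"
proof -
  interpret T: transformed_domains \<epsilon> \<Omega> Ys \<psi> \<psi>0 \<delta>
    by unfold_locales (fact assms)+
  have eqs: "\<Omega>h = T.\<Omega>h" "\<Omega>e = T.\<Omega>e" "neighbourhood \<delta> \<Omega> = T.U"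
    by (simp_all add: fun_eq_iff \<Omega>h_def \<Omega>e_def T.\<Omega>h_def T.\<Omega>e_def T.U_def)
  have p: "1 < p" "0 < p" using \<open>1 < p\<close> by auto
  have u: "\<And>n. u n \<in> Lp p (T.\<Omega>e n)" using assms(15) by (simp add: eqs)
  show ?thesis
    unfolding eqs Q_def
  proof (intro conjI iffI ballI impI; (elim bexE conjE)?)
    fix u0 assume "u0 \<in> Lp_transf p \<Omega> Ys \<psi>0"
      and w: "two_scale_weak \<epsilon> p T.U (\<lambda>n. zero_ext (T.\<Omega>e n) (u n)) (zero_ext T.cells u0)"
    then obtain f where f: "f \<in> Lp p (\<Omega> \<times> Ys)" "AE q in lebesgue_on T.cells. u0 q = f (T.back q)"
      by (auto simp: T.mem_Lp_transf_iff)
    from T.pull_back_two_scale[OF p(1) u f w]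
    show "\<exists>uh0 \<in> Lp p (\<Omega> \<times> Ys). two_scale_weak \<epsilon> p \<Omega> (\<lambda>n. zero_ext (T.\<Omega>h n) (u n \<circ> \<psi> n)) (zero_ext (\<Omega> \<times> Ys) uh0)"
      using f(1) by (rule bexI)
  next
    fix uh0 assume uh0: "uh0 \<in> Lp p (\<Omega> \<times> Ys)"
      and w: "two_scale_weak \<epsilon> p \<Omega> (\<lambda>n. zero_ext (T.\<Omega>h n) (u n \<circ> \<psi> n)) (zero_ext (\<Omega> \<times> Ys) uh0)"
    let ?u0 = "\<lambda>q. zero_ext (\<Omega> \<times> Ys) uh0 (T.back q)"
    have "?u0 \<in> Lp_transf p \<Omega> Ys \<psi>0"
      unfolding T.mem_Lp_transf_iff by (rule bexI[OF _ T.zero_ext_Lp_self[OF uh0 p(2)]]) simp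
    with T.push_forward_two_scale[OF p(1) u w, unfolded T.push_zero_ext]
    show "\<exists>u0 \<in> Lp_transf p \<Omega> Ys \<psi>0. two_scale_weak \<epsilon> p T.U (\<lambda>n. zero_ext (T.\<Omega>e n) (u n)) (zero_ext T.cells u0)"
      by (rule bexI)
  next
    fix u0 uh0
    assume w: "two_scale_weak \<epsilon> p T.U (\<lambda>n. zero_ext (T.\<Omega>e n) (u n)) (zero_ext T.cells u0)"
      "two_scale_weak \<epsilon> p \<Omega> (\<lambda>n. zero_ext (T.\<Omega>h n) (u n \<circ> \<psi> n)) (zero_ext (\<Omega> \<times> Ys) uh0)"
    note c = T.limits_correspond[OF p(1) u w]
    show "AE (x, y) in lebesgue_on (\<Omega> \<times> Ys). uh0 (x, y) = u0 (x, \<psi>0 x y)"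
      using c(2) by (simp add: T.transf_def split_beta)
    show "AE (x, y) in lebesgue_on T.cells. u0 (x, y) = uh0 (x, inv_transf Ys \<psi>0 x y)"
      using c(1) by (simp add: T.back_def split_beta)
  qed
qed

end
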